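(* Assume the Riemann Hypothesis and that all zeros of $\zeta(s)$ on the critical line are simple. Suppose that for every small fixed $\varepsilon>0$ one has $J_{-1/2}(T)=O(T^{1+\varepsilon})$ as $T\to\infty$. Then for every integer $k\ge 2$, $E_k(x)=O\left(x^{-1/2}\right)$ as $x\to\infty$.
   Context: $J_{-1/2}(T)=\sum_{0<\gamma\le T}\frac{1}{|\zeta'(\rho)|}$, the sum over nontrivial zeros $\rho=\frac12+i\gamma$ of $\zeta$ with $0<\gamma\le T$. $\mu$ is the Möbius function and $\psi(n)=\sum_{d\mid n} d\,\mu^2(n/d)$ is the Dedekind totient function. $S_k(x)=\frac{1}{k!}\sum_{l\le x}\frac{l}{\psi(l)}\left(1-\frac{l}{x}\right)^k$ and $E_k(x)=S_k(x)-\frac{\zeta(4)h(1)}{(k+1)!\,\zeta(2)}x$ with $h(1)=\prod_p\left(1+\frac{1}{p^2(p+1)}-\frac{1}{p^3(p+1)}\right)$. *)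

theory Defs
  imports
    "HOL-Complex_Analysis.Complex_Analysis"
    "HOL-Computational_Algebra.Squarefree"
    "HOL-Library.Landau_Symbols"
begin

(* The Riemann zeta function: the analytic continuation of the Dirichlet series to all
   complex numbers except 1. The value at the pole is irrelevant; fixing it makes the
   description unique. *)
definition zeta :: "complex \<Rightarrow> complex" where
  "zeta = (THE f. f holomorphic_on (- {1}) \<and>
                  (\<forall>s. Re s > 1 \<longrightarrow> (\<lambda>n. of_nat (Suc n) powr (- s)) sums f s) \<and>
                  f 1 = 0)"

(* Existence: Taylor expansion of (N + 1) powr (1 - s) around N, summed over N, expresses
   (s - 1) * zeta s through its values at s + 1, s + 2, ..., up to a series that converges
   in a larger half-plane. *)
context
begin

private definition ff :: "nat \<Rightarrow> complex \<Rightarrow> complex" where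
  "ff i s = (\<Prod>j<i. 1 - s - of_nat j)"

private definition rem :: "nat \<Rightarrow> nat \<Rightarrow> complex \<Rightarrow> complex" where
  "rem K n s = of_nat (Suc n + 1) powr (1 - s)
     - (\<Sum>i\<le>K. ff i s * of_nat (Suc n) powr (1 - s - of_nat i) / fact i)"

private lemma ff_holomorphic: "ff i holomorphic_on A"
  unfolding ff_def [abs_def] by (intro holomorphic_intros)

private lemma rem_holomorphic: "rem K n holomorphic_on A"
  unfolding rem_def [abs_def]
  by (intro holomorphic_intros ff_holomorphic) (auto simp del: of_nat_Suc of_nat_add)

private lemma rem_bound:
  assumes "Re s \<ge> - real K"
  shows "norm (rem K n s) \<le> norm (ff (Suc K) s) * real (Suc n) powr (- Re s - real K) / fact K"
proof -
  define N where "N = real (Suc n)"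
  have N: "N > 0" by (simp add: N_def)
  define S where "S = closed_segment (of_real N) (of_real (N + 1) :: complex)"
  define f where "f = (\<lambda>i x. ff i s * x powr (1 - s - of_nat i))"
  have S: "\<exists>t. x = of_real t \<and> t \<ge> N" if "x \<in> S" for x
    using that unfolding S_def closed_segment_of_real
    by (auto simp: closed_segment_eq_real_ivl)
  have "norm (f 0 (of_real (N + 1)) - (\<Sum>i\<le>K. f i (of_real N) * (of_real (N + 1) - of_real N) ^ i / fact i))
      \<le> (norm (ff (Suc K) s) * N powr (- Re s - real K)) * norm (of_real (N + 1) - of_real N :: complex) ^ Suc K / fact K"
  proof (rule complex_Taylor [where S = S])
    show "convex S" by (simp add: S_def)
    show "of_real N \<in> S" "of_real (N + 1) \<in> S" by (auto simp: S_def)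
  next
    fix i x assume x: "x \<in> S"
    then obtain t where t: "x = of_real t" "t \<ge> N" using S by blast
    have "x \<notin> \<real>\<^sub>\<le>\<^sub>0" using t N by auto
    then show "(f i has_field_derivative f (Suc i) x) (at x within S)"
      unfolding f_def
      by (auto intro!: derivative_eq_intros simp: ff_def algebra_simps)
  next
    fix x assume x: "x \<in> S"
    then obtain t where t: "x = of_real t" "t \<ge> N" using S by blast
    have "norm (x powr (1 - s - of_nat (Suc K))) = t powr (- Re s - real K)"
      using t N by (simp add: norm_powr_real_powr)
    also have "\<dots> \<le> N powr (- Re s - real K)"
      using t N assms by (intro powr_mono2') auto
    finally show "norm (f (Suc K) x) \<le> norm (ff (Suc K) s) * N powr (- Re s - real K)"
      unfolding f_def norm_mult by (intro mult_left_mono) auto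
  qed
  then show ?thesis
    by (simp add: rem_def f_def N_def ff_def add_ac)
qed

private lemma rem_sum_holomorphic:
  shows "(\<lambda>s. \<Sum>n. rem K n s) holomorphic_on {s. Re s > 1 - real K}"
proof (rule holomorphic_uniform_sequence [where f = "\<lambda>N s. \<Sum>n<N. rem K n s"])
  show "open {s. Re s > 1 - real K}" by (simp add: open_halfspace_Re_gt)
  show "(\<lambda>s. \<Sum>n<N. rem K n s) holomorphic_on {s. Re s > 1 - real K}" for N
    by (intro holomorphic_intros rem_holomorphic)
  fix z assume "z \<in> {s. Re s > 1 - real K}"
  define d where "d = (Re z - (1 - real K)) / 2"
  have d: "d > 0" using \<open>z \<in> _\<close> by (simp add: d_def)
  have Re: "Re s \<ge> 1 - real K + d" if "s \<in> cball z d" for s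
  proof -
    have "\<bar>Re (z - s)\<bar> \<le> d"
      using that abs_Re_le_cmod[of "z - s"] by (simp add: dist_norm)
    hence "Re z - Re s \<le> d" by simp
    moreover have "Re z = 1 - real K + 2 * d" by (simp add: d_def field_simps)
    ultimately show ?thesis by linarith
  qed
  have "compact (ff (Suc K) ` cball z d)"
    by (intro compact_continuous_image holomorphic_on_imp_continuous_on ff_holomorphic) auto
  then obtain C where C: "\<And>s. s \<in> cball z d \<Longrightarrow> norm (ff (Suc K) s) \<le> C"
    using compact_imp_bounded[of "ff (Suc K) ` cball z d"] unfolding bounded_iff by blast
  have "norm (ff (Suc K) z) \<le> C" by (rule C) (use d in simp)
  hence "0 \<le> C" using norm_ge_zero order_trans by blast
  have "uniform_limit (cball z d) (\<lambda>N s. \<Sum>n<N. rem K n s) (\<lambda>s. \<Sum>n. rem K n s) sequentially"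
  proof (rule Weierstrass_m_test)
    fix n s assume s: "s \<in> cball z d"
    have "norm (rem K n s) \<le> norm (ff (Suc K) s) * real (Suc n) powr (- Re s - real K) / fact K"
      using Re[OF s] d by (intro rem_bound) auto
    also have "\<dots> \<le> norm (ff (Suc K) s) * real (Suc n) powr (- Re s - real K)"
      using divide_left_mono[of 1 "fact K" "norm (ff (Suc K) s) * real (Suc n) powr (- Re s - real K)"]
      by simp
    also have "\<dots> \<le> C * real (Suc n) powr (- 1 - d)"
    proof (rule mult_mono)
      show "norm (ff (Suc K) s) \<le> C" by (rule C[OF s])
      have "- Re s - real K \<le> - 1 - d" using Re[OF s] by linarith
      thus "real (Suc n) powr (- Re s - real K) \<le> real (Suc n) powr (- 1 - d)"
        by (rule powr_mono) simp
    qed (use \<open>0 \<le> C\<close> in auto)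
    finally show "norm (rem K n s) \<le> C * real (Suc n) powr (- 1 - d)" .
  next
    have "summable (\<lambda>n. real n powr (- 1 - d))"
      using d by (subst summable_real_powr_iff) auto
    hence "summable (\<lambda>n. real (Suc n) powr (- 1 - d))"
      by (subst summable_Suc_iff)
    thus "summable (\<lambda>n. C * real (Suc n) powr (- 1 - d))"
      by (rule summable_mult)
  qed
  moreover have "cball z d \<subseteq> {s. Re s > 1 - real K}"
  proof
    fix s assume "s \<in> cball z d"
    from Re[OF this] show "s \<in> {s. Re s > 1 - real K}" using d by simp
  qed
  ultimately show "\<exists>d>0. cball z d \<subseteq> {s. Re s > 1 - real K} \<and>
      uniform_limit (cball z d) (\<lambda>N s. \<Sum>n<N. rem K n s) (\<lambda>s. \<Sum>n. rem K n s) sequentially"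
    using d by blast
qed

private definition Z :: "complex \<Rightarrow> complex" where
  "Z s = (\<Sum>n. of_nat (Suc n) powr (- s))"

private lemma Z_sums:
  assumes "Re s > 1"
  shows "(\<lambda>n. of_nat (Suc n) powr (- s)) sums Z s"
proof -
  have "summable (\<lambda>n. real n powr (- Re s))"
    using assms by (subst summable_real_powr_iff) auto
  hence "summable (\<lambda>n. real (Suc n) powr (- Re s))"
    by (subst summable_Suc_iff)
  moreover have "norm (of_nat (Suc n) powr (- s) :: complex) = real (Suc n) powr (- Re s)" for n
    using norm_powr_real_powr[of "of_nat (Suc n)" "-s"] by (simp del: of_nat_Suc)
  ultimately have "summable (\<lambda>n. norm (of_nat (Suc n) powr (- s) :: complex))"
    by (simp only:)
  hence "summable (\<lambda>n. of_nat (Suc n) powr (- s) :: complex)"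
    by (rule summable_norm_cancel)
  thus ?thesis unfolding Z_def by (rule summable_sums)
qed

private lemma Z_recurrence:
  assumes s: "Re s > 1" and K: "K \<ge> 1"
  shows "(s - 1) * Z s = (\<Sum>n. rem K n s) + 1
           - (\<Sum>i=2..K. ff (i - 1) s / fact i * ((s + of_nat i - 2) * Z (s + of_nat i - 1)))"
proof -
  have lim: "(\<lambda>n. of_nat (Suc n) powr (1 - s)) \<longlonglongrightarrow> (0 :: complex)"
  proof (rule tendsto_norm_zero_cancel)
    have "norm (of_nat (Suc n) powr (1 - s) :: complex) = real (Suc n) powr (1 - Re s)" for n
      using norm_powr_real_powr[of "of_nat (Suc n)" "1-s"] by (simp del: of_nat_Suc)
    moreover have "(\<lambda>n. real (Suc n) powr (1 - Re s)) \<longlonglongrightarrow> 0"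
      by (rule LIMSEQ_Suc, rule tendsto_neg_powr) (use s filterlim_real_sequentially in auto)
    ultimately show "(\<lambda>n. norm (of_nat (Suc n) powr (1 - s) :: complex)) \<longlonglongrightarrow> 0"
      by (simp del: of_nat_Suc)
  qed
  have tele: "(\<lambda>n. of_nat (Suc (Suc n)) powr (1 - s) - of_nat (Suc n) powr (1 - s)) sums (0 - 1 :: complex)"
    using telescope_sums[OF lim] by simp
  have summand: "(\<lambda>n. ff i s * of_nat (Suc n) powr (1 - s - of_nat i) / fact i)
          sums (ff i s * Z (s + of_nat i - 1) / fact i)" if "i \<in> {1..K}" for i
  proof -
    have "Re (s + of_nat i - 1) > 1" using that s by auto
    from Z_sums[OF this] show ?thesis
      by (intro sums_divide sums_mult) (simp add: algebra_simps)
  qed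
  have "rem K n s = (of_nat (Suc (Suc n)) powr (1 - s) - of_nat (Suc n) powr (1 - s))
      - (\<Sum>i\<in>{1..K}. ff i s * of_nat (Suc n) powr (1 - s - of_nat i) / fact i)" for n
  proof -
    have "{..K} = insert 0 {1..K}" by auto
    thus ?thesis by (simp add: rem_def ff_def)
  qed
  hence "(\<lambda>n. rem K n s) sums (0 - 1 - (\<Sum>i\<in>{1..K}. ff i s * Z (s + of_nat i - 1) / fact i))"
    by (simp only:) (intro sums_diff tele sums_sum summand)
  hence "(\<Sum>n. rem K n s) = - 1 - (\<Sum>i\<in>{1..K}. ff i s * Z (s + of_nat i - 1) / fact i)"
    by (simp add: sums_iff)
  also have "{1..K} = insert 1 {2..K}" using K by auto
  also have "(\<Sum>i\<in>insert 1 {2..K}. ff i s * Z (s + of_nat i - 1) / fact i) =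
     (1 - s) * Z s + (\<Sum>i=2..K. ff i s * Z (s + of_nat i - 1) / fact i)"
    by (simp add: ff_def)
  also have "(\<Sum>i=2..K. ff i s * Z (s + of_nat i - 1) / fact i) =
     (\<Sum>i=2..K. - (ff (i - 1) s / fact i * ((s + of_nat i - 2) * Z (s + of_nat i - 1))))"
  proof (rule sum.cong)
    fix i assume "i \<in> {2..K}"
    then obtain j where i: "i = Suc j" by (cases i) auto
    have "ff i s = - (s + of_nat i - 2) * ff (i - 1) s"
      by (simp add: ff_def i algebra_simps)
    thus "ff i s * Z (s + of_nat i - 1) / fact i =
       - (ff (i - 1) s / fact i * ((s + of_nat i - 2) * Z (s + of_nat i - 1)))"
      by (simp only:) (simp add: field_simps)
  qed auto
  finally have eq: "(\<Sum>n. rem K n s) = - 1 - ((1 - s) * Z s - T)"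
    if "T = (\<Sum>i=2..K. ff (i - 1) s / fact i * ((s + of_nat i - 2) * Z (s + of_nat i - 1)))" for T
    by (simp add: sum_negf that)
  show ?thesis by (subst eq[OF refl]) (simp add: left_diff_distrib)
qed

private lemma W_exists:
  "\<exists>W. W holomorphic_on {s. Re s > - real N} \<and> (\<forall>s. Re s > 1 \<longrightarrow> W s = (s - 1) * Z s)"
proof (induction N)
  case 0
  have "(\<lambda>s. (\<Sum>n. rem 1 n s) + 1) holomorphic_on {s. Re s > - real 0}"
    using rem_sum_holomorphic[of 1] by (intro holomorphic_intros) auto
  moreover have "(\<Sum>n. rem 1 n s) + 1 = (s - 1) * Z s" if "Re s > 1" for s
    using Z_recurrence[OF that, of 1] by simp
  ultimately show ?case by (intro exI[of _ "\<lambda>s. (\<Sum>n. rem 1 n s) + 1"]) auto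
next
  case (Suc N)
  then obtain W where W: "W holomorphic_on {s. Re s > - real N}"
    "\<And>s. Re s > 1 \<Longrightarrow> W s = (s - 1) * Z s" by blast
  define K where "K = N + 2"
  define W' where "W' = (\<lambda>s. (\<Sum>n. rem K n s) + 1
     - (\<Sum>i=2..K. ff (i - 1) s / fact i * W (s + of_nat i - 1)))"
  have "(\<lambda>s. W (s + of_nat i - 1)) holomorphic_on {s. Re s > - real (Suc N)}" if "i \<in> {2..K}" for i
    using that
    by (intro holomorphic_on_compose_gen[OF _ W(1), unfolded o_def] holomorphic_intros) auto
  hence "W' holomorphic_on {s. Re s > - real (Suc N)}"
    unfolding W'_def using rem_sum_holomorphic[of K]
    by (intro holomorphic_intros ff_holomorphic) (auto simp: K_def)
  moreover have "W' s = (s - 1) * Z s" if s: "Re s > 1" for s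
  proof -
    have "W (s + of_nat i - 1) = (s + of_nat i - 2) * Z (s + of_nat i - 1)" if "i \<in> {2..K}" for i
      using that s by (subst W(2)) auto
    hence "(\<Sum>i=2..K. ff (i - 1) s / fact i * W (s + of_nat i - 1)) =
        (\<Sum>i=2..K. ff (i - 1) s / fact i * ((s + of_nat i - 2) * Z (s + of_nat i - 1)))"
      by (intro sum.cong) auto
    moreover have "K \<ge> 1" by (simp add: K_def)
    ultimately show ?thesis using Z_recurrence[OF s, of K] by (simp only: W'_def)
  qed
  ultimately show ?case by blast
qed

private lemma W_global:
  "\<exists>W. W holomorphic_on UNIV \<and> (\<forall>s. Re s > 1 \<longrightarrow> W s = (s - 1) * Z s)"
proof -
  have "\<exists>F. \<forall>N. F N holomorphic_on {s. Re s > - real N} \<and>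
              (\<forall>s. Re s > 1 \<longrightarrow> F N s = (s - 1) * Z s)"
    by (intro choice allI W_exists)
  then obtain F where F: "\<And>N. F N holomorphic_on {s. Re s > - real N}"
    "\<And>N s. Re s > 1 \<Longrightarrow> F N s = (s - 1) * Z s" by blast
  have eq: "F N s = F M s" if "Re s > - real N" "Re s > - real M" for N M s
  proof (rule analytic_continuation_open
      [where s = "{s. Re s > 1}" and s' = "{s. Re s > - real (min N M)}" and f = "F N" and g = "F M"])
    have "(2 :: complex) \<in> {s. Re s > 1}" by simp
    thus "{s. Re s > 1} \<noteq> {}" by blast
    show "connected {s. Re s > - real (min N M)}"
      by (intro convex_connected convex_halfspace_Re_gt)
    show "F N holomorphic_on {s. Re s > - real (min N M)}"
      by (rule holomorphic_on_subset[OF F(1)]) auto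
    show "F M holomorphic_on {s. Re s > - real (min N M)}"
      by (rule holomorphic_on_subset[OF F(1)]) auto
  qed (use F(2) that in \<open>auto simp: open_halfspace_Re_gt min_def\<close>)
  define W where "W = (\<lambda>s. F (nat \<lceil>\<bar>Re s\<bar> + 1\<rceil>) s)"
  have W_eq: "W s = F N s" if "Re s > - real N" for s N
    unfolding W_def
  proof (rule eq)
    have "\<bar>Re s\<bar> + 1 \<le> real (nat \<lceil>\<bar>Re s\<bar> + 1\<rceil>)" by (rule of_nat_ceiling)
    thus "Re s > - real (nat \<lceil>\<bar>Re s\<bar> + 1\<rceil>)" by linarith
  qed (rule that)
  have "W holomorphic_on (\<Union>N. {s. Re s > - real N})"
  proof (rule holomorphic_on_UN_open)
    fix N
    show "W holomorphic_on {s. Re s > - real N}"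
      using F(1)[of N] by (rule holomorphic_transform) (use W_eq in auto)
  qed (auto simp: open_halfspace_Re_gt)
  also have "(\<Union>N. {s. Re s > - real N}) = UNIV"
  proof -
    have "\<exists>N. Re s > - real N" for s
      using reals_Archimedean2[of "- Re s"] by (metis minus_less_iff)
    thus ?thesis by auto
  qed
  finally show ?thesis using W_eq[of 0] F(2)[of _ 0] by (intro exI[of _ W] conjI) auto
qed

lemma zeta_exists_unique:
  "\<exists>!f. f holomorphic_on (- {1}) \<and>
        (\<forall>s. Re s > 1 \<longrightarrow> (\<lambda>n. of_nat (Suc n) powr (- s)) sums f s) \<and>
        f 1 = (0 :: complex)"
proof (rule ex_ex1I)
  obtain W where W: "W holomorphic_on UNIV" "\<And>s. Re s > 1 \<Longrightarrow> W s = (s - 1) * Z s"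
    using W_global by blast
  define f where "f = (\<lambda>s. W s / (s - 1))"
  have "f holomorphic_on (- {1})"
    unfolding f_def by (intro holomorphic_intros holomorphic_on_subset[OF W(1)]) auto
  moreover have "f s = Z s" if "Re s > 1" for s
    using W(2)[OF that] that by (auto simp: f_def)
  moreover have "f 1 = 0" by (simp add: f_def)
  ultimately show "\<exists>f. f holomorphic_on (- {1}) \<and>
        (\<forall>s. Re s > 1 \<longrightarrow> (\<lambda>n. of_nat (Suc n) powr (- s)) sums f s) \<and>
        f 1 = (0 :: complex)"
    using Z_sums by (intro exI[of _ f]) auto
next
  fix f g :: "complex \<Rightarrow> complex"
  assume f: "f holomorphic_on (- {1}) \<and>
        (\<forall>s. Re s > 1 \<longrightarrow> (\<lambda>n. of_nat (Suc n) powr (- s)) sums f s) \<and> f 1 = 0"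
  assume g: "g holomorphic_on (- {1}) \<and>
        (\<forall>s. Re s > 1 \<longrightarrow> (\<lambda>n. of_nat (Suc n) powr (- s)) sums g s) \<and> g 1 = 0"
  have "f s = g s" if "s \<noteq> 1" for s
  proof (rule analytic_continuation_open
      [where s = "{s. Re s > 1}" and s' = "- {1}" and f = f and g = g])
    have "(2 :: complex) \<in> {s. Re s > 1}" by simp
    thus "{s. Re s > 1} \<noteq> {}" by blast
    show "connected (- {1 :: complex})"
      by (rule connected_punctured_universe) simp
    show "f z = g z" if "z \<in> {s. Re s > 1}" for z
    proof -
      have "Re z > 1" using that by simp
      hence "(\<lambda>n. of_nat (Suc n) powr (- z)) sums f z" "(\<lambda>n. of_nat (Suc n) powr (- z)) sums g z"
        using f g by blast+
      thus ?thesis by (rule sums_unique2)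
    qed
  qed (use f g that in \<open>auto simp: open_halfspace_Re_gt\<close>)
  moreover have "f 1 = g 1" using f g by simp
  ultimately show "f = g" by (intro ext) (case_tac "x = 1", auto)
qed

end

lemma
  shows zeta_holomorphic: "zeta holomorphic_on (- {1})"
    and zeta_sums: "Re s > 1 \<Longrightarrow> (\<lambda>n. of_nat (Suc n) powr (- s)) sums zeta s"
    and zeta_1: "zeta 1 = 0"
proof -
  note * = theI'[OF zeta_exists_unique, folded zeta_def]
  show "zeta holomorphic_on (- {1})" by (rule conjunct1[OF *])
  show "(\<lambda>n. of_nat (Suc n) powr (- s)) sums zeta s" if "Re s > 1"
    by (rule mp[OF spec[OF conjunct1[OF conjunct2[OF *]]] that])
  show "zeta 1 = 0" by (rule conjunct2[OF conjunct2[OF *]])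
qed

definition nontrivial_zeros :: "complex set" where
  "nontrivial_zeros = {\<rho>. 0 < Re \<rho> \<and> Re \<rho> < 1 \<and> zeta \<rho> = 0}"

definition riemann_hypothesis :: bool where
  "riemann_hypothesis \<longleftrightarrow> (\<forall>\<rho>\<in>nontrivial_zeros. Re \<rho> = 1 / 2)"

definition simple_zeros_on_critical_line :: bool where
  "simple_zeros_on_critical_line \<longleftrightarrow> (\<forall>\<rho>. Re \<rho> = 1 / 2 \<longrightarrow> zeta \<rho> = 0 \<longrightarrow> zorder zeta \<rho> = 1)"

definition J_minus_half :: "real \<Rightarrow> real" where
  "J_minus_half T =
     (\<Sum>\<rho> \<in> {\<rho> \<in> nontrivial_zeros. 0 < Im \<rho> \<and> Im \<rho> \<le> T}. 1 / cmod (deriv zeta \<rho>))"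

definition moebius :: "nat \<Rightarrow> int" where
  "moebius n = (if squarefree n then (-1) ^ card (prime_factors n) else 0)"

definition dedekind_psi :: "nat \<Rightarrow> int" where
  "dedekind_psi n = (\<Sum>d | d dvd n. int d * (moebius (n div d))\<^sup>2)"

definition S_sum :: "nat \<Rightarrow> real \<Rightarrow> real" where
  "S_sum k x = 1 / fact k *
     (\<Sum>l | 0 < l \<and> real l \<le> x. real l / of_int (dedekind_psi l) * (1 - real l / x) ^ k)"

definition h_at_1 :: real where
  "h_at_1 = (\<Prod>p::nat. if prime p
     then 1 + 1 / (real p ^ 2 * (real p + 1)) - 1 / (real p ^ 3 * (real p + 1)) else 1)"

(* zeta 2 and zeta 4 are real, so taking real parts only changes the type. *)
definition E_err :: "nat \<Rightarrow> real \<Rightarrow> real" where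
  "E_err k x = S_sum k x - Re (zeta 4) * h_at_1 / (fact (k + 1) * Re (zeta 2)) * x"

end

theory Submission
  imports Defs "HOL-Number_Theory.Totient" "HOL-Real_Asymp.Real_Asymp"
begin

text \<open>
  The function \<open>l / \<psi>(l)\<close> is the Dirichlet convolution of \<open>\<phi>(l) / l\<close> with the multiplicative function
  \<open>b\<close> given by \<open>b(p\<^sup>j) = p\<^sup>-\<^sup>j / (p + 1)\<close>. As \<open>\<Sum> b(n) n\<^sup>1\<^sup>/\<^sup>2\<close> converges, for \<open>k = 2\<close> it suffices to treat the
  Riesz mean of \<open>\<phi>(l) / l\<close>, which is the Perron integral of
  \<open>A(s) = \<zeta>(s) / (\<zeta>(s + 1) s (s + 1) (s + 2))\<close>. The pole of \<open>A\<close> at \<open>1\<close> gives the main part, the poles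
  at \<open>\<rho> - 1\<close> lie on the line \<open>Re s = - 1 / 2\<close>, and by the functional equation and the bound on
  \<open>J\<^sub>-\<^sub>1\<^sub>/\<^sub>2\<close> their residues are absolutely summable. Instead of moving the contour of \<open>A\<close> across
  infinitely many poles at well-chosen heights, one subtracts the poles, each in the form
  \<open>4 r / ((s - p) (s - p + 4))\<close>, whose Perron integral is explicit. The remainder is holomorphic for
  \<open>Re s > - 2\<close> and, being a quotient of functions of exponential growth, itself grows at most
  exponentially; hence its integral can be moved to \<open>Re s = - 3 / 2\<close> and is negligible. The step from
  \<open>k\<close> to \<open>k + 1\<close> is the identity that \<open>x\<^sup>k\<^sup>+\<^sup>1 E\<^sub>k\<^sub>+\<^sub>1(x)\<close> is the integral of \<open>u\<^sup>k E\<^sub>k(u)\<close> over \<open>[0, x]\<close>.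
\<close>

section \<open>Multiplicative functions and Euler products\<close>

text \<open>The bound has no room for a factor x^\<epsilon>. The exponent -1/2 is reached because
  each zero contributes r x^p with Re p = -1/2 and the coefficients are absolutely summable: at
  \<rho> - 1 they are O(1 / (\<gamma>^2 |zeta'(\<rho>)|)), and dyadic blocks with
  \<open>J_minus_half\<close> at \<epsilon> = 1/2 add these up. The obstacle is 1 / zeta inside the
  strip, whose size between the zeros is unknown. After subtraction the remainder is still a
  quotient with the same denominator; it is bounded on discs centred on Re s = 3, where the Euler
  product keeps the denominator away from 0. The resulting bound exp(K |t|) is useless for
  convergence, but harmless under a factor exp(\<eta> s^2) with \<eta> tending to 0. The second
  fraction in each subtracted term gives quadratic decay, and the distance 4 puts its pole at Re s
  \<le> -3, outside the half-plane Re s > -2. The line Re s = -3/2 is admissible because zeta(s) /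
  zeta(s + 1) grows linearly there against a cubic denominator. Estimates are carried for all x > 0,
  since the convolution with b and the integration from 0 both use small arguments.\<close>

definition multiplicative :: "(nat \<Rightarrow> 'a :: comm_semiring_1) \<Rightarrow> bool" where
  "multiplicative f \<longleftrightarrow> f 1 = 1 \<and> (\<forall>a b. a > 0 \<longrightarrow> b > 0 \<longrightarrow> coprime a b \<longrightarrow> f (a * b) = f a * f b)"

lemma multiplicativeI:
  assumes "f 1 = 1" "\<And>a b. a > 0 \<Longrightarrow> b > 0 \<Longrightarrow> coprime a b \<Longrightarrow> f (a * b) = f a * f b"
  shows "multiplicative f"
  using assms unfolding multiplicative_def by blast

lemma multiplicativeD:
  assumes "multiplicative f"
  shows "f 1 = 1" "a > 0 \<Longrightarrow> b > 0 \<Longrightarrow> coprime a b \<Longrightarrow> f (a * b) = f a * f b"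
  using assms unfolding multiplicative_def by blast+

text \<open>Induction on n: remove the full power of one prime divisor; the cofactor is smaller and
  coprime to that power.\<close>

lemma multiplicative_eqI:
  assumes f: "multiplicative f" and g: "multiplicative g"
    and eq: "\<And>p j. prime p \<Longrightarrow> j > 0 \<Longrightarrow> f (p ^ j) = g (p ^ j)" and "n > 0"
  shows "f n = g n"
  using \<open>n > 0\<close>
proof (induction n rule: less_induct)
  case (less n)
  show ?case
  proof (cases "n = 1")
    case True
    then show ?thesis using f g by (simp add: multiplicative_def)
  next
    case False
    with less obtain p where p: "prime p" "p dvd n"
      using prime_factor_nat by blast
    define j where "j = multiplicity p n"
    have "n \<noteq> 0" "\<not> is_unit p" using less p by (auto simp: prime_nat_iff)
    then obtain m where m: "n = p ^ j * m" "\<not> p dvd m"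
      unfolding j_def by (rule multiplicity_decompose')
    have j: "j > 0" unfolding j_def using p \<open>n \<noteq> 0\<close>
      by (simp add: prime_multiplicity_gt_zero_iff)
    have cop: "coprime (p ^ j) m"
      using m p by (simp add: prime_imp_coprime)
    have m0: "m > 0" using \<open>n \<noteq> 0\<close> m by (auto intro!: Nat.gr0I)
    have "1 < p ^ j" using p j by (metis one_less_power prime_gt_1_nat)
    hence "m < n" using m0 m by simp
    have "f n = f (p ^ j) * f m" "g n = g (p ^ j) * g m"
      unfolding m(1) using multiplicativeD(2)[OF f _ m0 cop] multiplicativeD(2)[OF g _ m0 cop]
        p(1) by (auto simp: prime_gt_0_nat)
    then show ?thesis using eq[OF p(1) j] less.IH[OF \<open>m < n\<close> m0] by simp
  qed
qed

definition dconv :: "(nat \<Rightarrow> 'a :: comm_semiring_1) \<Rightarrow> (nat \<Rightarrow> 'a) \<Rightarrow> nat \<Rightarrow> 'a" where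
  "dconv f g n = (\<Sum>d | d dvd n. f d * g (n div d))"

text \<open>For coprime a and b every divisor of a * b is in exactly one way a product of a divisor
  of a and a divisor of b, so the divisor sum factors.\<close>

lemma multiplicative_dconv:
  assumes f: "multiplicative f" and g: "multiplicative g"
  shows "multiplicative (dconv f g)"
proof (rule multiplicativeI)
  show "dconv f g 1 = 1" using f g by (simp add: dconv_def multiplicative_def)
next
  fix a b :: nat assume ab: "a > 0" "b > 0" "coprime a b"
  have "bij_betw (\<lambda>(x, y). x * y) ({d. d dvd a} \<times> {d. d dvd b}) {d. d dvd a * b}"
  proof (rule bij_betw_imageI)
    show "inj_on (\<lambda>(x, y). x * y) ({d. d dvd a} \<times> {d. d dvd b})"
    proof (rule inj_onI, clarify)
      fix x y x' y' :: nat
      assume h: "x dvd a" "y dvd b" "x' dvd a" "y' dvd b" "x * y = x' * y'"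
      have c: "coprime x y'" "coprime x' y"
        using ab h by (meson coprime_divisors)+
      have "x dvd x' * y'" "x' dvd x * y" using h(5) by (metis dvd_triv_left)+
      with c have "x dvd x'" "x' dvd x"
        by (simp_all add: coprime_dvd_mult_left_iff)
      hence "x = x'" by (rule dvd_antisym)
      moreover have "x > 0" using h ab by (metis dvd_0_left gr0I)
      ultimately show "x = x' \<and> y = y'" using h(5) by simp
    qed
    show "(\<lambda>(x, y). x * y) ` ({d. d dvd a} \<times> {d. d dvd b}) = {d. d dvd a * b}"
      by (force dest: division_decomp simp: mult_dvd_mono image_iff)
  qed
  hence "dconv f g (a * b) = (\<Sum>(x, y)\<in>{d. d dvd a} \<times> {d. d dvd b}. f (x * y) * g (a * b div (x * y)))"
    unfolding dconv_def by (subst sum.reindex_bij_betw[symmetric], assumption) (simp add: case_prod_unfold)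
  also have "\<dots> = (\<Sum>(x, y)\<in>{d. d dvd a} \<times> {d. d dvd b}. (f x * g (a div x)) * (f y * g (b div y)))"
  proof (rule sum.cong, simp, clarify)
    fix x y assume h: "x dvd a" "y dvd b"
    have pos: "x > 0" "y > 0" using h ab by (auto intro!: Nat.gr0I)
    have "f (x * y) = f x * f y"
      using ab h pos by (intro multiplicativeD(2)[OF f]) (meson coprime_divisors)+
    moreover have "a * b div (x * y) = (a div x) * (b div y)"
      using h by (simp add: div_mult_div_if_dvd)
    moreover have "g ((a div x) * (b div y)) = g (a div x) * g (b div y)"
    proof (rule multiplicativeD(2)[OF g])
      have "a div x dvd a" "b div y dvd b"
        using h by (metis dvd_div_mult_self dvd_triv_left)+
      thus "coprime (a div x) (b div y)"
        using ab(3) by (meson coprime_divisors)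
    qed (use h ab pos in \<open>auto simp: div_greater_zero_iff dvd_imp_le\<close>)
    ultimately show "f (x * y) * g (a * b div (x * y)) = (f x * g (a div x)) * (f y * g (b div y))"
      by (simp add: mult_ac)
  qed
  also have "\<dots> = dconv f g a * dconv f g b"
    unfolding dconv_def by (simp add: sum_product sum.cartesian_product)
  finally show "dconv f g (a * b) = dconv f g a * dconv f g b" .
qed

lemma dconv_prime_power:
  assumes "prime p"
  shows "dconv f g (p ^ j) = (\<Sum>i\<le>j. f (p ^ i) * g (p ^ (j - i)))"
proof -
  have inj: "inj_on (\<lambda>i. p ^ i) {..j}"
    using prime_gt_1_nat[OF assms] by (auto simp: inj_on_def)
  have "{d. d dvd p ^ j} = (\<lambda>i. p ^ i) ` {..j}"
    using assms by (auto simp: divides_primepow_nat)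
  hence "dconv f g (p ^ j) = (\<Sum>i\<le>j. f (p ^ i) * g (p ^ j div p ^ i))"
    unfolding dconv_def by (simp add: sum.reindex[OF inj])
  also have "\<dots> = (\<Sum>i\<le>j. f (p ^ i) * g (p ^ (j - i)))"
    using prime_gt_0_nat[OF assms] by (intro sum.cong) (auto simp: power_diff)
  finally show ?thesis .
qed

lemma dedekind_psi_eq_dconv:
  "real_of_int (dedekind_psi n) = dconv real (\<lambda>n. if squarefree n then 1 else 0) n"
proof -
  have "real_of_int ((moebius m)\<^sup>2) = (if squarefree m then 1 else 0)" for m
    by (simp add: moebius_def flip: power_mult)
  thus ?thesis by (simp add: dedekind_psi_def dconv_def del: of_int_power)
qed

lemma multiplicative_dedekind_psi: "multiplicative (\<lambda>n. real_of_int (dedekind_psi n))"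
  unfolding dedekind_psi_eq_dconv
  by (rule multiplicative_dconv)
     (auto simp: multiplicative_def squarefree_mult_coprime dest: squarefree_multD)

text \<open>Only the divisors p^j and p^(j - 1) have a squarefree cofactor.\<close>

lemma dedekind_psi_prime_power:
  assumes p: "prime p" and "j > 0"
  shows "real_of_int (dedekind_psi (p ^ j)) = real p ^ j * (1 + 1 / real p)"
proof -
  obtain i where j: "j = Suc i" using \<open>j > 0\<close> by (cases j) auto
  have sqf: "squarefree (p ^ m) \<longleftrightarrow> m \<le> 1" for m
    using p by (auto simp: squarefree_power_iff squarefree_prime le_Suc_eq prime_nat_iff)
  have "real_of_int (dedekind_psi (p ^ j)) = (\<Sum>m\<le>j. real (p ^ m) * (if j - m \<le> 1 then 1 else 0))"
    unfolding dedekind_psi_eq_dconv dconv_prime_power[OF p] by (simp only: sqf)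
  also have "\<dots> = (\<Sum>m\<in>{i, j}. real (p ^ m) * (if j - m \<le> 1 then 1 else 0))"
    by (intro sum.mono_neutral_right) (auto simp: j)
  also have "\<dots> = real p ^ j * (1 + 1 / real p)"
    using prime_gt_0_nat[OF p] by (simp add: j field_simps)
  finally show ?thesis .
qed

definition psi_ratio :: "nat \<Rightarrow> real" where "psi_ratio l = real l / real_of_int (dedekind_psi l)"
definition phi_ratio :: "nat \<Rightarrow> real" where "phi_ratio l = real (totient l) / real l"
text \<open>As power series in X, the local factors at p of l / psi(l) and phi(l) / l have the
  quotient (1 - X / (p + 1)) / (1 - X / p), whose coefficient at X^j is p^(-j) / (p + 1) for j > 0.
  The closed form takes 1 / (p + 1) once for every prime divisor, whatever its exponent.\<close>

definition bcoeff :: "nat \<Rightarrow> real" where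
  "bcoeff n = 1 / (real n * (\<Prod>p\<in>prime_factors n. real p + 1))"

lemma multiplicative_psi_ratio: "multiplicative psi_ratio"
  using multiplicative_dedekind_psi unfolding multiplicative_def psi_ratio_def by auto

lemma multiplicative_phi_ratio: "multiplicative phi_ratio"
  unfolding multiplicative_def phi_ratio_def by (auto simp: totient_mult_coprime)

lemma multiplicative_bcoeff: "multiplicative bcoeff"
proof (rule multiplicativeI)
  fix a b :: nat assume ab: "a > 0" "b > 0" "coprime a b"
  have "prime_factors (a * b) = prime_factors a \<union> prime_factors b"
    using ab by (simp add: prime_factors_product)
  moreover have "prime_factors a \<inter> prime_factors b = {}"
    using ab by (auto simp: in_prime_factors_iff dest: coprime_common_divisor)
  ultimately show "bcoeff (a * b) = bcoeff a * bcoeff b"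
    by (simp add: bcoeff_def prod.union_disjoint)
qed (simp add: bcoeff_def)

lemma bcoeff_prime_power:
  assumes "prime p" "j > 0"
  shows "bcoeff (p ^ j) = (1 / real p) ^ j / (real p + 1)"
  using assms by (simp add: bcoeff_def prime_factorization_prime_power field_simps)

lemma phi_ratio_prime_power:
  assumes "prime p" "j > 0"
  shows "phi_ratio (p ^ j) = 1 - 1 / real p"
proof -
  obtain i where j: "j = Suc i" using \<open>j > 0\<close> by (cases j) auto
  have "real (totient (p ^ j)) = real (p ^ i) * (real p - 1)"
    using prime_gt_0_nat[OF assms(1)] totient_prime_power_Suc[OF assms(1), of i]
    by (simp add: j of_nat_diff Suc_leI del: power_Suc)
  thus ?thesis using prime_gt_0_nat[OF assms(1)] by (simp add: phi_ratio_def j field_simps)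
qed

lemma psi_ratio_prime_power:
  assumes "prime p" "j > 0"
  shows "psi_ratio (p ^ j) = real p / (real p + 1)"
  unfolding psi_ratio_def dedekind_psi_prime_power[OF assms]
  using prime_gt_0_nat[OF assms(1)] by (simp add: divide_simps)

lemma sum_atMost_ends:
  fixes f :: "nat \<Rightarrow> real"
  assumes "j > 0"
  shows "(\<Sum>i\<le>j. f i) = f 0 + (\<Sum>i=1..<j. f i) + f j"
proof -
  have "{..j} = insert 0 (insert j {1..<j})" using assms by auto
  thus ?thesis using assms by simp
qed

text \<open>On a prime power p^j, with r = 1 / p, the inner terms form a geometric progression that
  cancels against the last term and leaves 1 - r + r / (p + 1), the same value for every j >
  0.\<close>

lemma psi_ratio_eq_dconv:
  assumes "n > 0"
  shows "psi_ratio n = dconv bcoeff phi_ratio n"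
proof (rule multiplicative_eqI[OF multiplicative_psi_ratio _ _ assms])
  show "multiplicative (dconv bcoeff phi_ratio)"
    by (intro multiplicative_dconv multiplicative_bcoeff multiplicative_phi_ratio)
next
  fix p j :: nat assume p: "prime p" and j: "j > 0"
  define r where "r = 1 / real p"
  have p1: "real p > 1" using prime_gt_1_nat[OF p] by simp
  have geo: "(1 - r) * (\<Sum>i=1..<j. r ^ i) = r - r ^ j"
  proof -
    obtain i where i: "j = Suc i" using j by (cases j) auto
    show ?thesis unfolding i
      by (induction i) (simp_all add: distrib_left, simp add: left_diff_distrib)
  qed
  have "dconv bcoeff phi_ratio (p ^ j)
      = (1 - r) + (\<Sum>i=1..<j. r ^ i / (real p + 1) * (1 - r)) + r ^ j / (real p + 1)"
    unfolding dconv_prime_power[OF p] sum_atMost_ends[OF j]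
    using j p multiplicativeD(1)[OF multiplicative_phi_ratio] multiplicativeD(1)[OF multiplicative_bcoeff]
    by (auto simp: bcoeff_prime_power phi_ratio_prime_power r_def intro!: sum.cong)
  also have "(\<Sum>i=1..<j. r ^ i / (real p + 1) * (1 - r)) = ((1 - r) * (\<Sum>i=1..<j. r ^ i)) / (real p + 1)"
    by (simp add: sum_distrib_left sum_divide_distrib mult_ac)
  also have "(1 - r) + \<dots> + r ^ j / (real p + 1) = 1 - r + r / (real p + 1)"
    unfolding geo by (simp add: diff_divide_distrib)
  also have "\<dots> = real p / (real p + 1)"
  proof -
    have "(real p + 1) * (1 - r) + r = real p" using p1 by (simp add: r_def field_simps)
    thus ?thesis using p1 by (simp add: field_simps)
  qed
  finally show "psi_ratio (p ^ j) = dconv bcoeff phi_ratio (p ^ j)"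
    by (simp add: psi_ratio_prime_power[OF p j])
qed

section \<open>Unconditional sums, Dirichlet convolution and Euler products\<close>

lemma summable_on_times_complex:
  fixes f :: "'a \<Rightarrow> complex" and g :: "'b \<Rightarrow> complex"
  assumes "f summable_on A" "g summable_on B"
  shows "(\<lambda>(x, y). f x * g y) summable_on A \<times> B"
proof -
  have "(\<lambda>x. norm (f x)) summable_on A" "(\<lambda>x. norm (g x)) summable_on B"
    using assms by (simp_all add: summable_on_iff_abs_summable_on_complex)
  thus ?thesis
    unfolding summable_on_iff_abs_summable_on_complex Infinite_Sum.abs_summable_on_Sigma_iff
    by (auto simp: norm_mult infsum_cmult_right' abs_mult infsum_nonneg
        intro!: summable_on_cmult_right summable_on_cmult_left)
qed

lemma infsum_times_complex:
  fixes f :: "'a \<Rightarrow> complex" and g :: "'b \<Rightarrow> complex"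
  assumes "f summable_on A" "g summable_on B"
  shows "infsum (\<lambda>(x, y). f x * g y) (A \<times> B) = infsum f A * infsum g B"
  using infsum_Sigma'_banach[OF summable_on_times_complex[OF assms]]
  by (simp add: infsum_cmult_right' infsum_cmult_left')

text \<open>Pairs (d, m) correspond to pairs (l, d) with d dividing l through l = d * m, so the
  product of the two sums can be regrouped by l. Unconditional summability is what permits the
  regrouping.\<close>

lemma infsum_dconv:
  fixes f g :: "nat \<Rightarrow> complex"
  assumes "f summable_on {0<..}" "g summable_on {0<..}"
  shows "infsum (dconv f g) {0<..} = infsum f {0<..} * infsum g {0<..}"
    and "dconv f g summable_on {0<..}"
proof -
  let ?S = "Sigma {0<..} (\<lambda>l. {d. d dvd l}) :: (nat \<times> nat) set"
  let ?h = "\<lambda>(d, m). (d * m, d) :: nat \<times> nat"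
  have bij: "bij_betw ?h ({0<..} \<times> {0<..}) ?S"
    by (rule bij_betwI[where g = "\<lambda>(l, d). (d, l div d)"])
       (auto dest: dvd_imp_le simp: div_greater_zero_iff intro: dvd_pos_nat)
  have eq: "(\<lambda>(l, d). f d * g (l div d)) (?h z) = (\<lambda>(x, y). f x * g y) z"
    if "z \<in> {0<..} \<times> {0<..}" for z
    using that by auto
  have sm: "(\<lambda>(l, d). f d * g (l div d)) summable_on ?S"
    using summable_on_times_complex[OF assms] 
    by (subst summable_on_reindex_bij_betw[OF bij, symmetric]) (simp add: eq cong: summable_on_cong)

  have "infsum (dconv f g) {0<..} = infsum (\<lambda>l. infsum (\<lambda>d. f d * g (l div d)) {d. d dvd l}) {0<..}"
    by (intro infsum_cong) (simp add: dconv_def)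
  also have "\<dots> = infsum (\<lambda>(l, d). f d * g (l div d)) ?S"
    by (rule infsum_Sigma'_banach[OF sm])
  also have "\<dots> = infsum (\<lambda>(x, y). f x * g y) ({0<..} \<times> {0<..})"
    by (subst infsum_reindex_bij_betw[OF bij, symmetric]) (intro infsum_cong eq)
  also have "\<dots> = infsum f {0<..} * infsum g {0<..}"
    by (rule infsum_times_complex[OF assms])
  finally show "infsum (dconv f g) {0<..} = infsum f {0<..} * infsum g {0<..}" .
  show "dconv f g summable_on {0<..}"
    using summable_on_Sigma_banach[OF sm]
    by (rule summable_on_cong[THEN iffD1, rotated]) (simp add: dconv_def)
qed

definition smooth :: "nat set \<Rightarrow> nat set" where
  "smooth P = {n. n > 0 \<and> prime_factors n \<subseteq> P}"

lemma smooth_empty: "smooth {} = {1}"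
  by (auto simp: smooth_def prime_factorization_empty_iff)

text \<open>Splits off the power of the new prime. This is the induction step of both Euler product
  arguments: the identity for summable complex functions and the inequality for nonnegative
  ones.\<close>

lemma bij_betw_smooth_insert:
  assumes q: "prime q" "q \<notin> P"
  shows "bij_betw (\<lambda>(j, m). q ^ j * m) (UNIV \<times> smooth P) (smooth (insert q P))"
proof (rule bij_betwI[where g = "\<lambda>n. (multiplicity q n, n div q ^ multiplicity q n)"])
  have nd: "\<not> q dvd m" if "m \<in> smooth P" for m
    using that q by (auto simp: smooth_def in_prime_factors_iff)
  show "(\<lambda>(j, m). q ^ j * m) \<in> UNIV \<times> smooth P \<rightarrow> smooth (insert q P)"
  proof clarsimp
    fix j m assume m: "m \<in> smooth P"
    have "prime_factors (q ^ j) \<subseteq> {q}"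
      using q(1) by (auto simp: in_prime_factors_iff) (metis prime_dvd_power primes_dvd_imp_eq)
    thus "q ^ j * m \<in> smooth (insert q P)"
      using m q(1) by (auto simp: smooth_def prime_factors_product prime_gt_0_nat)
  qed
  show "(\<lambda>n. (multiplicity q n, n div q ^ multiplicity q n)) \<in> smooth (insert q P) \<rightarrow> UNIV \<times> smooth P"
  proof clarsimp
    fix n assume n: "n \<in> smooth (insert q P)"
    hence n0: "n > 0" by (simp add: smooth_def)
    define m where "m = n div q ^ multiplicity q n"
    have nm: "n = q ^ multiplicity q n * m"
      unfolding m_def by (simp add: multiplicity_dvd)
    have m0: "m > 0" using n0 nm by (metis gr0I mult_0_right)
    have "\<not> q dvd m" unfolding m_def
      using n0 q(1) by (metis gr_implies_not0 multiplicity_decompose not_prime_unit)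
    moreover have "prime_factors m \<subseteq> prime_factors n"
      using n0 nm by (metis dvd_prime_factors dvd_triv_right gr_implies_not0)
    ultimately have "prime_factors m \<subseteq> P"
      using n by (auto simp: smooth_def in_prime_factors_iff)
    thus "n div q ^ multiplicity q n \<in> smooth P" using m0 by (simp add: smooth_def m_def)
  qed
  fix x :: "nat \<times> nat" assume x: "x \<in> UNIV \<times> smooth P"
  obtain j m where [simp]: "x = (j, m)" by (cases x)
  have m: "m \<in> smooth P" using x by auto
  have "multiplicity q (q ^ j * m) = j"
    using nd[OF m] q m
    by (auto simp: smooth_def prime_elem_multiplicity_mult_distrib not_dvd_imp_multiplicity_0
        prime_gt_0_nat)
  thus "(\<lambda>n. (multiplicity q n, n div q ^ multiplicity q n)) ((\<lambda>(j, m). q ^ j * m) x) = x"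
    using prime_gt_0_nat[OF q(1)] by simp
next
  fix n assume "n \<in> smooth (insert q P)"
  show "(\<lambda>(j, m). q ^ j * m) (multiplicity q n, n div q ^ multiplicity q n) = n"
    by (simp add: multiplicity_dvd)
qed

lemma multiplicative_smooth:
  assumes "multiplicative f" "prime q" "q \<notin> P" "m \<in> smooth P"
  shows "f (q ^ j * m) = f (q ^ j) * f m"
proof (rule multiplicativeD(2)[OF assms(1)])
  have "\<not> q dvd m" using assms by (auto simp: smooth_def in_prime_factors_iff)
  thus "coprime (q ^ j) m" using assms by (simp add: prime_imp_coprime)
qed (use assms in \<open>auto simp: smooth_def prime_gt_0_nat\<close>)

lemma finite_euler_product:
  fixes f :: "nat \<Rightarrow> complex"
  assumes f: "multiplicative f" and sm: "f summable_on {0<..}"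
    and P: "finite P" "\<And>p. p \<in> P \<Longrightarrow> prime p"
  shows "infsum f (smooth P) = (\<Prod>p\<in>P. \<Sum>\<^sub>\<infinity>j. f (p ^ j))"
  using P
proof (induction P rule: finite_induct)
  case empty
  then show ?case using f by (simp add: smooth_empty multiplicative_def)
next
  case (insert q P)
  have q: "prime q" using insert by auto
  have sP: "f summable_on smooth P"
    by (rule summable_on_subset_banach[OF sm]) (auto simp: smooth_def)
  have "inj (\<lambda>j. q ^ j)" using prime_gt_1_nat[OF q] by (auto simp: inj_on_def)
  moreover have "f summable_on range (\<lambda>j. q ^ j)"
    by (rule summable_on_subset_banach[OF sm]) (use prime_gt_0_nat[OF q] in auto)
  ultimately have sq: "(\<lambda>j. f (q ^ j)) summable_on UNIV"
    by (simp add: summable_on_reindex o_def)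
  have "infsum f (smooth (insert q P)) = infsum (\<lambda>z. f (case z of (j, m) \<Rightarrow> q ^ j * m)) (UNIV \<times> smooth P)"
    by (rule infsum_reindex_bij_betw[OF bij_betw_smooth_insert[OF q insert.hyps(2)], symmetric])
  also have "\<dots> = infsum (\<lambda>(j, m). f (q ^ j) * f m) (UNIV \<times> smooth P)"
    by (intro infsum_cong) (auto simp: multiplicative_smooth[OF f q insert.hyps(2)])
  also have "\<dots> = (\<Sum>\<^sub>\<infinity>j. f (q ^ j)) * infsum f (smooth P)"
    by (rule infsum_times_complex[OF sq sP])
  finally show ?case using insert by simp
qed

text \<open>The integers whose prime factors are at most N include all n from 1 to N, so these sets
  eventually contain any given finite set, and the sums over them converge to the unconditional
  sum.\<close>

lemma euler_product:
  fixes f :: "nat \<Rightarrow> complex"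
  assumes f: "multiplicative f" and sm: "f summable_on {0<..}"
  shows "(\<lambda>N. \<Prod>p | prime p \<and> p \<le> N. \<Sum>\<^sub>\<infinity>j. f (p ^ j)) \<longlonglongrightarrow> infsum f {0<..}"
proof -
  let ?P = "\<lambda>N. {p. prime p \<and> p \<le> N}"
  have "(\<lambda>N. infsum f (smooth (?P N))) \<longlonglongrightarrow> infsum f {0<..}"
  proof (rule LIMSEQ_I)
    fix e :: real assume e: "e > 0"
    have "(sum f \<longlongrightarrow> infsum f {0<..}) (finite_subsets_at_top {0<..})"
      using has_sum_infsum[OF sm] by (simp add: has_sum_def)
    hence "\<forall>\<^sub>F X in finite_subsets_at_top {0<..}. dist (sum f X) (infsum f {0<..}) < e / 2"
      using e by (intro tendstoD) auto
    then obtain X where X': "finite X \<and> X \<subseteq> {0<..} \<and>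
        (\<forall>Y. finite Y \<and> X \<subseteq> Y \<and> Y \<subseteq> {0<..} \<longrightarrow> dist (sum f Y) (infsum f {0<..}) < e / 2)"
      unfolding eventually_finite_subsets_at_top ..
    hence X: "finite X" "X \<subseteq> {0<..}"
      "\<And>Y. finite Y \<Longrightarrow> X \<subseteq> Y \<Longrightarrow> Y \<subseteq> {0<..} \<Longrightarrow> dist (sum f Y) (infsum f {0<..}) < e / 2"
      by blast+
    obtain N0 where N0: "X \<subseteq> {..N0}"
      using X(1) by (metis finite_nat_iff_bounded_le)
    show "\<exists>no. \<forall>n\<ge>no. norm (infsum f (smooth (?P n)) - infsum f {0<..}) < e"
    proof (intro exI allI impI)
      fix n assume n: "n \<ge> N0"
      have sub: "X \<subseteq> smooth (?P n)"
      proof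
        fix x assume "x \<in> X"
        hence x: "0 < x" "x \<le> n" using X(2) N0 n by auto
        hence "prime p \<and> p \<le> n" if "p \<in> prime_factors x" for p
          using that by (auto simp: in_prime_factors_iff dest: dvd_imp_le)
        thus "x \<in> smooth (?P n)" using x by (auto simp: smooth_def)
      qed
      have sm': "f summable_on smooth (?P n)"
        by (rule summable_on_subset_banach[OF sm]) (auto simp: smooth_def)
      have "(sum f \<longlongrightarrow> infsum f (smooth (?P n))) (finite_subsets_at_top (smooth (?P n)))"
        using has_sum_infsum[OF sm'] by (simp add: has_sum_def)
      moreover have "\<forall>\<^sub>F Y in finite_subsets_at_top (smooth (?P n)). norm (sum f Y - infsum f {0<..}) \<le> e / 2"
        unfolding eventually_finite_subsets_at_top
      proof (intro exI[of _ X] conjI allI impI)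
        fix Y assume Y: "finite Y \<and> X \<subseteq> Y \<and> Y \<subseteq> smooth (?P n)"
        have "Y \<subseteq> {0<..}" using Y by (auto simp: smooth_def)
        thus "norm (sum f Y - infsum f {0<..}) \<le> e / 2"
          using X(3)[of Y] Y by (simp add: dist_norm)
      qed (use X sub in auto)
      ultimately have "norm (infsum f (smooth (?P n)) - infsum f {0<..}) \<le> e / 2"
        by (intro tendsto_upperbound[of "\<lambda>Y. norm (sum f Y - infsum f {0<..})"] tendsto_intros) auto
      thus "norm (infsum f (smooth (?P n)) - infsum f {0<..}) < e" using e by simp
    qed
  qed
  moreover have "infsum f (smooth (?P N)) = (\<Prod>p\<in>?P N. \<Sum>\<^sub>\<infinity>j. f (p ^ j))" for N
    by (rule finite_euler_product[OF f sm]) auto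
  ultimately show ?thesis by simp
qed

text \<open>The upper half of the Euler product for finite sets only: it presupposes no summability,
  so it can serve to prove it.\<close>

lemma sum_smooth_le:
  fixes f :: "nat \<Rightarrow> real"
  assumes f: "multiplicative f" and nonneg: "\<And>n. n > 0 \<Longrightarrow> 0 \<le> f n"
    and F: "\<And>p. prime p \<Longrightarrow> (\<lambda>j. f (p ^ j)) sums F p"
    and P: "finite P" "\<And>p. p \<in> P \<Longrightarrow> prime p"
  shows "finite A \<Longrightarrow> A \<subseteq> smooth P \<Longrightarrow> sum f A \<le> (\<Prod>p\<in>P. F p)"
  using P
proof (induction P arbitrary: A rule: finite_induct)
  case empty
  hence "A = {} \<or> A = {1}" by (auto simp: smooth_empty)
  then show ?case using f by (auto simp: multiplicative_def)
next
  case (insert q P)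
  have q: "prime q" using insert by auto
  let ?h = "\<lambda>(j, m). q ^ j * m"
  have bij: "bij_betw ?h (UNIV \<times> smooth P) (smooth (insert q P))"
    by (rule bij_betw_smooth_insert[OF q insert.hyps(2)])
  obtain B where B: "B \<subseteq> UNIV \<times> smooth P" "A = ?h ` B"
    using insert.prems(2) bij unfolding bij_betw_def by (metis subset_imageE)
  have inj: "inj_on ?h B" using bij B unfolding bij_betw_def by (metis inj_on_subset)
  have finB: "finite B" using insert.prems(1) inj unfolding B(2) by (rule finite_imageD)
  define J M where "J = fst ` B" and "M = snd ` B"
  have JM: "finite J" "finite M" "M \<subseteq> smooth P" "B \<subseteq> J \<times> M"
    using finB B(1) unfolding J_def M_def by (auto simp: image_iff) force+
  have fq: "f (q ^ j) \<ge> 0" for j using nonneg prime_gt_0_nat[OF q] by simp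
  have fM: "f m \<ge> 0" if "m \<in> M" for m using that JM nonneg by (auto simp: smooth_def)
  have "sum f A = (\<Sum>(j, m)\<in>B. f (q ^ j * m))"
    unfolding B(2) by (subst sum.reindex[OF inj]) (simp add: case_prod_unfold)
  also have "\<dots> = (\<Sum>(j, m)\<in>B. f (q ^ j) * f m)"
    using B(1) by (intro sum.cong) (auto simp: multiplicative_smooth[OF f q insert.hyps(2)])
  also have "\<dots> \<le> (\<Sum>(j, m)\<in>J \<times> M. f (q ^ j) * f m)"
    using JM fq fM by (intro sum_mono2) auto
  also have "\<dots> = (\<Sum>j\<in>J. f (q ^ j)) * sum f M"
    by (simp add: sum_product sum.cartesian_product)
  also have "\<dots> \<le> F q * (\<Prod>p\<in>P. F p)"
  proof (rule mult_mono)
    show "(\<Sum>j\<in>J. f (q ^ j)) \<le> F q"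
      using F[OF q] fq JM(1) sum_le_suminf[of "\<lambda>j. f (q ^ j)" J] by (auto simp: sums_iff)
    show "sum f M \<le> (\<Prod>p\<in>P. F p)" using insert JM by blast
    show "F q \<ge> 0" using F[OF q] fq by (metis sums_iff suminf_nonneg)
    show "sum f M \<ge> 0" using fM by (intro sum_nonneg)
  qed
  finally show ?case using insert.hyps by simp
qed

text \<open>Each finite partial sum is bounded by a finite product of factors 1 + c p, hence by exp
  of the sum of all c p.\<close>

lemma summable_on_multiplicative:
  fixes f :: "nat \<Rightarrow> real"
  assumes f: "multiplicative f" and nonneg: "\<And>n. n > 0 \<Longrightarrow> 0 \<le> f n"
    and F: "\<And>p. prime p \<Longrightarrow> (\<lambda>j. f (p ^ j)) sums F p"
    and c: "\<And>p. prime p \<Longrightarrow> F p \<le> 1 + c p" "\<And>p. c p \<ge> 0" "summable c"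
  shows "f summable_on {0<..}"
proof (rule nonneg_bounded_partial_sums_imp_summable_on)
  show "\<forall>\<^sub>F X in finite_subsets_at_top {0<..}. sum f X \<le> exp (suminf c)"
  proof (rule eventually_finite_subsets_at_top_weakI)
    fix X :: "nat set" assume X: "finite X" "X \<subseteq> {0<..}"
    define P where "P = (\<Union>x\<in>X. prime_factors x)"
    have P: "finite P" "\<And>p. p \<in> P \<Longrightarrow> prime p"
      using X by (auto simp: P_def in_prime_factors_iff)
    have Fnn: "F p \<ge> 0" if "prime p" for p
    proof -
      have "f (p ^ j) \<ge> 0" for j using nonneg prime_gt_0_nat[OF that] by simp
      thus ?thesis using F[OF that] by (metis sums_iff suminf_nonneg)
    qed
    have "sum f X \<le> (\<Prod>p\<in>P. F p)"
      using X by (intro sum_smooth_le[OF f nonneg F P]) (auto simp: smooth_def P_def)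
    also have "\<dots> \<le> (\<Prod>p\<in>P. exp (c p))"
    proof (rule prod_mono)
      fix p assume "p \<in> P"
      hence "prime p" using P by simp
      thus "0 \<le> F p \<and> F p \<le> exp (c p)"
        using Fnn[of p] c(1)[of p] exp_ge_add_one_self[of "c p"] by linarith
    qed
    also have "\<dots> = exp (sum c P)" using P by (simp add: exp_sum)
    also have "\<dots> \<le> exp (suminf c)"
      using c P by (simp add: sum_le_suminf)
    finally show "sum f X \<le> exp (suminf c)" .
  qed
qed (use nonneg in auto)

section \<open>The zeta function on the closed half-plane Re s at least 1\<close>

lemma holomorphic_suminf:
  fixes f :: "nat \<Rightarrow> complex \<Rightarrow> complex"
  assumes "open U" "\<And>n. f n holomorphic_on U"
    and "\<And>z. z \<in> U \<Longrightarrow> \<exists>d>0. \<exists>M. cball z d \<subseteq> U \<and> summable M \<and> (\<forall>n. \<forall>x\<in>cball z d. norm (f n x) \<le> M n)"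
  shows "(\<lambda>s. \<Sum>n. f n s) holomorphic_on U"
proof (rule holomorphic_uniform_sequence[OF assms(1), where f = "\<lambda>N s. \<Sum>n<N. f n s"])
  show "(\<lambda>s. \<Sum>n<N. f n s) holomorphic_on U" for N
    by (intro holomorphic_intros assms)
  fix z assume "z \<in> U"
  from assms(3)[OF this] obtain d M where
    "d > 0" "cball z d \<subseteq> U" "summable M" "\<forall>n. \<forall>x\<in>cball z d. norm (f n x) \<le> M n" by blast
  thus "\<exists>d>0. cball z d \<subseteq> U \<and>
      uniform_limit (cball z d) (\<lambda>N s. \<Sum>n<N. f n s) (\<lambda>s. \<Sum>n. f n s) sequentially"
    by (intro exI[of _ d] conjI Weierstrass_m_test[where M = M]) auto
qed

lemma norm_of_nat_powr: "n > 0 \<Longrightarrow> norm (of_nat n powr s :: complex) = real n powr Re s"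
  using norm_powr_real_powr[of "of_nat n" s] by simp

lemma summable_on_powr:
  assumes "Re s > 1"
  shows "(\<lambda>n. of_nat n powr (- s) :: complex) summable_on {0<..}"
    and "((\<lambda>n. of_nat n powr (- s)) has_sum zeta s) {0<..}"
proof -
  have "summable (\<lambda>n. real (Suc n) powr (- Re s))"
    using assms by (subst summable_Suc_iff[of "\<lambda>n. real n powr (- Re s)"]) (simp add: summable_real_powr_iff)
  hence "summable (\<lambda>n. norm (of_nat (Suc n) powr (- s) :: complex))"
    by (simp add: norm_of_nat_powr del: of_nat_Suc)
  hence "((\<lambda>n. of_nat (Suc n) powr (- s)) has_sum zeta s) UNIV"
    by (rule norm_summable_imp_has_sum[OF _ zeta_sums[OF assms]])
  hence *: "((\<lambda>n. of_nat n powr (- s)) has_sum zeta s) (range Suc)"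
    by (subst has_sum_reindex) (auto simp: o_def)
  have "range Suc = {0<..}" by (auto simp: image_iff gr0_conv_Suc)
  with * show "((\<lambda>n. of_nat n powr (- s)) has_sum zeta s) {0<..}" by simp
  thus "(\<lambda>n. of_nat n powr (- s) :: complex) summable_on {0<..}"
    by (auto simp: summable_on_def)
qed

lemma of_nat_mult_powr: "of_nat (a * b) powr s = of_nat a powr s * (of_nat b powr s :: complex)"
  by (simp add: powr_times_real)

lemma of_nat_power_powr: "p > 0 \<Longrightarrow> of_nat (p ^ j) powr s = (of_nat p powr s :: complex) ^ j"
  by (induction j) (simp_all only: power_Suc of_nat_mult_powr power_0, simp)

lemma multiplicative_powr: "multiplicative (\<lambda>n. of_nat n powr s :: complex)"
  by (rule multiplicativeI) (simp_all only: of_nat_mult_powr, simp)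

lemma infsum_geometric:
  fixes x :: complex
  assumes "norm x < 1"
  shows "(\<Sum>\<^sub>\<infinity>j. x ^ j) = 1 / (1 - x)"
proof (rule infsumI, rule norm_summable_imp_has_sum)
  show "summable (\<lambda>n. norm (x ^ n))" using assms by (simp add: norm_power summable_geometric)
  show "(\<lambda>n. x ^ n) sums (1 / (1 - x))" by (rule geometric_sums[OF assms])
qed

lemma prime_powr_less_1:
  assumes "prime p" "c > 0" shows "real p powr (- c) < 1" "real p powr (-c) > 0"
  using assms prime_gt_1_nat[OF assms(1)] by (simp_all add: powr_less_one)

lemma zeta_euler_product:
  assumes "Re s > 1"
  shows "(\<lambda>N. \<Prod>p | prime p \<and> p \<le> N. 1 / (1 - of_nat p powr (- s))) \<longlonglongrightarrow> zeta s"
proof -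
  have "(\<lambda>N. \<Prod>p | prime p \<and> p \<le> N. \<Sum>\<^sub>\<infinity>j. of_nat (p ^ j) powr (- s)) \<longlonglongrightarrow> infsum (\<lambda>n. of_nat n powr (- s)) {0<..}"
    by (intro euler_product multiplicative_powr summable_on_powr assms)
  also have "infsum (\<lambda>n. of_nat n powr (- s)) {0<..} = zeta s"
    using summable_on_powr(2)[OF assms] by (rule infsumI)
  also have "(\<lambda>N. \<Prod>p | prime p \<and> p \<le> N. \<Sum>\<^sub>\<infinity>j. of_nat (p ^ j) powr (- s)) =
    (\<lambda>N. \<Prod>p | prime p \<and> p \<le> N. 1 / (1 - of_nat p powr (- s)))"
  proof (intro ext prod.cong refl)
    fix N p :: nat assume "p \<in> {p. prime p \<and> p \<le> N}"
    hence p: "prime p" by simp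
    show "(\<Sum>\<^sub>\<infinity>j. of_nat (p ^ j) powr (- s)) = 1 / (1 - of_nat p powr (- s) :: complex)"
      using prime_powr_less_1(1)[OF p, of "Re s"] prime_gt_0_nat[OF p] assms
      by (simp only: of_nat_power_powr) (simp add: infsum_geometric norm_of_nat_powr)
  qed
  finally show ?thesis .
qed

lemma one_minus_norm_le:
  fixes z :: complex assumes "norm z < 1"
  shows "1 - norm z \<le> norm (1 - z)" "norm (1 - z) \<le> 1 + norm z"
  using norm_triangle_ineq2[of 1 z] norm_triangle_ineq4[of 1 z] by auto

text \<open>Factorwise comparison of Euler products: |1 - p^(-s)| is at least 1 - p^(-c).\<close>

lemma norm_zeta_le:
  assumes "1 < c" "c \<le> Re s"
  shows "norm (zeta s) \<le> norm (zeta (of_real c))"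
proof (rule LIMSEQ_le[OF tendsto_norm[OF zeta_euler_product] tendsto_norm[OF zeta_euler_product]])
  show "\<exists>N0. \<forall>N\<ge>N0. norm (\<Prod>p | prime p \<and> p \<le> N. 1 / (1 - of_nat p powr (- s) :: complex))
     \<le> norm (\<Prod>p | prime p \<and> p \<le> N. 1 / (1 - of_nat p powr (- of_real c) :: complex))"
    unfolding prod_norm[symmetric]
  proof (intro exI allI impI prod_mono conjI norm_ge_zero)
    fix N p :: nat assume "p \<in> {p. prime p \<and> p \<le> N}"
    hence p: "prime p" by simp
    define x where "x = real p powr (- Re s)"
    define y where "y = real p powr (- c)"
    have xy: "x \<le> y" "0 < x" "y < 1"
      using assms prime_powr_less_1[OF p, of c] prime_powr_less_1[OF p, of "Re s"] prime_gt_1_nat[OF p]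
      unfolding x_def y_def by (auto intro: powr_mono)
    have n: "norm (of_nat p powr (- s) :: complex) = x"
      using prime_gt_0_nat[OF p] by (simp add: norm_of_nat_powr x_def)
    have y: "of_nat p powr (- of_real c) = (of_real y :: complex)"
      using powr_of_real[of "real p" "-c"] by (simp add: y_def)
    have "1 / norm (1 - of_nat p powr (- s) :: complex) \<le> 1 / (1 - y)"
      using one_minus_norm_le(1)[of "of_nat p powr (- s)"] n xy by (intro divide_left_mono mult_pos_pos) auto
    also have "1 / (1 - y) = norm (1 / (1 - of_nat p powr (- of_real c) :: complex))"
    proof -
      have "norm (1 - complex_of_real y) = \<bar>1 - y\<bar>"
        using norm_of_real[of "1 - y", where 'a = complex] by simp
      thus ?thesis unfolding y norm_divide using xy by simp
    qed
    finally show "norm (1 / (1 - of_nat p powr (- s) :: complex)) \<le> norm (1 / (1 - of_nat p powr (- of_real c) :: complex))"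
      by (simp add: norm_divide)
  qed
qed (use assms in auto)

text \<open>A lower bound for |zeta| without division: with y = p^(-c), each factor satisfies |1 -
  p^(-s)| (1 - y) \<le> (1 + y) (1 - y) \<le> 1.\<close>

lemma norm_zeta_ge:
  assumes "1 < c" "c \<le> Re s"
  shows "1 \<le> norm (zeta s) * norm (zeta (of_real c))"
proof (rule LIMSEQ_le_const[OF tendsto_mult[OF tendsto_norm[OF zeta_euler_product] tendsto_norm[OF zeta_euler_product]]])
  show "\<exists>N0. \<forall>N\<ge>N0. 1 \<le> norm (\<Prod>p | prime p \<and> p \<le> N. 1 / (1 - of_nat p powr (- s) :: complex)) *
     norm (\<Prod>p | prime p \<and> p \<le> N. 1 / (1 - of_nat p powr (- of_real c) :: complex))"
    unfolding prod_norm[symmetric] prod.distrib[symmetric]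
  proof (intro exI allI impI prod_ge_1)
    fix N p :: nat assume "p \<in> {p. prime p \<and> p \<le> N}"
    hence p: "prime p" by simp
    define x where "x = real p powr (- Re s)"
    define y where "y = real p powr (- c)"
    have xy: "x \<le> y" "0 < x" "y < 1"
      using assms prime_powr_less_1[OF p, of c] prime_powr_less_1[OF p, of "Re s"] prime_gt_1_nat[OF p]
      unfolding x_def y_def by (auto intro: powr_mono)
    have n: "norm (of_nat p powr (- s) :: complex) = x"
      using prime_gt_0_nat[OF p] by (simp add: norm_of_nat_powr x_def)
    have y: "of_nat p powr (- of_real c) = (of_real y :: complex)"
      using powr_of_real[of "real p" "-c"] by (simp add: y_def)
    have "norm (1 - of_nat p powr (- s) :: complex) * (1 - y) \<le> (1 + x) * (1 - y)"
      using one_minus_norm_le(2)[of "of_nat p powr (- s)"] n xy by (intro mult_right_mono) auto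
    also have "\<dots> \<le> (1 + y) * (1 - y)" using xy by (intro mult_right_mono) auto
    also have "\<dots> \<le> 1" by (simp add: algebra_simps)
    finally have le: "norm (1 - of_nat p powr (- s) :: complex) * (1 - y) \<le> 1" .
    have pos: "norm (1 - of_nat p powr (- s) :: complex) > 0"
      using one_minus_norm_le(1)[of "of_nat p powr (- s)"] n xy by auto
    have eq: "norm (1 - complex_of_real y) = 1 - y"
    proof -
      have "norm (1 - complex_of_real y) = \<bar>1 - y\<bar>"
        using norm_of_real[of "1 - y", where 'a = complex] by simp
      thus ?thesis using xy by simp
    qed
    show "1 \<le> norm (1 / (1 - of_nat p powr (- s) :: complex)) * norm (1 / (1 - of_nat p powr (- of_real c) :: complex))"
      unfolding y norm_divide eq using le pos xy by (simp add: field_simps)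
  qed
qed (use assms in auto)

lemma zeta_nonzero_Re_gt_1: "Re s > 1 \<Longrightarrow> zeta s \<noteq> 0"
  using norm_zeta_ge[of "Re s" s] by auto

text \<open>Expanding the logarithms reduces the claim to 3 + 4 Re w + Re (w^2) \<ge> 0 for each w =
  z^n of norm 1, and this expression is 2 (1 + Re w)^2.\<close>

lemma three_four_one_local:
  fixes z :: complex
  assumes x: "0 \<le> x" "x < 1" and z: "norm z = 1"
  shows "norm (1 - of_real x :: complex) ^ 3 * norm (1 - of_real x * z) ^ 4 * norm (1 - of_real x * z ^ 2) \<le> 1"
proof -
  \<comment> \<open>The term with n = 0 vanishes because division by zero yields 0.\<close>
  have L: "(\<lambda>n. - ((of_real x * w) ^ n) / complex_of_nat n) sums Ln (1 - of_real x * w)" if "norm w = 1" for w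
    using Ln_series'[of "- (of_real x * w)"] that x by (simp add: norm_mult)
  have LR: "(\<lambda>n. Re (- ((of_real x * w) ^ n) / complex_of_nat n)) sums Re (Ln (1 - of_real x * w))" if "norm w = 1" for w
    by (rule sums_Re[OF L[OF that]])
  have LR': "(\<lambda>n. - (x ^ n / real n) * Re (w ^ n)) sums Re (Ln (1 - of_real x * w))" if "norm w = 1" for w
  proof -
    have "Re (- ((of_real x * w) ^ n) / complex_of_nat n) = - (x ^ n / real n) * Re (w ^ n)" for n
      by (simp add: power_mult_distrib Re_divide_of_nat flip: of_real_power)
    thus ?thesis using LR[OF that] by (simp only:)
  qed
  have z2: "norm (z ^ 2) = 1" using z by (simp add: norm_power)
  have S: "(\<lambda>n. 3 * (- (x ^ n / real n) * Re (1 ^ n)) + 4 * (- (x ^ n / real n) * Re (z ^ n)) + (- (x ^ n / real n) * Re ((z ^ 2) ^ n)))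
    sums (3 * Re (Ln (1 - of_real x * 1)) + 4 * Re (Ln (1 - of_real x * z)) + Re (Ln (1 - of_real x * z ^ 2)))"
    by (intro sums_add sums_mult LR' z z2) simp
  have "3 * (- (x ^ n / real n) * Re (1 ^ n)) + 4 * (- (x ^ n / real n) * Re (z ^ n)) + (- (x ^ n / real n) * Re ((z ^ 2) ^ n)) \<le> 0" for n
  proof -
    define w where "w = z ^ n"
    have w: "norm w = 1" using z by (simp add: w_def norm_power)
    hence "(Re w)\<^sup>2 + (Im w)\<^sup>2 = 1" by (simp add: cmod_power2[symmetric])
    moreover have "Re ((z ^ 2) ^ n) = (Re w)\<^sup>2 - (Im w)\<^sup>2"
      by (simp add: w_def flip: power_mult) (simp add: mult.commute power_mult power2_eq_square)
    ultimately have "3 + 4 * Re w + Re ((z ^ 2) ^ n) = 2 * (1 + Re w)\<^sup>2"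
      by (simp add: power2_eq_square algebra_simps)
    hence "0 \<le> (x ^ n / real n) * (3 + 4 * Re w + Re ((z ^ 2) ^ n))" using x by simp
    thus ?thesis by (simp add: w_def algebra_simps)
  qed
  hence le: "3 * Re (Ln (1 - of_real x * 1)) + 4 * Re (Ln (1 - of_real x * z)) + Re (Ln (1 - of_real x * z ^ 2)) \<le> 0"
    using sums_le[OF _ S sums_zero] by simp
  have N: "norm (1 - of_real x * w) = exp (Re (Ln (1 - of_real x * w)))" if "norm w = 1" for w :: complex
  proof -
    have "norm (of_real x * w) < 1" using that x by (simp add: norm_mult)
    hence "1 - of_real x * w \<noteq> 0" by auto
    hence "exp (Ln (1 - of_real x * w)) = 1 - of_real x * w" by simp
    thus ?thesis by (metis norm_exp_eq_Re)
  qed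
  have "norm (1 - of_real x :: complex) ^ 3 * norm (1 - of_real x * z) ^ 4 * norm (1 - of_real x * z ^ 2)
     = exp (3 * Re (Ln (1 - of_real x * 1)) + 4 * Re (Ln (1 - of_real x * z)) + Re (Ln (1 - of_real x * z ^ 2)))"
    using N[of 1] N[OF z] N[OF z2] by (simp add: exp_add exp_of_nat_mult[symmetric])
  also have "\<dots> \<le> 1" using le by simp
  finally show ?thesis .
qed

lemma three_four_one:
  assumes "\<sigma> > 1"
  shows "1 \<le> norm (zeta (of_real \<sigma>)) ^ 3 * norm (zeta (Complex \<sigma> t)) ^ 4 * norm (zeta (Complex \<sigma> (2 * t)))"
proof (rule LIMSEQ_le_const[OF tendsto_mult[OF tendsto_mult[OF
      tendsto_power[OF tendsto_norm[OF zeta_euler_product]]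
      tendsto_power[OF tendsto_norm[OF zeta_euler_product]]] tendsto_norm[OF zeta_euler_product]]])
  let ?f = "\<lambda>N s. (\<Prod>p | prime p \<and> p \<le> N. 1 / (1 - of_nat p powr (- s) :: complex))"
  show "\<exists>N0. \<forall>N\<ge>N0. 1 \<le> norm (?f N (of_real \<sigma>)) ^ 3 * norm (?f N (Complex \<sigma> t)) ^ 4 * norm (?f N (Complex \<sigma> (2 * t)))"
    unfolding prod_norm[symmetric] prod_power_distrib prod.distrib[symmetric]
  proof (intro exI allI impI prod_ge_1)
    fix N p :: nat assume "p \<in> {p. prime p \<and> p \<le> N}"
    hence p: "prime p" by simp
    define x where "x = real p powr (- \<sigma>)"
    define z where "z = (of_nat p :: complex) powr (- (\<i> * of_real t))"
    have p0: "p > 0" using prime_gt_0_nat[OF p] .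
    have x: "0 < x" "x < 1" using prime_powr_less_1[OF p, of \<sigma>] assms by (auto simp: x_def)
    have z: "norm z = 1" using p0 by (simp add: z_def norm_of_nat_powr)
    have y: "of_nat p powr (- of_real \<sigma>) = (of_real x :: complex)"
      using powr_of_real[of "real p" "-\<sigma>"] by (simp add: x_def)
    have 1: "of_nat p powr (- Complex \<sigma> t) = (of_real x * z :: complex)"
      using p0 by (simp add: y[symmetric] z_def Complex_eq powr_add[symmetric] powr_def exp_add[symmetric] algebra_simps)
    have 2: "of_nat p powr (- Complex \<sigma> (2 * t)) = (of_real x * z ^ 2 :: complex)"
      using p0 by (simp add: y[symmetric] z_def Complex_eq powr_def exp_add[symmetric] exp_double[symmetric] algebra_simps)
    have 3: "norm (1 - of_real x :: complex) > 0" "norm (1 - of_real x * z) > 0" "norm (1 - of_real x * z ^ 2) > 0"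
      using one_minus_norm_le(1)[of "of_real x"] one_minus_norm_le(1)[of "of_real x * z"]
        one_minus_norm_le(1)[of "of_real x * z ^ 2"] x z by (auto simp: norm_mult norm_power)
    show "1 \<le> norm (1 / (1 - of_nat p powr (- of_real \<sigma>) :: complex)) ^ 3
       * norm (1 / (1 - of_nat p powr (- Complex \<sigma> t) :: complex)) ^ 4
       * norm (1 / (1 - of_nat p powr (- Complex \<sigma> (2 * t)) :: complex))"
    proof -
      have "0 < norm (1 - of_real x :: complex) ^ 3 * norm (1 - of_real x * z) ^ 4 * norm (1 - of_real x * z ^ 2)"
        using 3 by (intro mult_pos_pos zero_less_power)
      hence "1 \<le> 1 / (norm (1 - of_real x :: complex) ^ 3 * norm (1 - of_real x * z) ^ 4 * norm (1 - of_real x * z ^ 2))"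
        using three_four_one_local[of x z] x z by (simp only: le_divide_eq_1_pos)
      thus ?thesis unfolding y 1 2 norm_divide power_divide by simp
    qed
  qed
qed (use assms in auto)

section \<open>Continuation of zeta to the half-plane Re s > 0\<close>

definition zeta_em_term :: "nat \<Rightarrow> complex \<Rightarrow> complex" where
  "zeta_em_term n s = (s - 1) * of_nat (Suc n) powr (- s)
     + (of_nat (Suc (Suc n)) powr (1 - s) - of_nat (Suc n) powr (1 - s))"

text \<open>The term is s - 1 times the difference between (n + 1)^(-s) and the integral of u^(-s)
  over [n + 1, n + 2], written without a division by s - 1. At the same time it is the remainder of
  the first-order Taylor expansion of x^(1 - s) at n + 1; the second derivative supplies the
  additional factor 1 / (n + 1) that makes the series converge for Re s > 0.\<close>

lemma norm_zeta_em_term: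
  assumes "Re s > 0"
  shows "norm (zeta_em_term n s) \<le> norm (s - 1) * norm s * real (Suc n) powr (- Re s - 1)"
proof -
  define N where "N = real (Suc n)"
  have N: "N > 0" by (simp add: N_def)
  define S where "S = closed_segment (of_real N) (of_real (N + 1) :: complex)"
  define c where "c = (\<lambda>i::nat. if i = 0 then 1 else if i = 1 then 1 - s else (1 - s) * (- s))"
  define f where "f = (\<lambda>(i::nat) x. c i * x powr (1 - s - of_nat i))"
  have S: "\<exists>t. x = of_real t \<and> t \<ge> N" if "x \<in> S" for x
    using that unfolding S_def closed_segment_of_real
    by (auto simp: closed_segment_eq_real_ivl)
  have "norm (f 0 (of_real (N + 1)) - (\<Sum>i\<le>1. f i (of_real N) * (of_real (N + 1) - of_real N) ^ i / fact i))
      \<le> (norm (s - 1) * norm s * N powr (- Re s - 1)) * norm (of_real (N + 1) - of_real N :: complex) ^ Suc 1 / fact 1"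
  proof (rule complex_Taylor [where S = S])
    show "convex S" by (simp add: S_def)
    show "of_real N \<in> S" "of_real (N + 1) \<in> S" by (auto simp: S_def)
  next
    fix i x assume x: "x \<in> S" and i: "i \<le> (1::nat)"
    then obtain t where t: "x = of_real t" "t \<ge> N" using S by blast
    have diff_minus_swap: "- 1 - s = - s - 1" by simp
    have "x \<notin> \<real>\<^sub>\<le>\<^sub>0" using t N by auto
    then show "(f i has_field_derivative f (Suc i) x) (at x within S)"
      using i unfolding f_def c_def
      by (cases i) (auto intro!: derivative_eq_intros simp: algebra_simps diff_minus_swap)
  next
    fix x assume x: "x \<in> S"
    then obtain t where t: "x = of_real t" "t \<ge> N" using S by blast
    have diff_minus_swap: "- 1 - Re s = - Re s - 1" by simp
    have "norm (x powr (1 - s - of_nat (Suc 1))) = t powr (- Re s - 1)"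
      using t N norm_powr_real_powr[of x "1 - s - of_nat (Suc 1)"] by (simp add: diff_minus_swap)
    also have "\<dots> \<le> N powr (- Re s - 1)"
      using t N assms by (intro powr_mono2') auto
    finally show "norm (f (Suc 1) x) \<le> norm (s - 1) * norm s * N powr (- Re s - 1)"
      unfolding f_def c_def norm_mult by (intro mult_mono) (auto simp: norm_mult norm_minus_commute)
  qed
  moreover have "f 0 (of_real (N + 1)) - (\<Sum>i\<le>1. f i (of_real N) * (of_real (N + 1) - of_real N) ^ i / fact i)
     = zeta_em_term n s"
    by (simp add: f_def c_def zeta_em_term_def N_def algebra_simps)
  ultimately show ?thesis by (simp add: N_def)
qed

definition zeta_em :: "complex \<Rightarrow> complex" where
  "zeta_em s = 1 + (\<Sum>n. zeta_em_term n s)"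

lemma summable_Suc_powr: "a < -1 \<Longrightarrow> summable (\<lambda>n. real (Suc n) powr a)"
  by (subst summable_Suc_iff[of "\<lambda>n. real n powr a"]) (simp add: summable_real_powr_iff)

lemma zeta_em_holomorphic: "zeta_em holomorphic_on {s. Re s > 0}"
  unfolding zeta_em_def
proof (intro holomorphic_intros holomorphic_suminf)
  show "open {s. 0 < Re s}" by (simp add: open_halfspace_Re_gt)
  show "zeta_em_term n holomorphic_on {s. 0 < Re s}" for n
    unfolding zeta_em_term_def by (intro holomorphic_intros) (auto simp del: of_nat_Suc)
  fix z assume "z \<in> {s. Re s > 0}"
  hence z: "Re z > 0" by simp
  define d where "d = Re z / 2"
  have Re: "Re s \<ge> d" if "s \<in> cball z d" for s
    using that abs_Re_le_cmod[of "z - s"] by (simp add: dist_norm d_def field_simps)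
  have "compact ((\<lambda>s. (s - 1) * s) ` cball z d)"
    by (intro compact_continuous_image continuous_intros) auto
  then obtain C where C: "\<And>s. s \<in> cball z d \<Longrightarrow> norm ((s - 1) * s) \<le> C"
    using compact_imp_bounded[of "(\<lambda>s. (s - 1) * s) ` cball z d"] unfolding bounded_iff by blast
  show "\<exists>d>0. \<exists>M. cball z d \<subseteq> {s. 0 < Re s} \<and> summable M \<and> (\<forall>n. \<forall>x\<in>cball z d. norm (zeta_em_term n x) \<le> M n)"
  proof (intro exI conjI allI ballI)
    show "d > 0" using z by (simp add: d_def)
    show "cball z d \<subseteq> {s. 0 < Re s}" using Re z by (force simp: d_def)
    show "summable (\<lambda>n. C * real (Suc n) powr (- d - 1))"
      using z by (intro summable_mult summable_Suc_powr) (simp add: d_def)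
    fix n x assume x: "x \<in> cball z d"
    have "norm (zeta_em_term n x) \<le> norm ((x - 1) * x) * real (Suc n) powr (- Re x - 1)"
      using norm_zeta_em_term[of x n] Re[OF x] z by (simp add: norm_mult d_def)
    also have "\<dots> \<le> C * real (Suc n) powr (- d - 1)"
      using C[OF x] Re[OF x] by (intro mult_mono powr_mono) (auto intro: order_trans[OF norm_ge_zero])
    finally show "norm (zeta_em_term n x) \<le> C * real (Suc n) powr (- d - 1)" .
  qed
qed

lemma norm_zeta_em:
  assumes "Re s \<ge> 1 / 2"
  shows "norm (zeta_em s) \<le> 1 + norm (s - 1) * norm s * (\<Sum>n. real (Suc n) powr (- 3 / 2))"
proof -
  have le: "norm (zeta_em_term n s) \<le> norm (s - 1) * norm s * real (Suc n) powr (- 3 / 2)" for n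
  proof -
    have "norm (zeta_em_term n s) \<le> norm (s - 1) * norm s * real (Suc n) powr (- Re s - 1)"
      using norm_zeta_em_term[of s n] assms by simp
    also have "\<dots> \<le> norm (s - 1) * norm s * real (Suc n) powr (- 3 / 2)"
      using assms by (intro mult_left_mono powr_mono) auto
    finally show ?thesis .
  qed
  have s: "summable (\<lambda>n. norm (s - 1) * norm s * real (Suc n) powr (- 3 / 2))"
    by (intro summable_mult summable_Suc_powr) simp
  have "norm (\<Sum>n. zeta_em_term n s) \<le> (\<Sum>n. norm (s - 1) * norm s * real (Suc n) powr (- 3 / 2))"
    by (rule norm_suminf_le[OF le s])
  also have "\<dots> = norm (s - 1) * norm s * (\<Sum>n. real (Suc n) powr (- 3 / 2))"
    by (intro suminf_mult summable_Suc_powr) simp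
  finally have *: "norm (\<Sum>n. zeta_em_term n s) \<le> norm (s - 1) * norm s * (\<Sum>n. real (Suc n) powr (- 3 / 2))" .
  show ?thesis unfolding zeta_em_def using norm_triangle_ineq[of 1 "\<Sum>n. zeta_em_term n s"] * by simp
qed

lemma zeta_em_1 [simp]: "zeta_em 1 = 1"
  by (simp add: zeta_em_def zeta_em_term_def del: of_nat_Suc)

text \<open>For Re s > 1 the differences in the terms telescope to -1, which the summand 1 in
  \<open>zeta_em\<close> compensates; the rest is the identity theorem on the punctured
  half-plane.\<close>

lemma zeta_em_eq:
  assumes "Re s > 0"
  shows "zeta_em s = (if s = 1 then 1 else (s - 1) * zeta s)"
proof (cases "s = 1")
  case False
  have "zeta_em s = (s - 1) * zeta s"
  proof (rule analytic_continuation_open[where s = "{s. Re s > 1}" and s' = "{s. Re s > 0} - {1}"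
        and f = zeta_em and g = "\<lambda>s. (s - 1) * zeta s"])
    have "(2 :: complex) \<in> {s. Re s > 1}" by simp
    thus "{s. Re s > 1} \<noteq> {}" by blast
    show "open {s. Re s > 1}" by (simp add: open_halfspace_Re_gt)
    show "open ({s. Re s > 0} - {1})" by (simp add: open_halfspace_Re_gt open_delete)
    show "connected ({s. 0 < Re s} - {1})"
      by (intro connected_open_delete convex_connected convex_halfspace_Re_gt open_halfspace_Re_gt) simp
    show "zeta_em holomorphic_on {s. 0 < Re s} - {1}"
      by (rule holomorphic_on_subset[OF zeta_em_holomorphic]) auto
    show "(\<lambda>s. (s - 1) * zeta s) holomorphic_on {s. 0 < Re s} - {1}"
      by (intro holomorphic_intros holomorphic_on_subset[OF zeta_holomorphic]) auto
    show "{s. Re s > 1} \<subseteq> {s. Re s > 0} - {1}" by auto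
  next
    fix z assume "z \<in> {s. Re s > 1}"
    hence z: "Re z > 1" by simp
    have "(\<lambda>n. norm (of_nat (Suc n) powr (1 - z) :: complex)) \<longlonglongrightarrow> 0"
    proof -
      have "(\<lambda>n. real (Suc n) powr (1 - Re z)) \<longlonglongrightarrow> 0"
        by (rule LIMSEQ_Suc, rule tendsto_neg_powr) (use z filterlim_real_sequentially in auto)
      thus ?thesis by (simp add: norm_of_nat_powr del: of_nat_Suc)
    qed
    hence lim: "(\<lambda>n. of_nat (Suc n) powr (1 - z)) \<longlonglongrightarrow> (0 :: complex)"
      by (rule tendsto_norm_zero_cancel)
    have "(\<lambda>n. zeta_em_term n z) sums ((z - 1) * zeta z + (0 - 1))"
      unfolding zeta_em_term_def
      using telescope_sums[OF lim] by (intro sums_add sums_mult zeta_sums z) simp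
    thus "zeta_em z = (z - 1) * zeta z" by (simp add: zeta_em_def sums_iff)
  qed (use assms False in auto)
  thus ?thesis using False by simp
qed simp

text \<open>The value at 1 is the residue of zeta at its pole, which makes the function
  entire.\<close>

definition zetaZ :: "complex \<Rightarrow> complex" where
  "zetaZ s = (if s = 1 then 1 else (s - 1) * zeta s)"

lemma zetaZ_1 [simp]: "zetaZ 1 = 1" by (simp add: zetaZ_def)

lemma zetaZ_holomorphic: "zetaZ holomorphic_on A"
proof -
  have "zetaZ holomorphic_on {s. Re s > 0} \<union> (- {1})"
  proof (rule holomorphic_on_Un)
    show "zetaZ holomorphic_on {s. 0 < Re s}"
      by (rule holomorphic_transform[OF zeta_em_holomorphic]) (simp add: zeta_em_eq zetaZ_def)
    have "(\<lambda>s. (s - 1) * zeta s) holomorphic_on - {1}"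
      by (intro holomorphic_intros zeta_holomorphic)
    thus "zetaZ holomorphic_on - {1}"
      by (rule holomorphic_transform) (auto simp: zetaZ_def)
  qed (auto simp: open_halfspace_Re_gt)
  moreover have "{s. Re s > 0} \<union> (- {1}) = UNIV" by auto
  ultimately show ?thesis using holomorphic_on_subset by blast
qed

lemma zetaZ_holomorphic' [holomorphic_intros]:
  "f holomorphic_on A \<Longrightarrow> (\<lambda>s. zetaZ (f s)) holomorphic_on A"
  using holomorphic_on_compose[OF _ zetaZ_holomorphic, of f A] by (simp add: o_def)

lemma zetaZ_bound:
  obtains C where "C > 0" "\<And>s. Re s \<ge> 1 / 2 \<Longrightarrow> norm (zetaZ s) \<le> C * (1 + norm s) ^ 2"
proof
  define S where "S = (\<Sum>n. real (Suc n) powr (- 3 / 2))"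
  have S: "S \<ge> 0" unfolding S_def by (intro suminf_nonneg summable_Suc_powr) auto
  show "1 + S > 0" using S by simp
  fix s :: complex assume s: "Re s \<ge> 1 / 2"
  have n1: "norm (s - 1) \<le> 1 + norm s" using norm_triangle_ineq4[of s 1] by simp
  have "norm (zetaZ s) \<le> 1 + norm (s - 1) * norm s * S"
    using norm_zeta_em[OF s] s by (simp add: zeta_em_eq zetaZ_def S_def)
  also have "\<dots> \<le> (1 + norm s) ^ 2 + (1 + norm s) ^ 2 * S"
  proof (rule add_mono)
    show "1 \<le> (1 + norm s) ^ 2" by (simp add: one_le_power)
    show "norm (s - 1) * norm s * S \<le> (1 + norm s) ^ 2 * S"
      unfolding power2_eq_square using n1 S by (intro mult_right_mono mult_mono) auto
  qed
  finally show "norm (zetaZ s) \<le> (1 + S) * (1 + norm s) ^ 2" by (simp add: algebra_simps)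
qed

text \<open>The pole at 1 enters the 3-4-1 product with power 3, a zero at 1 + i t would enter with
  power 4, and zeta is finite at 1 + 2 i t. At abscissa 1 + h the product would thus be O(h) as h
  tends to 0 from the right, although it is at least 1.\<close>

lemma zeta_nonzero_Re_1:
  assumes t: "t \<noteq> 0"
  shows "zeta (Complex 1 t) \<noteq> 0"
proof
  assume z: "zeta (Complex 1 t) = 0"
  \<comment> \<open>The 3-4-1 product with pole and zero made explicit: h^(-3) from the pole and h^4
    from the difference quotient leave the single factor h.\<close>
  define g where "g = (\<lambda>h::real. norm (zetaZ (Complex (1 + h) 0)) ^ 3 *
      norm ((zetaZ (Complex (1 + h) t) - zetaZ (Complex 1 t)) / of_real h) ^ 4 / norm (Complex h t) ^ 4 * h
      * norm (zeta (Complex (1 + h) (2 * t))))"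
  have ge: "1 \<le> g h" if h: "h > 0" for h
  proof -
    have e: "1 \<le> norm (zeta (of_real (1 + h))) ^ 3 * norm (zeta (Complex (1 + h) t)) ^ 4 * norm (zeta (Complex (1 + h) (2 * t)))"
      using three_four_one[of "1 + h" t] h by simp
    have a: "norm (zeta (of_real (1 + h))) = norm (zetaZ (Complex (1 + h) 0)) / h"
    proof -
      have "of_real (1 + h) = Complex (1 + h) 0" "Complex (1 + h) 0 - 1 = of_real h" "Complex (1 + h) 0 \<noteq> 1"
        using h by (simp_all add: complex_eq_iff)
      thus ?thesis using h by (simp add: zetaZ_def norm_mult)
    qed
    have "Complex (1 + h) t - 1 = Complex h t" by (simp add: complex_eq_iff)
    hence b: "norm (zeta (Complex (1 + h) t)) = norm (zetaZ (Complex (1 + h) t) - zetaZ (Complex 1 t)) / norm (Complex h t)"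
    proof -
      have "Complex (1 + h) t \<noteq> 1" "Complex 1 t \<noteq> 1" "Complex h t \<noteq> 0"
        using t by (simp_all add: complex_eq_iff)
      thus ?thesis using z by (simp add: zetaZ_def norm_mult \<open>Complex (1 + h) t - 1 = Complex h t\<close>)
    qed
    have "norm (zeta (of_real (1 + h))) ^ 3 * norm (zeta (Complex (1 + h) t)) ^ 4 * norm (zeta (Complex (1 + h) (2 * t))) = g h"
      unfolding a b g_def using h by (simp add: norm_divide power_divide field_simps power3_eq_cube power4_eq_xxxx)
    with e show ?thesis by simp
  qed
  have cont: "isCont zetaZ s" for s
    using holomorphic_on_imp_continuous_on[OF zetaZ_holomorphic[of UNIV]]
    by (simp add: continuous_on_eq_continuous_at)
  have zc: "isCont zeta s" if "s \<noteq> 1" for s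
    using holomorphic_on_imp_continuous_on[OF zeta_holomorphic] that
    by (subst (asm) continuous_on_eq_continuous_at) auto
  have D: "(zetaZ has_field_derivative deriv zetaZ (Complex 1 t)) (at (Complex 1 t))"
    using holomorphic_derivI[OF zetaZ_holomorphic[of UNIV]] by simp
  have hl: "filterlim (\<lambda>h. complex_of_real h) (at 0) (at_right 0)"
    by (intro filterlim_atI tendsto_eq_intros) (auto simp: eventually_at_filter)
  have l2: "((\<lambda>h. (zetaZ (Complex (1 + h) t) - zetaZ (Complex 1 t)) / of_real h) \<longlongrightarrow> deriv zetaZ (Complex 1 t)) (at_right 0)"
    using filterlim_compose[OF D[unfolded DERIV_def] hl]
    by (simp add: complex_of_real_def complex_add)
  have cl: "((\<lambda>h. Complex (1 + h) u) \<longlongrightarrow> Complex 1 u) (at_right 0)" for u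
    by (rule tendsto_eq_intros refl tendsto_intros | simp)+
  have l1: "((\<lambda>h. zetaZ (Complex (1 + h) 0)) \<longlongrightarrow> zetaZ (Complex 1 0)) (at_right 0)"
    by (rule isCont_tendsto_compose[OF cont cl])
  have l3: "((\<lambda>h. zeta (Complex (1 + h) (2 * t))) \<longlongrightarrow> zeta (Complex 1 (2 * t))) (at_right 0)"
    by (rule isCont_tendsto_compose[OF zc cl]) (use t in \<open>simp add: complex_eq_iff\<close>)
  have l4: "((\<lambda>h. Complex h t) \<longlongrightarrow> Complex 0 t) (at_right 0)"
    by (rule tendsto_eq_intros refl tendsto_intros | simp)+
  have "(g \<longlongrightarrow> norm (zetaZ (Complex 1 0)) ^ 3 * norm (deriv zetaZ (Complex 1 t)) ^ 4 / norm (Complex 0 t) ^ 4 * 0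
       * norm (zeta (Complex 1 (2 * t)))) (at_right 0)"
    unfolding g_def using t by (intro tendsto_intros l1 l2 l3 l4) (auto simp: complex_eq_iff)
  hence "(g \<longlongrightarrow> 0) (at_right 0)" by simp
  moreover have "\<forall>\<^sub>F h in at_right 0. 1 \<le> g h"
    using ge by (auto simp: eventually_at_filter)
  ultimately have "(1::real) \<le> 0" by (intro tendsto_lowerbound[of g 0 "at_right 0" 1]) auto
  thus False by simp
qed

section \<open>The functional equation\<close>

text \<open>On the disc of half the radius, Cauchy's inequality bounds the derivative in s, hence
  every difference quotient, by 2 / d times the dominating function. Dominated convergence then
  applies to the difference quotients along any sequence tending to the point.\<close>

lemma holomorphic_integral_dominated:
  fixes f :: "complex \<Rightarrow> 'a \<Rightarrow> complex"
  assumes U: "open U"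
    and hol: "\<And>x. x \<in> space M \<Longrightarrow> (\<lambda>s. f s x) holomorphic_on U"
    and meas: "\<And>s. s \<in> U \<Longrightarrow> f s \<in> borel_measurable M"
    and dom: "\<And>z. z \<in> U \<Longrightarrow> \<exists>d>0. \<exists>g. cball z d \<subseteq> U \<and> integrable M g \<and>
        (\<forall>s\<in>cball z d. \<forall>x\<in>space M. norm (f s x) \<le> g x)"
  shows "(\<lambda>s. \<integral>x. f s x \<partial>M) holomorphic_on U"
proof -
  have "((\<lambda>s. \<integral>x. f s x \<partial>M) has_field_derivative (\<integral>x. deriv (\<lambda>s. f s x) z \<partial>M)) (at z)"
    if z: "z \<in> U" for z
  proof -
    obtain d g where d: "d > 0" "cball z d \<subseteq> U" "integrable M g"
      and g: "\<And>s x. s \<in> cball z d \<Longrightarrow> x \<in> space M \<Longrightarrow> norm (f s x) \<le> g x"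
      using dom[OF z] by blast
    have int: "integrable M (f s)" if "s \<in> cball z d" for s
      using d that g[OF that] by (intro Bochner_Integration.integrable_bound[OF d(3)] meas AE_I2) force+
    have quot: "norm ((f w x - f z x) / (w - z)) \<le> 2 / d * g x"
      if w: "w \<in> cball z (d / 2)" "w \<noteq> z" and x: "x \<in> space M" for w x
    proof -
      have "norm (f w x - f z x) \<le> (2 / d * g x) * norm (w - z)"
      proof (rule field_differentiable_bound[where S = "cball z (d / 2)" and f' = "deriv (\<lambda>s. f s x)"])
        fix y assume y: "y \<in> cball z (d / 2)"
        have sub: "cball y (d / 2) \<subseteq> cball z d"
          using y by (simp add: cball_subset_cball_iff dist_commute)
        show "((\<lambda>s. f s x) has_field_derivative deriv (\<lambda>s. f s x) y) (at y within cball z (d / 2))"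
          using hol[OF x] U d y sub by (intro DERIV_subset[OF holomorphic_derivI[OF hol[OF x] U]]) force+
        have "norm ((deriv ^^ 1) (\<lambda>s. f s x) y) \<le> fact 1 * g x / (d / 2) ^ 1"
        proof (rule Cauchy_inequality)
          show "(\<lambda>s. f s x) holomorphic_on ball y (d / 2)"
            using hol[OF x] by (rule holomorphic_on_subset) (use sub d in force)
          show "continuous_on (cball y (d / 2)) (\<lambda>s. f s x)"
            using holomorphic_on_imp_continuous_on[OF hol[OF x]]
            by (rule continuous_on_subset) (use sub d in force)
          fix v assume "norm (y - v) = d / 2"
          hence "v \<in> cball y (d / 2)" by (simp add: dist_norm)
          thus "norm (f v x) \<le> g x" using sub by (intro g[OF _ x]) auto
        qed (use d in auto)
        thus "norm (deriv (\<lambda>s. f s x) y) \<le> 2 / d * g x" by (simp add: mult.commute)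
      qed (use w d in auto)
      thus ?thesis using w by (simp add: norm_divide divide_le_eq)
    qed
    have "((\<lambda>w. ((\<integral>x. f w x \<partial>M) - (\<integral>x. f z x \<partial>M)) / (w - z)) \<longlongrightarrow> (\<integral>x. deriv (\<lambda>s. f s x) z \<partial>M)) (at z)"
    proof (rule iffD2[OF tendsto_at_iff_sequentially], intro allI impI)
      fix X :: "nat \<Rightarrow> complex" assume X: "\<forall>i. X i \<in> UNIV - {z}" "X \<longlonglongrightarrow> z"
      have "\<forall>\<^sub>F n in sequentially. dist (X n) z < d / 2"
        using tendstoD[OF X(2), of "d / 2"] d(1) by simp
      then obtain N where N': "\<And>n. n \<ge> N \<Longrightarrow> dist (X n) z < d / 2"
        unfolding eventually_sequentially by blast
      hence N: "X n \<in> cball z (d / 2)" if "n \<ge> N" for n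
        using that by (simp add: dist_commute less_imp_le)
      define Y where "Y = (\<lambda>n. X (n + N))"
      have Y: "Y \<longlonglongrightarrow> z" "\<And>n. Y n \<noteq> z" "\<And>n. Y n \<in> cball z (d / 2)"
        using X N LIMSEQ_ignore_initial_segment[OF X(2)] by (auto simp: Y_def)
      have Yd: "Y n \<in> cball z d" for n
        using Y(3)[of n] d(1) by auto
      have "(\<lambda>n. \<integral>x. (f (Y n) x - f z x) / (Y n - z) \<partial>M) \<longlonglongrightarrow> (\<integral>x. deriv (\<lambda>s. f s x) z \<partial>M)"
      proof (rule integral_dominated_convergence[where w = "\<lambda>x. 2 / d * g x"])
        have conv: "(\<lambda>n. (f (Y n) x - f z x) / (Y n - z)) \<longlonglongrightarrow> deriv (\<lambda>s. f s x) z" if x: "x \<in> space M" for x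
        proof -
          have "((\<lambda>w. (f w x - f z x) / (w - z)) \<longlongrightarrow> deriv (\<lambda>s. f s x) z) (at z)"
            using holomorphic_derivI[OF hol[OF x] U z] by (simp add: has_field_derivative_iff)
          moreover have "filterlim Y (at z) sequentially"
            using Y by (intro filterlim_atI) auto
          ultimately show ?thesis by (rule filterlim_compose)
        qed
        show meas': "(\<lambda>x. (f (Y n) x - f z x) / (Y n - z)) \<in> borel_measurable M" for n
          using meas Yd[of n] d(2) z
          by (intro borel_measurable_divide borel_measurable_diff borel_measurable_const) blast+
        show "(\<lambda>x. deriv (\<lambda>s. f s x) z) \<in> borel_measurable M"
          by (rule borel_measurable_LIMSEQ_metric[OF meas' conv])
        show "AE x in M. (\<lambda>n. (f (Y n) x - f z x) / (Y n - z)) \<longlonglongrightarrow> deriv (\<lambda>s. f s x) z"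
          using conv by (intro AE_I2)
        show "AE x in M. norm ((f (Y n) x - f z x) / (Y n - z)) \<le> 2 / d * g x" for n
          using quot Y by (intro AE_I2) auto
      qed (use d in auto)
      moreover have "(\<integral>x. (f (Y n) x - f z x) / (Y n - z) \<partial>M) = ((\<integral>x. f (Y n) x \<partial>M) - (\<integral>x. f z x \<partial>M)) / (Y n - z)" for n
        using int[OF Yd] int[of z] d by simp
      ultimately have "(\<lambda>n. ((\<integral>x. f (Y n) x \<partial>M) - (\<integral>x. f z x \<partial>M)) / (Y n - z)) \<longlonglongrightarrow> (\<integral>x. deriv (\<lambda>s. f s x) z \<partial>M)"
        by (simp only:)
      hence "(\<lambda>n. ((\<integral>x. f (X (n + N)) x \<partial>M) - (\<integral>x. f z x \<partial>M)) / (X (n + N) - z)) \<longlonglongrightarrow> (\<integral>x. deriv (\<lambda>s. f s x) z \<partial>M)"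
        by (simp only: Y_def)
      thus "((\<lambda>w. ((\<integral>x. f w x \<partial>M) - (\<integral>x. f z x \<partial>M)) / (w - z)) \<circ> X) \<longlonglongrightarrow> (\<integral>x. deriv (\<lambda>s. f s x) z \<partial>M)"
        unfolding o_def by (rule LIMSEQ_offset)
    qed
    thus ?thesis by (simp add: has_field_derivative_iff)
  qed
  thus ?thesis using U by (auto simp: holomorphic_on_open)
qed

text \<open>The Mellin transform of this kernel, computed once from \<open>1 / (exp u - 1)\<close> and once from the
  partial fractions of the hyperbolic cotangent, gives the functional equation.\<close>

definition bern_kernel :: "real \<Rightarrow> real" where
  "bern_kernel u = 1 / (exp u - 1) - 1 / u + 1 / 2"

text \<open>Logarithmic differentiation of 2 sinh(x / 2) / x as the product of the factors 1 + x^2 /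
  (2 pi n)^2, which is the sine product at an imaginary argument. The logarithmic derivative of the
  left side is coth(x / 2) / 2 - 1 / x, another form of \<open>bern_kernel\<close>.\<close>

lemma bern_kernel_sums:
  assumes u: "u > 0"
  shows "(\<lambda>n. 2 * u / (u\<^sup>2 + (2 * pi * real (Suc n))\<^sup>2)) sums bern_kernel u"
proof -
  define c where "c = (\<lambda>n. (2 * pi * real (Suc n))\<^sup>2)"
  have c: "c n > 0" for n by (simp add: c_def)
  have csum: "summable (\<lambda>n. 1 / c n)"
  proof -
    have "summable (\<lambda>n. 1 / (2 * pi)\<^sup>2 * (1 / real (Suc n) ^ 2))"
      using inverse_squares_sums by (intro summable_mult) (auto simp: sums_iff)
    moreover have "1 / (2 * pi)\<^sup>2 * (1 / real (Suc n) ^ 2) = 1 / c n" for n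
      by (simp only: c_def power_mult_distrib) simp
    ultimately show ?thesis by (simp only:)
  qed
  define f where "f = (\<lambda>n x. ln (1 + x\<^sup>2 / c n))"
  define f' where "f' = (\<lambda>n x. 2 * x / (x\<^sup>2 + c n))"
  have fsums: "(\<lambda>n. f n x) sums ln (2 * sinh (x / 2) / x)" if x: "x > 0" for x
  proof -
    \<comment> \<open>Chosen so that the argument pi z of the sine is i x / 2.\<close>
    define z where "z = \<i> * of_real (x / (2 * pi))"
    have z: "z \<noteq> 0" using x by (simp add: z_def)
    have "(\<lambda>n. of_real pi * z * (\<Prod>k=1..n. 1 - z^2 / of_nat k^2) / (of_real pi * z)) \<longlonglongrightarrow> sin (of_real pi * z) / (of_real pi * z)"
      by (intro tendsto_divide sin_product_formula_complex tendsto_const) (use z in auto)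
    also have "(\<lambda>n. of_real pi * z * (\<Prod>k=1..n. 1 - z^2 / of_nat k^2) / (of_real pi * z))
       = (\<lambda>n. of_real (\<Prod>k<n. 1 + x\<^sup>2 / c k))"
    proof
      fix n
      have "of_real pi * z * (\<Prod>k=1..n. 1 - z^2 / of_nat k^2) / (of_real pi * z) = (\<Prod>k=1..n. 1 - z^2 / of_nat k^2)"
        using z by simp
      also have "\<dots> = (\<Prod>k<n. 1 - z^2 / of_nat (Suc k)^2)"
        by (rule prod.reindex_bij_witness[of _ Suc "\<lambda>k. k - 1"]) auto
      also have "\<dots> = (\<Prod>k<n. of_real (1 + x\<^sup>2 / c k))"
      proof (intro prod.cong refl)
        fix k
        have "c k = (2 * pi)\<^sup>2 * (real (Suc k))\<^sup>2" by (simp only: c_def power_mult_distrib)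
        hence "1 + x\<^sup>2 / c k = 1 + (x / (2 * pi))\<^sup>2 / (real (Suc k))\<^sup>2"
          by (simp add: power_divide del: of_nat_Suc)
        moreover have "z\<^sup>2 = - of_real ((x / (2 * pi))\<^sup>2)"
          by (simp add: z_def power_mult_distrib power_divide)
        ultimately show "1 - z^2 / of_nat (Suc k)^2 = of_real (1 + x\<^sup>2 / c k)"
          by (simp del: of_nat_Suc)
      qed
      finally show "of_real pi * z * (\<Prod>k=1..n. 1 - z^2 / of_nat k^2) / (of_real pi * z) = of_real (\<Prod>k<n. 1 + x\<^sup>2 / c k)"
        by simp
    qed
    also have "sin (of_real pi * z) / (of_real pi * z) = of_real (2 * sinh (x / 2) / x)"
    proof -
      have e1: "of_real pi * z = \<i> * of_real (x / 2)" by (simp add: z_def)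
      have e2: "sin (\<i> * of_real (x / 2)) = \<i> * of_real (sinh (x / 2))"
      proof -
        have "sin (\<i> * of_real y) = \<i> * of_real (sinh y)" for y :: real
        proof -
          have 1: "\<i> * (\<i> * complex_of_real y) = - of_real y" by (simp flip: mult.assoc)
          have 2: "complex_of_real (sinh y) = (exp (of_real y) - exp (- of_real y)) / 2"
            by (simp add: sinh_def exp_of_real[symmetric])
          show ?thesis unfolding sin_exp_eq 1 2 by (simp add: field_simps)
        qed
        thus ?thesis .
      qed
      show ?thesis unfolding e1 e2 using x by simp
    qed
    finally have "(\<lambda>n. \<Prod>k<n. 1 + x\<^sup>2 / c k) \<longlonglongrightarrow> 2 * sinh (x / 2) / x"
      by (subst (asm) tendsto_of_real_iff)
    hence "(\<lambda>n. ln (\<Prod>k<n. 1 + x\<^sup>2 / c k)) \<longlonglongrightarrow> ln (2 * sinh (x / 2) / x)"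
      by (rule tendsto_ln) (use x in simp)
    moreover have "ln (\<Prod>k<n. 1 + x\<^sup>2 / c k) = (\<Sum>k<n. f k x)" for n
    proof -
      have "1 + x\<^sup>2 / c k > 0" for k using c[of k] by (intro add_pos_nonneg) auto
      thus ?thesis unfolding f_def by (intro ln_prod) (auto simp: less_imp_neq[symmetric])
    qed
    ultimately show ?thesis by (simp add: sums_def)
  qed
  define S where "S = {0<..<u + 1}"
  have Su: "u \<in> interior S" using u by (simp add: S_def interior_open)
  have "((\<lambda>x. \<Sum>n. f n x) has_field_derivative (\<Sum>n. f' n u)) (at u)"
  proof (rule has_field_derivative_series'(2)[where S = S and x0 = u])
    show "convex S" by (simp add: S_def)
    show "(f n has_field_derivative f' n x) (at x within S)" if "x \<in> S" for n x
    proof -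
      have "1 + x\<^sup>2 / c n > 0" using c[of n] by (intro add_pos_nonneg) auto
      thus ?thesis using c[of n] unfolding f_def f'_def
        by (auto intro!: derivative_eq_intros simp: field_simps)
    qed
    show "uniformly_convergent_on S (\<lambda>n x. \<Sum>i<n. f' i x)"
    proof (rule Weierstrass_m_test')
      show "summable (\<lambda>n. 2 * (u + 1) * (1 / c n))" by (intro summable_mult csum)
      fix n x assume x: "x \<in> S"
      have "norm (f' n x) = 2 * x / (x\<^sup>2 + c n)"
        using x c[of n] unfolding f'_def S_def by (simp add: add_pos_pos)
      also have "\<dots> \<le> 2 * (u + 1) / c n"
        using x c[of n] unfolding S_def by (intro frac_le) auto
      finally show "norm (f' n x) \<le> 2 * (u + 1) * (1 / c n)" by simp
    qed
    show "u \<in> S" using Su interior_subset by blast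
    show "summable (\<lambda>n. f n u)" using fsums[OF u] by (simp add: sums_iff)
  qed (rule Su)
  moreover have "((\<lambda>x. \<Sum>n. f n x) has_field_derivative bern_kernel u) (at u)"
  proof (rule has_field_derivative_transform_within_open)
    show "((\<lambda>x. ln (2 * sinh (x / 2) / x)) has_field_derivative bern_kernel u) (at u)"
    proof -
      have e: "exp (u / 2) * exp (u / 2) = exp u" by (simp flip: exp_add)
      have e1: "exp u > 1" using u by simp
      have coth: "cosh (u / 2) / sinh (u / 2) = 2 / (exp u - 1) + 1"
        using e1 by (simp add: cosh_def sinh_def exp_minus field_simps e)
      have sp: "sinh (u / 2) > 0" using u by simp
      have "((\<lambda>x. ln (2 * sinh (x / 2) / x)) has_field_derivative
          ((cosh (u / 2) * u - 2 * sinh (u / 2)) / (u * u)) / (2 * sinh (u / 2) / u)) (at u)"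
        using u sp by (auto intro!: derivative_eq_intros simp: field_simps)
      also have "((cosh (u / 2) * u - 2 * sinh (u / 2)) / (u * u)) / (2 * sinh (u / 2) / u)
          = (cosh (u / 2) / sinh (u / 2)) / 2 - 1 / u"
        using u sp by (simp add: field_simps)
      also have "\<dots> = bern_kernel u" unfolding coth bern_kernel_def by simp
      finally show ?thesis .
    qed
    show "open {0::real<..}" by simp
    show "u \<in> {0<..}" using u by simp
    show "ln (2 * sinh (x / 2) / x) = (\<Sum>n. f n x)" if "x \<in> {0<..}" for x
      using fsums[of x] that by (simp add: sums_iff)
  qed
  ultimately have "(\<Sum>n. f' n u) = bern_kernel u" by (rule DERIV_unique)
  moreover have "summable (\<lambda>n. f' n u)"
  proof (rule summable_comparison_test')
    show "summable (\<lambda>n. 2 * u * (1 / c n))" by (intro summable_mult csum)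
    show "norm (f' n u) \<le> 2 * u * (1 / c n)" for n
    proof -
      have "norm (f' n u) = 2 * u / (u\<^sup>2 + c n)"
        using u c[of n] unfolding f'_def by (simp add: add_pos_pos)
      also have "\<dots> \<le> 2 * u / c n" using u c[of n] by (intro frac_le) auto
      finally show ?thesis by simp
    qed
  qed
  ultimately show ?thesis by (simp add: sums_iff f'_def c_def)
qed

lemma bern_kernel_bounds:
  assumes u: "u > 0"
  shows "0 \<le> bern_kernel u" "bern_kernel u \<le> 2 * u"
proof -
  show "0 \<le> bern_kernel u"
    by (rule sums_le[OF _ sums_zero bern_kernel_sums[OF u]]) (use u in simp)
  have S: "(\<lambda>n. u * (1 / real (Suc n) ^ 2)) sums (u * (pi\<^sup>2 / 6))"
    using inverse_squares_sums by (intro sums_mult) (simp add: add.commute)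
  have "bern_kernel u \<le> u * (pi\<^sup>2 / 6)"
  proof (rule sums_le[OF _ bern_kernel_sums[OF u] S])
    fix n
    have "1 \<le> pi * pi" using pi_ge_two by (metis (no_types) mult_mono' numeral_One numeral_le_one_iff order_trans one_le_numeral mult_1 zero_le_one)
    hence "2 * real (Suc n) ^ 2 \<le> (4 * (pi * pi)) * real (Suc n) ^ 2"
      by (intro mult_right_mono) auto
    hence "2 * real (Suc n) ^ 2 \<le> (2 * pi * real (Suc n))\<^sup>2"
      by (simp only: power_mult_distrib) (simp add: power2_eq_square)
    hence "2 * real (Suc n) ^ 2 \<le> u\<^sup>2 + (2 * pi * real (Suc n))\<^sup>2" by (simp add: add_increasing)
    hence "2 * u / (u\<^sup>2 + (2 * pi * real (Suc n))\<^sup>2) \<le> 2 * u / (2 * real (Suc n) ^ 2)"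
      using u by (intro divide_left_mono) (auto intro!: mult_pos_pos add_nonneg_pos simp del: of_nat_Suc)
    thus "2 * u / (u\<^sup>2 + (2 * pi * real (Suc n))\<^sup>2) \<le> u * (1 / real (Suc n) ^ 2)" by simp
  qed
  also have "u * (pi\<^sup>2 / 6) \<le> u * 2"
  proof -
    have "pi\<^sup>2 \<le> (32/10)\<^sup>2" using pi_less_4 pi_approx by (intro power_mono) auto
    thus ?thesis using u by (intro mult_left_mono) (auto simp: power2_eq_square)
  qed
  finally show "bern_kernel u \<le> 2 * u" by simp
qed

section \<open>Gamma and beta integrals over the positive half-line\<close>

lemma nn_integral_Gamma_scaled:
  assumes s: "s > (0::real)" and c: "c > 0"
  shows "(\<integral>\<^sup>+u\<in>{0<..}. ennreal (u powr (s - 1) * exp (- (c * u))) \<partial>lborel) = ennreal (Gamma s * c powr (- s))"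
    (is "?X = _")
proof -
  let ?f = "\<lambda>u::real. ennreal (u powr (s - 1) * exp (- u)) * indicator {0<..} u"
  have "ennreal (Gamma s) = (\<integral>\<^sup>+u. ?f u \<partial>lborel)"
    unfolding Gamma_conv_nn_integral_real[OF s]
    by (intro nn_integral_cong) (auto simp: indicator_def exp_minus field_simps)
  also have "\<dots> = ennreal \<bar>c\<bar> * (\<integral>\<^sup>+u. ?f (0 + c * u) \<partial>lborel)"
    by (rule nn_integral_real_affine) (use c in auto)
  also have "(\<integral>\<^sup>+u. ?f (0 + c * u) \<partial>lborel) = (\<integral>\<^sup>+u. ennreal (c powr (s - 1)) *
        (ennreal (u powr (s - 1) * exp (- (c * u))) * indicator {0<..} u) \<partial>lborel)"
    by (intro nn_integral_cong)
       (use c in \<open>auto simp: indicator_def powr_mult zero_less_mult_iff ennreal_mult[symmetric] mult_ac\<close>)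
  also have "\<dots> = ennreal (c powr (s - 1)) * ?X"
    by (rule nn_integral_cmult) measurable
  also have "ennreal \<bar>c\<bar> * \<dots> = ennreal (c powr s) * ?X"
    using c by (simp add: mult.assoc[symmetric] ennreal_mult[symmetric] powr_diff)
  finally have "ennreal (c powr (- s)) * ennreal (Gamma s) = ennreal (c powr (- s)) * (ennreal (c powr s) * ?X)" by simp
  also have "\<dots> = ennreal (c powr (- s) * c powr s) * ?X"
    by (simp add: ennreal_mult mult.assoc)
  also have "c powr (- s) * c powr s = 1" using c by (simp add: powr_minus field_simps)
  finally show ?thesis
    using Gamma_real_pos[OF s] by (simp add: ennreal_mult[symmetric] mult.commute)
qed

lemma zeta_real_sums:
  assumes "s > (1::real)"
  shows "(\<lambda>n. real (Suc n) powr (- s)) sums Re (zeta (of_real s))" "zeta (of_real s) = of_real (Re (zeta (of_real s)))"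
proof -
  have "of_nat (Suc n) powr (- complex_of_real s) = of_real (real (Suc n) powr (- s))" for n
    using powr_of_real[of "real (Suc n)" "- s"] by (simp del: of_nat_Suc)
  hence *: "(\<lambda>n. complex_of_real (real (Suc n) powr (- s))) sums zeta (of_real s)"
    using zeta_sums[of "of_real s"] assms by simp
  from sums_Re[OF *] show 1: "(\<lambda>n. real (Suc n) powr (- s)) sums Re (zeta (of_real s))" by simp
  from sums_of_real[OF 1] have "(\<lambda>n. complex_of_real (real (Suc n) powr (- s))) sums of_real (Re (zeta (of_real s)))" .
  with * show "zeta (of_real s) = of_real (Re (zeta (of_real s)))" by (rule sums_unique2)
qed

lemma zeta_real_nonneg: "s > (1::real) \<Longrightarrow> Re (zeta (of_real s)) \<ge> 0"
  by (rule sums_le[OF _ sums_zero zeta_real_sums(1)]) auto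

text \<open>Expand 1 / (exp u - 1) into the geometric series of exp (- u) and integrate termwise.
  With nonnegative extended integrals the exchange needs no integrability.\<close>

lemma nn_integral_Gamma_zeta:
  assumes s: "s > (1::real)"
  shows "(\<integral>\<^sup>+u\<in>{0<..}. ennreal (u powr (s - 1) / (exp u - 1)) \<partial>lborel) = ennreal (Gamma s * Re (zeta (of_real s)))"
proof -
  have G: "Gamma s > 0" using s by (intro Gamma_real_pos) auto
  have "(\<integral>\<^sup>+u\<in>{0<..}. ennreal (u powr (s - 1) / (exp u - 1)) \<partial>lborel) =
     (\<integral>\<^sup>+u. (\<Sum>n. ennreal (u powr (s - 1) * exp (- (real (Suc n) * u))) * indicator {0<..} u) \<partial>lborel)"
  proof (intro nn_integral_cong)
    fix u :: real
    show "ennreal (u powr (s - 1) / (exp u - 1)) * indicator {0<..} u =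
        (\<Sum>n. ennreal (u powr (s - 1) * exp (- (real (Suc n) * u))) * indicator {0<..} u)"
    proof (cases "u > 0")
      case True
      have "(\<lambda>n. exp (- u) * exp (- u) ^ n) sums (exp (- u) * (1 / (1 - exp (- u))))"
        using True by (intro sums_mult geometric_sums) simp
      also have "exp (- u) * (1 / (1 - exp (- u))) = 1 / (exp u - 1)"
        using True by (simp add: exp_minus field_simps)
      also have "(\<lambda>n. exp (- u) * exp (- u) ^ n) = (\<lambda>n. exp (- (real (Suc n) * u)))"
        by (auto simp: exp_of_nat_mult[symmetric] exp_add[symmetric] algebra_simps)
      finally have "(\<lambda>n. u powr (s - 1) * exp (- (real (Suc n) * u))) sums (u powr (s - 1) * (1 / (exp u - 1)))"
        by (rule sums_mult)
      hence "(\<Sum>n. ennreal (u powr (s - 1) * exp (- (real (Suc n) * u)))) = ennreal (u powr (s - 1) / (exp u - 1))"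
        by (subst suminf_ennreal_eq) auto
      thus ?thesis using True by simp
    qed simp
  qed
  also have "\<dots> = (\<Sum>n. \<integral>\<^sup>+u\<in>{0<..}. ennreal (u powr (s - 1) * exp (- (real (Suc n) * u))) \<partial>lborel)"
    by (rule nn_integral_suminf) measurable
  also have "\<dots> = (\<Sum>n. ennreal (Gamma s * real (Suc n) powr (- s)))"
    using s by (intro suminf_cong nn_integral_Gamma_scaled) auto
  also have "\<dots> = ennreal (Gamma s * Re (zeta (of_real s)))"
    using G by (intro suminf_ennreal_eq sums_mult zeta_real_sums s) auto
  finally show ?thesis .
qed

text \<open>The substitution y = v^2, carried out on bounded intervals and extended to the half-line
  by monotone convergence.\<close>

lemma nn_integral_square_subst:
  assumes a: "0 < (a::real)"
  shows "(\<integral>\<^sup>+v\<in>{0<..}. ennreal (v powr (2 * a - 1) / (1 + v\<^sup>2)) \<partial>lborel) * 2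
       = (\<integral>\<^sup>+y\<in>{0<..}. ennreal (y powr (a - 1) / (1 + y)) \<partial>lborel)"
proof -
  let ?f = "\<lambda>y::real. ennreal (y powr (a - 1) / (1 + y)) * indicator {0<..} y"
  let ?g = "\<lambda>v::real. ennreal (v powr (2 * a - 1) / (1 + v\<^sup>2)) * indicator {0<..} v * 2"
  have *: "(\<integral>\<^sup>+y. ?f y * indicator {0..(real n)\<^sup>2} y \<partial>lborel) = (\<integral>\<^sup>+v. ?g v * indicator {0..real n} v \<partial>lborel)"
    if n: "n > 0" for n :: nat
  proof -
    have "(\<integral>\<^sup>+y. ?f y * indicator {0\<^sup>2..(real n)\<^sup>2} y \<partial>lborel)
        = (\<integral>\<^sup>+v. ?f (v\<^sup>2) * ennreal (2 * v) * indicator {0..real n} v \<partial>lborel)"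
      by (rule nn_integral_substitution_aux)
         (use n in \<open>auto intro!: derivative_eq_intros continuous_intros\<close>)
    also have "\<dots> = (\<integral>\<^sup>+v. ?g v * indicator {0..real n} v \<partial>lborel)"
    proof (intro nn_integral_cong)
      fix v :: real
      have "?f (v\<^sup>2) * ennreal (2 * v) = ?g v" if v: "v > 0"
      proof -
        have "(v\<^sup>2) powr (a - 1) * v = v powr (2 * a - 1)"
          using v by (simp add: powr_powr powr_diff power2_eq_square powr_mult powr_add[symmetric] field_simps)
        hence e: "(v\<^sup>2) powr (a - 1) / (1 + v\<^sup>2) * (2 * v) = v powr (2 * a - 1) / (1 + v\<^sup>2) * 2"
          by (simp add: field_simps)
        have "?f (v\<^sup>2) * ennreal (2 * v) = ennreal ((v\<^sup>2) powr (a - 1) / (1 + v\<^sup>2) * (2 * v))"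
          using v by (subst ennreal_mult) (auto simp: add_nonneg_nonneg)
        also have "\<dots> = ?g v" unfolding e using v
          by (subst ennreal_mult) (auto simp: add_nonneg_nonneg)
        finally show ?thesis .
      qed
      moreover have "indicator {0..real n} v = (0::ennreal)" if "v < 0" using that by simp
      ultimately show "?f (v\<^sup>2) * ennreal (2 * v) * indicator {0..real n} v = ?g v * indicator {0..real n} v"
        by (cases v "0::real" rule: linorder_cases) (simp_all only: mult_zero_right, simp_all)
    qed
    finally show ?thesis by simp
  qed
  have lim: "(\<lambda>n. \<integral>\<^sup>+y. h y * indicator {0..r n} y \<partial>lborel) \<longlonglongrightarrow> (\<integral>\<^sup>+y. h y \<partial>lborel)"
    if [measurable]: "h \<in> borel_measurable borel" and h0: "\<And>y. y < 0 \<Longrightarrow> h y = 0" and r: "mono r" "filterlim r at_top sequentially"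
    for h :: "real \<Rightarrow> ennreal" and r :: "nat \<Rightarrow> real"
  proof (rule nn_integral_LIMSEQ)
    show "incseq (\<lambda>n y. h y * indicator {0..r n} y)"
      using r(1) by (auto simp: incseq_def le_fun_def indicator_def dest: order_trans)
    show "(\<lambda>n. h y * indicator {0..r n} y) \<longlonglongrightarrow> h y" for y
    proof (rule tendsto_eventually)
      have "\<forall>\<^sub>F n in sequentially. r n \<ge> y" using r(2) by (simp add: filterlim_at_top)
      thus "\<forall>\<^sub>F n in sequentially. h y * indicator {0..r n} y = h y"
        by eventually_elim (use h0 in \<open>auto simp: indicator_def not_le\<close>)
    qed
  qed auto
  have r1: "mono (\<lambda>n. real n)" "filterlim (\<lambda>n. real n) at_top sequentially"
    by (auto simp: mono_def filterlim_real_sequentially)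
  have r2: "mono (\<lambda>n. (real n)\<^sup>2)" "filterlim (\<lambda>n. (real n)\<^sup>2) at_top sequentially"
    by (auto simp: mono_def intro!: power_mono filterlim_pow_at_top filterlim_real_sequentially)
  have L1: "(\<lambda>n. \<integral>\<^sup>+y. ?f y * indicator {0..(real n)\<^sup>2} y \<partial>lborel) \<longlonglongrightarrow> (\<integral>\<^sup>+y. ?f y \<partial>lborel)"
    by (rule lim[OF _ _ r2]) auto
  have L2: "(\<lambda>n. \<integral>\<^sup>+v. ?g v * indicator {0..real n} v \<partial>lborel) \<longlonglongrightarrow> (\<integral>\<^sup>+v. ?g v \<partial>lborel)"
    by (rule lim[OF _ _ r1]) auto
  have "(\<lambda>n. \<integral>\<^sup>+y. ?f y * indicator {0..(real n)\<^sup>2} y \<partial>lborel) \<longlonglongrightarrow> (\<integral>\<^sup>+v. ?g v \<partial>lborel)"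
    by (rule Lim_transform_eventually[OF L2]) (use * in \<open>auto intro!: eventually_mono[OF eventually_gt_at_top[of 0]]\<close>)
  with L1 have "(\<integral>\<^sup>+y. ?f y \<partial>lborel) = (\<integral>\<^sup>+v. ?g v \<partial>lborel)" by (rule LIMSEQ_unique)
  also have "(\<integral>\<^sup>+v. ?g v \<partial>lborel) = (\<integral>\<^sup>+v\<in>{0<..}. ennreal (v powr (2 * a - 1) / (1 + v\<^sup>2)) \<partial>lborel) * 2"
    by (rule nn_integral_multc) measurable
  finally show ?thesis by simp
qed

text \<open>Write 1 / (1 + y) as the integral of exp (- w (1 + y)) over w > 0 and exchange the
  integrals: the inner one gives Gamma a w^(-a), the outer one Gamma (1 - a).\<close>

lemma nn_integral_powr_over_1_plus:
  assumes a: "0 < (a::real)" "a < 1"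
  shows "(\<integral>\<^sup>+y\<in>{0<..}. ennreal (y powr (a - 1) / (1 + y)) \<partial>lborel) = ennreal (Gamma a * Gamma (1 - a))"
proof -
  interpret pair_sigma_finite lborel "lborel :: real measure" ..
  let ?F = "\<lambda>(y::real, w::real). ennreal (y powr (a - 1) * exp (- (w * (1 + y)))) * indicator {0<..} w * indicator {0<..} y"
  have "(\<integral>\<^sup>+y\<in>{0<..}. ennreal (y powr (a - 1) / (1 + y)) \<partial>lborel) = (\<integral>\<^sup>+y. (\<integral>\<^sup>+w. ?F (y, w) \<partial>lborel) \<partial>lborel)"
  proof (intro nn_integral_cong)
    fix y :: real
    show "ennreal (y powr (a - 1) / (1 + y)) * indicator {0<..} y = (\<integral>\<^sup>+w. ?F (y, w) \<partial>lborel)"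
    proof (cases "y > 0")
      case True
      have "(\<integral>\<^sup>+w. ?F (y, w) \<partial>lborel) = (\<integral>\<^sup>+w. ennreal (y powr (a - 1)) * (ennreal (w powr (1 - 1) * exp (- ((1 + y) * w))) * indicator {0<..} w) \<partial>lborel)"
        using True by (intro nn_integral_cong) (auto simp: indicator_def ennreal_mult[symmetric] mult_ac)
      also have "\<dots> = ennreal (y powr (a - 1)) * (\<integral>\<^sup>+w\<in>{0<..}. ennreal (w powr (1 - 1) * exp (- ((1 + y) * w))) \<partial>lborel)"
        by (rule nn_integral_cmult) measurable
      also have "(\<integral>\<^sup>+w\<in>{0<..}. ennreal (w powr (1 - 1) * exp (- ((1 + y) * w))) \<partial>lborel) = ennreal (Gamma 1 * (1 + y) powr (- 1))"
        using True by (intro nn_integral_Gamma_scaled) auto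
      finally show ?thesis using True by (simp add: ennreal_mult[symmetric] powr_minus divide_inverse)
    qed simp
  qed
  also have "\<dots> = (\<integral>\<^sup>+w. (\<integral>\<^sup>+y. ?F (y, w) \<partial>lborel) \<partial>lborel)"
    by (rule lborel_pair.Fubini'[symmetric]) measurable
  also have "\<dots> = (\<integral>\<^sup>+w. ennreal (Gamma a) * (ennreal (w powr ((1 - a) - 1) * exp (- (1 * w))) * indicator {0<..} w) \<partial>lborel)"
  proof (intro nn_integral_cong)
    fix w :: real
    show "(\<integral>\<^sup>+y. ?F (y, w) \<partial>lborel) = ennreal (Gamma a) * (ennreal (w powr ((1 - a) - 1) * exp (- (1 * w))) * indicator {0<..} w)"
    proof (cases "w > 0")
      case True
      have "(\<integral>\<^sup>+y. ?F (y, w) \<partial>lborel) = (\<integral>\<^sup>+y. ennreal (exp (- w)) * (ennreal (y powr (a - 1) * exp (- (w * y))) * indicator {0<..} y) \<partial>lborel)"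
        using True by (intro nn_integral_cong)
          (auto simp: indicator_def ennreal_mult[symmetric] exp_add[symmetric] algebra_simps)
      also have "\<dots> = ennreal (exp (- w)) * ennreal (Gamma a * w powr (- a))"
        using True a by (subst nn_integral_cmult) (auto simp: nn_integral_Gamma_scaled)
      finally show ?thesis using True a by (simp add: ennreal_mult[symmetric] mult_ac)
    qed simp
  qed
  also have "\<dots> = ennreal (Gamma a) * (\<integral>\<^sup>+w\<in>{0<..}. ennreal (w powr ((1 - a) - 1) * exp (- (1 * w))) \<partial>lborel)"
    by (rule nn_integral_cmult) measurable
  also have "(\<integral>\<^sup>+w\<in>{0<..}. ennreal (w powr ((1 - a) - 1) * exp (- (1 * w))) \<partial>lborel) = ennreal (Gamma (1 - a) * 1 powr (- (1 - a)))"
    using a by (intro nn_integral_Gamma_scaled) auto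
  finally show ?thesis using a by (simp add: ennreal_mult[symmetric])
qed

text \<open>The polar part - 1 / u + 1 / 2 is compensated only for u < 1. The kernel is then O(u) at
  0 and exponentially small at infinity, so its Mellin transform converges for Re s > -1, and the
  compensated part has an elementary integral over (0, 1).\<close>

definition mellin_kernel :: "real \<Rightarrow> real" where
  "mellin_kernel u = (if u < 1 then bern_kernel u else 1 / (exp u - 1))"

lemma mellin_kernel_measurable [measurable]: "mellin_kernel \<in> borel_measurable borel"
  unfolding mellin_kernel_def bern_kernel_def by measurable

lemma mellin_kernel_bounds:
  assumes u: "u > 0"
  shows "0 \<le> mellin_kernel u" "mellin_kernel u \<le> 6 * u * exp (- u)"
proof -
  show "0 \<le> mellin_kernel u"
    using bern_kernel_bounds[OF u] u by (simp add: mellin_kernel_def)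
  show "mellin_kernel u \<le> 6 * u * exp (- u)"
  proof (cases "u < 1")
    case True
    have "exp u \<le> exp 1" using True by simp
    hence "exp u \<le> 3" using exp_le by linarith
    hence "2 * u * exp u \<le> 2 * u * 3" using u by (intro mult_left_mono) auto
    hence "2 * u \<le> 6 * u * exp (- u)" by (simp add: exp_minus field_simps)
    thus ?thesis using bern_kernel_bounds(2)[OF u] True by (simp add: mellin_kernel_def)
  next
    case False
    have e: "exp u \<ge> 2" using exp_ge_add_one_self[of u] False by linarith
    hence "1 / (exp u - 1) \<le> 1 / (exp u / 2)" using u by (intro divide_left_mono mult_pos_pos) auto
    also have "\<dots> = 2 * exp (- u)" by (simp add: exp_minus field_simps)
    also have "\<dots> \<le> 6 * u * exp (- u)" using False by (intro mult_right_mono) auto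
    finally show ?thesis using False by (simp add: mellin_kernel_def)
  qed
qed

definition zeta_mellin :: "complex \<Rightarrow> complex" where
  "zeta_mellin s = (\<integral>u. indicator {0<..} u *\<^sub>R (of_real u powr (s - 1) * of_real (mellin_kernel u)) \<partial>lborel)"

lemma integrable_powr_exp:
  assumes "a > -1"
  shows "integrable lborel (\<lambda>u::real. indicator {0<..} u * (u powr a * exp (- u)))"
proof (rule integrableI_nonneg)
  have "(\<integral>\<^sup>+u. ennreal (indicator {0<..} u * (u powr a * exp (- u))) \<partial>lborel)
      = (\<integral>\<^sup>+u\<in>{0<..}. ennreal (u powr ((a + 1) - 1) * exp (- (1 * u))) \<partial>lborel)"
    by (intro nn_integral_cong) (auto simp: indicator_def)
  also have "\<dots> = ennreal (Gamma (a + 1) * 1 powr (- (a + 1)))"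
    using assms by (intro nn_integral_Gamma_scaled) auto
  finally show "(\<integral>\<^sup>+u. ennreal (indicator {0<..} u * (u powr a * exp (- u))) \<partial>lborel) < \<infinity>" by simp
qed auto

lemma norm_mellin_integrand:
  assumes u: "u > 0" and s: "a \<le> Re s" "Re s \<le> b"
  shows "norm (of_real u powr (s - 1) * of_real (mellin_kernel u) :: complex) \<le> 6 * (u powr a * exp (- u)) + 6 * (u powr b * exp (- u))"
proof -
  have "norm (of_real u powr (s - 1) * of_real (mellin_kernel u) :: complex) = u powr (Re s - 1) * mellin_kernel u"
    using u mellin_kernel_bounds(1)[OF u] by (simp add: norm_mult norm_powr_real_powr)
  also have "\<dots> \<le> u powr (Re s - 1) * (6 * u * exp (- u))"
    using mellin_kernel_bounds(2)[OF u] by (intro mult_left_mono) auto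
  also have "\<dots> = 6 * (u powr (Re s) * exp (- u))"
    using u by (simp add: powr_diff)
  also have "u powr (Re s) \<le> u powr a + u powr b"
  proof (cases "u \<ge> 1")
    case True
    hence "u powr Re s \<le> u powr b" using s by (intro powr_mono) auto
    thus ?thesis by (simp add: add_increasing)
  next
    case False
    hence "u powr Re s \<le> u powr a" using s u by (intro powr_mono') auto
    thus ?thesis by (simp add: add_increasing2)
  qed
  finally show ?thesis by (simp add: algebra_simps)
qed

lemma zeta_mellin_holomorphic: "zeta_mellin holomorphic_on {s. Re s > -1}"
  unfolding zeta_mellin_def
proof (rule holomorphic_integral_dominated)
  show "open {s. - 1 < Re s}" by (simp add: open_halfspace_Re_gt)
  show "(\<lambda>s. indicator {0<..} x *\<^sub>R (of_real x powr (s - 1) * of_real (mellin_kernel x))) holomorphic_on {s. - 1 < Re s}" for x :: real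
    by (cases "x > 0") (auto intro!: holomorphic_intros simp: scaleR_conv_of_real)
  fix z assume "z \<in> {s. Re s > - 1}"
  hence z: "Re z > -1" by simp
  define d where "d = (Re z + 1) / 2"
  define g where "g = (\<lambda>u. 6 * (indicator {0<..} u * (u powr (Re z - d) * exp (- u))) + 6 * (indicator {0<..} u * (u powr (Re z + d) * exp (- u))))"
  have Re: "Re z - d \<le> Re s \<and> Re s \<le> Re z + d" if "s \<in> cball z d" for s
    using that abs_Re_le_cmod[of "z - s"] by (simp add: dist_norm) linarith
  have a: "Re z - d > -1" using z by (simp add: d_def field_simps)
  show "\<exists>d>0. \<exists>g. cball z d \<subseteq> {s. - 1 < Re s} \<and> integrable lborel g \<and>
      (\<forall>s\<in>cball z d. \<forall>u\<in>space lborel. norm (indicator {0<..} u *\<^sub>R (of_real u powr (s - 1) * of_real (mellin_kernel u)) :: complex) \<le> g u)"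
  proof (intro exI[of _ d] exI[of _ g] conjI ballI)
    show "d > 0" using z by (simp add: d_def)
    show "cball z d \<subseteq> {s. - 1 < Re s}" using Re a by force
    show "integrable lborel g" unfolding g_def
      using a \<open>d > 0\<close> z by (intro Bochner_Integration.integrable_add integrable_mult_right integrable_powr_exp) auto
    fix s u assume "s \<in> cball z d" "u \<in> space (lborel :: real measure)"
    thus "norm (indicator {0<..} u *\<^sub>R (of_real u powr (s - 1) * of_real (mellin_kernel u)) :: complex) \<le> g u"
      using Re[of s] norm_mellin_integrand[of u "Re z - d" s "Re z + d"] by (auto simp: g_def indicator_def)
  qed
qed auto

lemma zeta_mellin_of_real:
  assumes "s > -1" "r \<ge> 0"
    and "(\<integral>\<^sup>+u\<in>{0<..}. ennreal (u powr (s - 1) * mellin_kernel u) \<partial>lborel) = ennreal r"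
  shows "zeta_mellin (of_real s) = of_real r"
proof -
  have "zeta_mellin (of_real s) = (\<integral>u. complex_of_real (indicator {0<..} u * (u powr (s - 1) * mellin_kernel u)) \<partial>lborel)"
    unfolding zeta_mellin_def
    by (intro Bochner_Integration.integral_cong) (auto simp: indicator_def powr_of_real[of _ "s - 1", simplified])
  also have "\<dots> = of_real (\<integral>u. indicator {0<..} u * (u powr (s - 1) * mellin_kernel u) \<partial>lborel)"
    by (rule integral_complex_of_real)
  also have "(\<integral>u. indicator {0<..} u * (u powr (s - 1) * mellin_kernel u) \<partial>lborel) =
     enn2real (\<integral>\<^sup>+u. ennreal (indicator {0<..} u * (u powr (s - 1) * mellin_kernel u)) \<partial>lborel)"
    using mellin_kernel_bounds by (intro integral_eq_nn_integral) (auto simp: indicator_def)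
  also have "(\<integral>\<^sup>+u. ennreal (indicator {0<..} u * (u powr (s - 1) * mellin_kernel u)) \<partial>lborel)
     = (\<integral>\<^sup>+u\<in>{0<..}. ennreal (u powr (s - 1) * mellin_kernel u) \<partial>lborel)"
    by (intro nn_integral_cong) (auto simp: indicator_def)
  finally show ?thesis using assms by simp
qed

lemma nn_integral_mellin_kernel_finite:
  assumes "s > -1"
  obtains r where "r \<ge> 0" "(\<integral>\<^sup>+u\<in>{0<..}. ennreal (u powr (s - 1) * mellin_kernel u) \<partial>lborel) = ennreal r"
proof -
  let ?I = "(\<integral>\<^sup>+u\<in>{0<..}. ennreal (u powr (s - 1) * mellin_kernel u) \<partial>lborel)"
  have "?I \<le> (\<integral>\<^sup>+u. ennreal (12 * (indicator {0<..} u * (u powr s * exp (- u)))) \<partial>lborel)"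
  proof (intro nn_integral_mono)
    fix u :: real
    show "ennreal (u powr (s - 1) * mellin_kernel u) * indicator {0<..} u \<le> ennreal (12 * (indicator {0<..} u * (u powr s * exp (- u))))"
      using norm_mellin_integrand[of u s "of_real s" s] mellin_kernel_bounds(1)[of u]
      by (auto simp: indicator_def norm_mult norm_powr_real_powr mult_ac intro!: ennreal_leI)
  qed
  also have "\<dots> < \<infinity>"
    using integrable_mult_right[OF integrable_powr_exp[OF assms], of 12]
    by (subst nn_integral_eq_integral) (auto simp: indicator_def)
  finally have "?I < \<infinity>" .
  then obtain r where "r \<ge> 0" "?I = ennreal r" by (cases ?I) auto
  thus ?thesis by (rule that)
qed

text \<open>The two fractions are the Mellin integral of 1 / u - 1 / 2 over (0, 1), the part of 1 /
  (exp u - 1) that \<open>mellin_kernel\<close> omits. It is nonnegative there, so the identity can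
  be obtained from nonnegative integrals.\<close>

lemma zeta_mellin_gt_1:
  assumes s: "s > (1::real)"
  shows "Gamma (of_real s) * zeta (of_real s) = zeta_mellin (of_real s) + 1 / (of_real s - 1) - 1 / (2 * of_real s)"
proof -
  obtain r where r: "r \<ge> 0" "(\<integral>\<^sup>+u\<in>{0<..}. ennreal (u powr (s - 1) * mellin_kernel u) \<partial>lborel) = ennreal r"
    using nn_integral_mellin_kernel_finite[of s] s by auto
  define c where "c = 1 / (s - 1) - 1 / (2 * s)"
  have I: "(\<integral>\<^sup>+u. ennreal (u powr (s - 2) - u powr (s - 1) / 2) * indicator {0..1} u \<partial>lborel) = ennreal c"
  proof (rule nn_integral_has_integral_lebesgue')
    have "((\<lambda>u. u powr (s - 2) - u powr (s - 1) / 2) has_integral (1 powr (s - 2 + 1) / (s - 2 + 1) - 1 powr (s - 1 + 1) / (s - 1 + 1) / 2)) {0..1}"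
      using s by (intro has_integral_diff has_integral_divide has_integral_powr_from_0) auto
    thus "((\<lambda>u. u powr (s - 2) - u powr (s - 1) / 2) has_integral c) {0..1}"
      by (simp add: c_def mult.commute)
    fix u :: real assume "u \<in> {0..1}"
    hence "u = 0 \<or> u powr (s - 1) / 2 \<le> u powr (s - 2)"
    proof (cases "u = 0")
      case False
      hence u: "0 < u" "u \<le> 1" using \<open>u \<in> {0..1}\<close> by auto
      have "u powr (s - 1) \<le> u powr (s - 2)" using u by (intro powr_mono') auto
      moreover have "u powr (s - 1) \<ge> 0" by simp
      ultimately show ?thesis by linarith
    qed simp
    thus "0 \<le> u powr (s - 2) - u powr (s - 1) / 2" by auto
  qed
  have "ennreal (Gamma s * Re (zeta (of_real s))) = (\<integral>\<^sup>+u\<in>{0<..}. ennreal (u powr (s - 1) / (exp u - 1)) \<partial>lborel)"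
    by (rule nn_integral_Gamma_zeta[OF s, symmetric])
  also have "\<dots> = (\<integral>\<^sup>+u. ennreal (u powr (s - 1) * mellin_kernel u) * indicator {0<..} u
       + ennreal (u powr (s - 2) - u powr (s - 1) / 2) * indicator {0..1} u \<partial>lborel)"
  proof (rule nn_integral_cong_AE)
    have "AE u::real in lborel. u \<noteq> 0 \<and> u \<noteq> 1"
      using AE_lborel_singleton[of "0::real"] AE_lborel_singleton[of "1::real"] by eventually_elim auto
    thus "AE u in lborel. ennreal (u powr (s - 1) / (exp u - 1)) * indicator {0<..} u =
       ennreal (u powr (s - 1) * mellin_kernel u) * indicator {0<..} u
       + ennreal (u powr (s - 2) - u powr (s - 1) / 2) * indicator {0..1} u"
    proof eventually_elim
      case (elim u)
      consider "u < 0" | "0 < u" "u < 1" | "u > 1" using elim by linarith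
      thus ?case
      proof cases
        case 2
        have "u powr (s - 2) = u powr (s - 1) / u"
          using 2 powr_diff[of u "s - 1" 1] by (simp add: algebra_simps)
        hence e: "u powr (s - 1) / (exp u - 1) = u powr (s - 1) * mellin_kernel u + (u powr (s - 2) - u powr (s - 1) / 2)"
          using 2 by (simp add: mellin_kernel_def bern_kernel_def algebra_simps)
        have "u powr (s - 1) \<le> u powr (s - 2)" using 2 by (intro powr_mono') auto
        moreover have "u powr (s - 1) \<ge> 0" by simp
        ultimately have nn: "u powr (s - 2) - u powr (s - 1) / 2 \<ge> 0" by linarith
        show ?thesis using 2 mellin_kernel_bounds(1)[of u] nn
          by (simp add: e ennreal_plus)
      qed (auto simp: mellin_kernel_def)
    qed
  qed
  also have "\<dots> = ennreal r + ennreal c"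
    by (subst nn_integral_add) (simp_all add: r I)
  also have "\<dots> = ennreal (r + c)"
  proof -
    have "1 / (2 * s) \<le> 1 / (s - 1)" using s by (intro divide_left_mono) auto
    thus ?thesis using r by (simp add: ennreal_plus c_def)
  qed
  finally have "Gamma s * Re (zeta (of_real s)) = r + c"
  proof (subst (asm) ennreal_inj)
    show "0 \<le> Gamma s * Re (zeta (of_real s))"
      using s Gamma_real_pos[of s] by (intro mult_nonneg_nonneg zeta_real_nonneg) auto
    have "1 / (2 * s) \<le> 1 / (s - 1)" using s by (intro divide_left_mono) auto
    thus "0 \<le> r + c" using r by (simp add: c_def)
  qed
  hence "complex_of_real (Gamma s * Re (zeta (of_real s))) = of_real (r + c)" by simp
  moreover have "complex_of_real (Gamma s * Re (zeta (of_real s))) = Gamma (of_real s) * zeta (of_real s)"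
    using zeta_real_sums(2)[OF s] by (simp add: Gamma_complex_of_real)
  ultimately show ?thesis
    using zeta_mellin_of_real[OF _ r] s by (simp add: c_def add_diff_eq)
qed

lemma zeta_mellin_eq:
  assumes s: "Re s > -1" "s \<noteq> 0" "s \<noteq> 1"
  shows "Gamma s * zeta s = zeta_mellin s + 1 / (s - 1) - 1 / (2 * s)"
proof -
  define U where "U = {s. Re s > -1} - {0, 1}"
  have openU: "open U" unfolding U_def by (intro open_Diff open_halfspace_Re_gt) auto
  have "s \<notin> \<int>\<^sub>\<le>\<^sub>0" if "s \<in> U" for s
    using that unfolding U_def by (auto elim!: nonpos_Ints_cases)
  hence hol: "(\<lambda>s. Gamma s * zeta s - (zeta_mellin s + 1 / (s - 1) - 1 / (2 * s))) holomorphic_on U"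
    by (intro holomorphic_intros holomorphic_on_subset[OF zeta_holomorphic]
        holomorphic_on_subset[OF zeta_mellin_holomorphic]) (auto simp: U_def)
  have "Gamma s * zeta s - (zeta_mellin s + 1 / (s - 1) - 1 / (2 * s)) = 0"
  proof (rule analytic_continuation[OF hol openU, of "of_real ` {1<..}" 2])
    show "connected U" unfolding U_def
      by (rule connected_open_diff_countable)
         (auto intro!: convex_connected convex_halfspace_Re_gt open_halfspace_Re_gt)
    show "complex_of_real ` {1<..} \<subseteq> U" by (auto simp: U_def)
    show "2 \<in> U" by (simp add: U_def)
    have "(2::real) islimpt {1<..}" by (rule open_imp_islimpt) auto
    hence "complex_of_real 2 islimpt of_real ` {1<..}"
      by (rule islimpt_isCont_image) (simp_all only: of_real_eq_iff eventually_at_filter, simp_all)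
    thus "2 islimpt complex_of_real ` {1<..}" by simp
    show "s \<in> U" using s by (simp add: U_def)
  qed (use zeta_mellin_gt_1 in auto)
  thus ?thesis by simp
qed

text \<open>Termwise integration of the partial fractions. Scaling by 2 pi n turns each term into a
  multiple of the integral of v^s / (1 + v^2), which is pi / (2 cos(pi s / 2)) by the beta integral
  at (s + 1) / 2 and the reflection formula; the powers of n add up to zeta(1 - s).\<close>

lemma nn_integral_bern_kernel:
  assumes s: "-1 < (s::real)" "s < 0"
  shows "(\<integral>\<^sup>+u\<in>{0<..}. ennreal (u powr (s - 1) * bern_kernel u) \<partial>lborel)
    = ennreal ((2 * pi) powr s * Re (zeta (of_real (1 - s))) / (2 * cos (pi * s / 2)))"
proof -
  define I where "I = Gamma ((s + 1) / 2) * Gamma (1 - (s + 1) / 2)"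
  have "complex_of_real I = of_real (pi / cos (pi * s / 2))"
  proof -
    have "complex_of_real I = Gamma (of_real ((s + 1) / 2)) * Gamma (1 - of_real ((s + 1) / 2))"
      unfolding I_def by (simp only: of_real_mult Gamma_complex_of_real[symmetric] of_real_diff of_real_1)
    also have "\<dots> = of_real pi / sin (of_real pi * of_real ((s + 1) / 2))"
      by (rule Gamma_reflection_complex)
    also have "\<dots> = of_real (pi / sin (pi * ((s + 1) / 2)))"
      by (simp only: of_real_divide sin_of_real[symmetric] of_real_mult)
    also have "sin (pi * ((s + 1) / 2)) = cos (pi * s / 2)"
    proof -
      have "pi * ((s + 1) / 2) = pi * s / 2 + pi / 2" by (simp add: field_simps)
      thus ?thesis by (simp only: sin_add) simp
    qed
    finally show ?thesis .
  qed
  hence I_eq: "I = pi / cos (pi * s / 2)" by (simp only: of_real_eq_iff)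
  have cospos: "cos (pi * s / 2) > 0"
    using s mult_strict_left_mono[of "-1" s pi] mult_strict_left_mono[of s 0 pi]
    by (intro cos_gt_zero_pi) auto
  have I0: "I \<ge> 0" using cospos by (simp add: I_eq)
  define J where "J = (\<integral>\<^sup>+v\<in>{0<..}. ennreal (v powr s / (1 + v\<^sup>2)) \<partial>lborel)"
  have "J * 2 = ennreal I"
  proof -
    have e: "2 * ((s + 1) / 2) - 1 = s" by (simp add: field_simps)
    have p: "0 < (s + 1) / 2" "(s + 1) / 2 < 1" using s by simp_all
    show ?thesis
      using nn_integral_square_subst[OF p(1)] nn_integral_powr_over_1_plus[OF p]
      unfolding J_def I_def by (simp only: e)
  qed
  hence J: "J = ennreal (I / 2)"
    using I0 by (cases J) (auto simp: ennreal_mult_top ennreal_top_mult ennreal_mult[symmetric]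
        simp flip: ennreal_numeral)
  have scaled: "(\<integral>\<^sup>+u\<in>{0<..}. ennreal (u powr (s - 1) * (2 * u / (u\<^sup>2 + c\<^sup>2))) \<partial>lborel) = ennreal (c powr (s - 1) * I)"
    (is "?L = _") if c: "c > 0" for c
  proof -
    have "?L = ennreal \<bar>c\<bar> * (\<integral>\<^sup>+v. ennreal ((0 + c * v) powr (s - 1) * (2 * (0 + c * v) / ((0 + c * v)\<^sup>2 + c\<^sup>2))) * indicator {0<..} (0 + c * v) \<partial>lborel)"
      by (rule nn_integral_real_affine) (use c in auto)
    also have "(\<integral>\<^sup>+v. ennreal ((0 + c * v) powr (s - 1) * (2 * (0 + c * v) / ((0 + c * v)\<^sup>2 + c\<^sup>2))) * indicator {0<..} (0 + c * v) \<partial>lborel)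
      = (\<integral>\<^sup>+v. ennreal (2 * c powr (s - 2)) * (ennreal (v powr s / (1 + v\<^sup>2)) * indicator {0<..} v) \<partial>lborel)"
    proof (intro nn_integral_cong)
      fix v :: real
      show "ennreal ((0 + c * v) powr (s - 1) * (2 * (0 + c * v) / ((0 + c * v)\<^sup>2 + c\<^sup>2))) * indicator {0<..} (0 + c * v)
         = ennreal (2 * c powr (s - 2)) * (ennreal (v powr s / (1 + v\<^sup>2)) * indicator {0<..} v)"
      proof (cases "v > 0")
        case True
        have "(c * v) powr (s - 1) = c powr (s - 2) * c * (v powr s / v)"
          using True c powr_diff[of c "s - 1" 1] powr_diff[of v s 1] by (simp add: powr_mult algebra_simps)
        moreover have "(c * v)\<^sup>2 + c\<^sup>2 = c * c * (1 + v\<^sup>2)" by (simp add: power2_eq_square algebra_simps)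
        ultimately have "(c * v) powr (s - 1) * (2 * (c * v) / ((c * v)\<^sup>2 + c\<^sup>2))
            = (c powr (s - 2) * c * (v powr s / v)) * (2 * (c * v) / (c * c * (1 + v\<^sup>2)))"
          by (simp only:)
        also have "\<dots> = 2 * c powr (s - 2) * (v powr s / (1 + v\<^sup>2))"
          using True c by simp
        finally have "(c * v) powr (s - 1) * (2 * (c * v) / ((c * v)\<^sup>2 + c\<^sup>2)) = 2 * c powr (s - 2) * (v powr s / (1 + v\<^sup>2))" .
        thus ?thesis using True c by (simp add: ennreal_mult[symmetric] zero_less_mult_iff)
      next
        case False
        thus ?thesis using c by (simp add: zero_less_mult_iff)
      qed
    qed
    also have "\<dots> = ennreal (2 * c powr (s - 2)) * J"
      unfolding J_def by (rule nn_integral_cmult) measurable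
    also have "ennreal \<bar>c\<bar> * \<dots> = ennreal (c * (2 * c powr (s - 2)) * (I / 2))"
      using c I0 by (simp add: J ennreal_mult[symmetric] mult_ac)
    also have "c * (2 * c powr (s - 2)) * (I / 2) = c powr (s - 1) * I"
      using c powr_diff[of c "s - 1" 1] by (simp add: algebra_simps)
    finally show ?thesis .
  qed
  have "(\<integral>\<^sup>+u\<in>{0<..}. ennreal (u powr (s - 1) * bern_kernel u) \<partial>lborel) =
     (\<integral>\<^sup>+u. (\<Sum>n. ennreal (u powr (s - 1) * (2 * u / (u\<^sup>2 + (2 * pi * real (Suc n))\<^sup>2))) * indicator {0<..} u) \<partial>lborel)"
  proof (intro nn_integral_cong)
    fix u :: real
    show "ennreal (u powr (s - 1) * bern_kernel u) * indicator {0<..} u =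
        (\<Sum>n. ennreal (u powr (s - 1) * (2 * u / (u\<^sup>2 + (2 * pi * real (Suc n))\<^sup>2))) * indicator {0<..} u)"
    proof (cases "u > 0")
      case True
      have "(\<Sum>n. ennreal (u powr (s - 1) * (2 * u / (u\<^sup>2 + (2 * pi * real (Suc n))\<^sup>2)))) = ennreal (u powr (s - 1) * bern_kernel u)"
        using True by (intro suminf_ennreal_eq sums_mult bern_kernel_sums) auto
      thus ?thesis using True by simp
    qed simp
  qed
  also have "\<dots> = (\<Sum>n. \<integral>\<^sup>+u\<in>{0<..}. ennreal (u powr (s - 1) * (2 * u / (u\<^sup>2 + (2 * pi * real (Suc n))\<^sup>2))) \<partial>lborel)"
    by (rule nn_integral_suminf) measurable
  also have "\<dots> = (\<Sum>n. ennreal ((2 * pi) powr (s - 1) * I * real (Suc n) powr (- (1 - s))))"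
  proof (intro suminf_cong)
    fix n
    show "(\<integral>\<^sup>+u\<in>{0<..}. ennreal (u powr (s - 1) * (2 * u / (u\<^sup>2 + (2 * pi * real (Suc n))\<^sup>2))) \<partial>lborel)
       = ennreal ((2 * pi) powr (s - 1) * I * real (Suc n) powr (- (1 - s)))"
      by (subst scaled) (simp_all add: powr_mult mult_ac del: of_nat_Suc)
  qed
  also have "\<dots> = ennreal ((2 * pi) powr (s - 1) * I * Re (zeta (of_real (1 - s))))"
    using I0 s by (intro suminf_ennreal_eq sums_mult zeta_real_sums) auto
  also have "(2 * pi) powr (s - 1) * I * Re (zeta (of_real (1 - s))) = (2 * pi) powr s * Re (zeta (of_real (1 - s))) / (2 * cos (pi * s / 2))"
    by (simp add: I_eq powr_diff)
  finally show ?thesis .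
qed

text \<open>For s < 0 the function - 1 / u + 1 / 2, by which \<open>bern_kernel\<close> exceeds
  \<open>mellin_kernel\<close> beyond u = 1, has the convergent Mellin integral 1 / (s - 1) - 1 / (2
  s) over [1, \<infinity>). These are exactly the correction terms of \<open>zeta_mellin_eq\<close>,
  so Gamma(s) zeta(s) is the Mellin transform of \<open>bern_kernel\<close> itself.\<close>

lemma zeta_functional_real:
  assumes s: "-1 < (s::real)" "s < 0"
  shows "2 * cos (of_real pi * of_real s / 2) * Gamma (of_real s) * zeta (of_real s) = of_real (2 * pi) powr (of_real s) * zeta (1 - of_real s)"
proof -
  obtain r where r: "r \<ge> 0" "(\<integral>\<^sup>+u\<in>{0<..}. ennreal (u powr (s - 1) * mellin_kernel u) \<partial>lborel) = ennreal r"
    using nn_integral_mellin_kernel_finite[of s] s by auto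
  define Q where "Q = (2 * pi) powr s * Re (zeta (of_real (1 - s))) / (2 * cos (pi * s / 2))"
  have cospos: "cos (pi * s / 2) > 0"
    using s mult_strict_left_mono[of "-1" s pi] mult_strict_left_mono[of s 0 pi]
    by (intro cos_gt_zero_pi) auto
  have "Re (zeta (of_real (1 - s))) \<ge> 0"
    by (rule zeta_real_nonneg) (use s in auto)
  hence Q0: "Q \<ge> 0" using cospos by (simp add: Q_def)
  have neg: "1 / (2 * s) \<le> 0" using s by (simp add: divide_nonneg_neg)
  have I1: "(\<integral>\<^sup>+u. ennreal (u powr (s - 2)) * indicator {1..} u \<partial>lborel) = ennreal (1 / (1 - s))"
  proof (rule nn_integral_has_integral_lebesgue')
    have "((\<lambda>u. u powr (s - 2)) has_integral - (1 powr (s - 2 + 1)) / (s - 2 + 1)) {1..}"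
      by (rule has_integral_powr_to_inf) (use s in auto)
    also have "- (1 powr (s - 2 + 1)) / (s - 2 + 1) = 1 / (1 - s)" using s by (simp add: field_simps)
    finally show "((\<lambda>u. u powr (s - 2)) has_integral 1 / (1 - s)) {1..}" .
  qed auto
  have I2: "(\<integral>\<^sup>+u. ennreal (u powr (s - 1) / 2) * indicator {1..} u \<partial>lborel) = ennreal (- 1 / (2 * s))"
  proof (rule nn_integral_has_integral_lebesgue')
    have "((\<lambda>u. u powr (s - 1) / 2) has_integral - (1 powr (s - 1 + 1)) / (s - 1 + 1) / 2) {1..}"
      by (rule has_integral_divide, rule has_integral_powr_to_inf) (use s in auto)
    thus "((\<lambda>u. u powr (s - 1) / 2) has_integral - 1 / (2 * s)) {1..}" by (simp add: mult.commute)
  qed auto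
  \<comment> \<open>The negative part is moved to the other side, so that both sides are sums of
    nonnegative integrals.\<close>
  have "(\<integral>\<^sup>+u. ennreal (u powr (s - 1) * bern_kernel u) * indicator {0<..} u + ennreal (u powr (s - 2)) * indicator {1..} u \<partial>lborel)
     = (\<integral>\<^sup>+u. ennreal (u powr (s - 1) * mellin_kernel u) * indicator {0<..} u + ennreal (u powr (s - 1) / 2) * indicator {1..} u \<partial>lborel)"
  proof (rule nn_integral_cong)
    fix u :: real
    consider "u \<le> 0" | "0 < u" "u < 1" | "u \<ge> 1" by linarith
    thus "ennreal (u powr (s - 1) * bern_kernel u) * indicator {0<..} u + ennreal (u powr (s - 2)) * indicator {1..} u
       = ennreal (u powr (s - 1) * mellin_kernel u) * indicator {0<..} u + ennreal (u powr (s - 1) / 2) * indicator {1..} u"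
    proof cases
      case 3
      have "u powr (s - 2) = u powr (s - 1) / u"
        using 3 powr_diff[of u "s - 1" 1] by (simp add: algebra_simps)
      hence e: "u powr (s - 1) * bern_kernel u + u powr (s - 2) = u powr (s - 1) * mellin_kernel u + u powr (s - 1) / 2"
        using 3 by (simp add: mellin_kernel_def bern_kernel_def algebra_simps)
      show ?thesis using 3 mellin_kernel_bounds(1)[of u] bern_kernel_bounds(1)[of u]
        by (simp add: ennreal_plus[symmetric] e del: ennreal_plus)
    qed (auto simp: mellin_kernel_def)
  qed
  moreover have bm: "(\<lambda>u. bern_kernel u) \<in> borel_measurable borel"
    unfolding bern_kernel_def by measurable
  ultimately have "ennreal Q + ennreal (1 / (1 - s)) = ennreal r + ennreal (- 1 / (2 * s))"
    unfolding Q_def nn_integral_bern_kernel[OF s, symmetric] I1[symmetric] I2[symmetric] r(2)[symmetric]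
    by (subst (asm) (1 2) nn_integral_add) (auto intro!: measurable_If borel_measurable_times_ennreal)
  hence "ennreal (Q + 1 / (1 - s)) = ennreal (r + - 1 / (2 * s))"
    using Q0 r(1) s neg by (subst (asm) (1 2) ennreal_plus[symmetric]) (auto simp: divide_nonneg_neg)
  hence Qr: "Q + 1 / (1 - s) = r - 1 / (2 * s)"
  proof (subst (asm) ennreal_inj)
    show "0 \<le> r + - 1 / (2 * s)" using order_trans[OF neg r(1)] by simp
    show "0 \<le> Q + 1 / (1 - s)" using Q0 s by simp
  qed simp
  have "Gamma (complex_of_real s) * zeta (of_real s) = zeta_mellin (of_real s) + 1 / (of_real s - 1) - 1 / (2 * of_real s)"
    using s by (intro zeta_mellin_eq) auto
  also have "zeta_mellin (of_real s) = of_real r"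
    by (rule zeta_mellin_of_real) (use s r in auto)
  also have "of_real r + 1 / (of_real s - 1) - 1 / (2 * of_real s) = complex_of_real (r + 1 / (s - 1) - 1 / (2 * s))"
    by simp
  also have "r + 1 / (s - 1) - 1 / (2 * s) = Q"
  proof -
    have "1 / (s - 1) = - (1 / (1 - s))" using s by (simp add: field_simps)
    thus ?thesis using Qr by simp
  qed
  finally have "Gamma (complex_of_real s) * zeta (of_real s) = of_real Q" .
  hence "2 * cos (of_real pi * of_real s / 2) * Gamma (of_real s) * zeta (of_real s) = of_real (2 * cos (pi * s / 2) * Q)"
    by (simp add: cos_of_real[symmetric] mult.assoc)
  also have "2 * cos (pi * s / 2) * Q = (2 * pi) powr s * Re (zeta (of_real (1 - s)))"
    using cospos by (simp add: Q_def)
  also have "complex_of_real ((2 * pi) powr s * Re (zeta (of_real (1 - s)))) = of_real (2 * pi) powr (of_real s) * zeta (1 - of_real s)"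
    using zeta_real_sums(2)[of "1 - s"] s powr_of_real[of "2 * pi" s] by simp
  finally show ?thesis .
qed

text \<open>Both sides are holomorphic away from 0 and 1, so the identity on the real interval (-1,
  0) extends. The half-plane Re s > -1 contains s or 1 - s for every s.\<close>

theorem zeta_functional_equation:
  assumes s: "Re s > -1" "s \<noteq> 0" "s \<noteq> 1"
  shows "of_real (2 * pi) powr s * zeta (1 - s) = 2 * cos (of_real pi * s / 2) * Gamma s * zeta s"
proof -
  define U where "U = {s. Re s > -1} - {0, 1}"
  have openU: "open U" unfolding U_def by (intro open_Diff open_halfspace_Re_gt) auto
  have "s \<notin> \<int>\<^sub>\<le>\<^sub>0" if "s \<in> U" for s
    using that unfolding U_def by (auto elim!: nonpos_Ints_cases)
  hence hol: "(\<lambda>s. 2 * cos (of_real pi * s / 2) * Gamma s * zeta s - of_real (2 * pi) powr s * zeta (1 - s)) holomorphic_on U"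
    by (intro holomorphic_intros holomorphic_on_subset[OF zeta_holomorphic]
        holomorphic_on_compose_gen[OF _ zeta_holomorphic, unfolded o_def, of "\<lambda>s. 1 - s"]) (auto simp: U_def)
  have "2 * cos (of_real pi * s / 2) * Gamma s * zeta s - of_real (2 * pi) powr s * zeta (1 - s) = 0"
  proof (rule analytic_continuation[OF hol openU, of "of_real ` {-1<..<0}" "of_real (- 1 / 2)"])
    show "connected U" unfolding U_def
      by (rule connected_open_diff_countable)
         (auto intro!: convex_connected convex_halfspace_Re_gt open_halfspace_Re_gt)
    show "complex_of_real ` {-1<..<0} \<subseteq> U" by (auto simp: U_def)
    show "complex_of_real (- 1 / 2) \<in> U" by (auto simp: U_def complex_eq_iff)
    have "(- 1 / 2 :: real) islimpt {-1<..<0}" by (rule open_imp_islimpt) auto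
    thus "complex_of_real (- 1 / 2) islimpt of_real ` {-1<..<0}"
      by (rule islimpt_isCont_image) (simp_all only: of_real_eq_iff eventually_at_filter, simp_all)
    show "s \<in> U" using s by (simp add: U_def)
  qed (use zeta_functional_real in auto)
  thus ?thesis by simp
qed

section \<open>Growth of the zeta function\<close>

lemma norm_Gamma_le:
  assumes "Re z > 0"
  shows "norm (Gamma z) \<le> Gamma (Re z)"
proof -
  have "norm (integral {0..} (\<lambda>t. of_real t powr (z - 1) / of_real (exp t) :: complex))
     \<le> integral {0..} (\<lambda>t. t powr (Re z - 1) / exp t)"
  proof (rule integral_norm_bound_integral)
    show "(\<lambda>t. of_real t powr (z - 1) / of_real (exp t) :: complex) integrable_on {0..}"
      using Gamma_integral_complex[OF assms] by blast
    show "(\<lambda>t. t powr (Re z - 1) / exp t) integrable_on {0..}"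
      using Gamma_integral_real[OF assms] by blast
    fix t :: real assume "t \<in> {0..}"
    thus "norm (of_real t powr (z - 1) / of_real (exp t) :: complex) \<le> t powr (Re z - 1) / exp t"
      by (simp add: norm_divide norm_powr_real_powr)
  qed
  thus ?thesis
    using Gamma_integral_complex[OF assms] Gamma_integral_real[OF assms]
    by (simp add: integral_unique)
qed

text \<open>To the right of 1/2 the quadratic bound is stronger; to the left the functional equation
  is used. Since exponential growth is all that is claimed, the crude estimate |cos z| \<le> exp |z|
  and the boundedness of Gamma on the real interval [1/2, 3] suffice, and Stirling's formula is
  avoided.\<close>

lemma zetaZ_growth:
  obtains C where "C > 0" "\<And>s. Re s \<ge> - 2 \<Longrightarrow> norm (zetaZ s) \<le> C * exp (5 * norm s)"
proof -
  obtain C1 where C1: "C1 > 0" "\<And>s. Re s \<ge> 1 / 2 \<Longrightarrow> norm (zetaZ s) \<le> C1 * (1 + norm s) ^ 2"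
    using zetaZ_bound by blast
  have poly: "(1 + x) ^ 2 \<le> exp (2 * x)" if "x \<ge> 0" for x :: real
    using power_mono[OF exp_ge_add_one_self[of x], of 2] that by (simp add: exp_double)
  have C1': "norm (zetaZ s) \<le> C1 * exp (2 * norm s)" if "Re s \<ge> 1 / 2" for s
    using C1(2)[OF that] mult_left_mono[OF poly[of "norm s"], of C1] C1(1)
    by (meson less_imp_le norm_ge_zero order_trans)
  have "compact (zetaZ ` cball 0 1)"
    by (intro compact_continuous_image holomorphic_on_imp_continuous_on zetaZ_holomorphic) auto
  then obtain B where B: "\<And>s. s \<in> cball 0 1 \<Longrightarrow> norm (zetaZ s) \<le> B"
    using compact_imp_bounded[of "zetaZ ` cball 0 1"] unfolding bounded_iff by blast
  have B0: "B \<ge> 0" using B[of 0] norm_ge_zero[of "zetaZ 0"] by (simp del: norm_ge_zero)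
  have "continuous_on {1/2..3::real} Gamma"
    by (intro continuous_intros) (auto elim!: nonpos_Ints_cases)
  hence "compact (Gamma ` {1/2..3::real})" by (intro compact_continuous_image) auto
  then obtain G where G: "\<And>x. x \<in> {1/2..3::real} \<Longrightarrow> norm (Gamma x) \<le> G"
    using compact_imp_bounded[of "Gamma ` {1/2..3::real}"] unfolding bounded_iff by blast
  have G0: "G \<ge> 0" using G[of 1] norm_ge_zero[of "Gamma 1 :: real"] by (simp del: norm_ge_zero)
  \<comment> \<open>Outside the unit disc |w - 1| = |s| \<ge> 1 for w = 1 - s, so dividing
    \<open>zetaZ w\<close> by w - 1 does no harm.\<close>
  have left: "norm (zetaZ s) \<le> 2 * G * C1 * exp 5 * exp (5 * norm s)"
    if s: "- 2 \<le> Re s" "Re s \<le> 1 / 2" "norm s \<ge> 1" for s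
  proof -
    define w where "w = 1 - s"
    have w: "1 / 2 \<le> Re w" "Re w \<le> 3" "w \<noteq> 0" "w \<noteq> 1" "norm (w - 1) \<ge> 1"
      using s by (auto simp: w_def norm_minus_commute)
    have sw: "s = 1 - w" by (simp add: w_def)
    have "of_real (2 * pi) powr w \<noteq> (0 :: complex)" by simp
    hence "zeta (1 - w) = 2 * cos (of_real pi * w / 2) * Gamma w * zeta w / of_real (2 * pi) powr w"
      using zeta_functional_equation[of w] w by (simp add: field_simps)
    moreover have "zeta w = zetaZ w / (w - 1)" using w by (simp add: zetaZ_def)
    moreover have "zetaZ s = - w * zeta (1 - w)" using w by (simp add: zetaZ_def sw)
    ultimately have "zetaZ s = - w * (2 * cos (of_real pi * w / 2) * Gamma w * (zetaZ w / (w - 1)) / of_real (2 * pi) powr w)"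
      by (simp only:)
    hence "norm (zetaZ s) = norm w * (2 * norm (cos (of_real pi * w / 2)) * norm (Gamma w) * (norm (zetaZ w) / norm (w - 1)) / norm (of_real (2 * pi) powr w :: complex))"
      by (simp add: norm_mult norm_divide)
    also have "\<dots> \<le> exp (norm w) * (2 * exp (2 * norm w) * G * (C1 * exp (2 * norm w) / 1) / 1)"
    proof (intro mult_mono divide_mono)
      show "norm w \<le> exp (norm w)" using exp_ge_add_one_self[of "norm w"] by linarith
      have "norm (cos (of_real pi * w / 2)) \<le> exp (norm (of_real pi * w / 2))" by (rule norm_cos_le)
      also have "norm (of_real pi * w / 2) = pi / 2 * norm w" by (simp add: norm_mult)
      also have "exp (pi / 2 * norm w) \<le> exp (2 * norm w)"
        using pi_less_4 by (simp add: mult_right_mono)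
      finally show "norm (cos (of_real pi * w / 2)) \<le> exp (2 * norm w)" .
      have "Gamma (Re w) \<le> G" using G[of "Re w"] w by auto
      thus "norm (Gamma w) \<le> G" using norm_Gamma_le[of w] w by linarith
      show "norm (zetaZ w) \<le> C1 * exp (2 * norm w)" by (rule C1') (use w in auto)
      have "1 \<le> (2 * pi) powr Re w" using w pi_ge_two by (intro ge_one_powr_ge_zero) auto
      thus "1 \<le> norm (of_real (2 * pi) powr w :: complex)" by (subst norm_powr_real_powr) auto
    qed (use w G0 C1 in auto)
    also have "\<dots> = 2 * G * C1 * exp (5 * norm w)"
      by (simp add: mult_ac exp_add[symmetric])
    also have "\<dots> \<le> 2 * G * C1 * exp (5 + 5 * norm s)"
      using norm_triangle_ineq4[of 1 s] G0 C1 by (intro mult_left_mono) (auto simp: w_def)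
    finally show ?thesis by (simp add: exp_add mult_ac)
  qed
  show ?thesis
  proof
    let ?C = "C1 + B + 2 * G * C1 * exp 5"
    show "?C > 0" using C1 B0 G0 by (intro add_pos_nonneg) auto
    fix s :: complex assume s: "Re s \<ge> - 2"
    have le: "x * exp (5 * norm s) \<le> ?C * exp (5 * norm s)" if "x \<in> {C1, B, 2 * G * C1 * exp 5}" for x
      using that C1 B0 G0 by (intro mult_right_mono) auto
    consider "Re s \<ge> 1 / 2" | "norm s \<le> 1" | "Re s \<le> 1 / 2" "norm s \<ge> 1" by linarith
    thus "norm (zetaZ s) \<le> ?C * exp (5 * norm s)"
    proof cases
      case 1
      have "C1 * exp (2 * norm s) \<le> C1 * exp (5 * norm s)" using C1 by simp
      also have "\<dots> \<le> ?C * exp (5 * norm s)" by (rule le) simp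
      finally show ?thesis using C1'[OF 1] by linarith
    next
      case 2
      have "B * 1 \<le> B * exp (5 * norm s)" using B0 by (intro mult_left_mono) auto
      also have "\<dots> \<le> ?C * exp (5 * norm s)" by (rule le) simp
      finally show ?thesis using B[of s] 2 by simp
    next
      case 3
      have "2 * G * C1 * exp 5 * exp (5 * norm s) \<le> ?C * exp (5 * norm s)" by (rule le) simp
      thus ?thesis using left[OF s 3] by linarith
    qed
  qed
qed

lemma norm_cos_squared_cosh:
  "(norm (cos z))\<^sup>2 = (cos (Re z))\<^sup>2 + (sinh (Im z))\<^sup>2"
  by (simp add: norm_cos_squared sinh_def exp_minus power_divide)

text \<open>The functional equation excludes this point, so the value is taken as a limit at w = 1:
  the zero of cos(pi w / 2) cancels the pole of zeta, with quotient tending to - pi / 2, and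
  \<open>zetaZ 0\<close> comes out as 1 / 2.\<close>

lemma zetaZ_0_nonzero: "zetaZ 0 \<noteq> 0"
proof -
  have contZ: "isCont zetaZ s" for s
    using holomorphic_on_imp_continuous_on[OF zetaZ_holomorphic[of UNIV]]
    by (simp add: continuous_on_eq_continuous_at)
  have G: "isCont Gamma (1 :: complex)"
    by (intro continuous_intros) auto
  have D: "((\<lambda>w. cos (of_real pi * w / 2)) has_field_derivative (- (of_real pi / 2))) (at (1::complex))"
  proof -
    have "sin (complex_of_real pi / 2) = 1" using sin_of_real[of "pi / 2", where 'a = complex] by simp
    thus ?thesis by (auto intro!: derivative_eq_intros)
  qed
  have c0: "cos (complex_of_real pi / 2) = 0" using cos_of_real[of "pi / 2", where 'a = complex] by simp
  have npi: "2 * complex_of_real pi \<notin> \<real>\<^sub>\<le>\<^sub>0"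
    by (simp add: complex_nonpos_Reals_iff not_le)
  have l1: "((\<lambda>w. cos (of_real pi * w / 2) / (w - 1)) \<longlongrightarrow> - (of_real pi / 2)) (at (1::complex))"
    using D unfolding has_field_derivative_iff by (simp add: c0)
  have "((\<lambda>w. - w * (2 * (cos (of_real pi * w / 2) / (w - 1)) * Gamma w * zetaZ w / of_real (2 * pi) powr w))
      \<longlongrightarrow> - 1 * (2 * (- (of_real pi / 2)) * Gamma 1 * zetaZ 1 / of_real (2 * pi) powr 1)) (at 1)"
    using contZ[of 1] G npi by (intro tendsto_intros l1) (auto simp: isCont_def)
  moreover have "\<forall>\<^sub>F w in at (1::complex). - w * (2 * (cos (of_real pi * w / 2) / (w - 1)) * Gamma w * zetaZ w / of_real (2 * pi) powr w) = zetaZ (1 - w)"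
  proof -
    have "\<forall>\<^sub>F w in at (1::complex). w \<in> ball 1 1 - {1}"
      by (intro eventually_at_in_open) auto
    thus ?thesis
    proof eventually_elim
      case (elim w)
      have "\<bar>1 - Re w\<bar> \<le> norm (1 - w)" using abs_Re_le_cmod[of "1 - w"] by simp
      hence "Re w > 0" "w \<noteq> 1" "w \<noteq> 0" using elim by (auto simp: dist_norm)
      hence "zeta (1 - w) = 2 * cos (of_real pi * w / 2) * Gamma w * zeta w / of_real (2 * pi) powr w"
        using zeta_functional_equation[of w] \<open>w \<noteq> 1\<close> by (auto simp: field_simps)
      thus ?case using \<open>w \<noteq> 1\<close> \<open>w \<noteq> 0\<close> by (auto simp: zetaZ_def field_simps)
    qed
  qed
  ultimately have "((\<lambda>w. zetaZ (1 - w)) \<longlongrightarrow> - 1 * (2 * (- (of_real pi / 2)) * Gamma 1 * zetaZ 1 / of_real (2 * pi) powr 1)) (at 1)"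
    by (rule Lim_transform_eventually)
  moreover have "((\<lambda>w. zetaZ (1 - w)) \<longlongrightarrow> zetaZ (1 - 1)) (at 1)"
    by (intro isCont_tendsto_compose[OF contZ] tendsto_intros)
  ultimately have "zetaZ (1 - 1) = - 1 * (2 * (- (of_real pi / 2)) * Gamma 1 * zetaZ 1 / of_real (2 * pi) powr 1)"
    using tendsto_unique[OF at_neq_bot] by blast
  hence "zetaZ 0 * 2 = 1" by simp
  thus ?thesis by (metis mult_zero_left zero_neq_one)
qed

text \<open>A zero with -1 < Re s \<le> 0 reflects to w = 1 - s with 1 \<le> Re w < 2, where Gamma
  and zeta do not vanish; cos(pi w / 2) vanishes only at odd integers, and w = 1 belongs to s = 0,
  which is treated separately.\<close>

lemma zetaZ_zero_strip:
  assumes "zetaZ s = 0" "Re s > -1"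
  shows "0 < Re s \<and> Re s < 1 \<and> zeta s = 0"
proof -
  have s1: "s \<noteq> 1" using assms by auto
  have z: "zeta s = 0" using assms s1 by (auto simp: zetaZ_def)
  have s0: "s \<noteq> 0" using assms zetaZ_0_nonzero by auto
  have "Re s < 1"
  proof (rule ccontr)
    assume "\<not> Re s < 1"
    hence "Re s > 1 \<or> Re s = 1" by linarith
    thus False
    proof
      assume "Re s = 1"
      hence "s = Complex 1 (Im s)" "Im s \<noteq> 0" using s1 by (auto simp: complex_eq_iff)
      thus False using zeta_nonzero_Re_1 z by metis
    qed (use zeta_nonzero_Re_gt_1 z in auto)
  qed
  moreover have "Re s > 0"
  proof (rule ccontr)
    assume ns: "\<not> Re s > 0"
    define w where "w = 1 - s"
    have w: "1 \<le> Re w" "Re w < 2" "w \<noteq> 1" "w \<noteq> 0" "s = 1 - w"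
      using ns assms s0 s1 by (auto simp: w_def)
    have "2 * cos (of_real pi * w / 2) * Gamma w * zeta w = 0"
      using zeta_functional_equation[of w] w z by simp
    moreover have "Gamma w \<noteq> 0"
      using w by (auto simp: Gamma_eq_zero_iff elim!: nonpos_Ints_cases)
    moreover have "zeta w \<noteq> 0"
    proof (cases "Re w = 1")
      case True
      hence "w = Complex 1 (Im w)" "Im w \<noteq> 0" using w by (auto simp: complex_eq_iff)
      thus ?thesis using zeta_nonzero_Re_1 by metis
    qed (use w zeta_nonzero_Re_gt_1 in auto)
    moreover have "cos (of_real pi * w / 2) \<noteq> 0"
    proof
      assume "cos (of_real pi * w / 2) = 0"
      hence "(cos (pi * Re w / 2))\<^sup>2 + (sinh (pi * Im w / 2))\<^sup>2 = 0"
        using norm_cos_squared_cosh[of "of_real pi * w / 2"] by simp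
      hence c: "cos (pi * Re w / 2) = 0" "sinh (pi * Im w / 2) = 0"
        by (simp_all add: add_nonneg_eq_0_iff)
      have "Im w = 0" using c(2) by simp
      hence "Re w > 1" using w by (auto simp: complex_eq_iff)
      have "cos (pi * Re w / 2) < cos (pi / 2)"
        using w \<open>Re w > 1\<close> by (intro cos_monotone_0_pi) auto
      thus False using c(1) by simp
    qed
    ultimately show False by simp
  qed
  ultimately show ?thesis using z by simp
qed

text \<open>Exact identities replace Stirling's formula. On Re v = 1/2 the reflection formula gives
  |Gamma v|^2 = pi / cosh(pi t), and with w = v + 1 one has |cos(pi w / 2)|^2 = cosh(pi t) / 2, so
  the exponential factors cancel. The factor v in Gamma w = v Gamma v causes the linear
  growth.\<close>

lemma norm_zeta_minus_half:
  obtains C where "C > 0" "\<And>t. norm (zeta (Complex (- 1 / 2) t)) \<le> C * (1 + \<bar>t\<bar>)"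
proof
  define Z where "Z = norm (zeta (of_real (3 / 2)))"
  have Z: "Z > 0" using zeta_nonzero_Re_gt_1[of "of_real (3/2)"] by (simp add: Z_def)
  show "4 * Z > 0" using Z by simp
  fix t :: real
  define w where "w = Complex (3 / 2) (- t)"
  define v where "v = Complex (1 / 2) (- t)"
  have wv: "w = v + 1" "Complex (- 1 / 2) t = 1 - w" by (simp_all add: w_def v_def complex_eq_iff)
  have "v \<notin> \<int>\<^sub>\<le>\<^sub>0" by (auto simp: v_def elim!: nonpos_Ints_cases simp: complex_eq_iff)
  hence Gw: "Gamma w = v * Gamma v" unfolding wv by (rule Gamma_plus1)
  have cnjv: "cnj v = 1 - v" by (simp add: v_def complex_eq_iff)
  have "complex_of_real ((norm (Gamma v))\<^sup>2) = Gamma v * cnj (Gamma v)"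
    by (rule complex_norm_square)
  also have "\<dots> = of_real pi / sin (of_real pi * v)"
    using Gamma_reflection_complex[of v] by (simp add: cnj_Gamma cnjv)
  also have "sin (of_real pi * v) = cos (\<i> * of_real (pi * t))"
  proof -
    have "of_real pi * v = of_real (pi / 2) - \<i> * of_real (pi * t)" by (simp add: v_def complex_eq_iff)
    thus ?thesis by (simp only: sin_diff cos_of_real sin_of_real) simp
  qed
  also have "cos (\<i> * of_real (pi * t)) = of_real (cosh (pi * t))"
  proof -
    have 1: "\<i> * (\<i> * complex_of_real y) = - of_real y" for y by (simp flip: mult.assoc)
    have 2: "complex_of_real (cosh y) = (exp (of_real y) + exp (- of_real y)) / 2" for y
      by (simp add: cosh_def exp_of_real[symmetric])
    show ?thesis unfolding cos_exp_eq 1 2 by (simp add: add.commute)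
  qed
  finally have "complex_of_real ((norm (Gamma v))\<^sup>2) = of_real (pi / cosh (pi * t))" by simp
  hence Gv: "(norm (Gamma v))\<^sup>2 = pi / cosh (pi * t)" by (simp only: of_real_eq_iff)
  have c34: "(cos (pi * (3 / 2) / 2))\<^sup>2 = 1 / 2"
  proof -
    have "pi * (3 / 2) / 2 = pi / 2 + pi / 4" by simp
    hence "cos (pi * (3 / 2) / 2) = - sin (pi / 4)" by (simp only: cos_add) simp
    thus ?thesis by (simp add: sin_45 power_divide)
  qed
  have "(norm (cos (of_real pi * w / 2)))\<^sup>2 = 1 / 2 + (sinh (pi * t / 2))\<^sup>2"
    unfolding norm_cos_squared_cosh using c34 by (simp add: w_def)
  also have "\<dots> = cosh (pi * t) / 2"
  proof -
    have "cosh (pi * t) = cosh (2 * (pi * t / 2))" by simp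
    also have "\<dots> = 2 * (sinh (pi * t / 2))\<^sup>2 + 1"
      unfolding cosh_double using cosh_square_eq[of "pi * t / 2"] by simp
    finally show ?thesis by simp
  qed
  finally have cw: "(norm (cos (of_real pi * w / 2)))\<^sup>2 = cosh (pi * t) / 2" .
  have "(norm (cos (of_real pi * w / 2)) * norm (Gamma v))\<^sup>2 = pi / 2"
    unfolding power_mult_distrib Gv cw using cosh_real_pos[of "pi * t"] by simp
  also have "\<dots> \<le> 2 ^ 2" using pi_less_4 by simp
  finally have cG: "norm (cos (of_real pi * w / 2)) * norm (Gamma v) \<le> 2"
    by (rule power2_le_imp_le) simp
  have fe: "of_real (2 * pi) powr w * zeta (1 - w) = 2 * cos (of_real pi * w / 2) * (v * Gamma v) * zeta w"
    using zeta_functional_equation[of w] by (simp add: Gw) (auto simp: w_def complex_eq_iff)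
  have "1 * norm (zeta (1 - w)) \<le> norm (of_real (2 * pi) powr w :: complex) * norm (zeta (1 - w))"
  proof (intro mult_right_mono)
    have "1 \<le> (2 * pi) powr Re w" using pi_ge_two by (intro ge_one_powr_ge_zero) (auto simp: w_def)
    thus "1 \<le> norm (of_real (2 * pi) powr w :: complex)" by (subst norm_powr_real_powr) auto
  qed simp
  also have "\<dots> = 2 * (norm (cos (of_real pi * w / 2)) * norm (Gamma v)) * norm v * norm (zeta w)"
    using arg_cong[OF fe, of norm] by (simp add: norm_mult mult_ac)
  also have "\<dots> \<le> 2 * 2 * (1 + \<bar>t\<bar>) * Z"
  proof (intro mult_mono cG)
    show "norm v \<le> 1 + \<bar>t\<bar>" using cmod_le[of v] by (simp add: v_def)
    show "norm (zeta w) \<le> Z" unfolding Z_def by (rule norm_zeta_le) (auto simp: w_def)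
  qed (use Z in auto)
  finally show "norm (zeta (Complex (- 1 / 2) t)) \<le> 4 * Z * (1 + \<bar>t\<bar>)"
    unfolding wv(2) by (simp add: mult_ac)
qed

text \<open>Compare the functional equations at w and w + 1 with Re w = 3/2: the Gamma quotient is
  exactly w, and the two cosines have the same modulus because cos^2 takes the same value at 3 pi /
  4 and 5 pi / 4. Only linear growth remains.\<close>

lemma norm_zeta_ratio:
  obtains C where "C > 0" "\<And>t. zeta (Complex (- 1 / 2) t) \<noteq> 0"
    "\<And>t. norm (zeta (Complex (- 3 / 2) t) / zeta (Complex (- 1 / 2) t)) \<le> C * (2 + \<bar>t\<bar>)"
proof -
  define Z where "Z = norm (zeta (of_real (3 / 2)))"
  have Z: "Z > 0" using zeta_nonzero_Re_gt_1[of "of_real (3/2)"] by (simp add: Z_def)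
  have ne: "zeta (Complex (- 1 / 2) t) \<noteq> 0" for t
  proof
    assume "zeta (Complex (- 1 / 2) t) = 0"
    hence "zetaZ (Complex (- 1 / 2) t) = 0" by (simp add: zetaZ_def complex_eq_iff)
    from zetaZ_zero_strip[OF this] show False by simp
  qed
  show ?thesis
  proof (rule that[of "Z * Z"])
    show "Z * Z > 0" using Z by simp
    fix t :: real
    show "zeta (Complex (- 1 / 2) t) \<noteq> 0" by (rule ne)
    define w where "w = Complex (3 / 2) (- t)"
    define v where "v = w + 1"
    have e: "Complex (- 1 / 2) t = 1 - w" "Complex (- 3 / 2) t = 1 - v"
      by (simp_all add: w_def v_def complex_eq_iff)
    have rew: "Re w = 3 / 2" by (simp add: w_def)
    have "w \<notin> \<int>\<^sub>\<le>\<^sub>0" using rew by (auto elim!: nonpos_Ints_cases)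
    hence Gv: "Gamma v = w * Gamma w" and Gw: "Gamma w \<noteq> 0"
      unfolding v_def by (rule Gamma_plus1, simp add: Gamma_eq_zero_iff)
    have few: "of_real (2 * pi) powr w * zeta (1 - w) = 2 * cos (of_real pi * w / 2) * Gamma w * zeta w"
      by (rule zeta_functional_equation) (use rew in auto)
    have fev: "of_real (2 * pi) powr v * zeta (1 - v) = 2 * cos (of_real pi * v / 2) * Gamma v * zeta v"
      by (rule zeta_functional_equation) (use rew in \<open>auto simp: v_def complex_eq_iff\<close>)
    have p: "of_real (2 * pi) powr v = of_real (2 * pi) powr w * complex_of_real (2 * pi)"
      unfolding v_def by (simp add: powr_add)
    have c34: "(cos (pi * (3 / 2) / 2))\<^sup>2 = 1 / 2" "(cos (pi * (3 / 2) / 2 + pi / 2))\<^sup>2 = 1 / 2"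
    proof -
      have "pi * (3 / 2) / 2 = pi / 2 + pi / 4" by simp
      hence "cos (pi * (3 / 2) / 2) = - sin (pi / 4)" "sin (pi * (3 / 2) / 2) = cos (pi / 4)"
        by (simp_all only: cos_add sin_add) simp_all
      moreover have "cos (pi * (3 / 2) / 2 + pi / 2) = - sin (pi * (3 / 2) / 2)"
        by (simp only: cos_add) simp
      moreover have "(sin (pi / 4))\<^sup>2 = 1 / 2" "(cos (pi / 4))\<^sup>2 = 1 / 2"
        by (simp_all add: sin_45 cos_45 power_divide)
      ultimately show "(cos (pi * (3 / 2) / 2))\<^sup>2 = 1 / 2" "(cos (pi * (3 / 2) / 2 + pi / 2))\<^sup>2 = 1 / 2"
        by (simp_all only: power2_minus)
    qed
    have "(norm (cos (of_real pi * w / 2)))\<^sup>2 = (norm (cos (of_real pi * v / 2)))\<^sup>2"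
    proof -
      have "Re (of_real pi * v / 2) = pi * (3 / 2) / 2 + pi / 2"
        using rew by (simp add: v_def field_simps)
      moreover have "Re (of_real pi * w / 2) = pi * (3 / 2) / 2" using rew by simp
      moreover have "Im (of_real pi * v / 2) = Im (of_real pi * w / 2)" by (simp add: v_def)
      ultimately show ?thesis unfolding norm_cos_squared_cosh using c34 by (simp only:)
    qed
    hence nc: "norm (cos (of_real pi * w / 2)) = norm (cos (of_real pi * v / 2))"
      by (simp add: power2_eq_iff_nonneg)
    have nz: "norm (cos (of_real pi * w / 2)) > 0" "norm (Gamma w) > 0" "norm (zeta w) > 0"
      using few ne[of t] Gw zeta_nonzero_Re_gt_1[of w] rew unfolding e by auto
    have "norm (zeta (1 - w)) * norm (of_real (2 * pi) powr w :: complex)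
        = 2 * norm (cos (of_real pi * w / 2)) * norm (Gamma w) * norm (zeta w)"
      using arg_cong[OF few, of norm] by (simp only: norm_mult) (simp add: mult_ac)
    moreover have "norm (zeta (1 - v)) * norm (of_real (2 * pi) powr w :: complex) * (2 * pi)
        = 2 * norm (cos (of_real pi * w / 2)) * norm (Gamma w) * norm w * norm (zeta v)"
      using arg_cong[OF fev, of norm] unfolding p Gv nc by (simp only: norm_mult norm_of_real) (simp add: mult_ac)
    ultimately have "norm (zeta (1 - v)) * norm (of_real (2 * pi) powr w :: complex) * (2 * pi) * norm (zeta w)
        = norm (zeta (1 - w)) * norm (of_real (2 * pi) powr w :: complex) * norm w * norm (zeta v)"
      by (simp add: mult_ac)
    hence eq: "norm (zeta (1 - v)) * (2 * pi) * norm (zeta w) = norm (zeta (1 - w)) * norm w * norm (zeta v)"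
      by simp
    have zw: "1 \<le> norm (zeta w) * Z" unfolding Z_def by (rule norm_zeta_ge) (use rew in auto)
    have zv: "norm (zeta v) \<le> Z" unfolding Z_def by (rule norm_zeta_le) (use rew in \<open>auto simp: v_def\<close>)
    have "norm (zeta (1 - v)) * 1 \<le> norm (zeta (1 - v)) * ((2 * pi) * (norm (zeta w) * Z))"
    proof (intro mult_left_mono)
      have "1 * 1 \<le> (2 * pi) * (norm (zeta w) * Z)" using zw pi_ge_two by (intro mult_mono) auto
      thus "1 \<le> (2 * pi) * (norm (zeta w) * Z)" by simp
    qed simp
    also have "\<dots> = norm (zeta (1 - w)) * norm w * norm (zeta v) * Z"
      using eq by (simp add: mult_ac)
    also have "\<dots> \<le> norm (zeta (1 - w)) * (2 + \<bar>t\<bar>) * Z * Z"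
    proof (intro mult_right_mono mult_mono zv)
      show "norm w \<le> 2 + \<bar>t\<bar>" using cmod_le[of w] by (simp add: w_def)
    qed (use Z in auto)
    finally show "norm (zeta (Complex (- 3 / 2) t) / zeta (Complex (- 1 / 2) t)) \<le> Z * Z * (2 + \<bar>t\<bar>)"
      using ne[of t] unfolding e by (simp add: norm_divide divide_le_eq mult_ac)
  qed
qed

section \<open>Vertical line integrals\<close>

lemma integrable_inverse_1_plus_sq: "integrable lborel (\<lambda>t::real. 1 / (1 + t\<^sup>2))"
proof (rule integrableI_nonneg)
  let ?g = "\<lambda>t::real. 1 / (1 + t\<^sup>2)"
  have pos: "1 + t\<^sup>2 > 0" for t :: real by (simp add: add_pos_nonneg)
  have A: "(\<integral>\<^sup>+t. ennreal (?g t) * indicator {0..} t \<partial>lborel) = ennreal (pi / 2 - arctan 0)"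
  proof (rule nn_integral_FTC_atLeast)
    fix x :: real
    show "DERIV arctan x :> ?g x"
      using DERIV_arctan[of x] by (simp add: inverse_eq_divide)
    show "0 \<le> ?g x" using pos[of x] by simp
  qed (auto simp: tendsto_arctan_at_top)
  have B: "(\<integral>\<^sup>+t. ennreal (?g t) * indicator {..0} t \<partial>lborel) = (\<integral>\<^sup>+t. ennreal (?g t) * indicator {0..} t \<partial>lborel)"
  proof -
    have "(\<integral>\<^sup>+t. ennreal (?g t) * indicator {..0} t \<partial>lborel)
       = ennreal \<bar>-1\<bar> * (\<integral>\<^sup>+t. ennreal (?g (0 + (-1) * t)) * indicator {..0} (0 + (-1) * t) \<partial>lborel)"
      by (rule nn_integral_real_affine) auto
    thus ?thesis by (simp add: indicator_def)
  qed
  have "(\<integral>\<^sup>+t. ennreal (?g t) \<partial>lborel) \<le> (\<integral>\<^sup>+t. ennreal (?g t) * indicator {0..} t + ennreal (?g t) * indicator {..0} t \<partial>lborel)"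
    by (intro nn_integral_mono) (auto simp: indicator_def)
  also have "\<dots> = (\<integral>\<^sup>+t. ennreal (?g t) * indicator {0..} t \<partial>lborel) + (\<integral>\<^sup>+t. ennreal (?g t) * indicator {..0} t \<partial>lborel)"
    by (rule nn_integral_add) auto
  also have "\<dots> < \<infinity>" unfolding B A by (simp add: ennreal_add_less_top)
  finally show "(\<integral>\<^sup>+t. ennreal (?g t) \<partial>lborel) < \<infinity>" .
qed auto

lemma rectpath_integral_bound:
  assumes ab: "a \<le> b" and T: "T > 0"
    and cont: "continuous_on (path_image (rectpath (Complex a (- T)) (Complex b T))) f"
    and M: "\<And>s. a \<le> Re s \<Longrightarrow> Re s \<le> b \<Longrightarrow> \<bar>Im s\<bar> = T \<Longrightarrow> norm (f s) \<le> M" "M \<ge> 0"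
  shows "norm (contour_integral (rectpath (Complex a (- T)) (Complex b T)) f
     - \<i> * (integral {-T..T} (\<lambda>t. f (Complex b t)) - integral {-T..T} (\<lambda>t. f (Complex a t)))) \<le> 2 * M * (b - a)"
proof -
  define a1 a2 a3 a4 where "a1 = Complex a (- T)" and "a2 = Complex b (- T)"
    and "a3 = Complex b T" and "a4 = Complex a T"
  have rp: "rectpath a1 a3 = linepath a1 a2 +++ linepath a2 a3 +++ linepath a3 a4 +++ linepath a4 a1"
    by (simp add: rectpath_def Let_def a1_def a2_def a3_def a4_def)
  have im: "path_image (rectpath a1 a3) = closed_segment a1 a2 \<union> closed_segment a2 a3 \<union> closed_segment a3 a4 \<union> closed_segment a4 a1"
    unfolding rp by (simp add: path_image_join Un_assoc)
  have c: "continuous_on (closed_segment a1 a2) f" "continuous_on (closed_segment a2 a3) f"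
    "continuous_on (closed_segment a3 a4) f" "continuous_on (closed_segment a4 a1) f"
    by (rule continuous_on_subset[OF cont], use im in \<open>auto simp: a1_def a3_def\<close>)+
  have ci: "f contour_integrable_on linepath a1 a2" "f contour_integrable_on linepath a2 a3"
    "f contour_integrable_on linepath a3 a4" "f contour_integrable_on linepath a4 a1"
    using c by (simp_all add: contour_integrable_continuous_linepath)
  have eq: "contour_integral (rectpath a1 a3) f = contour_integral (linepath a1 a2) f
     + (contour_integral (linepath a2 a3) f + (contour_integral (linepath a3 a4) f + contour_integral (linepath a4 a1) f))"
    unfolding rp using ci by (simp add: contour_integrable_joinI)
  have v1: "contour_integral (linepath a2 a3) f = \<i> * integral {-T..T} (\<lambda>t. f (Complex b t))"
    by (rule contour_integral_linepath_same_Re) (use T in \<open>auto simp: a2_def a3_def\<close>)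
  have "contour_integral (linepath a4 a1) f = - contour_integral (linepath a1 a4) f"
    using contour_integral_reverse_linepath[of a4 a1 f] c(4) by simp
  also have "contour_integral (linepath a1 a4) f = \<i> * integral {-T..T} (\<lambda>t. f (Complex a t))"
    by (rule contour_integral_linepath_same_Re) (use T in \<open>auto simp: a1_def a4_def\<close>)
  finally have v2: "contour_integral (linepath a4 a1) f = - (\<i> * integral {-T..T} (\<lambda>t. f (Complex a t)))" .
  have h1: "norm (contour_integral (linepath a1 a2) f) \<le> M * norm (a2 - a1)"
  proof (rule contour_integral_bound_linepath[OF ci(1) M(2)])
    fix x assume "x \<in> closed_segment a1 a2"
    hence "Im x = - T \<and> Re x \<in> closed_segment a b"
      by (subst (asm) closed_segment_same_Im) (auto simp: a1_def a2_def)
    thus "norm (f x) \<le> M" using ab T by (intro M) (auto simp: closed_segment_eq_real_ivl split: if_splits)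
  qed
  have h2: "norm (contour_integral (linepath a3 a4) f) \<le> M * norm (a4 - a3)"
  proof (rule contour_integral_bound_linepath[OF ci(3) M(2)])
    fix x assume "x \<in> closed_segment a3 a4"
    hence "Im x = T \<and> Re x \<in> closed_segment b a"
      by (subst (asm) closed_segment_same_Im) (auto simp: a3_def a4_def)
    thus "norm (f x) \<le> M" using ab T by (intro M) (auto simp: closed_segment_eq_real_ivl split: if_splits)
  qed
  have n: "norm (a2 - a1) = b - a" "norm (a4 - a3) = b - a"
    using ab by (simp_all add: a1_def a2_def a3_def a4_def cmod_def)
  have "contour_integral (rectpath a1 a3) f
     - \<i> * (integral {-T..T} (\<lambda>t. f (Complex b t)) - integral {-T..T} (\<lambda>t. f (Complex a t)))
     = contour_integral (linepath a1 a2) f + contour_integral (linepath a3 a4) f"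
    unfolding eq v1 v2 by (simp add: algebra_simps)
  also have "norm \<dots> \<le> M * (b - a) + M * (b - a)"
    using h1 h2 n by (intro order_trans[OF norm_triangle_ineq add_mono]) auto
  finally show ?thesis by (simp add: a1_def a3_def)
qed

lemma integral_truncate_tendsto:
  fixes g :: "real \<Rightarrow> complex"
  assumes "integrable lborel g"
  shows "(\<lambda>n. integral {- real n..real n} g) \<longlonglongrightarrow> (\<integral>t. g t \<partial>lborel)"
proof -
  have "(\<lambda>n. \<integral>t. indicator {- real n..real n} t *\<^sub>R g t \<partial>lborel) \<longlonglongrightarrow> (\<integral>t. g t \<partial>lborel)"
  proof (rule integral_dominated_convergence[where w = "\<lambda>t. norm (g t)"])
    show "AE t in lborel. (\<lambda>n. indicator {- real n..real n} t *\<^sub>R g t) \<longlonglongrightarrow> g t"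
    proof (rule AE_I2, rule tendsto_eventually)
      fix t :: real
      have "\<forall>\<^sub>F n in sequentially. real n \<ge> \<bar>t\<bar>"
        using filterlim_real_sequentially by (simp add: filterlim_at_top)
      thus "\<forall>\<^sub>F n in sequentially. indicator {- real n..real n} t *\<^sub>R g t = g t"
        by eventually_elim (auto simp: indicator_def)
    qed
  qed (use assms in \<open>auto simp: indicator_def intro!: borel_measurable_scaleR\<close>)
  moreover have "(\<integral>t. indicator {- real n..real n} t *\<^sub>R g t \<partial>lborel) = integral {- real n..real n} g" for n
  proof -
    have "set_integrable lborel {- real n..real n} g"
      unfolding set_integrable_def using assms by (intro integrable_mult_indicator) auto
    from set_borel_integral_eq_integral(2)[OF this] show ?thesis
      by (simp add: set_lebesgue_integral_def)
  qed
  ultimately show ?thesis by simp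
qed

lemma path_image_rectpath_Re_Im:
  assumes "a \<le> b" "T > 0" "s \<in> path_image (rectpath (Complex a (- T)) (Complex b T))"
  shows "(Re s \<in> {a, b} \<and> \<bar>Im s\<bar> \<le> T) \<or> (\<bar>Im s\<bar> = T \<and> a \<le> Re s \<and> Re s \<le> b)"
  using assms by (subst (asm) path_image_rectpath) auto

text \<open>The factor \<open>exp (\<eta> * s\<^sup>2)\<close> kills the horizontal sides, so no choice of good heights is needed.\<close>

lemma vertical_line_shift:
  assumes U: "open U" "{s. a \<le> Re s \<and> Re s \<le> b} \<subseteq> U" and ab: "a \<le> b"
    and h: "h holomorphic_on U"
    and growth: "\<And>s. a \<le> Re s \<Longrightarrow> Re s \<le> b \<Longrightarrow> norm (h s) \<le> K * exp (K * \<bar>Im s\<bar>)"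
    and int: "integrable lborel (\<lambda>t. h (Complex a t))" "integrable lborel (\<lambda>t. h (Complex b t))"
  shows "(\<integral>t. h (Complex a t) \<partial>lborel) = (\<integral>t. h (Complex b t) \<partial>lborel)"
proof -
  define m where "m = a\<^sup>2 + b\<^sup>2"
  have sq: "x\<^sup>2 \<le> m" if "a \<le> x" "x \<le> b" for x
  proof (cases "x \<ge> 0")
    case True
    hence "x\<^sup>2 \<le> b\<^sup>2" using that by (intro power_mono) auto
    thus ?thesis by (simp add: m_def add_increasing)
  next
    case False
    hence "(- x)\<^sup>2 \<le> (- a)\<^sup>2" using that by (intro power_mono) auto
    thus ?thesis by (simp add: m_def add_increasing2)
  qed
  have K0: "K \<ge> 0"
  proof -
    have "0 \<le> norm (h (Complex a 0))" by simp
    also have "\<dots> \<le> K * exp (K * 0)" using growth[of "Complex a 0"] ab by simp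
    finally show ?thesis by simp
  qed
  define e where "e = (\<lambda>\<eta>::real. \<lambda>s. exp (of_real \<eta> * s\<^sup>2) :: complex)"
  have ne: "norm (e \<eta> s) = exp (\<eta> * ((Re s)\<^sup>2 - (Im s)\<^sup>2))" for \<eta> s
    by (simp add: e_def Re_power2)
  have ne_le: "norm (e \<eta> s) \<le> exp m" if "a \<le> Re s" "Re s \<le> b" "0 \<le> \<eta>" "\<eta> \<le> 1" for \<eta> s
  proof -
    have "\<eta> * ((Re s)\<^sup>2 - (Im s)\<^sup>2) \<le> \<eta> * m"
      using sq[of "Re s"] that by (intro mult_left_mono) (auto intro: order_trans[of _ "(Re s)\<^sup>2"])
    also have "\<dots> \<le> 1 * m" using that by (intro mult_right_mono) (auto simp: m_def)
    finally show ?thesis by (simp add: ne)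
  qed
  have meas: "(\<lambda>t. e \<eta> (Complex x t)) \<in> borel_measurable borel" for \<eta> x
    unfolding e_def Complex_eq by (intro borel_measurable_continuous_onI continuous_intros)
  have int_e: "integrable lborel (\<lambda>t. h (Complex x t) * e \<eta> (Complex x t))"
    if "x = a \<or> x = b" "0 \<le> \<eta>" "\<eta> \<le> 1" for x \<eta>
  proof (rule Bochner_Integration.integrable_bound)
    have ix: "integrable lborel (\<lambda>t. h (Complex x t))" using that int by auto
    show "integrable lborel (\<lambda>t. exp m * norm (h (Complex x t)))"
      using ix by (intro integrable_mult_right integrable_norm)
    show "(\<lambda>t. h (Complex x t) * e \<eta> (Complex x t)) \<in> borel_measurable lborel"
      using ix meas by (intro borel_measurable_times) auto
    show "AE t in lborel. norm (h (Complex x t) * e \<eta> (Complex x t)) \<le> norm (exp m * norm (h (Complex x t)))"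
    proof (rule AE_I2)
      fix t
      have "norm (e \<eta> (Complex x t)) \<le> exp m" using that ab by (intro ne_le) auto
      hence "norm (h (Complex x t)) * norm (e \<eta> (Complex x t)) \<le> norm (h (Complex x t)) * exp m"
        by (intro mult_left_mono) auto
      thus "norm (h (Complex x t) * e \<eta> (Complex x t)) \<le> norm (exp m * norm (h (Complex x t)))"
        by (simp add: norm_mult mult.commute)
    qed
  qed
  have eq: "(\<integral>t. h (Complex a t) * e \<eta> (Complex a t) \<partial>lborel) = (\<integral>t. h (Complex b t) * e \<eta> (Complex b t) \<partial>lborel)"
    if \<eta>: "0 < \<eta>" "\<eta> \<le> 1" for \<eta>
  proof -
    let ?f = "\<lambda>s. h s * e \<eta> s"
    define D where "D = (\<lambda>n. integral {- real n..real n} (\<lambda>t. ?f (Complex b t)) - integral {- real n..real n} (\<lambda>t. ?f (Complex a t)))"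
    have bound: "norm (D n) \<le> 2 * (K * exp (K * real n) * exp (\<eta> * (m - (real n)\<^sup>2))) * (b - a)" if n: "n > 0" for n
    proof -
      let ?R = "rectpath (Complex a (- real n)) (Complex b (real n))"
      let ?M = "K * exp (K * real n) * exp (\<eta> * (m - (real n)\<^sup>2))"
      have sub: "path_image ?R \<subseteq> {s. a \<le> Re s \<and> Re s \<le> b}"
        using path_image_rectpath_Re_Im[of a b "real n"] ab n by force
      have conv: "convex {s. a \<le> Re s \<and> Re s \<le> b}"
      proof -
        have "{s. a \<le> Re s \<and> Re s \<le> b} = {s. Re s \<ge> a} \<inter> {s. Re s \<le> b}" by auto
        thus ?thesis by (simp add: convex_Int convex_halfspace_Re_ge convex_halfspace_Re_le)
      qed
      have hol: "?f holomorphic_on {s. a \<le> Re s \<and> Re s \<le> b}"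
        unfolding e_def by (intro holomorphic_intros holomorphic_on_subset[OF h U(2)])
      have z: "contour_integral ?R ?f = 0"
        using Cauchy_theorem_convex_simple[OF hol conv _ sub] by (simp add: contour_integral_unique)
      have "norm (contour_integral ?R ?f - \<i> * D n) \<le> 2 * ?M * (b - a)"
        unfolding D_def
      proof (rule rectpath_integral_bound[OF ab])
        show "continuous_on (path_image ?R) ?f"
          by (rule continuous_on_subset[OF holomorphic_on_imp_continuous_on[OF hol] sub])
        fix s assume s: "a \<le> Re s" "Re s \<le> b" "\<bar>Im s\<bar> = real n"
        have "(Im s)\<^sup>2 = (real n)\<^sup>2" using s(3) by (metis power2_abs)
        hence "norm (e \<eta> s) \<le> exp (\<eta> * (m - (real n)\<^sup>2))"
          unfolding ne using sq[OF s(1,2)] \<eta> by simp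
        thus "norm (h s * e \<eta> s) \<le> ?M"
          unfolding norm_mult using growth[OF s(1,2)] s(3) K0 by (intro mult_mono) auto
      qed (use n K0 in auto)
      thus ?thesis by (simp add: z norm_mult)
    qed
    \<comment> \<open>For fixed positive \<eta> the factor exp (- \<eta> n^2) on the horizontal
      sides beats the growth exp (K n) of h.\<close>
    have "(\<lambda>n. 2 * (K * exp (K * real n) * exp (\<eta> * (m - (real n)\<^sup>2))) * (b - a)) \<longlonglongrightarrow> 0"
    proof -
      have "(\<lambda>n. exp (K * real n + \<eta> * (m - (real n)\<^sup>2))) \<longlonglongrightarrow> 0"
        using \<eta> by real_asymp
      hence "(\<lambda>n. 2 * K * (b - a) * exp (K * real n + \<eta> * (m - (real n)\<^sup>2))) \<longlonglongrightarrow> 2 * K * (b - a) * 0"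
        by (intro tendsto_intros)
      moreover have "2 * (K * exp (K * real n) * exp (\<eta> * (m - (real n)\<^sup>2))) * (b - a)
          = 2 * K * (b - a) * exp (K * real n + \<eta> * (m - (real n)\<^sup>2))" for n
        unfolding exp_add by (simp only: mult_ac)
      ultimately show ?thesis by (simp only: mult_zero_right)
    qed
    hence "D \<longlonglongrightarrow> 0"
      by (rule Lim_null_comparison[rotated]) (use bound in \<open>auto intro!: eventually_mono[OF eventually_gt_at_top[of 0]]\<close>)
    moreover have "D \<longlonglongrightarrow> (\<integral>t. ?f (Complex b t) \<partial>lborel) - (\<integral>t. ?f (Complex a t) \<partial>lborel)"
      unfolding D_def by (intro tendsto_diff integral_truncate_tendsto int_e) (use \<eta> in auto)
    ultimately have "(\<integral>t. ?f (Complex b t) \<partial>lborel) - (\<integral>t. ?f (Complex a t) \<partial>lborel) = 0"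
      by (rule LIMSEQ_unique[symmetric])
    thus ?thesis by simp
  qed
  \<comment> \<open>Letting \<eta> = 1 / (n + 1) tend to 0 removes the auxiliary factor; on both
    lines it is dominated by exp m because \<eta> \<le> 1 and Re s is bounded.\<close>
  have lim: "(\<lambda>n. \<integral>t. h (Complex x t) * e (1 / real (Suc n)) (Complex x t) \<partial>lborel) \<longlonglongrightarrow> (\<integral>t. h (Complex x t) \<partial>lborel)"
    if x: "x = a \<or> x = b" for x
  proof (rule integral_dominated_convergence[where w = "\<lambda>t. exp m * norm (h (Complex x t))"])
    have ix: "integrable lborel (\<lambda>t. h (Complex x t))" using x int by auto
    show "(\<lambda>t. h (Complex x t)) \<in> borel_measurable lborel" using ix by auto
    show "(\<lambda>t. h (Complex x t) * e (1 / real (Suc n)) (Complex x t)) \<in> borel_measurable lborel" for n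
      using ix meas by (intro borel_measurable_times) auto
    show "integrable lborel (\<lambda>t. exp m * norm (h (Complex x t)))"
      using ix by (intro integrable_mult_right integrable_norm)
    show "AE t in lborel. norm (h (Complex x t) * e (1 / real (Suc n)) (Complex x t)) \<le> exp m * norm (h (Complex x t))" for n
    proof (rule AE_I2)
      fix t
      have "norm (e (1 / real (Suc n)) (Complex x t)) \<le> exp m" using x ab by (intro ne_le) auto
      hence "norm (h (Complex x t)) * norm (e (1 / real (Suc n)) (Complex x t)) \<le> norm (h (Complex x t)) * exp m"
        by (intro mult_left_mono) auto
      thus "norm (h (Complex x t) * e (1 / real (Suc n)) (Complex x t)) \<le> exp m * norm (h (Complex x t))"
        by (simp add: norm_mult mult.commute)
    qed
    show "AE t in lborel. (\<lambda>n. h (Complex x t) * e (1 / real (Suc n)) (Complex x t)) \<longlonglongrightarrow> h (Complex x t)"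
    proof (rule AE_I2)
      fix t
      have "(\<lambda>n. 1 / real (Suc n)) \<longlonglongrightarrow> 0" by real_asymp
      hence "(\<lambda>n. h (Complex x t) * e (1 / real (Suc n)) (Complex x t)) \<longlonglongrightarrow> h (Complex x t) * exp (of_real 0 * (Complex x t)\<^sup>2)"
        unfolding e_def by (intro tendsto_intros)
      thus "(\<lambda>n. h (Complex x t) * e (1 / real (Suc n)) (Complex x t)) \<longlonglongrightarrow> h (Complex x t)" by simp
    qed
  qed
  have "(\<lambda>n. \<integral>t. h (Complex a t) * e (1 / real (Suc n)) (Complex a t) \<partial>lborel) \<longlonglongrightarrow> (\<integral>t. h (Complex b t) \<partial>lborel)"
    using lim[of b] by (subst eq) auto
  with lim[of a] show ?thesis by (intro LIMSEQ_unique) auto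
qed

section \<open>The Perron kernel and its integral\<close>

definition perron_kernel :: "real \<Rightarrow> complex \<Rightarrow> complex" where
  "perron_kernel d w = of_real d / (w * (w + of_real d))"

text \<open>The kernel is 1 / w - 1 / (w + d). The difference decays quadratically along vertical
  lines that avoid both poles, so all line integrals converge absolutely and no principal values
  occur.\<close>

lemma norm_perron_kernel:
  assumes "c \<noteq> 0" "c + d \<noteq> 0" "d > 0"
  obtains C where "C > 0" "\<And>t. norm (perron_kernel d (Complex c t)) \<le> C / (1 + t\<^sup>2)"
proof
  define m where "m = min (min (c\<^sup>2) ((c + d)\<^sup>2)) 1"
  have m: "m > 0" "m \<le> 1" "m \<le> c\<^sup>2" "m \<le> (c + d)\<^sup>2" using assms by (auto simp: m_def)
  show "d / m > 0" using m assms by simp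
  fix t :: real
  have le: "m * (1 + t\<^sup>2) \<le> x\<^sup>2 + t\<^sup>2" if "m \<le> x\<^sup>2" for x
    using that m mult_right_mono[of m 1 "t\<^sup>2"] by (simp add: distrib_left)
  have n: "norm (Complex x t) \<ge> sqrt (m * (1 + t\<^sup>2))" if "m \<le> x\<^sup>2" for x
    unfolding complex_norm using le[OF that] by simp
  have pos: "m * (1 + t\<^sup>2) > 0" using m by (simp add: add_pos_nonneg)
  have "m * (1 + t\<^sup>2) = sqrt (m * (1 + t\<^sup>2)) * sqrt (m * (1 + t\<^sup>2))" using pos by simp
  also have "\<dots> \<le> norm (Complex c t) * norm (Complex (c + d) t)"
    using n[OF m(3)] n[OF m(4)] pos by (intro mult_mono) auto
  finally have *: "m * (1 + t\<^sup>2) \<le> norm (Complex c t) * norm (Complex (c + d) t)" .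
  have "norm (perron_kernel d (Complex c t)) = d / (norm (Complex c t) * norm (Complex (c + d) t))"
  proof -
    have "Complex c t + of_real d = Complex (c + d) t" by (simp add: complex_eq_iff)
    thus ?thesis using assms(3) by (simp add: perron_kernel_def norm_divide norm_mult)
  qed
  also have "\<dots> \<le> d / (m * (1 + t\<^sup>2))"
    using * pos assms(3) by (intro divide_left_mono) auto
  finally show "norm (perron_kernel d (Complex c t)) \<le> d / m / (1 + t\<^sup>2)" by simp
qed

lemma perron_integrand:
  assumes "c \<noteq> 0" "c + d \<noteq> 0" "d > 0" "x > 0"
  shows "integrable lborel (\<lambda>t. of_real x powr (Complex c t) * perron_kernel d (Complex c t))"
proof -
  obtain C where C: "C > 0" "\<And>t. norm (perron_kernel d (Complex c t)) \<le> C / (1 + t\<^sup>2)"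
    using norm_perron_kernel[OF assms(1-3)] by blast
  show ?thesis
  proof (rule Bochner_Integration.integrable_bound)
    show "integrable lborel (\<lambda>t. x powr c * C * (1 / (1 + t\<^sup>2)))"
      by (intro integrable_mult_right integrable_inverse_1_plus_sq)
    have nz: "complex_of_real c + \<i> * of_real t \<noteq> 0" "complex_of_real c + \<i> * of_real t + of_real d \<noteq> 0" for t
      using assms by (auto simp: complex_eq_iff)
    have "continuous_on UNIV (\<lambda>t. of_real x powr (Complex c t) * perron_kernel d (Complex c t))"
      unfolding perron_kernel_def Complex_eq using assms
      by (intro continuous_intros) (use nz assms in \<open>auto simp: complex_nonneg_Reals_iff\<close>)
    thus "(\<lambda>t. of_real x powr (Complex c t) * perron_kernel d (Complex c t)) \<in> borel_measurable lborel"
      by (simp add: borel_measurable_continuous_onI)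
    show "AE t in lborel. norm (of_real x powr (Complex c t) * perron_kernel d (Complex c t)) \<le> norm (x powr c * C * (1 / (1 + t\<^sup>2)))"
    proof (rule AE_I2)
      fix t :: real
      have "norm (of_real x powr (Complex c t) * perron_kernel d (Complex c t)) = x powr c * norm (perron_kernel d (Complex c t))"
        using assms by (simp add: norm_mult norm_powr_real_powr)
      also have "\<dots> \<le> x powr c * (C / (1 + t\<^sup>2))" using C by (intro mult_left_mono) auto
      also have "\<dots> \<le> norm (x powr c * C * (1 / (1 + t\<^sup>2)))" using C(1) by (simp add: abs_mult)
      finally show "norm (of_real x powr (Complex c t) * perron_kernel d (Complex c t)) \<le> norm (x powr c * C * (1 / (1 + t\<^sup>2)))" .
    qed
  qed
qed

text \<open>For x \<ge> 1 the line is moved to the left across the poles 0 and -d, with residues 1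
  and - x^(-d); for x < 1 it is moved to the right, where there is no pole. Width and height of the
  rectangles grow together, and on the far side |x^w| \<le> 1 in both cases.\<close>

lemma perron_formula:
  assumes c: "c > 0" and d: "d > 0" and x: "x > 0"
  shows "(\<integral>t. of_real x powr (Complex c t) * perron_kernel d (Complex c t) \<partial>lborel)
      = (if x \<ge> 1 then of_real (2 * pi * (1 - x powr (- d))) else 0)"
proof -
  define f where "f = (\<lambda>w. of_real x powr w * perron_kernel d w)"
  have int: "integrable lborel (\<lambda>t. f (Complex c t))"
    unfolding f_def using c d x by (intro perron_integrand) auto
  have lim: "(\<lambda>n. integral {- real n..real n} (\<lambda>t. f (Complex c t))) \<longlonglongrightarrow> (\<integral>t. f (Complex c t) \<partial>lborel)"
    by (rule integral_truncate_tendsto[OF int])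
  have hol: "f holomorphic_on - {0, - of_real d}"
    unfolding f_def perron_kernel_def using d
    by (intro holomorphic_intros) (auto simp: add_eq_0_iff2)
  have nf: "norm (f w) = x powr Re w * (d / (norm w * norm (w + of_real d)))" for w
    using x d by (simp add: f_def perron_kernel_def norm_mult norm_divide norm_powr_real_powr)
  show ?thesis
  proof (cases "x \<ge> 1")
    case True
    define I where "I = complex_of_real (2 * pi * (1 - x powr (- d)))"
    have bound: "norm (I - integral {- real n..real n} (\<lambda>t. f (Complex c t)))
        \<le> 2 * (x powr c * d / (real n)\<^sup>2) * (c + real n) + 2 * d / (real n - d)" if n: "real n > d" for n
    proof -
      define T where "T = real n"
      have T: "T > d" "T > 0" using n d by (auto simp: T_def)
      let ?R = "rectpath (Complex (- T) (- T)) (Complex c T)"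
      have pim: "(Re s \<in> {- T, c} \<and> \<bar>Im s\<bar> \<le> T) \<or> (\<bar>Im s\<bar> = T \<and> - T \<le> Re s \<and> Re s \<le> c)" if "s \<in> path_image ?R" for s
        using path_image_rectpath_Re_Im[OF _ _ that] T c by auto
      have sub: "path_image ?R \<subseteq> - {0, - of_real d}"
      proof
        fix s assume "s \<in> path_image ?R"
        from pim[OF this] show "s \<in> - {0, - of_real d}" using T c d by auto
      qed
      have res0: "residue f 0 = 1"
      proof -
        have "residue (\<lambda>w. (of_real x powr w * of_real d / (w + of_real d)) / (w - 0)) 0
           = of_real x powr 0 * of_real d / (0 + of_real d)"
          by (rule residue_simple[of "- {- of_real d}"])
             (use d in \<open>auto intro!: holomorphic_intros simp: add_eq_0_iff2\<close>)
        thus ?thesis using d x by (simp add: f_def perron_kernel_def mult_ac)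
      qed
      have res1: "residue f (- of_real d) = - of_real (x powr (- d))"
      proof -
        have "residue (\<lambda>w. (of_real x powr w * of_real d / w) / (w - (- of_real d))) (- of_real d)
           = of_real x powr (- of_real d) * of_real d / (- of_real d)"
          by (rule residue_simple[of "- {0}"])
             (use d in \<open>auto intro!: holomorphic_intros\<close>)
        moreover have "of_real x powr (- of_real d) = complex_of_real (x powr (- d))"
          using x powr_of_real[of x "- d"] by simp
        ultimately show ?thesis using d by (simp add: f_def perron_kernel_def mult_ac)
      qed
      have "contour_integral ?R f = of_real (2 * pi) * \<i> * (\<Sum>p\<in>{0, - of_real d}. winding_number ?R p * residue f p)"
      proof (rule Residue_theorem[of UNIV])
        show "f holomorphic_on UNIV - {0, - of_real d}" using hol by (simp add: Compl_eq_Diff_UNIV)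
      qed (use sub in auto)
      also have "(\<Sum>p\<in>{0, - of_real d}. winding_number ?R p * residue f p) = 1 - of_real (x powr (- d))"
      proof -
        have "winding_number ?R 0 = 1" "winding_number ?R (- of_real d) = 1"
          by (rule winding_number_rectpath; use T c d in \<open>simp add: in_box_complex_iff\<close>)+
        thus ?thesis using d by (simp add: res0 res1)
      qed
      finally have ci: "contour_integral ?R f = \<i> * I" by (simp add: I_def mult_ac)
      have 1: "norm (contour_integral ?R f - \<i> * (integral {-T..T} (\<lambda>t. f (Complex c t)) - integral {-T..T} (\<lambda>t. f (Complex (- T) t))))
          \<le> 2 * (x powr c * d / T\<^sup>2) * (c - (- T))"
      proof (rule rectpath_integral_bound)
        show "continuous_on (path_image ?R) f"
          by (rule continuous_on_subset[OF holomorphic_on_imp_continuous_on[OF hol] sub])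
        fix s assume s: "- T \<le> Re s" "Re s \<le> c" "\<bar>Im s\<bar> = T"
        have Ts: "T \<le> norm s" "T \<le> norm (s + of_real d)"
          using abs_Im_le_cmod[of s] abs_Im_le_cmod[of "s + of_real d"] s by auto
        hence "T * T \<le> norm s * norm (s + of_real d)" using T by (intro mult_mono) auto
        hence "d / (norm s * norm (s + of_real d)) \<le> d / (T * T)"
          using T d Ts by (intro divide_left_mono mult_pos_pos) linarith+
        moreover have "x powr Re s \<le> x powr c" using True s by (intro powr_mono) auto
        ultimately have "x powr Re s * (d / (norm s * norm (s + of_real d))) \<le> x powr c * (d / (T * T))"
          using d by (intro mult_mono) auto
        thus "norm (f s) \<le> x powr c * d / T\<^sup>2" by (simp add: nf power2_eq_square)
      qed (use T c d x in auto)
      have 2: "norm (integral {-T..T} (\<lambda>t. f (Complex (- T) t))) \<le> (d / (T * (T - d))) * (T - (- T))"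
      proof (rule integral_bound)
        have "Complex (- T) t \<noteq> 0" "Complex (- T) t \<noteq> - of_real d" for t
          using T d by (auto simp: complex_eq_iff)
        thus "continuous_on {- T..T} (\<lambda>t. f (Complex (- T) t))"
          by (intro continuous_on_compose2[OF holomorphic_on_imp_continuous_on[OF hol]])
             (auto simp: Complex_eq intro!: continuous_intros)
        fix t assume "t \<in> {- T..T}"
        have Ts: "T \<le> norm (Complex (- T) t)" "T - d \<le> norm (Complex (- T) t + of_real d)"
          using abs_Re_le_cmod[of "Complex (- T) t"] abs_Re_le_cmod[of "Complex (- T) t + of_real d"] T by auto
        hence "T * (T - d) \<le> norm (Complex (- T) t) * norm (Complex (- T) t + of_real d)"
          using T by (intro mult_mono) auto
        moreover have "0 < T * (T - d)" using T by simp
        ultimately have "d / (norm (Complex (- T) t) * norm (Complex (- T) t + of_real d)) \<le> d / (T * (T - d))"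
          using T d Ts by (intro divide_left_mono mult_pos_pos) linarith+
        moreover have "x powr (- T) \<le> 1" using True T ge_one_powr_ge_zero[of x T] by (simp add: powr_minus inverse_le_1_iff)
        ultimately have "x powr (- T) * (d / (norm (Complex (- T) t) * norm (Complex (- T) t + of_real d))) \<le> 1 * (d / (T * (T - d)))"
          using T d by (intro mult_mono) auto
        thus "norm (f (Complex (- T) t)) \<le> d / (T * (T - d))" by (simp add: nf)
      qed (use T in auto)
      have "norm (I - integral {-T..T} (\<lambda>t. f (Complex c t))) = norm (\<i> * (I - integral {-T..T} (\<lambda>t. f (Complex c t))))"
        by (simp add: norm_mult)
      also have "\<i> * (I - integral {-T..T} (\<lambda>t. f (Complex c t))) =
         (contour_integral ?R f - \<i> * (integral {-T..T} (\<lambda>t. f (Complex c t)) - integral {-T..T} (\<lambda>t. f (Complex (- T) t))))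
          - \<i> * integral {-T..T} (\<lambda>t. f (Complex (- T) t))"
        unfolding ci by (simp add: algebra_simps)
      also have "norm \<dots> \<le> 2 * (x powr c * d / T\<^sup>2) * (c - (- T)) + (d / (T * (T - d))) * (T - (- T))"
        using 1 2 by (intro order_trans[OF norm_triangle_ineq4 add_mono]) (simp_all add: norm_mult)
      also have "(d / (T * (T - d))) * (T - (- T)) = 2 * d / (T - d)"
        using T by (simp add: field_simps)
      finally show ?thesis by (simp add: T_def)
    qed
    have "(\<lambda>n. 2 * (x powr c * d / (real n)\<^sup>2) * (c + real n) + 2 * d / (real n - d)) \<longlonglongrightarrow> 0"
      by real_asymp
    hence "(\<lambda>n. I - integral {- real n..real n} (\<lambda>t. f (Complex c t))) \<longlonglongrightarrow> 0"
    proof (rule Lim_null_comparison[rotated])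
      have "\<forall>\<^sub>F n in sequentially. real n > d"
        using filterlim_real_sequentially by (simp add: filterlim_at_top_dense)
      thus "\<forall>\<^sub>F n in sequentially. norm (I - integral {- real n..real n} (\<lambda>t. f (Complex c t)))
         \<le> 2 * (x powr c * d / (real n)\<^sup>2) * (c + real n) + 2 * d / (real n - d)"
        by eventually_elim (rule bound)
    qed
    from tendsto_diff[OF tendsto_const[of I] this]
    have "(\<lambda>n. integral {- real n..real n} (\<lambda>t. f (Complex c t))) \<longlonglongrightarrow> I" by simp
    with lim have "(\<integral>t. f (Complex c t) \<partial>lborel) = I" by (rule LIMSEQ_unique)
    thus ?thesis using True by (simp add: f_def I_def)
  next
    case False
    have bound: "norm (integral {- real n..real n} (\<lambda>t. f (Complex c t)))
        \<le> 2 * (d / (real n)\<^sup>2) * (real n) + 2 * d / real n" if n: "real n > c" for n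
    proof -
      define T where "T = real n"
      have T: "T > c" "T > 0" using n c by (auto simp: T_def)
      let ?R = "rectpath (Complex c (- T)) (Complex T T)"
      have xle: "x powr y \<le> 1" if "y \<ge> 0" for y
        using False x that by (intro powr_le1) auto
      have sub: "path_image ?R \<subseteq> {s. Re s \<ge> c}"
        using path_image_rectpath_Re_Im[of c T T] T by force
      have hol': "f holomorphic_on {s. Re s \<ge> c}"
        by (rule holomorphic_on_subset[OF hol]) (use c d in auto)
      have ci: "contour_integral ?R f = 0"
        using Cauchy_theorem_convex_simple[OF hol' _ _ sub]
        by (simp add: contour_integral_unique convex_halfspace_Re_ge)
      have 1: "norm (contour_integral ?R f - \<i> * (integral {-T..T} (\<lambda>t. f (Complex T t)) - integral {-T..T} (\<lambda>t. f (Complex c t))))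
          \<le> 2 * (d / T\<^sup>2) * (T - c)"
      proof (rule rectpath_integral_bound)
        show "continuous_on (path_image ?R) f"
          by (rule continuous_on_subset[OF holomorphic_on_imp_continuous_on[OF hol'] sub])
        fix s assume s: "c \<le> Re s" "Re s \<le> T" "\<bar>Im s\<bar> = T"
        have Ts: "T \<le> norm s" "T \<le> norm (s + of_real d)"
          using abs_Im_le_cmod[of s] abs_Im_le_cmod[of "s + of_real d"] s by auto
        hence "T * T \<le> norm s * norm (s + of_real d)" using T by (intro mult_mono) auto
        hence "d / (norm s * norm (s + of_real d)) \<le> d / (T * T)"
          using T d Ts by (intro divide_left_mono mult_pos_pos) linarith+
        moreover have "x powr Re s \<le> 1" using xle s c by auto
        ultimately have "x powr Re s * (d / (norm s * norm (s + of_real d))) \<le> 1 * (d / (T * T))"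
          using d by (intro mult_mono) auto
        thus "norm (f s) \<le> d / T\<^sup>2" by (simp add: nf power2_eq_square)
      qed (use T c d x in auto)
      have 2: "norm (integral {-T..T} (\<lambda>t. f (Complex T t))) \<le> (d / (T * T)) * (T - (- T))"
      proof (rule integral_bound)
        show "continuous_on {- T..T} (\<lambda>t. f (Complex T t))"
          by (intro continuous_on_compose2[OF holomorphic_on_imp_continuous_on[OF hol']])
             (use T in \<open>auto simp: Complex_eq intro!: continuous_intros\<close>)
        fix t assume "t \<in> {- T..T}"
        have Ts: "T \<le> norm (Complex T t)" "T \<le> norm (Complex T t + of_real d)"
          using abs_Re_le_cmod[of "Complex T t"] abs_Re_le_cmod[of "Complex T t + of_real d"] T d by auto
        hence "T * T \<le> norm (Complex T t) * norm (Complex T t + of_real d)"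
          using T by (intro mult_mono) auto
        moreover have "0 < T * T" using T by simp
        ultimately have "d / (norm (Complex T t) * norm (Complex T t + of_real d)) \<le> d / (T * T)"
          using T d Ts by (intro divide_left_mono mult_pos_pos) linarith+
        hence "x powr T * (d / (norm (Complex T t) * norm (Complex T t + of_real d))) \<le> 1 * (d / (T * T))"
          using T d xle[of T] by (intro mult_mono) auto
        thus "norm (f (Complex T t)) \<le> d / (T * T)" by (simp add: nf)
      qed (use T in auto)
      have "norm (integral {-T..T} (\<lambda>t. f (Complex c t))) = norm (\<i> * integral {-T..T} (\<lambda>t. f (Complex c t)))"
        by (simp add: norm_mult)
      also have "\<i> * integral {-T..T} (\<lambda>t. f (Complex c t)) =
         (contour_integral ?R f - \<i> * (integral {-T..T} (\<lambda>t. f (Complex T t)) - integral {-T..T} (\<lambda>t. f (Complex c t))))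
          + \<i> * integral {-T..T} (\<lambda>t. f (Complex T t))"
        unfolding ci by (simp add: algebra_simps)
      also have "norm \<dots> \<le> 2 * (d / T\<^sup>2) * (T - c) + (d / (T * T)) * (T - (- T))"
        using 1 2 by (intro order_trans[OF norm_triangle_ineq add_mono]) (simp_all add: norm_mult)
      also have "(d / (T * T)) * (T - (- T)) = 2 * d / T"
        using T by (simp add: field_simps)
      also have "2 * (d / T\<^sup>2) * (T - c) \<le> 2 * (d / T\<^sup>2) * T"
        using c d by (intro mult_left_mono) auto
      finally show ?thesis by (simp add: T_def)
    qed
    have "(\<lambda>n. 2 * (d / (real n)\<^sup>2) * (real n) + 2 * d / real n) \<longlonglongrightarrow> 0"
      by real_asymp
    hence "(\<lambda>n. integral {- real n..real n} (\<lambda>t. f (Complex c t))) \<longlonglongrightarrow> 0"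
    proof (rule Lim_null_comparison[rotated])
      have "\<forall>\<^sub>F n in sequentially. real n > c"
        using filterlim_real_sequentially by (simp add: filterlim_at_top_dense)
      thus "\<forall>\<^sub>F n in sequentially. norm (integral {- real n..real n} (\<lambda>t. f (Complex c t)))
         \<le> 2 * (d / (real n)\<^sup>2) * (real n) + 2 * d / real n"
        by eventually_elim (rule bound)
    qed
    with lim have "(\<integral>t. f (Complex c t) \<partial>lborel) = 0" by (rule LIMSEQ_unique)
    thus ?thesis using False by (simp add: f_def)
  qed
qed

section \<open>Quotients of holomorphic functions\<close>

text \<open>At a simple zero of \<open>g\<close> where \<open>f\<close> vanishes too, l'Hopital's rule gives the value that removes the singularity.\<close>

definition holo_quot :: "(complex \<Rightarrow> complex) \<Rightarrow> (complex \<Rightarrow> complex) \<Rightarrow> complex \<Rightarrow> complex" where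
  "holo_quot f g z = (if g z = 0 then deriv f z / deriv g z else f z / g z)"

text \<open>Near a zero p of g both functions are divided by z - p. The two quotients extend
  holomorphically, that of g has no zero near p, and their ratio is
  \<open>holo_quot f g\<close>.\<close>

lemma holo_quot_holomorphic:
  assumes U: "open U" and f: "f holomorphic_on U" and g: "g holomorphic_on U"
    and z: "\<And>z. z \<in> U \<Longrightarrow> g z = 0 \<Longrightarrow> f z = 0 \<and> deriv g z \<noteq> 0"
  shows "holo_quot f g holomorphic_on U"
proof -
  have "holo_quot f g field_differentiable (at p)" if p: "p \<in> U" for p
  proof (cases "g p = 0")
    case False
    have "open (U \<inter> g -` (- {0}))"
      using continuous_open_preimage[OF holomorphic_on_imp_continuous_on[OF g] U, of "- {0}"] by auto
    moreover have "(\<lambda>z. f z / g z) holomorphic_on (U \<inter> g -` (- {0}))"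
      by (intro holomorphic_intros holomorphic_on_subset[OF f] holomorphic_on_subset[OF g]) auto
    hence "holo_quot f g holomorphic_on (U \<inter> g -` (- {0}))"
      by (rule holomorphic_transform) (auto simp: holo_quot_def)
    ultimately show ?thesis using p False by (auto intro: holomorphic_on_imp_differentiable_at)
  next
    case True
    define F where "F = (\<lambda>z. if z = p then deriv f p else (f z - f p) / (z - p))"
    define G where "G = (\<lambda>z. if z = p then deriv g p else (g z - g p) / (z - p))"
    have ip: "p \<in> interior U" using p U by (simp add: interior_open)
    have FG: "F holomorphic_on U" "G holomorphic_on U"
      unfolding F_def G_def by (rule pole_lemma[OF f ip], rule pole_lemma[OF g ip])
    have Gp: "G p \<noteq> 0" using z[OF p True] by (simp add: G_def)
    define V where "V = U \<inter> G -` (- {0})"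
    have V: "open V" "p \<in> V"
      using continuous_open_preimage[OF holomorphic_on_imp_continuous_on[OF FG(2)] U, of "- {0}"] p Gp
      by (auto simp: V_def)
    have "(\<lambda>z. F z / G z) holomorphic_on V"
      by (intro holomorphic_intros holomorphic_on_subset[OF FG(1)] holomorphic_on_subset[OF FG(2)]) (auto simp: V_def)
    hence "holo_quot f g holomorphic_on V"
    proof (rule holomorphic_transform)
      fix x assume x: "x \<in> V"
      show "F x / G x = holo_quot f g x"
      proof (cases "x = p")
        case True
        thus ?thesis using \<open>g p = 0\<close> by (simp add: F_def G_def holo_quot_def)
      next
        case False
        hence "g x \<noteq> 0" using x True by (auto simp: V_def G_def)
        thus ?thesis using False True z[OF p True] by (simp add: F_def G_def holo_quot_def)
      qed
    qed
    thus ?thesis using V by (auto intro: holomorphic_on_imp_differentiable_at)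
  qed
  thus ?thesis using U by (auto simp: holomorphic_on_def intro: field_differentiable_at_within)
qed

lemma holo_quot_mult:
  assumes "\<And>z. z \<in> U \<Longrightarrow> g z = 0 \<Longrightarrow> f z = 0 \<and> deriv g z \<noteq> 0" "z \<in> U"
  shows "f z = g z * holo_quot f g z"
  using assms by (auto simp: holo_quot_def)

text \<open>Harnack's inequality for the positive harmonic function - log |g / M|: a holomorphic
  logarithm has values in a half-plane, and the Schwarz lemma limits how far it can move away from
  its value at the centre.\<close>

lemma zero_free_lower_bound:
  assumes g: "g holomorphic_on ball 0 1" and nz: "\<And>z. z \<in> ball 0 1 \<Longrightarrow> g z \<noteq> 0"
    and M: "\<And>z. z \<in> ball 0 1 \<Longrightarrow> norm (g z) < M" and r: "r < 1" "norm z \<le> r"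
  shows "M * exp (- ((1 + r) / (1 - r) * ln (M / norm (g 0)))) \<le> norm (g z)"
proof -
  have r0: "r \<ge> 0" using r norm_ge_zero[of z] by linarith
  have zb: "z \<in> ball 0 1" using r by simp
  have M0: "M > 0" using M[of 0] by (auto intro: le_less_trans[OF norm_ge_zero])
  obtain f where f: "f holomorphic_on ball 0 1" "\<And>z. z \<in> ball 0 1 \<Longrightarrow> g z / of_real M = exp (f z)"
  proof (rule holomorphic_logarithm_exists[of "ball 0 1" "\<lambda>z. g z / of_real M" 0])
    show "(\<lambda>z. g z / of_real M) holomorphic_on ball 0 1"
      using M0 by (intro holomorphic_intros g) auto
  qed (use nz M0 that in auto)
  define h where "h = (\<lambda>z. - f z)"
  have ng: "norm (g z) = M * exp (- Re (h z))" if "z \<in> ball 0 1" for z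
  proof -
    have "norm (g z / of_real M) = exp (Re (f z))" unfolding f(2)[OF that] by simp
    thus ?thesis using M0 by (simp add: norm_divide h_def field_simps)
  qed
  have Reh: "Re (h z) > 0" if "z \<in> ball 0 1" for z
  proof -
    have "exp (- Re (h z)) < 1" using ng[OF that] M[OF that] M0 by simp
    thus ?thesis by simp
  qed
  define L where "L = Re (h 0)"
  have L: "L > 0" unfolding L_def by (rule Reh) simp
  have Leq: "ln (M / norm (g 0)) = L"
  proof -
    have e: "norm (g 0) = M * exp (- L)" using ng[of 0] by (simp add: L_def)
    have "M / norm (g 0) = exp L" unfolding e using M0 by (simp add: exp_minus inverse_eq_divide)
    thus ?thesis by simp
  qed
  have den: "h z + cnj (h 0) \<noteq> 0" if "z \<in> ball 0 1" for z
  proof -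
    have "Re (h z + cnj (h 0)) > 0" using Reh[OF that] L by (simp add: L_def)
    thus ?thesis by (metis less_irrefl zero_complex.sel(1))
  qed
  \<comment> \<open>The Cayley transform that takes the right half-plane to the unit disc and
    \<open>h 0\<close> to 0.\<close>
  define u where "u = (\<lambda>z. (h z - h 0) / (h z + cnj (h 0)))"
  have "norm (u z) \<le> norm z"
  proof (rule Schwarz_Lemma(1))
    show "u holomorphic_on ball 0 1"
      unfolding u_def using den by (intro holomorphic_intros) (auto simp: h_def intro!: holomorphic_intros f)
    show "u 0 = 0" by (simp add: u_def)
    show "norm z < 1" using zb by simp
    fix w :: complex assume "norm w < 1"
    hence w: "w \<in> ball 0 1" by simp
    have "(norm (h w - h 0))\<^sup>2 < (norm (h w + cnj (h 0)))\<^sup>2"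
      using Reh[OF w] L unfolding cmod_power2 L_def by (simp add: power2_eq_square algebra_simps)
    hence "norm (h w - h 0) < norm (h w + cnj (h 0))" by (simp add: power2_less_imp_less)
    thus "norm (u w) < 1" using den[OF w] by (simp add: u_def norm_divide divide_less_eq)
  qed
  hence ur: "norm (u z) \<le> r" using r by simp
  have "h z = of_real (2 * L) / (1 - u z) - cnj (h 0)"
  proof -
    have d: "h z + cnj (h 0) \<noteq> 0" by (rule den[OF zb])
    have "1 - u z = (h 0 + cnj (h 0)) / (h z + cnj (h 0))"
      using d by (simp add: u_def field_simps)
    also have "h 0 + cnj (h 0) = of_real (2 * L)" by (simp add: L_def complex_add_cnj)
    finally have "of_real (2 * L) / (1 - u z) = h z + cnj (h 0)" using L d by simp
    thus ?thesis by simp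
  qed
  hence "Re (h z) = Re (of_real (2 * L) / (1 - u z)) - L" by (simp add: L_def)
  also have "Re (of_real (2 * L) / (1 - u z)) \<le> norm (of_real (2 * L) / (1 - u z))" by (rule complex_Re_le_cmod)
  also have "\<dots> = 2 * L / norm (1 - u z)" using L by (simp add: norm_divide)
  also have "\<dots> \<le> 2 * L / (1 - r)"
    using one_minus_norm_le(1)[of "u z"] ur r L by (intro divide_left_mono mult_pos_pos) auto
  also have "2 * L / (1 - r) - L = (1 + r) / (1 - r) * L" using r by (simp add: field_simps)
  finally have "exp (- ((1 + r) / (1 - r) * L)) \<le> exp (- Re (h z))" by simp
  thus ?thesis unfolding Leq ng[OF zb] using M0 by simp
qed

lemma norm_blaschke_on_circle:
  assumes "norm z = 1" shows "norm (z - a) = norm (1 - cnj a * z)"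
proof -
  have "norm (z - a) = norm (cnj z * (z - a))" using assms by (simp add: norm_mult)
  also have "cnj z * (z - a) = cnj (1 - cnj a * z)"
  proof -
    have "cnj z * z = 1" using assms by (simp add: complex_norm_square[symmetric] mult.commute)
    thus ?thesis by (simp add: algebra_simps)
  qed
  finally show ?thesis by (simp only: complex_mod_cnj)
qed

text \<open>Dividing numerator and denominator by the Blaschke product of the zeros of the denominator
  preserves both bounds and only increases the denominator at the centre.\<close>

lemma quotient_bound_unit_disc:
  assumes U: "open U" "cball 0 1 \<subseteq> U" and q: "q holomorphic_on U" and h: "h holomorphic_on U"
    and M: "\<And>z. z \<in> cball 0 1 \<Longrightarrow> norm (q z) < M" and M': "\<And>z. z \<in> cball 0 1 \<Longrightarrow> norm (q z * h z) \<le> M'"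
    and q0: "q 0 \<noteq> 0" and fin: "finite {z \<in> ball 0 1. q z = 0}"
    and simple: "\<And>z. z \<in> ball 0 1 \<Longrightarrow> q z = 0 \<Longrightarrow> deriv q z \<noteq> 0"
    and r: "r < 1" "norm z \<le> r"
  shows "norm (h z) \<le> M' / M * exp ((1 + r) / (1 - r) * ln (M / norm (q 0)))"
proof -
  define A where "A = {z \<in> ball 0 1. q z = 0}"
  have A: "finite A" "\<And>a. a \<in> A \<Longrightarrow> norm a < 1" using fin by (auto simp: A_def)
  define P where "P = (\<lambda>z. \<Prod>a\<in>A. (z - a))"
  define C where "C = (\<lambda>z. \<Prod>a\<in>A. (1 - cnj a * z))"
  define Q where "Q = holo_quot q P"
  have P0: "P z = 0 \<longleftrightarrow> z \<in> A" for z using A(1) by (auto simp: P_def prod_zero_iff)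
  have Phol: "P holomorphic_on U" unfolding P_def by (intro holomorphic_intros)
  have dP: "deriv P a \<noteq> 0" if a: "a \<in> A" for a
  proof -
    have P: "P = (\<lambda>z. (z - a) * (\<Prod>b\<in>A - {a}. (z - b)))"
      unfolding P_def using A(1) a by (auto simp: prod.remove fun_eq_iff)
    have d: "((\<lambda>z. \<Prod>b\<in>A - {a}. (z - b)) has_field_derivative deriv (\<lambda>z. \<Prod>b\<in>A - {a}. (z - b)) a) (at a)"
      by (rule holomorphic_derivI[of _ UNIV]) (auto intro!: holomorphic_intros)
    have "(P has_field_derivative (1 * (\<Prod>b\<in>A - {a}. (a - b)) + deriv (\<lambda>z. \<Prod>b\<in>A - {a}. (z - b)) a * (a - a))) (at a)"
      unfolding P by (rule DERIV_mult[OF _ d]) (auto intro!: derivative_eq_intros)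
    hence "deriv P a = (\<Prod>b\<in>A - {a}. (a - b))" by (simp add: DERIV_imp_deriv)
    thus ?thesis using A(1) by (simp add: prod_zero_iff)
  qed
  have cond: "q z = 0 \<and> deriv P z \<noteq> 0" if "P z = 0" for z
    using that dP by (auto simp: P0 A_def)
  have Qhol: "Q holomorphic_on U" unfolding Q_def
    by (rule holo_quot_holomorphic[OF U(1) q Phol cond])
  have qPQ: "q z = P z * Q z" for z unfolding Q_def
    by (rule holo_quot_mult[of UNIV]) (use cond in auto)
  have Qnz: "Q z \<noteq> 0" if "z \<in> ball 0 1" for z
  proof (cases "z \<in> A")
    case True
    hence "Q z = deriv q z / deriv P z" by (simp add: Q_def holo_quot_def P0)
    thus ?thesis using simple[OF that] dP[OF True] True by (simp add: A_def)
  next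
    case False
    hence "q z \<noteq> 0" using that by (simp add: A_def)
    thus ?thesis using qPQ[of z] by auto
  qed
  have Cnz: "C z \<noteq> 0" if "norm z \<le> 1" for z
  proof -
    have "1 - cnj a * z \<noteq> 0" if "a \<in> A" for a
    proof -
      have "norm (cnj a * z) < 1" using A(2)[OF that] \<open>norm z \<le> 1\<close>
        by (simp add: norm_mult) (metis le_less_trans mult_left_le norm_ge_zero)
      thus ?thesis by auto
    qed
    thus ?thesis using A(1) by (simp add: C_def prod_zero_iff)
  qed
  have circ: "norm (P z) = norm (C z)" if "norm z = 1" for z
    unfolding P_def C_def prod_norm[symmetric]
    by (intro prod.cong refl norm_blaschke_on_circle that)
  \<comment> \<open>C / P is the reciprocal of the Blaschke product of the zeros, so g = q C / P has
    no zeros in the disc and the same modulus as q on the unit circle.\<close>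
  define g where "g = (\<lambda>z. C z * Q z)"
  have Chol: "C holomorphic_on X" for X unfolding C_def by (intro holomorphic_intros)
  have ghol: "g holomorphic_on U" unfolding g_def by (intro holomorphic_intros Chol Qhol)
  have ngq: "norm (g z) = norm (q z)" if "norm z = 1" for z
    using circ[OF that] by (simp add: g_def qPQ norm_mult)
  have maxmod: "norm (k z) \<le> B" if k: "k holomorphic_on U" and b: "\<And>z. norm z = 1 \<Longrightarrow> norm (k z) \<le> B"
    and z: "z \<in> cball 0 1" for k z B
  proof (rule maximum_modulus_frontier[of k "cball 0 1"])
    show "k holomorphic_on interior (cball 0 1)"
      by (rule holomorphic_on_subset[OF k]) (use U(2) in auto)
    show "continuous_on (closure (cball 0 1)) k"
      by (rule continuous_on_subset[OF holomorphic_on_imp_continuous_on[OF k]]) (use U(2) in auto)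
  qed (use b z in auto)
  \<comment> \<open>The maximum is attained on the closed disc, so the strict bound by M survives
    the passage through the maximum principle.\<close>
  have "\<exists>M1<M. \<forall>z\<in>cball 0 1. norm (q z) \<le> M1"
  proof -
    have "continuous_on (cball 0 1) (\<lambda>z. norm (q z))"
      by (intro continuous_intros continuous_on_subset[OF holomorphic_on_imp_continuous_on[OF q] U(2)])
    then obtain y where "y \<in> cball 0 1" "\<forall>z\<in>cball 0 1. norm (q z) \<le> norm (q y)"
      using continuous_attains_sup[of "cball 0 1" "\<lambda>z. norm (q z)"] by auto
    thus ?thesis using M by blast
  qed
  then obtain M1 where M1: "M1 < M" "\<And>z. z \<in> cball 0 1 \<Longrightarrow> norm (q z) \<le> M1" by blast
  have gM: "norm (g z) < M" if "z \<in> ball 0 1" for z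
  proof -
    have "norm (g z) \<le> M1"
      by (rule maxmod[OF ghol]) (use ngq M1 that in auto)
    thus ?thesis using M1 by simp
  qed
  have g0: "norm (q 0) \<le> norm (g 0)"
  proof -
    have "norm (P 0) \<le> 1" unfolding P_def prod_norm[symmetric]
      using A(2) by (intro prod_le_1) (auto intro: less_imp_le)
    thus ?thesis by (simp add: g_def qPQ norm_mult C_def mult_left_le_one_le)
  qed
  have M0: "M > 0" using M[of 0] by (auto intro: le_less_trans[OF norm_ge_zero])
  have k0: "(1 + r) / (1 - r) \<ge> 0" using r norm_ge_zero[of z] by (simp del: norm_ge_zero)
  have zb: "z \<in> ball 0 1" using r by simp
  have lb: "M * exp (- ((1 + r) / (1 - r) * ln (M / norm (q 0)))) \<le> norm (g z)"
  proof -
    have "ln (M / norm (g 0)) \<le> ln (M / norm (q 0))"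
      using g0 q0 M0 by (intro ln_mono divide_left_mono) (auto intro!: divide_pos_pos mult_pos_pos intro: less_le_trans)
    hence "M * exp (- ((1 + r) / (1 - r) * ln (M / norm (q 0)))) \<le> M * exp (- ((1 + r) / (1 - r) * ln (M / norm (g 0))))"
      using mult_left_mono[OF _ k0] M0 by (intro mult_left_mono) (simp_all only: exp_le_cancel_iff neg_le_iff_le less_imp_le)
    also have "\<dots> \<le> norm (g z)"
    proof (rule zero_free_lower_bound[OF _ _ gM r])
      show "g holomorphic_on ball 0 1" by (rule holomorphic_on_subset[OF ghol]) (use U(2) in auto)
      show "g z \<noteq> 0" if "z \<in> ball 0 1" for z using Qnz[OF that] Cnz[of z] that by (simp add: g_def)
    qed
    finally show ?thesis .
  qed
  \<comment> \<open>On the unit circle g h and q h have the same modulus, so the maximum principle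
    carries the bound M' inside, where g is bounded below.\<close>
  have "norm (g z * h z) \<le> M'"
  proof (rule maxmod[of "\<lambda>z. g z * h z" M' z])
    show "(\<lambda>z. g z * h z) holomorphic_on U" by (intro holomorphic_intros ghol h)
    fix w :: complex assume "norm w = 1"
    thus "norm (g w * h w) \<le> M'" using ngq[of w] M'[of w] by (simp add: norm_mult)
  qed (use zb in auto)
  hence "M * exp (- ((1 + r) / (1 - r) * ln (M / norm (q 0)))) * norm (h z) \<le> M'"
    using mult_right_mono[OF lb, of "norm (h z)"] by (simp add: norm_mult)
  thus ?thesis using M0 by (simp add: exp_minus field_simps)
qed

lemma quotient_bound_disc:
  assumes R: "R > 0" and U: "open U" "cball c R \<subseteq> U" and q: "q holomorphic_on U" and h: "h holomorphic_on U"
    and M: "\<And>z. z \<in> cball c R \<Longrightarrow> norm (q z) < M" and M': "\<And>z. z \<in> cball c R \<Longrightarrow> norm (q z * h z) \<le> M'"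
    and q0: "q c \<noteq> 0" and fin: "finite {z \<in> ball c R. q z = 0}"
    and simple: "\<And>z. z \<in> ball c R \<Longrightarrow> q z = 0 \<Longrightarrow> deriv q z \<noteq> 0"
    and r: "r < 1" "dist c z \<le> r * R"
  shows "norm (h z) \<le> M' / M * exp ((1 + r) / (1 - r) * ln (M / norm (q c)))"
proof -
  define T where "T = (\<lambda>w. c + of_real R * w)"
  define V where "V = T -` U"
  have Tb: "T w \<in> cball c R \<longleftrightarrow> w \<in> cball 0 1" "T w \<in> ball c R \<longleftrightarrow> w \<in> ball 0 1" for w
    using R by (auto simp: T_def dist_norm norm_mult)
  have "open V" unfolding V_def using U(1)
    by (rule open_vimage) (auto simp: T_def intro!: continuous_intros)
  have hol: "(\<lambda>w. k (T w)) holomorphic_on V" if "k holomorphic_on U" for k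
  proof -
    have "T holomorphic_on V" unfolding T_def by (intro holomorphic_intros)
    thus ?thesis using holomorphic_on_compose_gen[OF _ that, of T V] by (auto simp: V_def o_def)
  qed
  define w where "w = (z - c) / of_real R"
  have Tw: "T w = z" using R by (simp add: T_def w_def)
  have "norm (h (T w)) \<le> M' / M * exp ((1 + r) / (1 - r) * ln (M / norm (q (T 0))))"
  proof (rule quotient_bound_unit_disc[OF \<open>open V\<close> _ hol[OF q] hol[OF h]])
    show "cball 0 1 \<subseteq> V" using U(2) Tb(1) unfolding V_def by blast
    have inj: "inj T" using R by (auto simp: inj_def T_def)
    have "T ` {w \<in> ball 0 1. q (T w) = 0} \<subseteq> {z \<in> ball c R. q z = 0}" using Tb by auto
    hence "finite (T ` {w \<in> ball 0 1. q (T w) = 0})" using fin by (rule finite_subset)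
    thus "finite {w \<in> ball 0 1. q (T w) = 0}" using inj by (auto intro: finite_imageD inj_on_subset)
    show "norm w \<le> r" using r R by (simp add: w_def norm_divide dist_norm norm_minus_commute divide_le_eq)
    fix w assume w: "w \<in> ball 0 1" "q (T w) = 0"
    have "(q has_field_derivative deriv q (T w)) (at (T w))"
      by (rule holomorphic_derivI[OF q U(1)]) (use w Tb U(2) in auto)
    moreover have "(T has_field_derivative of_real R) (at w)"
      unfolding T_def by (auto intro!: derivative_eq_intros)
    ultimately have "((\<lambda>w. q (T w)) has_field_derivative deriv q (T w) * of_real R) (at w)"
      by (rule DERIV_chain2)
    hence "deriv (\<lambda>w. q (T w)) w = deriv q (T w) * of_real R" by (rule DERIV_imp_deriv)
    thus "deriv (\<lambda>w. q (T w)) w \<noteq> 0" using simple[of "T w"] w Tb R by simp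
  qed (use M M' Tb q0 r in \<open>auto simp: T_def\<close>)
  thus ?thesis by (simp add: Tw) (simp add: T_def)
qed

section \<open>Poles and residues\<close>

text \<open>Connects the order of the zero, in which simplicity is phrased, with the derivative,
  which appears in the residues.\<close>

lemma deriv_nonzero_of_zorder_1:
  assumes f: "f holomorphic_on S" "open S" "connected S" "z \<in> S" and nc: "\<exists>w\<in>S. f w \<noteq> 0"
    and z: "zorder f z = 1"
  shows "deriv f z \<noteq> 0"
proof -
  define g where "g = zor_poly f z"
  obtain r where r: "r > 0" "cball z r \<subseteq> S" "g holomorphic_on cball z r"
     "\<And>w. w \<in> cball z r \<Longrightarrow> f w = g w * (w - z) \<and> g w \<noteq> 0"
    using zorder_exist_zero[OF f(1,2,3,4) nc] z unfolding g_def by auto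
  have "g holomorphic_on ball z r" by (rule holomorphic_on_subset[OF r(3)]) auto
  hence "(g has_field_derivative deriv g z) (at z)"
    by (rule holomorphic_derivI) (use r in auto)
  hence "((\<lambda>w. g w * (w - z)) has_field_derivative (deriv g z * (z - z) + 1 * g z)) (at z)"
    by (rule DERIV_mult) (auto intro!: derivative_eq_intros)
  hence "((\<lambda>w. g w * (w - z)) has_field_derivative g z) (at z)" by simp
  hence "(f has_field_derivative g z) (at z)"
  proof (rule has_field_derivative_transform_within_open)
    fix w assume "w \<in> ball z r"
    hence "w \<in> cball z r" by simp
    from r(4)[OF this] show "g w * (w - z) = f w" by simp
  qed (use r(1) in auto)
  hence "deriv f z = g z" by (rule DERIV_imp_deriv)
  thus ?thesis using r by auto
qed

text \<open>Since \<open>zetaZ (s + 1) = s * zeta (s + 1)\<close>, the quotient \<open>zetaZ s / qden s\<close> is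
  \<open>zeta s / (zeta (s + 1) * s * (s + 1) * (s + 2))\<close> with the removable singularity at \<open>0\<close> filled in.\<close>

definition qden :: "complex \<Rightarrow> complex" where
  "qden s = zetaZ (s + 1) * ((s - 1) * (s + 1) * (s + 2))"

text \<open>The restriction leaves out the zero of \<open>qden\<close> at -2 and everything to its
  left. What remains is 1, -1 and the points \<rho> - 1.\<close>

definition qpoles :: "complex set" where
  "qpoles = {s. Re s > - 2 \<and> qden s = 0}"

text \<open>The residue of \<open>zetaZ s / qden s\<close> at a simple zero p of the
  denominator.\<close>

definition qres :: "complex \<Rightarrow> complex" where
  "qres p = zetaZ p / deriv qden p"

lemma qden_holomorphic: "qden holomorphic_on A"
  unfolding qden_def [abs_def] by (intro holomorphic_intros)

lemma deriv_qden:
  "deriv qden s = deriv zetaZ (s + 1) * ((s - 1) * (s + 1) * (s + 2))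
     + zetaZ (s + 1) * ((s + 1) * (s + 2) + (s - 1) * (s + 2) + (s - 1) * (s + 1))"
proof -
  have "((\<lambda>s. zetaZ (s + 1)) has_field_derivative deriv zetaZ (s + 1)) (at s)"
    by (rule iffD1[OF DERIV_shift]) (rule holomorphic_derivI[OF zetaZ_holomorphic[of UNIV]], auto)
  moreover have "((\<lambda>s. (s - 1) * (s + 1) * (s + 2)) has_field_derivative
     ((s + 1) * (s + 2) + (s - 1) * (s + 2) + (s - 1) * (s + 1))) (at s)"
    by (auto intro!: derivative_eq_intros simp: algebra_simps)
  ultimately have "((\<lambda>s. zetaZ (s + 1) * ((s - 1) * (s + 1) * (s + 2))) has_field_derivative
     deriv zetaZ (s + 1) * ((s - 1) * (s + 1) * (s + 2)) + ((s + 1) * (s + 2) + (s - 1) * (s + 2) + (s - 1) * (s + 1)) * zetaZ (s + 1)) (at s)"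
    by (rule DERIV_mult)
  thus ?thesis unfolding qden_def [abs_def] by (subst DERIV_imp_deriv) (auto simp: mult.commute)
qed

lemma zetaZ_2: "zetaZ 2 = zeta 2" by (simp add: zetaZ_def)

lemma zeta_2_nonzero: "zeta 2 \<noteq> 0" by (rule zeta_nonzero_Re_gt_1) simp

lemma one_in_qpoles: "1 \<in> qpoles" by (simp add: qpoles_def qden_def)

lemma qres_1: "qres 1 = 1 / (6 * zeta 2)"
  by (simp add: qres_def deriv_qden zetaZ_2)

lemma qpoles_cases:
  assumes "p \<in> qpoles"
  obtains "p = 1" | "p = - 1" | "p + 1 \<in> nontrivial_zeros"
proof -
  from assms have p: "Re p > - 2" "zetaZ (p + 1) = 0 \<or> p = 1 \<or> p = - 1 \<or> p = - 2"
    by (auto simp: qpoles_def qden_def add_eq_0_iff2)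
  have "p \<noteq> - 2" using p(1) by auto
  moreover have "p + 1 \<in> nontrivial_zeros" if "zetaZ (p + 1) = 0"
    using zetaZ_zero_strip[OF that] p by (auto simp: nontrivial_zeros_def)
  ultimately show ?thesis using p(2) that by blast
qed

lemma deriv_zetaZ_zero:
  assumes "\<rho> \<in> nontrivial_zeros"
  shows "deriv zetaZ \<rho> = (\<rho> - 1) * deriv zeta \<rho>"
proof -
  have r: "\<rho> \<noteq> 1" "zeta \<rho> = 0" using assms by (auto simp: nontrivial_zeros_def)
  have "(zeta has_field_derivative deriv zeta \<rho>) (at \<rho>)"
    by (rule holomorphic_derivI[OF zeta_holomorphic]) (use r in auto)
  hence "((\<lambda>s. (s - 1) * zeta s) has_field_derivative 1 * zeta \<rho> + deriv zeta \<rho> * (\<rho> - 1)) (at \<rho>)"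
    by (intro DERIV_mult) (auto intro!: derivative_eq_intros)
  hence "((\<lambda>s. (s - 1) * zeta s) has_field_derivative deriv zeta \<rho> * (\<rho> - 1)) (at \<rho>)"
    using r by simp
  hence "(zetaZ has_field_derivative deriv zeta \<rho> * (\<rho> - 1)) (at \<rho>)"
    by (rule has_field_derivative_transform_within_open[where S = "- {1}"]) (use r in \<open>auto simp: zetaZ_def\<close>)
  thus ?thesis by (subst DERIV_imp_deriv) (auto simp: mult.commute)
qed

lemma deriv_zeta_zero_nonzero:
  assumes "riemann_hypothesis" "simple_zeros_on_critical_line" "\<rho> \<in> nontrivial_zeros"
  shows "deriv zeta \<rho> \<noteq> 0"
proof (rule deriv_nonzero_of_zorder_1[OF zeta_holomorphic])
  show "open (- {1 :: complex})" "\<rho> \<in> - {1}" using assms by (auto simp: nontrivial_zeros_def)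
  show "connected (- {1 :: complex})" by (rule connected_punctured_universe) simp
  show "\<exists>w\<in>- {1}. zeta w \<noteq> 0" using zeta_2_nonzero by (intro bexI[of _ 2]) auto
  show "zorder zeta \<rho> = 1"
    using assms by (auto simp: riemann_hypothesis_def simple_zeros_on_critical_line_def nontrivial_zeros_def)
qed

lemma nontrivial_zeros_RH:
  assumes "riemann_hypothesis" "\<rho> \<in> nontrivial_zeros"
  shows "Re \<rho> = 1 / 2" "zeta \<rho> = 0" "\<rho> = Complex (1 / 2) (Im \<rho>)"
  using assms by (auto simp: riemann_hypothesis_def nontrivial_zeros_def complex_eq_iff)

lemma deriv_qden_zero:
  assumes "\<rho> \<in> nontrivial_zeros"
  shows "deriv qden (\<rho> - 1) = (\<rho> - 1) * deriv zeta \<rho> * ((\<rho> - 2) * \<rho> * (\<rho> + 1))"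
proof -
  have "zetaZ \<rho> = 0" using assms by (auto simp: nontrivial_zeros_def zetaZ_def)
  thus ?thesis by (simp add: deriv_qden deriv_zetaZ_zero[OF assms])
qed

text \<open>All poles are simple: at 1 and -1 because zeta(2) and \<open>zetaZ 0\<close> are
  nonzero, at \<rho> - 1 because \<rho> is a simple zero and, having real part 1/2, is not a zero of
  the polynomial factor.\<close>

lemma deriv_qden_nonzero:
  assumes "riemann_hypothesis" "simple_zeros_on_critical_line" "p \<in> qpoles"
  shows "deriv qden p \<noteq> 0"
  using assms(3)
proof (cases rule: qpoles_cases)
  case 1
  thus ?thesis using zeta_2_nonzero by (simp add: deriv_qden zetaZ_2)
next
  case 2
  thus ?thesis using zetaZ_0_nonzero by (simp add: deriv_qden)
next
  case 3
  note r = nontrivial_zeros_RH[OF assms(1) 3]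
  have "p + 1 \<noteq> 1" "p + 1 \<noteq> 2" "p + 1 \<noteq> 0" "p + 1 \<noteq> - 1"
    using r(1) by (auto simp: complex_eq_iff)
  hence "p + 1 - 1 \<noteq> 0" "p + 1 - 2 \<noteq> 0" "p + 1 + 1 \<noteq> 0" "p + 1 \<noteq> 0"
    by (simp_all add: add_eq_0_iff2)
  hence "deriv qden (p + 1 - 1) \<noteq> 0"
    unfolding deriv_qden_zero[OF 3]
    using deriv_zeta_zero_nonzero[OF assms(1,2) 3] by (simp only: mult_eq_0_iff) simp
  thus ?thesis by simp
qed

lemma qres_zero:
  assumes RH: "riemann_hypothesis" and r: "\<rho> \<in> nontrivial_zeros"
  shows "qres (\<rho> - 1) = zeta (\<rho> - 1) / ((\<rho> - 1) * \<rho> * (\<rho> + 1) * deriv zeta \<rho>)"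
proof -
  have n: "\<rho> \<noteq> 2" using nontrivial_zeros_RH[OF RH r] by auto
  have z: "zetaZ (\<rho> - 1) = (\<rho> - 2) * zeta (\<rho> - 1)" using n by (auto simp: zetaZ_def)
  show ?thesis unfolding qres_def deriv_qden_zero[OF r] z using n by simp
qed

section \<open>Conjugation symmetry and absolute summability of the residues\<close>

lemma zeta_cnj: "zeta (cnj s) = cnj (zeta s)"
proof (cases "s = 1")
  case False
  have "zeta s - cnj (zeta (cnj s)) = 0"
  proof (rule analytic_continuation_open[where s = "{s. Re s > 1}" and s' = "- {1}"
        and f = "\<lambda>s. zeta s - cnj (zeta (cnj s))" and g = "\<lambda>_. 0"])
    have "(2 :: complex) \<in> {s. Re s > 1}" by simp
    thus "{s. Re s > 1} \<noteq> {}" by blast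
    show "open {s. 1 < Re s}" by (simp add: open_halfspace_Re_gt)
    show "connected (- {1 :: complex})" by (rule connected_punctured_universe) simp
    have "(cnj \<circ> zeta \<circ> cnj) holomorphic_on - {1}"
    proof (rule holomorphic_on_compose_cnj_cnj)
      have "cnj ` (- {1}) = - {1}"
      proof (intro equalityI subsetI)
        fix x :: complex assume "x \<in> - {1}"
        hence "x = cnj (cnj x)" "cnj x \<in> - {1}" by (auto simp: complex_eq_iff)
        thus "x \<in> cnj ` (- {1})" by (rule image_eqI)
      qed (auto simp: complex_eq_iff)
      thus "zeta holomorphic_on cnj ` (- {1})" using zeta_holomorphic by simp
    qed auto
    thus "(\<lambda>s. zeta s - cnj (zeta (cnj s))) holomorphic_on - {1}"
      by (intro holomorphic_intros zeta_holomorphic) (auto simp: o_def)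
    fix z assume "z \<in> {s. Re s > 1}"
    hence z: "Re z > 1" by simp
    have "cnj (of_nat (Suc n) powr (- cnj z)) = (of_nat (Suc n) powr (- z) :: complex)" for n
      using cnj_powr[of "of_nat (Suc n)" "- cnj z"] by simp
    moreover have "(\<lambda>n. cnj (of_nat (Suc n) powr (- cnj z))) sums cnj (zeta (cnj z))"
      unfolding sums_cnj by (rule zeta_sums) (use z in simp)
    ultimately have "(\<lambda>n. of_nat (Suc n) powr (- z)) sums cnj (zeta (cnj z))"
      by (simp only:)
    with zeta_sums[OF z] show "zeta z - cnj (zeta (cnj z)) = 0" by (simp add: sums_unique2)
  qed (use False in auto)
  thus ?thesis by simp
qed (simp add: zeta_1)

text \<open>Transfers estimates from the zeros above the real axis, to which
  \<open>J_minus_half\<close> is confined, to their conjugates.\<close>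

lemma deriv_zeta_cnj:
  assumes "s \<noteq> 1" shows "deriv zeta (cnj s) = cnj (deriv zeta s)"
proof -
  have "(zeta has_field_derivative deriv zeta s) (at s)"
    by (rule holomorphic_derivI[OF zeta_holomorphic]) (use assms in auto)
  hence "(cnj \<circ> zeta \<circ> cnj has_field_derivative cnj (deriv zeta s)) (at (cnj s))"
    by (intro has_field_derivative_cnj_cnj) auto
  moreover have "cnj \<circ> zeta \<circ> cnj = zeta" by (auto simp: fun_eq_iff zeta_cnj)
  ultimately show ?thesis by (simp add: DERIV_imp_deriv)
qed

lemma cnj_nontrivial_zeros: "cnj \<rho> \<in> nontrivial_zeros \<longleftrightarrow> \<rho> \<in> nontrivial_zeros"
  by (auto simp: nontrivial_zeros_def zeta_cnj)

lemma zetaZ_nonconst: "\<not> zetaZ constant_on UNIV"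
proof
  assume "zetaZ constant_on UNIV"
  then obtain c where c: "\<And>s. zetaZ s = c" by (auto simp: constant_on_def)
  have "(1::complex) = zetaZ 3" using c[of 1] c[of 3] by simp
  hence "2 * zeta 3 = 1" by (simp add: zetaZ_def)
  moreover have "1 = (2 - 1) * zeta 2" using c[of 1] c[of 2] by (simp add: zetaZ_def)
  ultimately have z: "zeta 2 = 1" "norm (zeta 3) = 1 / 2" by (auto simp: norm_mult dest: arg_cong[of _ _ norm])
  have "1 \<le> norm (zeta 3) * norm (zeta (of_real 2))" by (rule norm_zeta_ge) auto
  thus False using z by simp
qed

lemma finite_nontrivial_zeros: "finite {\<rho> \<in> nontrivial_zeros. \<bar>Im \<rho>\<bar> \<le> T}"
proof (rule finite_subset)
  show "finite {z \<in> cbox (Complex 0 (- T)) (Complex 1 T). zetaZ z = 0}"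
    by (rule holomorphic_compact_finite_zeros[OF zetaZ_holomorphic[of UNIV]]) (use zetaZ_nonconst in auto)
  show "{\<rho> \<in> nontrivial_zeros. \<bar>Im \<rho>\<bar> \<le> T} \<subseteq> {z \<in> cbox (Complex 0 (- T)) (Complex 1 T). zetaZ z = 0}"
    by (auto simp: nontrivial_zeros_def zetaZ_def in_cbox_complex_iff)
qed

text \<open>Dyadic decomposition: zeros with 2^j \<le> Im \<rho> \<le> 2^(j + 1) contribute at most
  J(2^(j + 1)) / 4^j = O(2^(-j / 2)), since 3/2 is less than 2.\<close>

lemma summable_on_inverse_deriv_upper:
  assumes J: "J_minus_half \<in> O[at_top](\<lambda>T. T powr (3 / 2))"
  shows "(\<lambda>\<rho>. 1 / ((Im \<rho>)\<^sup>2 * norm (deriv zeta \<rho>))) summable_on {\<rho> \<in> nontrivial_zeros. Im \<rho> \<ge> 1}"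
proof -
  obtain c T0 where c: "c > 0" "\<And>T. T \<ge> T0 \<Longrightarrow> norm (J_minus_half T) \<le> c * norm (T powr (3 / 2))"
    using landau_o.bigE[OF J] unfolding eventually_at_top_linorder by blast
  obtain j0 :: nat where j0: "T0 \<le> real j0" using real_arch_simple by blast
  define Z where "Z = {\<rho> \<in> nontrivial_zeros. Im \<rho> \<ge> 1}"
  define w where "w = (\<lambda>\<rho>. 1 / norm (deriv zeta \<rho>))"
  define B where "B = (\<lambda>j. \<bar>J_minus_half (2 ^ Suc j)\<bar> / 4 ^ j)"
  have finJ: "finite {\<rho> \<in> nontrivial_zeros. 0 < Im \<rho> \<and> Im \<rho> \<le> T}" for T
    by (rule finite_subset[OF _ finite_nontrivial_zeros[of T]]) auto
  have "summable B"
  proof (rule summable_comparison_test_ev)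
    show "\<forall>\<^sub>F j in sequentially. norm (B j) \<le> c * 2 powr (3 / 2) * (2 powr (- 1 / 2)) ^ j"
    proof (rule eventually_mono[OF eventually_ge_at_top[of j0]])
      fix j assume j: "j \<ge> j0"
      have "real j \<le> 2 ^ Suc j" using of_nat_less_two_power[of "Suc j", where 'a = real] by linarith
      hence "norm (J_minus_half (2 ^ Suc j)) \<le> c * norm ((2 ^ Suc j) powr (3 / 2) :: real)"
        using j j0 by (intro c) linarith
      hence "norm (B j) \<le> c * (2 ^ Suc j) powr (3 / 2) / 4 ^ j"
        by (simp add: B_def divide_right_mono)
      also have "(2 ^ Suc j) powr (3 / 2) = 2 powr (3 / 2) * (2 powr (3 / 2 :: real)) ^ j"
        by (simp add: powr_mult powr_powr powr_realpow[symmetric] mult.commute)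
      also have "c * (2 powr (3 / 2) * (2 powr (3 / 2)) ^ j) / 4 ^ j = c * 2 powr (3 / 2) * (2 powr (3 / 2) / 4) ^ j"
        by (simp add: power_divide)
      also have "2 powr (3 / 2) / 4 = (2::real) powr (- 1 / 2)"
      proof -
        have "(4::real) = 2 powr 2" by simp
        hence "2 powr (3 / 2) / 4 = (2::real) powr (3 / 2 - 2)" by (simp only: powr_diff)
        thus ?thesis by simp
      qed
      finally show "norm (B j) \<le> c * 2 powr (3 / 2) * (2 powr (- 1 / 2)) ^ j" .
    qed
    have "(2::real) powr (- 1 / 2) < 1" by (rule powr_less_one) auto
    thus "summable (\<lambda>j. c * 2 powr (3 / 2) * (2 powr (- 1 / 2)) ^ j)"
      by (intro summable_mult summable_geometric) simp
  qed
  have "(\<lambda>\<rho>. 1 / (Im \<rho>)\<^sup>2 * w \<rho>) summable_on Z"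
  proof (rule nonneg_bounded_partial_sums_imp_summable_on)
    show "\<forall>\<^sub>F X in finite_subsets_at_top Z. sum (\<lambda>\<rho>. 1 / (Im \<rho>)\<^sup>2 * w \<rho>) X \<le> suminf B"
    proof (rule eventually_finite_subsets_at_top_weakI)
      fix X assume X: "finite X" "X \<subseteq> Z"
      define lev where "lev = (\<lambda>\<rho>. nat \<lfloor>log 2 (Im \<rho>)\<rfloor>)"
      have lev: "2 ^ lev \<rho> \<le> Im \<rho>" "Im \<rho> \<le> 2 ^ Suc (lev \<rho>)" if "\<rho> \<in> X" for \<rho>
      proof -
        have I: "Im \<rho> \<ge> 1" using that X by (auto simp: Z_def)
        hence l: "log 2 (Im \<rho>) \<ge> 0" by simp
        have "real (lev \<rho>) \<le> log 2 (Im \<rho>)" "log 2 (Im \<rho>) \<le> real (Suc (lev \<rho>))"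
          using l unfolding lev_def by linarith+
        hence "2 powr real (lev \<rho>) \<le> 2 powr log 2 (Im \<rho>)" "2 powr log 2 (Im \<rho>) \<le> 2 powr real (Suc (lev \<rho>))"
          by (simp_all only: powr_le_cancel_iff one_less_numeral_iff semiring_norm)
        thus "2 ^ lev \<rho> \<le> Im \<rho>" "Im \<rho> \<le> 2 ^ Suc (lev \<rho>)"
          using I by (simp_all only: powr_realpow powr_log_cancel zero_less_numeral)
      qed
      define m where "m = Suc (Max (insert 0 (lev ` X)))"
      have "sum (\<lambda>\<rho>. 1 / (Im \<rho>)\<^sup>2 * w \<rho>) X = (\<Sum>j<m. \<Sum>\<rho>\<in>{\<rho> \<in> X. lev \<rho> = j}. 1 / (Im \<rho>)\<^sup>2 * w \<rho>)"
        by (rule sum.group[symmetric]) (use X in \<open>auto simp: m_def less_Suc_eq_le\<close>)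
      also have "\<dots> \<le> (\<Sum>j<m. B j)"
      proof (rule sum_mono)
        fix j
        have "(\<Sum>\<rho>\<in>{\<rho> \<in> X. lev \<rho> = j}. 1 / (Im \<rho>)\<^sup>2 * w \<rho>) \<le> (\<Sum>\<rho>\<in>{\<rho> \<in> X. lev \<rho> = j}. 1 / 4 ^ j * w \<rho>)"
        proof (intro sum_mono mult_right_mono)
          fix \<rho> assume "\<rho> \<in> {\<rho> \<in> X. lev \<rho> = j}"
          hence l: "2 ^ j \<le> Im \<rho>" using lev by auto
          hence I0: "0 < Im \<rho>" using less_le_trans[of 0 "2 ^ j" "Im \<rho>"] by simp
          from l have "(2 ^ j)\<^sup>2 \<le> (Im \<rho>)\<^sup>2" by (intro power_mono) auto
          moreover have "(2 ^ j)\<^sup>2 = (4::real) ^ j" by (simp add: power2_eq_square power_mult_distrib[symmetric])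
          ultimately show "1 / (Im \<rho>)\<^sup>2 \<le> 1 / 4 ^ j"
            using I0 by (intro divide_left_mono mult_pos_pos) auto
        qed (simp add: w_def)
        also have "\<dots> = (\<Sum>\<rho>\<in>{\<rho> \<in> X. lev \<rho> = j}. w \<rho>) / 4 ^ j" by (simp add: sum_divide_distrib)
        also have "(\<Sum>\<rho>\<in>{\<rho> \<in> X. lev \<rho> = j}. w \<rho>) \<le> J_minus_half (2 ^ Suc j)"
          unfolding J_minus_half_def w_def
        proof (rule sum_mono2[OF finJ])
          show "{\<rho> \<in> X. lev \<rho> = j} \<subseteq> {\<rho> \<in> nontrivial_zeros. 0 < Im \<rho> \<and> Im \<rho> \<le> 2 ^ Suc j}"
            using lev X by (force simp: Z_def)
        qed auto
        finally show "(\<Sum>\<rho>\<in>{\<rho> \<in> X. lev \<rho> = j}. 1 / (Im \<rho>)\<^sup>2 * w \<rho>) \<le> B j"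
          by (simp add: B_def divide_right_mono) (meson abs_ge_self divide_right_mono order_trans zero_le_numeral zero_le_power)
      qed
      also have "\<dots> \<le> suminf B"
        by (rule sum_le_suminf[OF \<open>summable B\<close>]) (auto simp: B_def)
      finally show "sum (\<lambda>\<rho>. 1 / (Im \<rho>)\<^sup>2 * w \<rho>) X \<le> suminf B" .
    qed
  qed (simp add: w_def)
  thus ?thesis by (simp add: w_def Z_def)
qed

lemma qpoles_subset: "qpoles \<subseteq> (\<lambda>\<rho>. \<rho> - 1) ` nontrivial_zeros \<union> {1, - 1}"
proof
  fix p assume "p \<in> qpoles"
  thus "p \<in> ((\<lambda>\<rho>. \<rho> - 1) ` nontrivial_zeros) \<union> {1, - 1}"
    by (cases rule: qpoles_cases) (auto intro: image_eqI[of p _ "p + 1"])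
qed

text \<open>At \<rho> - 1, on the line Re s = -1/2, zeta is O(|\<gamma>|), and the three linear
  factors of the denominator supply |\<gamma>|^3; this leaves 1 / (\<gamma>^2 |zeta'(\<rho>)|). The
  finitely many zeros with |\<gamma>| \<le> 1 and the poles 1 and -1 are added at the end.\<close>

lemma summable_on_qres:
  assumes RH: "riemann_hypothesis" and J: "J_minus_half \<in> O[at_top](\<lambda>T. T powr (3 / 2))"
  shows "(\<lambda>p. norm (qres p)) summable_on qpoles"
proof -
  let ?f = "\<lambda>\<rho>. 1 / ((Im \<rho>)\<^sup>2 * norm (deriv zeta \<rho>))"
  define Zu where "Zu = {\<rho> \<in> nontrivial_zeros. Im \<rho> \<ge> 1}"
  define Zl where "Zl = {\<rho> \<in> nontrivial_zeros. Im \<rho> \<le> - 1}"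
  define Zm where "Zm = {\<rho> \<in> nontrivial_zeros. \<bar>Im \<rho>\<bar> \<le> 1}"
  have u: "?f summable_on Zu" unfolding Zu_def by (rule summable_on_inverse_deriv_upper[OF J])
  have bij: "bij_betw cnj Zl Zu"
    by (rule bij_betwI[where g = cnj]) (auto simp: Zu_def Zl_def cnj_nontrivial_zeros)
  have "(\<lambda>\<rho>. ?f (cnj \<rho>)) summable_on Zl"
    using u summable_on_reindex_bij_betw[OF bij, of ?f] by simp
  hence l: "?f summable_on Zl"
  proof (rule summable_on_cong[THEN iffD1, rotated])
    fix \<rho> assume "\<rho> \<in> Zl"
    hence "\<rho> \<noteq> 1" by (auto simp: Zl_def)
    thus "?f (cnj \<rho>) = ?f \<rho>" by (simp add: deriv_zeta_cnj)
  qed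
  have ul: "?f summable_on Zu \<union> Zl"
    by (rule summable_on_Un_disjoint[OF u l]) (auto simp: Zu_def Zl_def)
  obtain C where C: "C > 0" "\<And>t. norm (zeta (Complex (- 1 / 2) t)) \<le> C * (1 + \<bar>t\<bar>)"
    using norm_zeta_minus_half by blast
  have le: "norm (qres (\<rho> - 1)) \<le> 2 * C * ?f \<rho>" if r: "\<rho> \<in> Zu \<union> Zl" for \<rho>
  proof -
    have rn: "\<rho> \<in> nontrivial_zeros" and g: "\<bar>Im \<rho>\<bar> \<ge> 1" using r by (auto simp: Zu_def Zl_def)
    define t where "t = \<bar>Im \<rho>\<bar>"
    have t: "t \<ge> 1" using g by (simp add: t_def)
    have "\<rho> - 1 = Complex (- 1 / 2) (Im \<rho>)"
      using nontrivial_zeros_RH[OF RH rn] by (simp add: complex_eq_iff)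
    hence z: "norm (zeta (\<rho> - 1)) \<le> C * (1 + t)" using C(2)[of "Im \<rho>"] by (simp add: t_def)
    also have "\<dots> \<le> 2 * C * t" using t C(1) by (simp add: algebra_simps)
    finally have z: "norm (zeta (\<rho> - 1)) \<le> 2 * C * t" .
    have n: "t \<le> norm (\<rho> - 1)" "t \<le> norm \<rho>" "t \<le> norm (\<rho> + 1)"
      using abs_Im_le_cmod[of "\<rho> - 1"] abs_Im_le_cmod[of \<rho>] abs_Im_le_cmod[of "\<rho> + 1"] by (simp_all add: t_def)
    have "t * t * t \<le> norm (\<rho> - 1) * norm \<rho> * norm (\<rho> + 1)"
      using n t by (intro mult_mono mult_nonneg_nonneg) auto
    hence d: "t * t * t * norm (deriv zeta \<rho>) \<le> norm (\<rho> - 1) * norm \<rho> * norm (\<rho> + 1) * norm (deriv zeta \<rho>)"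
      by (intro mult_right_mono) auto
    show ?thesis
    proof (cases "deriv zeta \<rho> = 0")
      case False
      have "norm (qres (\<rho> - 1)) = norm (zeta (\<rho> - 1)) / (norm (\<rho> - 1) * norm \<rho> * norm (\<rho> + 1) * norm (deriv zeta \<rho>))"
        by (simp add: qres_zero[OF RH rn] norm_divide norm_mult)
      also have "\<dots> \<le> (2 * C * t) / (t * t * t * norm (deriv zeta \<rho>))"
        using d z t False C(1) by (intro frac_le) (auto intro!: mult_pos_pos)
      also have "\<dots> = 2 * C * ?f \<rho>"
        using t by (simp add: power2_eq_square t_def)
      finally show ?thesis .
    qed (simp add: qres_zero[OF RH rn])
  qed
  have "(\<lambda>\<rho>. norm (qres (\<rho> - 1))) summable_on Zu \<union> Zl"
  proof (rule summable_on_comparison_test)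
    show "(\<lambda>\<rho>. 2 * C * ?f \<rho>) summable_on Zu \<union> Zl" using ul by (rule summable_on_cmult_right)
  qed (use le in auto)
  moreover have "finite Zm" unfolding Zm_def by (rule finite_nontrivial_zeros)
  hence "(\<lambda>\<rho>. norm (qres (\<rho> - 1))) summable_on Zm" by (rule summable_on_finite)
  ultimately have "(\<lambda>\<rho>. norm (qres (\<rho> - 1))) summable_on (Zu \<union> Zl) \<union> Zm"
    by (rule summable_on_union)
  moreover have "nontrivial_zeros \<subseteq> (Zu \<union> Zl) \<union> Zm" by (auto simp: Zu_def Zl_def Zm_def)
  ultimately have nz: "(\<lambda>\<rho>. norm (qres (\<rho> - 1))) summable_on nontrivial_zeros"
    by (rule summable_on_subset_banach)
  have "(\<lambda>p. norm (qres p)) summable_on (\<lambda>\<rho>. \<rho> - 1) ` nontrivial_zeros"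
    using nz by (subst summable_on_reindex) (auto simp: o_def inj_on_def)
  hence "(\<lambda>p. norm (qres p)) summable_on ((\<lambda>\<rho>. \<rho> - 1) ` nontrivial_zeros) \<union> {1, - 1}"
    by (rule summable_on_union[OF _ summable_on_finite]) auto
  thus ?thesis using qpoles_subset by (rule summable_on_subset_banach)
qed

lemma qden_nonconst: "\<not> qden constant_on UNIV"
proof
  assume "qden constant_on UNIV"
  then obtain c where c: "\<And>s. qden s = c" by (auto simp: constant_on_def)
  have "qden 1 = 0" by (simp add: qden_def)
  moreover have "qden 3 \<noteq> 0"
    using zeta_nonzero_Re_gt_1[of 4] by (simp add: qden_def zetaZ_def)
  ultimately show False using c by metis
qed

lemma countable_qpoles: "countable qpoles"
proof (rule countable_subset[OF qpoles_subset])
  have "nontrivial_zeros = (\<Union>n::nat. {\<rho> \<in> nontrivial_zeros. \<bar>Im \<rho>\<bar> \<le> real n})"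
  proof (intro equalityI subsetI)
    fix \<rho> assume r: "\<rho> \<in> nontrivial_zeros"
    obtain n :: nat where "\<bar>Im \<rho>\<bar> \<le> real n" using real_arch_simple by blast
    thus "\<rho> \<in> (\<Union>n::nat. {\<rho> \<in> nontrivial_zeros. \<bar>Im \<rho>\<bar> \<le> real n})" using r by blast
  qed auto
  moreover have "countable \<dots>"
    by (rule countable_UN[OF _ countable_finite[OF finite_nontrivial_zeros]]) simp
  ultimately have "countable nontrivial_zeros" by simp
  thus "countable ((\<lambda>\<rho>. \<rho> - 1) ` nontrivial_zeros \<union> {1, - 1})" by auto
qed

lemma qpoles_sequence:
  assumes "riemann_hypothesis" "J_minus_half \<in> O[at_top](\<lambda>T. T powr (3 / 2))"
  obtains P r where "\<And>n::nat. P n \<in> qpoles" "summable (\<lambda>n. norm (r n))"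
    "\<And>p. p \<in> qpoles \<Longrightarrow> \<exists>n. P n = p \<and> r n = qres p \<and> (\<forall>m. m \<noteq> n \<longrightarrow> P m = p \<longrightarrow> r m = 0)"
proof
  define P where "P = from_nat_into qpoles"
  define I where "I = to_nat_on qpoles ` qpoles"
  define r where "r = (\<lambda>n. if n \<in> I then qres (P n) else 0)"
  have ne: "qpoles \<noteq> {}" using one_in_qpoles by auto
  show "P n \<in> qpoles" for n unfolding P_def using ne by (rule from_nat_into)
  have inj: "inj_on (to_nat_on qpoles) qpoles" using countable_qpoles by (rule inj_on_to_nat_on)
  have Pt: "P (to_nat_on qpoles p) = p" if "p \<in> qpoles" for p
    unfolding P_def using that countable_qpoles by simp
  have "(\<lambda>n. norm (qres (P n))) summable_on I"
    unfolding I_def summable_on_reindex[OF inj]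
    using summable_on_qres[OF assms] by (rule summable_on_cong[THEN iffD1, rotated]) (simp add: Pt)
  hence "(\<lambda>n. norm (r n)) summable_on UNIV"
    by (rule summable_on_cong_neutral[THEN iffD1, rotated 3]) (auto simp: r_def)
  thus "summable (\<lambda>n. norm (r n))" by (simp add: summable_on_UNIV_nonneg_real_iff)
  fix p assume p: "p \<in> qpoles"
  show "\<exists>n. P n = p \<and> r n = qres p \<and> (\<forall>m. m \<noteq> n \<longrightarrow> P m = p \<longrightarrow> r m = 0)"
  proof (intro exI conjI allI impI)
    show "P (to_nat_on qpoles p) = p" by (rule Pt[OF p])
    show "r (to_nat_on qpoles p) = qres p" using p by (simp add: r_def I_def Pt)
    fix m assume m: "m \<noteq> to_nat_on qpoles p" "P m = p"
    have "m \<notin> I" using m Pt by (auto simp: I_def)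
    thus "r m = 0" by (simp add: r_def)
  qed
qed

section \<open>Exponential bounds for the denominator and the regularised kernels\<close>

lemma qden_growth:
  obtains C where "C \<ge> 1" "\<And>s. Re s \<ge> - 3 \<Longrightarrow> norm (qden s) \<le> C * exp (8 * norm s)"
    "\<And>s. Re s \<ge> - 2 \<Longrightarrow> norm (zetaZ s) \<le> C * exp (8 * norm s)"
proof -
  obtain C0 where C0: "C0 > 0" "\<And>s. Re s \<ge> - 2 \<Longrightarrow> norm (zetaZ s) \<le> C0 * exp (5 * norm s)"
    using zetaZ_growth by blast
  define C where "C = 1 + C0 + C0 * exp 5 * (1 * 1 * exp 1 * 1 * exp 1 * exp 1)"
  have lin: "norm (s + of_int k) \<le> exp 1 * exp (norm s)" if "\<bar>k\<bar> \<le> 2" for s :: complex and k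
  proof -
    have "norm (s + of_int k) \<le> norm s + \<bar>of_int k\<bar>" using norm_triangle_ineq[of s "of_int k"] by simp
    also have "\<dots> \<le> 1 + (1 + norm s)" using that by linarith
    also have "\<dots> \<le> exp (1 + norm s)" by (rule exp_ge_add_one_self)
    finally show ?thesis by (simp add: exp_add)
  qed
  show ?thesis
  proof (rule that[of C])
    have pos: "C0 * exp 5 * (1 * 1 * exp 1 * 1 * exp 1 * exp 1) > 0" using C0 by simp
    show "C \<ge> 1" using C0 pos unfolding C_def by linarith
    fix s :: complex
    show "norm (zetaZ s) \<le> C * exp (8 * norm s)" if "Re s \<ge> - 2"
    proof -
      have "norm (zetaZ s) \<le> C0 * exp (5 * norm s)" using C0(2)[OF that] .
      also have "\<dots> \<le> C * exp (8 * norm s)"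
        using C0(1) pos by (intro mult_mono) (auto simp: C_def)
      finally show ?thesis .
    qed
    assume s: "Re s \<ge> - 3"
    have "norm (qden s) = norm (zetaZ (s + 1)) * (norm (s + of_int (-1)) * norm (s + of_int 1) * norm (s + of_int 2))"
      by (simp add: qden_def norm_mult)
    also have "\<dots> \<le> (C0 * exp (5 * norm (s + 1))) * ((exp 1 * exp (norm s)) * (exp 1 * exp (norm s)) * (exp 1 * exp (norm s)))"
      using C0 s by (intro mult_mono lin C0(2) mult_nonneg_nonneg) auto
    also have "\<dots> \<le> (C0 * exp (5 + 5 * norm s)) * ((exp 1 * exp (norm s)) * (exp 1 * exp (norm s)) * (exp 1 * exp (norm s)))"
      using norm_triangle_ineq[of s 1] C0 by (intro mult_right_mono mult_left_mono) auto
    also have "\<dots> = C0 * exp 5 * (1 * 1 * exp 1 * 1 * exp 1 * exp 1) * exp (8 * norm s)"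
    proof -
      have "exp (5 + 5 * norm s) * (exp (norm s) * exp (norm s) * exp (norm s)) = exp 5 * exp (8 * norm s)"
        by (simp add: exp_add[symmetric])
      thus ?thesis by (simp add: mult_ac)
    qed
    also have "\<dots> \<le> C * exp (8 * norm s)"
      using C0 by (intro mult_right_mono) (auto simp: C_def)
    finally show "norm (qden s) \<le> C * exp (8 * norm s)" .
  qed
qed

text \<open>\<open>qden s * perron_kernel 4 (s - p)\<close> at a zero \<open>p\<close> of \<open>qden\<close>, without the removable singularity at \<open>p\<close>.\<close>

definition qkernel :: "complex \<Rightarrow> complex \<Rightarrow> complex" where
  "qkernel p s = (if s = p then deriv qden p else (qden s - qden p) / (s - p)) * (4 / (s - p + 4))"

lemma qpoles_Re_le: "p \<in> qpoles \<Longrightarrow> Re p \<le> 1"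
  by (erule qpoles_cases) (auto simp: nontrivial_zeros_def)

text \<open>Here the distance 4 matters: since Re p \<le> 1, the second pole p - 4 of the kernel
  lies to the left of the half-plane Re s > -2.\<close>

lemma qkernel_holomorphic:
  assumes "p \<in> qpoles"
  shows "qkernel p holomorphic_on {s. Re s > - 2}"
proof -
  have "(\<lambda>s. if s = p then deriv qden p else (qden s - qden p) / (s - p)) holomorphic_on {s. Re s > - 2}"
    using pole_lemma[OF qden_holomorphic[of UNIV], of p] by (auto intro: holomorphic_on_subset)
  thus ?thesis unfolding qkernel_def [abs_def] using qpoles_Re_le[OF assms]
    by (intro holomorphic_intros) (auto simp: complex_eq_iff)
qed

lemma qkernel_eq:
  assumes "p \<in> qpoles" "s \<noteq> p"
  shows "qkernel p s = qden s * perron_kernel 4 (s - p)"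
  using assms by (simp add: qkernel_def qpoles_def perron_kernel_def)

lemma qkernel_at_pole: "qkernel p p = deriv qden p"
  by (simp add: qkernel_def)

text \<open>A bound uniform in p. At distance at least 1/4 from p the quotient is estimated
  directly; closer to p the maximum principle on the disc of radius 1/4 around p reduces to that
  case. All points used are within distance 1 of s, hence the bound on \<open>qden\<close> in the
  larger half-plane Re s \<ge> -3.\<close>

lemma norm_qkernel_le:
  assumes p: "p \<in> qpoles" and s: "Re s > - 2"
    and C: "C \<ge> 1" "\<And>s. Re s \<ge> - 3 \<Longrightarrow> norm (qden s) \<le> C * exp (8 * norm s)"
  shows "norm (qkernel p s) \<le> 16 * C * exp 8 * exp (8 * norm s)"
proof -
  define B where "B = C * exp 8 * exp (8 * norm s)"
  have B: "norm (qden z) \<le> B" if z: "norm (z - s) \<le> 1" for z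
  proof -
    have "\<bar>Re (z - s)\<bar> \<le> 1" using abs_Re_le_cmod[of "z - s"] z by linarith
    hence "norm (qden z) \<le> C * exp (8 * norm z)" using s by (intro C) auto
    also have "norm z \<le> 1 + norm s" using norm_triangle_ineq[of "z - s" s] z by simp
    hence "C * exp (8 * norm z) \<le> C * exp (8 + 8 * norm s)" using C by simp
    finally show ?thesis by (simp add: B_def exp_add)
  qed
  define F where "F = (\<lambda>s. if s = p then deriv qden p else (qden s - qden p) / (s - p))"
  have Fhol: "F holomorphic_on UNIV"
    unfolding F_def using pole_lemma[OF qden_holomorphic[of UNIV], of p] by simp
  have far: "norm (F z) \<le> 4 * B" if z: "norm (z - p) \<ge> 1 / 4" "norm (z - s) \<le> 1" for z
  proof -
    have "z \<noteq> p" using z by auto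
    hence "norm (F z) = norm (qden z) / norm (z - p)" using p by (simp add: F_def qpoles_def norm_divide)
    also have "\<dots> \<le> B / (1 / 4)" using B[OF z(2)] z by (intro frac_le) (auto intro: order_trans[OF norm_ge_zero])
    finally show ?thesis by simp
  qed
  have F: "norm (F s) \<le> 4 * B"
  proof (cases "norm (s - p) \<ge> 1 / 4")
    case True
    thus ?thesis by (intro far) auto
  next
    case False
    show ?thesis
    proof (rule maximum_modulus_frontier[of F "cball p (1 / 4)"])
      show "F holomorphic_on interior (cball p (1 / 4))" by (rule holomorphic_on_subset[OF Fhol]) auto
      show "continuous_on (closure (cball p (1 / 4))) F"
        by (rule continuous_on_subset[OF holomorphic_on_imp_continuous_on[OF Fhol]]) auto
      show "s \<in> cball p (1 / 4)" using False by (simp add: dist_norm norm_minus_commute)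
      fix z assume "z \<in> frontier (cball p (1 / 4))"
      hence z: "norm (z - p) = 1 / 4" by (simp add: dist_norm norm_minus_commute)
      have "norm (z - s) \<le> norm (z - p) + norm (p - s)" using norm_triangle_ineq[of "z - p" "p - s"] by simp
      thus "norm (F z) \<le> 4 * B" using z False by (intro far) (auto simp: norm_minus_commute)
    qed simp
  qed
  have "1 \<le> Re (s - p + 4)" using qpoles_Re_le[OF p] s by simp
  hence "1 \<le> norm (s - p + 4)" using complex_Re_le_cmod order_trans by blast
  hence "norm (4 / (s - p + 4)) \<le> 4" by (simp add: norm_divide divide_le_eq)
  hence "norm (F s) * norm (4 / (s - p + 4)) \<le> (4 * B) * 4"
    using F order_trans[OF norm_ge_zero F] by (intro mult_mono) auto
  moreover have "norm (qkernel p s) = norm (F s) * norm (4 / (s - p + 4))"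
    by (simp only: qkernel_def F_def norm_mult)
  ultimately show ?thesis by (simp add: B_def mult_ac)
qed

section \<open>The Riesz mean of the totient ratio\<close>

lemma phi_ratio_bounds: "0 \<le> phi_ratio l" "phi_ratio l \<le> 1"
  using totient_le[of l] by (auto simp: phi_ratio_def divide_le_eq)

text \<open>Multiplying by zeta(s + 1) convolves phi(l) / l with 1 / d; the result is 1 because the
  totients of the divisors of l add up to l.\<close>

lemma phi_ratio_dirichlet_series:
  assumes s: "Re s > 1"
  shows "(\<lambda>l. of_real (phi_ratio l) * of_nat l powr (- s) :: complex) summable_on {0<..}"
    and "zeta (s + 1) * (\<Sum>\<^sub>\<infinity>l\<in>{0<..}. of_real (phi_ratio l) * of_nat l powr (- s)) = zeta s"
proof -
  let ?f = "\<lambda>d. of_nat d powr (- (s + 1)) :: complex"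
  let ?g = "\<lambda>l. of_real (phi_ratio l) * of_nat l powr (- s) :: complex"
  have "(\<lambda>l. norm (of_nat l powr (- s) :: complex)) summable_on {0<..}"
    using summable_on_powr(1)[OF s] by (simp add: summable_on_iff_abs_summable_on_complex)
  hence "(\<lambda>l. norm (?g l)) summable_on {0<..}"
    by (rule Infinite_Sum.abs_summable_on_comparison_test)
       (use phi_ratio_bounds in \<open>auto simp: norm_mult mult_left_le_one_le\<close>)
  thus g: "?g summable_on {0<..}" by (simp add: summable_on_iff_abs_summable_on_complex)
  have s1: "Re (s + 1) > 1" using s by simp
  have "dconv ?f ?g l = of_nat l powr (- s)" if l: "l \<in> {0<..}" for l
  proof -
    have l0: "l > 0" using l by simp
    have "dconv ?f ?g l = (\<Sum>d | d dvd l. of_nat l powr (- s) * of_real (real (totient (l div d)) / real l))"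
      unfolding dconv_def
    proof (rule sum.cong, simp)
      fix d assume "d \<in> {d. d dvd l}"
      then obtain k where k: "l = d * k" by auto
      have dk: "d > 0" "k > 0" using l0 k by auto
      have "?f d = of_nat d powr (- s) / of_nat d"
        using dk by (simp add: powr_diff)
      moreover have "of_nat l powr (- s) = of_nat d powr (- s) * (of_nat k powr (- s) :: complex)"
        unfolding k by (rule of_nat_mult_powr)
      ultimately show "?f d * ?g (l div d) = of_nat l powr (- s) * of_real (real (totient (l div d)) / real l)"
        using dk by (simp add: k phi_ratio_def field_simps)
    qed
    also have "\<dots> = of_nat l powr (- s) * of_real (real (\<Sum>d | d dvd l. totient (l div d)) / real l)"
      by (simp add: sum_distrib_left sum_divide_distrib)
    also have "(\<Sum>d | d dvd l. totient (l div d)) = (\<Sum>d | d dvd l. totient d)"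
      by (rule sum.reindex_bij_witness[of _ "\<lambda>d. l div d" "\<lambda>d. l div d"]) (use l0 in auto)
    also have "\<dots> = l" by (rule totient_divisor_sum)
    finally show ?thesis using l0 by simp
  qed
  hence "infsum (dconv ?f ?g) {0<..} = infsum (\<lambda>l. of_nat l powr (- s)) {0<..}"
    by (rule infsum_cong)
  moreover have "infsum (dconv ?f ?g) {0<..} = infsum ?f {0<..} * infsum ?g {0<..}"
    by (rule infsum_dconv(1)[OF summable_on_powr(1)[OF s1] g])
  ultimately show "zeta (s + 1) * (\<Sum>\<^sub>\<infinity>l\<in>{0<..}. of_real (phi_ratio l) * of_nat l powr (- s)) = zeta s"
    using infsumI[OF summable_on_powr(2)[OF s]] infsumI[OF summable_on_powr(2)[OF s1]] by simp
qed

lemma phi_ratio_sums: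
  assumes s: "Re s > 1"
  shows "(\<lambda>n. of_real (phi_ratio (Suc n)) * of_nat (Suc n) powr (- s)) sums (zeta s / zeta (s + 1))"
proof -
  let ?g = "\<lambda>l. of_real (phi_ratio l) * of_nat l powr (- s) :: complex"
  have "zeta (s + 1) \<noteq> 0" using s by (intro zeta_nonzero_Re_gt_1) simp
  hence "(?g has_sum (zeta s / zeta (s + 1))) {0<..}"
    using has_sum_infsum[OF phi_ratio_dirichlet_series(1)[OF s]] phi_ratio_dirichlet_series(2)[OF s]
    by (metis nonzero_mult_div_cancel_left)
  moreover have "{0<..} = range Suc" by (auto simp: image_iff gr0_conv_Suc)
  ultimately have "(?g \<circ> Suc has_sum (zeta s / zeta (s + 1))) UNIV"
    by (simp add: has_sum_reindex)
  thus ?thesis by (auto dest: has_sum_imp_sums simp: o_def)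
qed

definition phi_mean :: "real \<Rightarrow> real" where
  "phi_mean x = (\<Sum>l | 0 < l \<and> real l \<le> x. phi_ratio l * (1 - real l / x) ^ 2) / 2"

definition aquot :: "complex \<Rightarrow> complex" where "aquot s = zetaZ s / qden s"

lemma norm_half_le: "norm (w / 2 :: complex) \<le> norm w"
  by (simp add: norm_divide)

text \<open>Splits 1 / (s (s + 1) (s + 2)) into two Perron kernels. On the side of the sums this is
  (1 - z) - (1 - z^2) / 2 = (1 - z)^2 / 2 with z = l / x, the quadratic Riesz weight.\<close>

lemma aquot_eq:
  assumes "Re s > 1"
  shows "aquot s = zeta s / zeta (s + 1) * (perron_kernel 1 s - perron_kernel 2 s / 2)"
proof -
  have n: "s \<noteq> 0" "s \<noteq> 1" "s + 1 \<noteq> 0" "s + 2 \<noteq> 0" "s - 1 \<noteq> 0"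
    using assms by (auto simp: complex_eq_iff)
  have "perron_kernel 1 s - perron_kernel 2 s / 2 = 1 / (s * (s + 1) * (s + 2))"
  proof -
    have "perron_kernel 1 s = 1 / (s * (s + 1))" "perron_kernel 2 s / 2 = 1 / (s * (s + 2))"
      by (simp_all add: perron_kernel_def)
    moreover have "1 / (s * (s + 1)) = (s + 2) / (s * (s + 1) * (s + 2))"
      "1 / (s * (s + 2)) = (s + 1) / (s * (s + 1) * (s + 2))"
      using n by (simp_all add: mult.assoc mult.left_commute[of s "s + 1"])
    hence "1 / (s * (s + 1)) - 1 / (s * (s + 2)) = ((s + 2) - (s + 1)) / (s * (s + 1) * (s + 2))"
      by (simp only: diff_divide_distrib)
    ultimately show ?thesis by simp
  qed
  moreover have "aquot s = zeta s / zeta (s + 1) * (1 / (s * (s + 1) * (s + 2)))"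
    using n by (simp add: aquot_def qden_def zetaZ_def)
  ultimately show ?thesis by simp
qed

lemma norm_aquot_2:
  obtains C where "C > 0" "\<And>t. norm (aquot (Complex 2 t)) \<le> C / (1 + t\<^sup>2)"
proof -
  obtain C1 where C1: "C1 > 0" "\<And>t. norm (perron_kernel 1 (Complex 2 t)) \<le> C1 / (1 + t\<^sup>2)"
    using norm_perron_kernel[of 2 1] by auto
  obtain C2 where C2: "C2 > 0" "\<And>t. norm (perron_kernel 2 (Complex 2 t)) \<le> C2 / (1 + t\<^sup>2)"
    using norm_perron_kernel[of 2 2] by auto
  define Z where "Z = norm (zeta (of_real 2))"
  have Z: "Z > 0" using zeta_2_nonzero by (simp add: Z_def)
  show ?thesis
  proof (rule that[of "Z * Z * (C1 + C2)"])
    show "Z * Z * (C1 + C2) > 0" using Z C1 C2 by simp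
    fix t
    have z1: "norm (zeta (Complex 2 t)) \<le> Z" unfolding Z_def by (rule norm_zeta_le) auto
    have z2: "1 \<le> norm (zeta (Complex 2 t + 1)) * Z" unfolding Z_def by (rule norm_zeta_ge) auto
    hence pos: "norm (zeta (Complex 2 t + 1)) > 0"
      by (metis mult_zero_left not_one_le_zero zero_less_norm_iff norm_zero)
    have q: "norm (zeta (Complex 2 t) / zeta (Complex 2 t + 1)) \<le> Z * Z"
    proof -
      have "norm (zeta (Complex 2 t)) / norm (zeta (Complex 2 t + 1)) \<le> Z / norm (zeta (Complex 2 t + 1))"
        using z1 pos by (intro divide_right_mono) auto
      also have "\<dots> \<le> Z * Z" using z2 pos Z by (simp add: field_simps)
      finally show ?thesis by (simp add: norm_divide)
    qed
    have p: "1 + t\<^sup>2 > 0" by (simp add: add_pos_nonneg)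
    have "norm (perron_kernel 1 (Complex 2 t) - perron_kernel 2 (Complex 2 t) / 2)
       \<le> norm (perron_kernel 1 (Complex 2 t)) + norm (perron_kernel 2 (Complex 2 t) / 2)"
      by (rule norm_triangle_ineq4)
    also have "\<dots> \<le> C1 / (1 + t\<^sup>2) + C2 / (1 + t\<^sup>2)"
      using C1(2)[of t] order_trans[OF norm_half_le C2(2)[of t]] by (rule add_mono)
    also have "\<dots> = (C1 + C2) / (1 + t\<^sup>2)" by (simp add: add_divide_distrib)
    finally have k: "norm (perron_kernel 1 (Complex 2 t) - perron_kernel 2 (Complex 2 t) / 2) \<le> (C1 + C2) / (1 + t\<^sup>2)" .
    have "norm (aquot (Complex 2 t)) \<le> Z * Z * ((C1 + C2) / (1 + t\<^sup>2))"
      by (subst aquot_eq, simp, subst norm_mult) (intro mult_mono q k, use Z in auto)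
    thus "norm (aquot (Complex 2 t)) \<le> Z * Z * (C1 + C2) / (1 + t\<^sup>2)" by simp
  qed
qed

text \<open>Shows that Re s = -3/2 is a possible target line: there is no pole on it, and linear
  growth of zeta(s) / zeta(s + 1) against a cubic denominator leaves an integrable function.\<close>

lemma norm_aquot_minus_three_halves:
  obtains C where "C > 0" "\<And>t. norm (aquot (Complex (- 3 / 2) t)) \<le> C / (1 + t\<^sup>2)"
    "\<And>t. qden (Complex (- 3 / 2) t) \<noteq> 0"
proof -
  obtain C where C: "C > 0" "\<And>t. zeta (Complex (- 1 / 2) t) \<noteq> 0"
    "\<And>t. norm (zeta (Complex (- 3 / 2) t) / zeta (Complex (- 1 / 2) t)) \<le> C * (2 + \<bar>t\<bar>)"
    using norm_zeta_ratio by blast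
  show ?thesis
  proof (rule that[of "12 * C"])
    show "12 * C > 0" using C by simp
    fix t
    define s where "s = Complex (- 3 / 2) t"
    have s1: "s + 1 = Complex (- 1 / 2) t" by (simp add: s_def complex_eq_iff)
    have n: "s \<noteq> 0" "s \<noteq> 1" "s + 1 \<noteq> 0" "s + 2 \<noteq> 0" "s - 1 \<noteq> 0" "s + 1 \<noteq> 1"
      by (auto simp: complex_eq_iff s_def)
    show "qden (Complex (- 3 / 2) t) \<noteq> 0"
      using n C(2)[of t] unfolding qden_def s_def[symmetric] s1[symmetric] by (simp add: zetaZ_def)
    have a: "aquot s = zeta s / zeta (s + 1) * (1 / (s * (s + 1) * (s + 2)))"
      using n by (simp add: aquot_def qden_def zetaZ_def)
    have ns: "2 + \<bar>t\<bar> \<le> 3 * norm s"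
      using abs_Re_le_cmod[of s] abs_Im_le_cmod[of s] by (simp add: s_def)
    have s2: "s + 2 = Complex (1 / 2) t" by (simp add: s_def complex_eq_iff)
    have "norm (s + 1) * norm (s + 2) = 1 / 4 + t\<^sup>2"
      unfolding s1 s2 complex_norm by (simp add: power2_eq_square)
    hence n12: "norm (s + 1) * norm (s + 2) \<ge> (1 + t\<^sup>2) / 4" by simp
    have p: "1 + t\<^sup>2 > 0" by (simp add: add_pos_nonneg)
    have ps: "norm s > 0" using n by simp
    have "norm (aquot s) \<le> C * (2 + \<bar>t\<bar>) * (1 / (norm s * (norm (s + 1) * norm (s + 2))))"
      unfolding a norm_mult using C(3)[of t] unfolding s_def[symmetric] s1[symmetric]
      by (intro mult_mono) (use C(1) in \<open>auto simp: norm_divide norm_mult\<close>)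
    also have "\<dots> \<le> C * (3 * norm s) * (1 / (norm s * ((1 + t\<^sup>2) / 4)))"
      using ns n12 p ps C(1) by (intro mult_mono divide_left_mono mult_left_mono mult_pos_pos)
        (auto intro: less_le_trans[of 0 "(1 + t\<^sup>2) / 4"])
    also have "\<dots> = 12 * C / (1 + t\<^sup>2)"
    proof -
      have "C * (3 * a) * (1 / (a * (b / 4))) = 12 * C / b" if "a > 0" "b > 0" for a b :: real
        using that by (simp add: field_simps)
      thus ?thesis using ps p by blast
    qed
    finally show "norm (aquot (Complex (- 3 / 2) t)) \<le> 12 * C / (1 + t\<^sup>2)" by (simp add: s_def)
  qed
qed

lemma of_real_powr_Complex_norm: "x > 0 \<Longrightarrow> norm (of_real x powr s :: complex) = x powr Re s"
  by (simp add: norm_powr_real_powr)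

text \<open>On Re s = 2 the Dirichlet series converges absolutely and the kernel is integrable, so
  the Perron integral may be taken termwise, each term with x / l in place of x.\<close>

lemma perron_phi_mean:
  assumes x: "x \<ge> 1"
  shows "(\<integral>t. of_real x powr (Complex 2 t) * aquot (Complex 2 t) \<partial>lborel) = of_real (2 * pi * phi_mean x)"
proof -
  have x0: "x > 0" using x by simp
  define K where "K = (\<lambda>s. perron_kernel 1 s - perron_kernel 2 s / 2)"
  define y where "y = (\<lambda>n. x / real (Suc n))"
  have y: "y n > 0" for n using x0 by (simp add: y_def)
  define h where "h = (\<lambda>n t. of_real (phi_ratio (Suc n)) * (of_real (y n) powr (Complex 2 t) * K (Complex 2 t)))"
  have intd: "integrable lborel (\<lambda>t. of_real (y n) powr (Complex 2 t) * perron_kernel d (Complex 2 t))"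
    if "d > 0" for n d using y[of n] that by (intro perron_integrand) auto
  have int1: "integrable lborel (\<lambda>t. of_real (y n) powr (Complex 2 t) * K (Complex 2 t))" for n
  proof -
    have "integrable lborel (\<lambda>t. of_real (y n) powr (Complex 2 t) * perron_kernel 1 (Complex 2 t)
       - of_real (y n) powr (Complex 2 t) * perron_kernel 2 (Complex 2 t) / 2)"
      by (intro Bochner_Integration.integrable_diff integrable_divide intd) auto
    thus ?thesis by (simp add: K_def algebra_simps)
  qed
  have I: "(\<integral>t. of_real (y n) powr (Complex 2 t) * K (Complex 2 t) \<partial>lborel)
     = (if real (Suc n) \<le> x then of_real (pi * (1 - real (Suc n) / x)\<^sup>2) else 0)" for n
  proof -
    have "(\<integral>t. of_real (y n) powr (Complex 2 t) * K (Complex 2 t) \<partial>lborel)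
      = (\<integral>t. of_real (y n) powr (Complex 2 t) * perron_kernel 1 (Complex 2 t)
       - of_real (y n) powr (Complex 2 t) * perron_kernel 2 (Complex 2 t) / 2 \<partial>lborel)"
      by (intro Bochner_Integration.integral_cong) (auto simp: K_def algebra_simps)
    also have "\<dots> = (\<integral>t. of_real (y n) powr (Complex 2 t) * perron_kernel 1 (Complex 2 t) \<partial>lborel)
       - (\<integral>t. of_real (y n) powr (Complex 2 t) * perron_kernel 2 (Complex 2 t) \<partial>lborel) / 2"
      by (subst Bochner_Integration.integral_diff) (auto intro!: intd integrable_divide)
    also have "\<dots> = (if y n \<ge> 1 then of_real (2 * pi * (1 - y n powr (- 1)) - 2 * pi * (1 - y n powr (- 2)) / 2) else 0)"
      using y[of n] x0 by (simp add: perron_formula)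
    also have "y n \<ge> 1 \<longleftrightarrow> real (Suc n) \<le> x" by (simp add: y_def)
    also have "2 * pi * (1 - y n powr (- 1)) - 2 * pi * (1 - y n powr (- 2)) / 2 = pi * (1 - real (Suc n) / x)\<^sup>2"
    proof -
      have 1: "y n powr (- 1) = real (Suc n) / x" using y[of n] x0 by (simp add: powr_minus y_def)
      have "y n powr (- 2) = inverse ((y n)\<^sup>2)" using y[of n] x0 by (simp add: powr_minus powr_numeral)
      hence 2: "y n powr (- 2) = (real (Suc n) / x)\<^sup>2" by (simp add: y_def power_divide)
      have "2 * pi * (1 - z) - 2 * pi * (1 - z\<^sup>2) / 2 = pi * (1 - z)\<^sup>2" for z :: real
        by (simp add: power2_eq_square field_simps)
      thus ?thesis unfolding 1 2 .
    qed
    finally show ?thesis .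
  qed
  obtain C1 where C1: "C1 > 0" "\<And>t. norm (perron_kernel 1 (Complex 2 t)) \<le> C1 / (1 + t\<^sup>2)"
    using norm_perron_kernel[of 2 1] by auto
  obtain C2 where C2: "C2 > 0" "\<And>t. norm (perron_kernel 2 (Complex 2 t)) \<le> C2 / (1 + t\<^sup>2)"
    using norm_perron_kernel[of 2 2] by auto
  have nK: "norm (K (Complex 2 t)) \<le> (C1 + C2) * (1 / (1 + t\<^sup>2))" for t
  proof -
    have "norm (K (Complex 2 t)) \<le> norm (perron_kernel 1 (Complex 2 t)) + norm (perron_kernel 2 (Complex 2 t) / 2)"
      unfolding K_def by (rule norm_triangle_ineq4)
    also have "\<dots> \<le> C1 / (1 + t\<^sup>2) + C2 / (1 + t\<^sup>2)"
      using C1(2)[of t] order_trans[OF norm_half_le C2(2)[of t]] by (rule add_mono)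
    finally show ?thesis by (simp add: add_divide_distrib)
  qed
  have nh: "norm (h n t) \<le> x\<^sup>2 * (real (Suc n) powr (- 2)) * ((C1 + C2) * (1 / (1 + t\<^sup>2)))" for n t
  proof -
    have "norm (h n t) = phi_ratio (Suc n) * (y n powr 2 * norm (K (Complex 2 t)))"
      using y[of n] phi_ratio_bounds(1)[of "Suc n"] by (simp add: h_def norm_mult of_real_powr_Complex_norm)
    also have "\<dots> \<le> 1 * (y n powr 2 * ((C1 + C2) * (1 / (1 + t\<^sup>2))))"
      using phi_ratio_bounds[of "Suc n"] nK[of t] by (intro mult_mono) auto
    also have "y n powr 2 = x\<^sup>2 * (real (Suc n) powr (- 2))"
      using x0 by (simp add: y_def powr_divide powr_minus powr_numeral divide_inverse power_mult_distrib power_inverse del: of_nat_Suc)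
    finally show ?thesis by simp
  qed
  have sm2: "summable (\<lambda>n. real (Suc n) powr (- 2))" by (rule summable_Suc_powr) simp
  have inth: "integrable lborel (h n)" for n
    unfolding h_def by (intro integrable_mult_right int1)
  have swap: "(\<integral>t. (\<Sum>n. h n t) \<partial>lborel) = (\<Sum>n. \<integral>t. h n t \<partial>lborel)"
  proof (rule integral_suminf[OF inth])
    show "AE t in lborel. summable (\<lambda>n. norm (h n t))"
    proof (rule AE_I2, rule summable_comparison_test')
      fix t :: real
      show "summable (\<lambda>n. x\<^sup>2 * (real (Suc n) powr (- 2)) * ((C1 + C2) * (1 / (1 + t\<^sup>2))))"
        by (intro summable_mult summable_mult2 sm2)
      show "norm (norm (h n t)) \<le> x\<^sup>2 * (real (Suc n) powr (- 2)) * ((C1 + C2) * (1 / (1 + t\<^sup>2)))" for n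
        using nh[of n t] by simp
    qed
    define V where "V = (\<integral>t. (C1 + C2) * (1 / (1 + t\<^sup>2)) \<partial>lborel)"
    show "summable (\<lambda>n. \<integral>t. norm (h n t) \<partial>lborel)"
    proof (rule summable_comparison_test')
      show "summable (\<lambda>n. x\<^sup>2 * (real (Suc n) powr (- 2)) * V)"
        by (intro summable_mult summable_mult2 sm2)
      fix n
      have "(\<integral>t. norm (h n t) \<partial>lborel) \<le> (\<integral>t. x\<^sup>2 * (real (Suc n) powr (- 2)) * ((C1 + C2) * (1 / (1 + t\<^sup>2))) \<partial>lborel)"
        by (intro integral_mono integrable_norm inth integrable_mult_right integrable_inverse_1_plus_sq nh)
      also have "\<dots> = x\<^sup>2 * (real (Suc n) powr (- 2)) * V" unfolding V_def by (rule integral_mult_right_zero)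
      finally show "norm (\<integral>t. norm (h n t) \<partial>lborel) \<le> x\<^sup>2 * (real (Suc n) powr (- 2)) * V"
        by (simp add: integral_nonneg_AE)
    qed
  qed
  have "(\<Sum>n. h n t) = of_real x powr (Complex 2 t) * aquot (Complex 2 t)" for t
  proof -
    let ?s = "Complex 2 t"
    have "(\<lambda>n. (of_real x powr ?s * K ?s) * (of_real (phi_ratio (Suc n)) * of_nat (Suc n) powr (- ?s)))
       sums ((of_real x powr ?s * K ?s) * (zeta ?s / zeta (?s + 1)))"
      by (intro sums_mult phi_ratio_sums) simp
    moreover have "(of_real x powr ?s * K ?s) * (of_real (phi_ratio (Suc n)) * of_nat (Suc n) powr (- ?s)) = h n t" for n
    proof -
      have "of_real x = of_real (y n) * complex_of_real (real (Suc n))" by (simp add: y_def del: of_nat_Suc)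
      hence "of_real x powr ?s = of_real (y n) powr ?s * (of_nat (Suc n) powr ?s)"
        using y[of n] by (simp add: powr_times_real del: of_nat_Suc)
      moreover have "of_nat (Suc n) powr ?s * of_nat (Suc n) powr (- ?s) = (1 :: complex)"
        by (simp add: powr_minus del: of_nat_Suc)
      ultimately show ?thesis by (simp add: h_def mult_ac)
    qed
    ultimately have "(\<lambda>n. h n t) sums ((of_real x powr ?s * K ?s) * (zeta ?s / zeta (?s + 1)))" by simp
    thus ?thesis by (simp add: sums_iff aquot_eq K_def mult_ac)
  qed
  hence "(\<integral>t. of_real x powr (Complex 2 t) * aquot (Complex 2 t) \<partial>lborel) = (\<Sum>n. \<integral>t. h n t \<partial>lborel)"
    using swap by simp
  also have "\<dots> = (\<Sum>n. of_real (phi_ratio (Suc n)) * (if real (Suc n) \<le> x then of_real (pi * (1 - real (Suc n) / x)\<^sup>2) else 0))"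
    unfolding h_def integral_mult_right_zero I ..
  also have "\<dots> = (\<Sum>n | real (Suc n) \<le> x. of_real (phi_ratio (Suc n)) * (if real (Suc n) \<le> x then of_real (pi * (1 - real (Suc n) / x)\<^sup>2) else 0))"
  proof (rule suminf_finite)
    have "{n. real (Suc n) \<le> x} \<subseteq> {..nat \<lfloor>x\<rfloor>}" by (auto simp: le_nat_floor)
    thus "finite {n. real (Suc n) \<le> x}" by (rule finite_subset) simp
  qed auto
  also have "\<dots> = (\<Sum>n | real (Suc n) \<le> x. of_real (phi_ratio (Suc n) * (pi * (1 - real (Suc n) / x)\<^sup>2)))"
    by (intro sum.cong) auto
  also have "\<dots> = (\<Sum>l | 0 < l \<and> real l \<le> x. of_real (phi_ratio l * (pi * (1 - real l / x)\<^sup>2)))"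
    by (rule sum.reindex_bij_witness[of _ "\<lambda>l. l - 1" Suc]) auto
  also have "\<dots> = of_real (2 * pi * phi_mean x)"
    by (simp add: phi_mean_def sum_distrib_left mult_ac)
  finally show ?thesis .
qed

section \<open>Subtraction of the poles and growth of the remainder\<close>

locale qpole_data =
  fixes P :: "nat \<Rightarrow> complex" and r :: "nat \<Rightarrow> complex"
  assumes RH: "riemann_hypothesis" and SZ: "simple_zeros_on_critical_line"
    and P: "P n \<in> qpoles" and r: "summable (\<lambda>n. norm (r n))"
    and Pr: "p \<in> qpoles \<Longrightarrow> \<exists>n. P n = p \<and> r n = qres p \<and> (\<forall>m. m \<noteq> n \<longrightarrow> P m = p \<longrightarrow> r m = 0)"
begin

text \<open>\<open>qden\<close> times the remainder of \<open>aquot\<close> after the subtraction of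
  all poles. In this form no term is singular, and the remainder becomes a quotient of two functions
  of exponential growth.\<close>

definition Nfun :: "complex \<Rightarrow> complex" where
  "Nfun s = zetaZ s - (\<Sum>n. r n * qkernel (P n) s)"

definition Hfun :: "complex \<Rightarrow> complex" where
  "Hfun = holo_quot Nfun qden"

lemma norm_term_le:
  assumes "Re s > - 2" and C: "C \<ge> 1" "\<And>s. Re s \<ge> - 3 \<Longrightarrow> norm (qden s) \<le> C * exp (8 * norm s)"
  shows "norm (r n * qkernel (P n) s) \<le> norm (r n) * (16 * C * exp 8 * exp (8 * norm s))"
  unfolding norm_mult using norm_qkernel_le[OF P assms] by (intro mult_left_mono) auto

lemma summable_terms:
  assumes "Re s > - 2"
  shows "summable (\<lambda>n. r n * qkernel (P n) s)"
proof -
  obtain C where C: "C \<ge> 1" "\<And>s. Re s \<ge> - 3 \<Longrightarrow> norm (qden s) \<le> C * exp (8 * norm s)"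
    by (rule qden_growth) (rule that)
  show ?thesis
    by (rule summable_comparison_test'[OF summable_mult2[OF r] norm_term_le[OF assms C]])
qed

lemma Nfun_holomorphic: "Nfun holomorphic_on {s. Re s > - 2}"
proof -
  obtain C where C: "C \<ge> 1" "\<And>s. Re s \<ge> - 3 \<Longrightarrow> norm (qden s) \<le> C * exp (8 * norm s)"
    by (rule qden_growth) (rule that)
  have "(\<lambda>s. \<Sum>n. r n * qkernel (P n) s) holomorphic_on {s. Re s > - 2}"
  proof (rule holomorphic_suminf)
    show op: "open {s. - 2 < Re s}" by (rule open_halfspace_Re_gt)
    show "(\<lambda>s. r n * qkernel (P n) s) holomorphic_on {s. - 2 < Re s}" for n
      by (intro holomorphic_intros qkernel_holomorphic P)
    fix z assume "z \<in> {s. Re s > - 2}"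
    then obtain d where d: "d > 0" "cball z d \<subseteq> {s. - 2 < Re s}"
      using op open_contains_cball by blast
    show "\<exists>d>0. \<exists>M. cball z d \<subseteq> {s. - 2 < Re s} \<and> summable M \<and>
        (\<forall>n. \<forall>x\<in>cball z d. norm (r n * qkernel (P n) x) \<le> M n)"
    proof (intro exI[of _ d] exI conjI allI ballI)
      show "summable (\<lambda>n. norm (r n) * (16 * C * exp 8 * exp (8 * (norm z + d))))"
        by (rule summable_mult2[OF r])
      fix n x assume x: "x \<in> cball z d"
      have "norm x \<le> norm z + d" using x norm_triangle_ineq2[of x z] by (simp add: dist_norm norm_minus_commute)
      hence "norm (r n) * (16 * C * exp 8 * exp (8 * norm x)) \<le> norm (r n) * (16 * C * exp 8 * exp (8 * (norm z + d)))"
        using C by (intro mult_left_mono) auto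
      moreover have "norm (r n * qkernel (P n) x) \<le> norm (r n) * (16 * C * exp 8 * exp (8 * norm x))"
        by (rule norm_term_le[OF _ C]) (use x d in auto)
      ultimately show "norm (r n * qkernel (P n) x) \<le> norm (r n) * (16 * C * exp 8 * exp (8 * (norm z + d)))"
        by linarith
    qed (use d in auto)
  qed
  thus ?thesis unfolding Nfun_def [abs_def] by (intro holomorphic_intros)
qed

lemma Nfun_growth:
  obtains C where "C \<ge> 1" "\<And>s. Re s > - 2 \<Longrightarrow> norm (Nfun s) \<le> C * exp (8 * norm s)"
    "\<And>s. Re s > - 2 \<Longrightarrow> norm (qden s) \<le> C * exp (8 * norm s)"
proof -
  obtain C where C: "C \<ge> 1" "\<And>s. Re s \<ge> - 3 \<Longrightarrow> norm (qden s) \<le> C * exp (8 * norm s)"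
    "\<And>s. Re s \<ge> - 2 \<Longrightarrow> norm (zetaZ s) \<le> C * exp (8 * norm s)"
    using qden_growth by blast
  define S where "S = (\<Sum>n. norm (r n))"
  have S: "S \<ge> 0" unfolding S_def using r by (intro suminf_nonneg) auto
  show ?thesis
  proof (rule that[of "C + S * (16 * C * exp 8)"])
    show "C + S * (16 * C * exp 8) \<ge> 1" using C(1) S by (intro order_trans[OF C(1)]) simp
    fix s :: complex assume s: "Re s > - 2"
    have "norm (\<Sum>n. r n * qkernel (P n) s) \<le> (\<Sum>n. norm (r n) * (16 * C * exp 8 * exp (8 * norm s)))"
      by (rule norm_suminf_le[OF norm_term_le[OF s C(1,2)] summable_mult2[OF r]])
    also have "\<dots> = S * (16 * C * exp 8 * exp (8 * norm s))"
      unfolding S_def by (rule suminf_mult2[OF r, symmetric])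
    finally have "norm (Nfun s) \<le> C * exp (8 * norm s) + S * (16 * C * exp 8 * exp (8 * norm s))"
      unfolding Nfun_def using C(3)[of s] s by (intro order_trans[OF norm_triangle_ineq4 add_mono]) auto
    thus "norm (Nfun s) \<le> (C + S * (16 * C * exp 8)) * exp (8 * norm s)" by (simp add: algebra_simps)
    have "norm (qden s) \<le> C * exp (8 * norm s)" by (rule C(2)) (use s in simp)
    also have "\<dots> \<le> (C + S * (16 * C * exp 8)) * exp (8 * norm s)"
      using S C(1) by (intro mult_right_mono) auto
    finally show "norm (qden s) \<le> (C + S * (16 * C * exp 8)) * exp (8 * norm s)" .
  qed
qed

text \<open>At a pole p the kernels of all other poles vanish because they contain the factor
  \<open>qden p\<close>; the kernel of p itself equals \<open>deriv qden p\<close>, and multiplied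
  by the residue it gives \<open>zetaZ p\<close>.\<close>

lemma Nfun_zero:
  assumes "Re p > - 2" "qden p = 0"
  shows "Nfun p = 0 \<and> deriv qden p \<noteq> 0"
proof
  have p: "p \<in> qpoles" using assms by (simp add: qpoles_def)
  show d: "deriv qden p \<noteq> 0" by (rule deriv_qden_nonzero[OF RH SZ p])
  obtain n where n: "P n = p" "r n = qres p" "\<And>m. m \<noteq> n \<Longrightarrow> P m = p \<Longrightarrow> r m = 0"
    using Pr[OF p] by blast
  have z: "r m * qkernel (P m) p = 0" if "m \<noteq> n" for m
  proof (cases "P m = p")
    case False
    thus ?thesis using qkernel_eq[OF P, of p m] assms by auto
  qed (use n that in auto)
  have "(\<Sum>m. r m * qkernel (P m) p) = (\<Sum>m\<in>{n}. r m * qkernel (P m) p)"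
    by (rule suminf_finite) (use z in auto)
  also have "\<dots> = zetaZ p" using n d by (simp add: qkernel_at_pole qres_def)
  finally show "Nfun p = 0" by (simp add: Nfun_def)
qed

lemma Hfun_holomorphic: "Hfun holomorphic_on {s. Re s > - 2}"
  unfolding Hfun_def
  by (rule holo_quot_holomorphic[OF open_halfspace_Re_gt Nfun_holomorphic qden_holomorphic])
     (use Nfun_zero in auto)

lemma Hfun_mult: "Re s > - 2 \<Longrightarrow> qden s * Hfun s = Nfun s"
  unfolding Hfun_def using holo_quot_mult[of "{s. Re s > - 2}" qden Nfun s] Nfun_zero by auto

lemma Hfun_eq:
  assumes "Re s > - 2" "qden s \<noteq> 0"
  shows "(\<lambda>n. r n * perron_kernel 4 (s - P n)) sums (aquot s - Hfun s)"
proof -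
  have "s \<noteq> P n" for n using P[of n] assms by (auto simp: qpoles_def)
  hence e: "r n * qkernel (P n) s / qden s = r n * perron_kernel 4 (s - P n)" for n
    using qkernel_eq[OF P, of s n] assms by simp
  have "(\<lambda>n. r n * qkernel (P n) s / qden s) sums ((\<Sum>n. r n * qkernel (P n) s) / qden s)"
    using summable_sums[OF summable_terms[OF assms(1)]] by (rule sums_divide)
  also have "(\<Sum>n. r n * qkernel (P n) s) / qden s = aquot s - Hfun s"
    using Hfun_mult[OF assms(1)] assms(2) by (simp add: Nfun_def aquot_def field_simps)
  finally show ?thesis by (simp only: e)
qed

text \<open>The quotient bound needs the denominator bounded below at the centres of the discs,
  uniformly in their height; on Re s = 3 the Euler product provides this.\<close>

lemma norm_qden_3_ge:
  obtains c where "c > 0" "\<And>t. norm (qden (Complex 3 t)) \<ge> c"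
proof
  define Z where "Z = norm (zeta (of_real 2))"
  have Z: "Z > 0" using zeta_2_nonzero by (simp add: Z_def)
  show "1 / Z > 0" using Z by simp
  fix t :: real
  define s where "s = Complex 3 t"
  have "s + 1 \<noteq> 1" by (simp add: s_def complex_eq_iff)
  hence q: "norm (qden s) = norm s * norm (zeta (s + 1)) * (norm (s - 1) * norm (s + 1) * norm (s + 2))"
    by (simp add: qden_def zetaZ_def norm_mult)
  have "1 \<le> norm (zeta (s + 1)) * Z" unfolding Z_def by (rule norm_zeta_ge) (auto simp: s_def)
  hence z: "1 / Z \<le> norm (zeta (s + 1))" using Z by (simp add: field_simps)
  have n: "1 \<le> norm s" "1 \<le> norm (s - 1)" "1 \<le> norm (s + 1)" "1 \<le> norm (s + 2)"
    using abs_Re_le_cmod[of s] abs_Re_le_cmod[of "s - 1"] abs_Re_le_cmod[of "s + 1"] abs_Re_le_cmod[of "s + 2"]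
    by (simp_all add: s_def)
  have "1 * (1 / Z) * (1 * 1 * 1) \<le> norm s * norm (zeta (s + 1)) * (norm (s - 1) * norm (s + 1) * norm (s + 2))"
    using n z Z by (intro mult_mono mult_nonneg_nonneg) auto
  hence "1 / Z \<le> norm (qden s)" unfolding q by simp
  thus "norm (qden (Complex 3 t)) \<ge> 1 / Z" by (simp only: s_def)
qed

text \<open>The disc of radius 19/4 about 3 + i t stays in Re s \<ge> -7/4, where numerator and
  denominator are holomorphic and at most exponential, and its concentric part of radius 9/2 reaches
  the line Re s = -3/2. Since the radius does not depend on t, the quotient bound is exponential in
  |t|.\<close>

lemma Hfun_growth:
  obtains K where "K \<ge> 0" "\<And>s. - 3 / 2 \<le> Re s \<Longrightarrow> Re s \<le> 2 \<Longrightarrow> norm (Hfun s) \<le> K * exp (K * \<bar>Im s\<bar>)"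
proof -
  obtain C where C: "C \<ge> 1" "\<And>s. Re s > - 2 \<Longrightarrow> norm (Nfun s) \<le> C * exp (8 * norm s)"
    "\<And>s. Re s > - 2 \<Longrightarrow> norm (qden s) \<le> C * exp (8 * norm s)"
    using Nfun_growth by blast
  obtain c0 where c0: "c0 > 0" "\<And>t. norm (qden (Complex 3 t)) \<ge> c0"
    using norm_qden_3_ge by blast
  define L where "L = 37 * (\<bar>ln ((C + 1) / c0)\<bar> + 64)"
  have L: "L \<ge> 0" by (simp add: L_def)
  show ?thesis
  proof (rule that[of "exp L + 296"])
    show "exp L + 296 \<ge> 0" by (simp add: add_nonneg_nonneg)
    fix s :: complex assume s: "- 3 / 2 \<le> Re s" "Re s \<le> 2"
    define t where "t = Im s"
    define c where "c = Complex 3 t"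
    define M where "M = (C + 1) * exp (8 * \<bar>t\<bar> + 64)"
    have M0: "M > 0" using C(1) by (simp add: M_def)
    have ball: "Re z > - 2 \<and> norm z \<le> \<bar>t\<bar> + 8" if "z \<in> cball c (19 / 4)" for z
    proof -
      have d: "norm (z - c) \<le> 19 / 4" using that by (simp add: dist_norm norm_minus_commute)
      have "\<bar>Re (z - c)\<bar> \<le> 19 / 4" using abs_Re_le_cmod[of "z - c"] d by linarith
      moreover have "Re (z - c) = Re z - 3" by (simp add: c_def)
      ultimately have "Re z > - 2" by linarith
      moreover have "norm c \<le> 3 + \<bar>t\<bar>" using cmod_le[of c] by (simp add: c_def)
      hence "norm z \<le> \<bar>t\<bar> + 8" using norm_triangle_ineq[of "z - c" c] d by simp
      ultimately show ?thesis by simp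
    qed
    have bd: "C * exp (8 * norm z) < M" if "z \<in> cball c (19 / 4)" for z
    proof -
      have "C * exp (8 * norm z) < (C + 1) * exp (8 * norm z)" by simp
      also have "\<dots> \<le> M" unfolding M_def using ball[OF that] C(1) by (intro mult_left_mono) auto
      finally show ?thesis .
    qed
    \<comment> \<open>9/2 is 18/19 of the radius, and (1 + r) / (1 - r) = 37 for r = 18/19. With the
      exponent 8 of the growth bounds this yields 296 = 37 * 8.\<close>
    have "norm (Hfun s) \<le> M / M * exp ((1 + 18 / 19) / (1 - 18 / 19) * ln (M / norm (qden c)))"
    proof (rule quotient_bound_disc[of "19 / 4" "{s. Re s > - 2}" c qden Hfun])
      show "cball c (19 / 4) \<subseteq> {s. - 2 < Re s}" using ball by auto
      show "norm (qden z) < M" if "z \<in> cball c (19 / 4)" for z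
        using C(3)[of z] ball[OF that] bd[OF that] by simp
      show "norm (qden z * Hfun z) \<le> M" if "z \<in> cball c (19 / 4)" for z
        using C(2)[of z] ball[OF that] bd[OF that] Hfun_mult[of z] by simp
      show "qden c \<noteq> 0" using c0(1) c0(2)[of t] by (auto simp: c_def)
      have "finite {z \<in> cball c (19 / 4). qden z = 0}"
        by (rule holomorphic_compact_finite_zeros[OF qden_holomorphic[of UNIV]]) (use qden_nonconst in auto)
      thus "finite {z \<in> ball c (19 / 4). qden z = 0}" by (rule rev_finite_subset) auto
      show "deriv qden z \<noteq> 0" if "z \<in> ball c (19 / 4)" "qden z = 0" for z
        using Nfun_zero[of z] ball[of z] that by auto
      have "c - s = of_real (3 - Re s)" by (simp add: c_def t_def complex_eq_iff)
      hence "dist c s = \<bar>3 - Re s\<bar>" by (simp only: dist_norm norm_of_real)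
      thus "dist c s \<le> 18 / 19 * (19 / 4)" using s by simp
    qed (auto intro: open_halfspace_Re_gt Hfun_holomorphic qden_holomorphic)
    also have "\<dots> = exp (37 * ln (M / norm (qden c)))" using M0 by simp
    also have "\<dots> \<le> exp (37 * ln (M / c0))"
    proof -
      have "norm (qden c) > 0" using c0(1) c0(2)[of t] unfolding c_def by linarith
      hence "ln (M / norm (qden c)) \<le> ln (M / c0)"
        using c0(1) c0(2)[of t] M0 by (intro ln_mono divide_left_mono mult_pos_pos divide_pos_pos) (auto simp: c_def)
      thus ?thesis by simp
    qed
    also have "ln (M / c0) = ln ((C + 1) / c0) + (8 * \<bar>t\<bar> + 64)"
    proof -
      have "M / c0 = (C + 1) / c0 * exp (8 * \<bar>t\<bar> + 64)" by (simp add: M_def)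
      thus ?thesis using C(1) c0(1) by (simp only: ln_mult ln_exp) (simp add: ln_mult)
    qed
    also have "37 * (ln ((C + 1) / c0) + (8 * \<bar>t\<bar> + 64)) \<le> L + 296 * \<bar>t\<bar>"
      unfolding L_def by (simp add: algebra_simps)
    hence "exp (37 * (ln ((C + 1) / c0) + (8 * \<bar>t\<bar> + 64))) \<le> exp L * exp (296 * \<bar>t\<bar>)"
      by (simp add: exp_add[symmetric])
    also have "\<dots> \<le> (exp L + 296) * exp ((exp L + 296) * \<bar>t\<bar>)"
      by (intro mult_mono) (auto intro!: mult_right_mono add_increasing)
    finally show "norm (Hfun s) \<le> (exp L + 296) * exp ((exp L + 296) * \<bar>Im s\<bar>)" by (simp add: t_def)
  qed
qed

lemma P_Re: "Re (P n) \<in> {1, - 1, - 1 / 2}"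
  using P[of n]
proof (cases rule: qpoles_cases)
  case 3
  thus ?thesis using nontrivial_zeros_RH(1)[OF RH 3] by simp
qed auto

text \<open>One constant serves all n, because the real parts of the poles take only three values;
  the imaginary part merely translates the bound.\<close>

lemma norm_shifted_kernel:
  assumes "c = 2 \<or> c = - 3 / 2"
  obtains B where "B > 0" "\<And>n t. norm (perron_kernel 4 (Complex c t - P n)) \<le> B / (1 + (t - Im (P n))\<^sup>2)"
proof -
  have ex: "\<forall>b\<in>{1, - 1, - 1 / 2}. \<exists>B. B > 0 \<and> (\<forall>t. norm (perron_kernel 4 (Complex (c - b) t)) \<le> B / (1 + t\<^sup>2))"
  proof
    fix b :: real assume "b \<in> {1, - 1, - 1 / 2}"
    hence "c - b \<noteq> 0" "c - b + 4 \<noteq> 0" using assms by auto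
    then obtain B where "B > 0" "\<And>t. norm (perron_kernel 4 (Complex (c - b) t)) \<le> B / (1 + t\<^sup>2)"
      using norm_perron_kernel[of "c - b" 4, OF _ _ zero_less_numeral] by blast
    thus "\<exists>B. B > 0 \<and> (\<forall>t. norm (perron_kernel 4 (Complex (c - b) t)) \<le> B / (1 + t\<^sup>2))" by blast
  qed
  obtain B where "\<forall>b\<in>{1, - 1, - 1 / 2}. B b > 0 \<and> (\<forall>t. norm (perron_kernel 4 (Complex (c - b) t)) \<le> B b / (1 + t\<^sup>2))"
    using bchoice[OF ex] ..
  hence B: "\<And>b. b \<in> {1, - 1, - 1 / 2} \<Longrightarrow> B b > 0"
    "\<And>b t. b \<in> {1, - 1, - 1 / 2} \<Longrightarrow> norm (perron_kernel 4 (Complex (c - b) t)) \<le> B b / (1 + t\<^sup>2)"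
    by blast+
  show ?thesis
  proof (rule that[of "B 1 + B (- 1) + B (- 1 / 2)"])
    have p: "B 1 > 0" "B (- 1) > 0" "B (- 1 / 2) > 0" using B(1) by auto
    thus "B 1 + B (- 1) + B (- 1 / 2) > 0" by simp
    fix n t
    have e: "Complex c t - P n = Complex (c - Re (P n)) (t - Im (P n))" by (simp add: complex_eq_iff)
    have "norm (perron_kernel 4 (Complex c t - P n)) \<le> B (Re (P n)) / (1 + (t - Im (P n))\<^sup>2)"
      unfolding e by (rule B(2)[OF P_Re])
    also have "\<dots> \<le> (B 1 + B (- 1) + B (- 1 / 2)) / (1 + (t - Im (P n))\<^sup>2)"
      using P_Re[of n] p by (intro divide_right_mono) auto
    finally show "norm (perron_kernel 4 (Complex c t - P n)) \<le> (B 1 + B (- 1) + B (- 1 / 2)) / (1 + (t - Im (P n))\<^sup>2)" .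
  qed
qed

definition gterm :: "real \<Rightarrow> real \<Rightarrow> nat \<Rightarrow> real \<Rightarrow> complex" where
  "gterm x c n t = of_real x powr (Complex c t) * (r n * perron_kernel 4 (Complex c t - P n))"

lemma integral_translate:
  fixes a :: real and f :: "real \<Rightarrow> 'a :: {banach, second_countable_topology}"
  shows "(\<integral>t. f (t - a) \<partial>lborel) = (\<integral>t. f t \<partial>lborel)"
  using lborel_integral_real_affine[of 1 f "- a"] by simp

text \<open>The dominating functions are translates of one another and have the same integral, so
  the integrals of the norms are at most a constant times \<open>norm (r n)\<close>, and sum and
  integral can be exchanged.\<close>

lemma gterm_facts:
  assumes x: "x > 0" and c: "c = 2 \<or> c = - 3 / 2"
  shows "integrable lborel (gterm x c n)"
    and "integrable lborel (\<lambda>t. \<Sum>n. gterm x c n t)"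
    and "(\<integral>t. (\<Sum>n. gterm x c n t) \<partial>lborel) = (\<Sum>n. \<integral>t. gterm x c n t \<partial>lborel)"
proof -
  obtain B where B: "B > 0" "\<And>n t. norm (perron_kernel 4 (Complex c t - P n)) \<le> B / (1 + (t - Im (P n))\<^sup>2)"
    using norm_shifted_kernel[OF c] by blast
  have ineg: "integrable lborel (\<lambda>t. 1 / (1 + (t - a)\<^sup>2))" for a :: real
    using lborel_integrable_real_affine[OF integrable_inverse_1_plus_sq, of 1 "- a"] by simp
  define V :: real where "V = (\<integral>t. 1 / (1 + t\<^sup>2) \<partial>lborel)"
  have V: "(\<integral>t. 1 / (1 + (t - a)\<^sup>2) \<partial>lborel) = V" for a :: real
    unfolding V_def by (rule integral_translate)
  have n: "norm (gterm x c n t) \<le> x powr c * norm (r n) * B * (1 / (1 + (t - Im (P n))\<^sup>2))" for n t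
  proof -
    have "norm (gterm x c n t) = x powr c * (norm (r n) * norm (perron_kernel 4 (Complex c t - P n)))"
      using x by (simp add: gterm_def norm_mult of_real_powr_Complex_norm)
    also have "\<dots> \<le> x powr c * (norm (r n) * (B / (1 + (t - Im (P n))\<^sup>2)))"
      by (intro mult_left_mono B) auto
    finally show ?thesis by (simp add: mult_ac)
  qed
  have meas: "gterm x c n \<in> borel_measurable lborel" for n
  proof -
    have nz: "Complex c t - P n \<noteq> 0" "Complex c t - P n + 4 \<noteq> 0" for t
      using P_Re[of n] c by (auto simp: complex_eq_iff)
    have "continuous_on UNIV (gterm x c n)"
      unfolding gterm_def [abs_def] perron_kernel_def
      using nz x unfolding Complex_eq by (intro continuous_intros) auto
    thus ?thesis by (simp add: borel_measurable_continuous_onI)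
  qed
  show int: "integrable lborel (gterm x c n)" for n
  proof (rule Bochner_Integration.integrable_bound[OF _ meas])
    show "integrable lborel (\<lambda>t. x powr c * norm (r n) * B * (1 / (1 + (t - Im (P n))\<^sup>2)))"
      by (intro integrable_mult_right ineg)
    show "AE t in lborel. norm (gterm x c n t) \<le> norm (x powr c * norm (r n) * B * (1 / (1 + (t - Im (P n))\<^sup>2)))"
    proof (rule AE_I2)
      fix t
      show "norm (gterm x c n t) \<le> norm (x powr c * norm (r n) * B * (1 / (1 + (t - Im (P n))\<^sup>2)))"
        using n[of n t] by (rule order_trans) (simp only: real_norm_def abs_ge_self)
    qed
  qed
  have s1: "AE t in lborel. summable (\<lambda>n. norm (gterm x c n t))"
  proof (rule AE_I2, rule summable_comparison_test')
    fix t :: real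
    show "summable (\<lambda>n. x powr c * norm (r n) * B)" by (intro summable_mult2 summable_mult r)
    fix n
    have "1 / (1 + (t - Im (P n))\<^sup>2) \<le> 1" by (simp add: divide_le_eq add_pos_nonneg)
    hence "x powr c * norm (r n) * B * (1 / (1 + (t - Im (P n))\<^sup>2)) \<le> x powr c * norm (r n) * B * 1"
      using B(1) by (intro mult_left_mono) auto
    thus "norm (norm (gterm x c n t)) \<le> x powr c * norm (r n) * B" using n[of n t] by simp
  qed
  have s2: "summable (\<lambda>n. \<integral>t. norm (gterm x c n t) \<partial>lborel)"
  proof (rule summable_comparison_test')
    show "summable (\<lambda>n. x powr c * norm (r n) * B * V)" by (intro summable_mult2 summable_mult r)
    fix n
    have "(\<integral>t. norm (gterm x c n t) \<partial>lborel) \<le> (\<integral>t. x powr c * norm (r n) * B * (1 / (1 + (t - Im (P n))\<^sup>2)) \<partial>lborel)"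
      by (intro integral_mono integrable_norm int integrable_mult_right ineg n)
    also have "\<dots> = x powr c * norm (r n) * B * V" unfolding integral_mult_right_zero V ..
    finally show "norm (\<integral>t. norm (gterm x c n t) \<partial>lborel) \<le> x powr c * norm (r n) * B * V"
      by (simp add: integral_nonneg_AE)
  qed
  show "integrable lborel (\<lambda>t. \<Sum>n. gterm x c n t)" by (rule integrable_suminf[OF int s1 s2])
  show "(\<integral>t. (\<Sum>n. gterm x c n t) \<partial>lborel) = (\<Sum>n. \<integral>t. gterm x c n t \<partial>lborel)"
    by (rule integral_suminf[OF int s1 s2])
qed

text \<open>Factoring x^s as x^(P n) x^(s - P n) and translating the imaginary part leaves a Perron
  integral on the line Re w = 2 - Re (P n), which is to the right of 0.\<close>

lemma gterm_integral:
  assumes x: "x \<ge> 1"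
  shows "(\<integral>t. gterm x 2 n t \<partial>lborel) = r n * of_real x powr (P n) * of_real (2 * pi * (1 - x powr (- 4)))"
proof -
  define b where "b = 2 - Re (P n)"
  have b: "b > 0" using P_Re[of n] by (auto simp: b_def)
  have x0: "x > 0" using x by simp
  have "gterm x 2 n t = r n * of_real x powr (P n) * (of_real x powr (Complex b (t - Im (P n))) * perron_kernel 4 (Complex b (t - Im (P n))))" for t
  proof -
    have e: "Complex 2 t - P n = Complex b (t - Im (P n))" by (simp add: b_def complex_eq_iff)
    have "Complex 2 t = P n + Complex b (t - Im (P n))" by (simp add: b_def complex_eq_iff)
    hence "of_real x powr (Complex 2 t) = of_real x powr (P n) * of_real x powr (Complex b (t - Im (P n)))"
      by (simp only: powr_add)
    thus ?thesis by (simp only: gterm_def e) (simp add: mult_ac)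
  qed
  hence "(\<integral>t. gterm x 2 n t \<partial>lborel) = r n * of_real x powr (P n) *
     (\<integral>t. of_real x powr (Complex b (t - Im (P n))) * perron_kernel 4 (Complex b (t - Im (P n))) \<partial>lborel)"
    by (simp only: integral_mult_right_zero)
  also have "(\<integral>t. of_real x powr (Complex b (t - Im (P n))) * perron_kernel 4 (Complex b (t - Im (P n))) \<partial>lborel)
     = (\<integral>t. of_real x powr (Complex b t) * perron_kernel 4 (Complex b t) \<partial>lborel)"
    by (rule integral_translate)
  also have "\<dots> = of_real (2 * pi * (1 - x powr (- 4)))"
    using perron_formula[OF b, of 4 x] x x0 by simp
  finally show ?thesis .
qed

lemma qden_line_2: "qden (Complex 2 t) \<noteq> 0"
proof -
  have "zeta (Complex 2 t + 1) \<noteq> 0" by (rule zeta_nonzero_Re_gt_1) simp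
  moreover have "Complex 2 t + 1 \<noteq> 1" "Complex 2 t \<noteq> 0" "Complex 2 t - 1 \<noteq> 0" "Complex 2 t + 1 \<noteq> 0" "Complex 2 t + 2 \<noteq> 0"
    by (simp_all add: complex_eq_iff)
  ultimately show ?thesis by (simp add: qden_def zetaZ_def)
qed

lemma integrable_line:
  assumes c: "c = 2 \<or> c = - 3 / 2" and x: "x > 0"
  shows "integrable lborel (\<lambda>t. of_real x powr (Complex c t) * aquot (Complex c t))"
    and "integrable lborel (\<lambda>t. of_real x powr (Complex c t) * Hfun (Complex c t))"
    and "(\<integral>t. of_real x powr (Complex c t) * aquot (Complex c t) \<partial>lborel)
      = (\<integral>t. of_real x powr (Complex c t) * Hfun (Complex c t) \<partial>lborel) + (\<integral>t. (\<Sum>n. gterm x c n t) \<partial>lborel)"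
proof -
  obtain C where C: "C > 0" "\<And>t. norm (aquot (Complex c t)) \<le> C / (1 + t\<^sup>2)" "\<And>t. qden (Complex c t) \<noteq> 0"
  proof (cases "c = 2")
    case True
    obtain C where "C > 0" "\<And>t. norm (aquot (Complex 2 t)) \<le> C / (1 + t\<^sup>2)" using norm_aquot_2 by blast
    thus ?thesis using that True qden_line_2 by blast
  next
    case False
    hence "c = - 3 / 2" using c by simp
    thus ?thesis using norm_aquot_minus_three_halves that by blast
  qed
  have contZ: "continuous_on UNIV zetaZ" "continuous_on UNIV qden"
    by (intro holomorphic_on_imp_continuous_on zetaZ_holomorphic qden_holomorphic)+
  show A: "integrable lborel (\<lambda>t. of_real x powr (Complex c t) * aquot (Complex c t))"
  proof (rule Bochner_Integration.integrable_bound)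
    show "integrable lborel (\<lambda>t. x powr c * C * (1 / (1 + t\<^sup>2)))"
      by (intro integrable_mult_right integrable_inverse_1_plus_sq)
    have "continuous_on UNIV (\<lambda>t. of_real x powr (Complex c t) * aquot (Complex c t))"
      unfolding aquot_def using C(3) x
      by (intro continuous_intros continuous_on_compose2[OF contZ(1)] continuous_on_compose2[OF contZ(2)])
         (auto simp: Complex_eq intro!: continuous_intros)
    thus "(\<lambda>t. of_real x powr (Complex c t) * aquot (Complex c t)) \<in> borel_measurable lborel"
      by (simp add: borel_measurable_continuous_onI)
    show "AE t in lborel. norm (of_real x powr (Complex c t) * aquot (Complex c t)) \<le> norm (x powr c * C * (1 / (1 + t\<^sup>2)))"
    proof (rule AE_I2)
      fix t :: real
      have "norm (of_real x powr (Complex c t) * aquot (Complex c t)) = x powr c * norm (aquot (Complex c t))"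
        using x by (simp add: norm_mult of_real_powr_Complex_norm)
      also have "\<dots> \<le> x powr c * (C / (1 + t\<^sup>2))" using C by (intro mult_left_mono) auto
      also have "\<dots> \<le> norm (x powr c * C * (1 / (1 + t\<^sup>2)))" using C(1) by (simp add: abs_mult)
      finally show "norm (of_real x powr (Complex c t) * aquot (Complex c t)) \<le> norm (x powr c * C * (1 / (1 + t\<^sup>2)))" .
    qed
  qed
  have G: "integrable lborel (\<lambda>t. \<Sum>n. gterm x c n t)" by (rule gterm_facts(2)[OF x c])
  have eq: "of_real x powr (Complex c t) * Hfun (Complex c t)
      = of_real x powr (Complex c t) * aquot (Complex c t) - (\<Sum>n. gterm x c n t)" for t
  proof -
    have "Re (Complex c t) > - 2" using c by auto
    hence "(\<lambda>n. of_real x powr (Complex c t) * (r n * perron_kernel 4 (Complex c t - P n)))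
        sums (of_real x powr (Complex c t) * (aquot (Complex c t) - Hfun (Complex c t)))"
      by (intro sums_mult Hfun_eq C(3))
    hence "(\<Sum>n. gterm x c n t) = of_real x powr (Complex c t) * (aquot (Complex c t) - Hfun (Complex c t))"
      by (simp add: gterm_def sums_iff)
    thus ?thesis by (simp add: algebra_simps)
  qed
  show "integrable lborel (\<lambda>t. of_real x powr (Complex c t) * Hfun (Complex c t))"
    unfolding eq by (intro Bochner_Integration.integrable_diff A G)
  have "(\<integral>t. of_real x powr (Complex c t) * Hfun (Complex c t) \<partial>lborel)
     = (\<integral>t. of_real x powr (Complex c t) * aquot (Complex c t) \<partial>lborel) - (\<integral>t. (\<Sum>n. gterm x c n t) \<partial>lborel)"
    unfolding eq by (rule Bochner_Integration.integral_diff[OF A G])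
  thus "(\<integral>t. of_real x powr (Complex c t) * aquot (Complex c t) \<partial>lborel)
      = (\<integral>t. of_real x powr (Complex c t) * Hfun (Complex c t) \<partial>lborel) + (\<integral>t. (\<Sum>n. gterm x c n t) \<partial>lborel)"
    by simp
qed

text \<open>The growth constant may depend on x, since the shift is an exact identity for each fixed
  x.\<close>

lemma Hfun_shift:
  assumes x: "x \<ge> 1"
  shows "(\<integral>t. of_real x powr (Complex 2 t) * Hfun (Complex 2 t) \<partial>lborel)
       = (\<integral>t. of_real x powr (Complex (- 3 / 2) t) * Hfun (Complex (- 3 / 2) t) \<partial>lborel)"
proof -
  obtain K where K: "K \<ge> 0" "\<And>s. - 3 / 2 \<le> Re s \<Longrightarrow> Re s \<le> 2 \<Longrightarrow> norm (Hfun s) \<le> K * exp (K * \<bar>Im s\<bar>)"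
    using Hfun_growth by blast
  have x0: "x > 0" using x by simp
  show ?thesis
  proof (rule vertical_line_shift[symmetric, where h = "\<lambda>s. of_real x powr s * Hfun s" and U = "{s. Re s > - 2}" and K = "x powr 2 * K + K"])
    show "open {s. - 2 < Re s}" by (rule open_halfspace_Re_gt)
    show "(\<lambda>s. of_real x powr s * Hfun s) holomorphic_on {s. - 2 < Re s}"
      using x0 by (intro holomorphic_intros Hfun_holomorphic) auto
    fix s :: complex assume s: "- 3 / 2 \<le> Re s" "Re s \<le> 2"
    have "norm (of_real x powr s * Hfun s) = x powr Re s * norm (Hfun s)"
      using x0 by (simp add: norm_mult of_real_powr_Complex_norm)
    also have "\<dots> \<le> x powr 2 * (K * exp (K * \<bar>Im s\<bar>))"
      using K(2)[OF s] x s by (intro mult_mono powr_mono) auto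
    also have "\<dots> \<le> (x powr 2 * K + K) * exp ((x powr 2 * K + K) * \<bar>Im s\<bar>)"
      unfolding mult.assoc[symmetric] using K(1) by (intro mult_mono) (auto intro!: mult_right_mono)
    finally show "norm (of_real x powr s * Hfun s) \<le> (x powr 2 * K + K) * exp ((x powr 2 * K + K) * \<bar>Im s\<bar>)" .
  qed (use integrable_line x0 in auto)
qed

text \<open>The mean is the sum of all r x^p (1 - x^(-4)) over the poles plus the integral of the
  remainder on Re s = -3/2, which is O(x^(-3/2)). The pole 1 contributes the main part up to
  O(x^(-3)). Every other pole has Re p \<le> -1/2, so absolute summability of the residues gives
  x^(-1/2) without an \<epsilon>.\<close>

lemma phi_mean_bound:
  obtains C where "C > 0" "\<And>x. x \<ge> 1 \<Longrightarrow> norm (of_real (phi_mean x) - of_real x / (6 * zeta 2)) \<le> C * x powr (- 1 / 2)"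
proof -
  obtain n0 where n0: "P n0 = 1" "r n0 = qres 1" "\<And>m. m \<noteq> n0 \<Longrightarrow> P m = 1 \<Longrightarrow> r m = 0"
    using Pr[OF one_in_qpoles] by blast
  define S where "S = (\<Sum>n. norm (r n))"
  define V where "V = (\<integral>t. norm (Hfun (Complex (- 3 / 2) t)) \<partial>lborel)"
  have S: "S \<ge> 0" unfolding S_def using r by (intro suminf_nonneg) auto
  have V: "V \<ge> 0" unfolding V_def by (simp add: integral_nonneg_AE)
  show ?thesis
  proof (rule that[of "1 + S + S + V"])
    show "1 + S + S + V > 0" using S V by linarith
    fix x :: real assume x: "x \<ge> 1"
    have x0: "x > 0" using x by simp
    define T where "T = (\<lambda>n. r n * of_real x powr (P n) * of_real (1 - x powr (- 4)))"
    define W where "W = (\<integral>t. of_real x powr (Complex (- 3 / 2) t) * Hfun (Complex (- 3 / 2) t) \<partial>lborel)"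
    have x4: "0 \<le> 1 - x powr (- 4)" "1 - x powr (- 4) \<le> 1"
      using x powr_mono[of "- 4" 0 x] by auto
    have xP: "x powr Re (P n) \<le> x" for n
      using P_Re[of n] x powr_mono[of "Re (P n)" 1 x] by auto
    have nT: "norm (T n) \<le> norm (r n) * x powr Re (P n)" for n
    proof -
      have "norm (T n) = norm (r n) * x powr Re (P n) * (1 - x powr (- 4))"
        using x0 x4 by (simp only: T_def norm_mult of_real_powr_Complex_norm norm_of_real)
      also have "\<dots> \<le> norm (r n) * x powr Re (P n) * 1" using x4 by (intro mult_left_mono) auto
      finally show ?thesis by simp
    qed
    have sT: "summable (\<lambda>n. norm (T n))"
    proof (rule summable_comparison_test'[OF summable_mult2[OF r, of x]])
      fix n
      have "norm (r n) * x powr Re (P n) \<le> norm (r n) * x" by (intro mult_left_mono xP) auto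
      thus "norm (norm (T n)) \<le> norm (r n) * x" using nT[of n] by simp
    qed
    have "of_real (2 * pi * phi_mean x) = W + (\<Sum>n. of_real (2 * pi) * T n)"
      using perron_phi_mean[OF x] integrable_line(3)[of 2 x] Hfun_shift[OF x] gterm_facts(3)[of x 2] x x0
      by (simp add: W_def T_def gterm_integral mult_ac)
    also have "(\<Sum>n. of_real (2 * pi) * T n) = of_real (2 * pi) * (\<Sum>n. T n)"
      by (rule suminf_mult[OF summable_norm_cancel[OF sT]])
    finally have m: "of_real (phi_mean x) = W / of_real (2 * pi) + (\<Sum>n. T n)"
      by (simp add: field_simps)
    define T' where "T' = (\<lambda>n. if n = n0 then 0 else T n)"
    have sT': "summable (\<lambda>n. norm (T' n))"
      by (rule summable_comparison_test'[OF sT]) (auto simp: T'_def)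
    have "(\<Sum>n. T n) = T n0 + (\<Sum>n. T' n)"
    proof -
      have "(\<lambda>n. if n = n0 then T n else 0) sums T n0" by (rule sums_single)
      moreover have "T' sums (\<Sum>n. T' n)" by (rule summable_sums[OF summable_norm_cancel[OF sT']])
      ultimately have "(\<lambda>n. (if n = n0 then T n else 0) + T' n) sums (T n0 + (\<Sum>n. T' n))" by (rule sums_add)
      moreover have "(\<lambda>n. (if n = n0 then T n else 0) + T' n) = T" by (auto simp: T'_def)
      ultimately show ?thesis by (simp add: sums_iff)
    qed
    moreover have "T n0 = of_real x / (6 * zeta 2) - qres 1 * of_real (x * x powr (- 4))"
      using x0 by (simp add: T_def n0 qres_1 right_diff_distrib) 
    ultimately have d: "of_real (phi_mean x) - of_real x / (6 * zeta 2)
       = W / of_real (2 * pi) + ((\<Sum>n. T' n) - qres 1 * of_real (x * x powr (- 4)))"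
      unfolding m by simp
    have "norm (\<Sum>n. T' n) \<le> (\<Sum>n. norm (r n) * x powr (- 1 / 2))"
    proof (rule norm_suminf_le[OF _ summable_mult2[OF r]])
      fix n
      show "norm (T' n) \<le> norm (r n) * x powr (- 1 / 2)"
      proof (cases "n = n0 \<or> r n = 0")
        case True
        thus ?thesis by (auto simp: T'_def T_def)
      next
        case False
        \<comment> \<open>The only pole of real part 1 is 1 itself, and any index other than n0 that
          repeats it has coefficient 0.\<close>
        have "Re (P n) \<noteq> 1"
        proof
          assume R: "Re (P n) = 1"
          have "P n = 1"
            using P[of n]
          proof (cases rule: qpoles_cases)
            case 3
            thus ?thesis using nontrivial_zeros_RH(1)[OF RH 3] R by simp
          qed (use R in auto)
          thus False using n0(3)[of n] False by auto
        qed
        hence "x powr Re (P n) \<le> x powr (- 1 / 2)"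
          using P_Re[of n] x by (intro powr_mono) auto
        hence "norm (r n) * x powr Re (P n) \<le> norm (r n) * x powr (- 1 / 2)" by (intro mult_left_mono) auto
        with nT[of n] have "norm (T n) \<le> norm (r n) * x powr (- 1 / 2)" by (rule order_trans)
        thus ?thesis using False by (simp add: T'_def)
      qed
    qed
    also have "\<dots> = S * x powr (- 1 / 2)" unfolding S_def by (rule suminf_mult2[OF r, symmetric])
    finally have b1: "norm (\<Sum>n. T' n) \<le> S * x powr (- 1 / 2)" .
    have "norm (qres 1) \<le> S"
      using sum_le_suminf[OF r, of "{n0}"] n0 by (simp add: S_def)
    moreover have "x * x powr (- 4) \<le> x powr (- 1 / 2)"
    proof -
      have "x * x powr (- 4) = x powr (- 3)" using x0 powr_add[of x 1 "- 4"] by simp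
      also have "\<dots> \<le> x powr (- 1 / 2)" using x by (intro powr_mono) auto
      finally show ?thesis .
    qed
    ultimately have b2: "norm (qres 1 * of_real (x * x powr (- 4))) \<le> S * x powr (- 1 / 2)"
      unfolding norm_mult norm_of_real using x0 S by (intro mult_mono) auto
    have "norm W \<le> (\<integral>t. norm (of_real x powr (Complex (- 3 / 2) t) * Hfun (Complex (- 3 / 2) t)) \<partial>lborel)"
      unfolding W_def by (rule integral_norm_bound)
    also have "\<dots> = x powr (- 3 / 2) * V"
      using x0 by (simp add: norm_mult of_real_powr_Complex_norm V_def)
    also have "\<dots> \<le> x powr (- 1 / 2) * V" using x V by (intro mult_right_mono powr_mono) auto
    finally have "norm W \<le> V * x powr (- 1 / 2)" by (simp add: mult.commute)
    moreover have "norm (W / of_real (2 * pi)) \<le> norm W"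
    proof -
      have "1 \<le> 2 * pi" using pi_ge_two by simp
      hence "norm W / (2 * pi) \<le> norm W / 1" by (intro divide_left_mono) auto
      thus ?thesis by (simp add: norm_divide)
    qed
    ultimately have b3: "norm (W / of_real (2 * pi)) \<le> V * x powr (- 1 / 2)" by linarith
    have "norm (of_real (phi_mean x) - of_real x / (6 * zeta 2))
      \<le> V * x powr (- 1 / 2) + (S * x powr (- 1 / 2) + S * x powr (- 1 / 2))"
      unfolding d by (intro order_trans[OF norm_triangle_ineq add_mono] b3 order_trans[OF norm_triangle_ineq4 add_mono] b1 b2)
    also have "\<dots> \<le> (1 + S + S + V) * x powr (- 1 / 2)" by (simp add: algebra_simps)
    finally show "norm (of_real (phi_mean x) - of_real x / (6 * zeta 2)) \<le> (1 + S + S + V) * x powr (- 1 / 2)" .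
  qed
qed

end

section \<open>Transfer to the Dedekind function\<close>

lemma bcoeff_nonneg: "bcoeff n \<ge> 0"
  by (simp add: bcoeff_def prod_nonneg)

section \<open>The convolution factor b and the constant of the main part\<close>

lemma multiplicative_bcoeff_powr: "multiplicative (\<lambda>n. bcoeff n * real n powr a)"
  using multiplicative_bcoeff by (auto simp: multiplicative_def powr_mult)

lemma bcoeff_powr_sums:
  assumes p: "prime p" and a: "a < 1"
  shows "(\<lambda>j. bcoeff (p ^ j) * real (p ^ j) powr a)
     sums (1 + real p powr (a - 1) / ((1 - real p powr (a - 1)) * (real p + 1)))"
proof -
  define x where "x = real p powr (a - 1)"
  have p0: "real p > 0" using prime_gt_0_nat[OF p] by simp
  have x: "0 < x" "x < 1" using prime_powr_less_1[OF p, of "1 - a"] a by (simp_all add: x_def)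
  have pw: "(real p ^ j) powr a = (real p powr a) ^ j" for j
    by (induction j) (simp_all add: powr_mult)
  have x': "1 / real p * real p powr a = x" using p0 by (simp add: x_def powr_diff)
  \<comment> \<open>The term with j = 0 is 1 and not 1 / (p + 1); the second summand corrects this
    single exception to the geometric series.\<close>
  have eq: "bcoeff (p ^ j) * real (p ^ j) powr a
      = x ^ j / (real p + 1) + (if j = 0 then 1 - 1 / (real p + 1) else 0)" for j
  proof (cases "j = 0")
    case True
    thus ?thesis using multiplicative_bcoeff by (simp add: multiplicative_def)
  next
    case False
    hence "bcoeff (p ^ j) * real (p ^ j) powr a = (1 / real p) ^ j * (real p powr a) ^ j / (real p + 1)"
      by (simp add: bcoeff_prime_power[OF p] pw)
    also have "\<dots> = x ^ j / (real p + 1)" by (simp only: power_mult_distrib[symmetric] x')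
    finally show ?thesis using False by simp
  qed
  have "(\<lambda>j. x ^ j / (real p + 1) + (if j = 0 then 1 - 1 / (real p + 1) else 0))
     sums (1 / (1 - x) / (real p + 1) + (1 - 1 / (real p + 1)))"
    using x by (intro sums_add sums_divide geometric_sums sums_single) auto
  also have "1 / (1 - x) / (real p + 1) + (1 - 1 / (real p + 1)) = 1 + x / ((1 - x) * (real p + 1))"
    using x p0 by (simp add: divide_simps) (simp add: algebra_simps)
  finally show ?thesis unfolding eq x_def .
qed

text \<open>The local factor is 1 + O(p^(a - 2)). The lemma is applied with a = -1 for the main part
  and with a = 1/2 for the error term.\<close>

lemma summable_on_bcoeff_powr:
  assumes a: "a < 1"
  shows "(\<lambda>n. bcoeff n * real n powr a) summable_on {0<..}"
proof (rule summable_on_multiplicative[OF multiplicative_bcoeff_powr _ bcoeff_powr_sums[OF _ a]])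
  define y :: real where "y = 2 powr (a - 1)"
  have y: "y < 1" using a by (simp add: y_def powr_less_one)
  show "0 \<le> bcoeff n * real n powr a" for n by (simp add: bcoeff_nonneg)
  show "0 \<le> real n powr (a - 2) / (1 - y)" for n using y by simp
  show "summable (\<lambda>n. real n powr (a - 2) / (1 - y))"
    by (intro summable_divide) (use a in \<open>simp add: summable_real_powr_iff\<close>)
  fix p :: nat assume p: "prime p"
  define x where "x = real p powr (a - 1)"
  have p2: "real p \<ge> 2" using prime_ge_2_nat[OF p] by simp
  have x: "0 < x" "x \<le> y" unfolding x_def y_def using p2 a by (auto intro!: powr_mono2')
  have "x / ((1 - x) * (real p + 1)) \<le> x / ((1 - y) * real p)"
    using x y p2 by (intro divide_left_mono mult_mono mult_pos_pos) auto
  also have "\<dots> = x / real p / (1 - y)" by simp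
  also have "x / real p = real p powr (a - 2)"
    using powr_diff[of "real p" "a - 1" 1] p2 by (simp add: x_def)
  finally show "1 + real p powr (a - 1) / ((1 - real p powr (a - 1)) * (real p + 1)) \<le> 1 + real p powr (a - 2) / (1 - y)"
    by (simp add: x_def)
qed

text \<open>The origin of zeta(4) h(1): the left side is the sum of b(p^j) p^(-j), the right side
  the factor of h(1) at p times the Euler factor of zeta(4).\<close>

lemma local_factor_identity:
  fixes p :: real
  assumes "p > 1"
  shows "1 + p powr (- 2) / ((1 - p powr (- 2)) * (p + 1))
    = (1 + 1 / (p ^ 2 * (p + 1)) - 1 / (p ^ 3 * (p + 1))) * (1 / (1 - p powr (- 4)))"
proof -
  have e: "p powr (- 2) = 1 / p ^ 2" "p powr (- 4) = 1 / p ^ 4"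
    using assms by (simp_all add: powr_minus_divide powr_numeral)
  have "p ^ 2 > 1" "p ^ 4 > 1" using assms by (simp_all add: one_less_power)
  hence "p ^ 2 \<noteq> 1" "p ^ 4 \<noteq> 1" by (metis less_irrefl)+
  hence nz: "1 - 1 / p ^ 2 \<noteq> 0" "1 - 1 / p ^ 4 \<noteq> 0" "p + 1 \<noteq> 0" "p \<noteq> 0" "p ^ 2 - 1 \<noteq> 0" "p ^ 4 - 1 \<noteq> 0"
    using assms by auto
  have "1 / p ^ 2 / ((1 - 1 / p ^ 2) * (p + 1)) = 1 / ((p ^ 2 - 1) * (p + 1))"
    using nz by (simp add: field_simps)
  moreover have "1 / (1 - 1 / p ^ 4) = p ^ 4 / (p ^ 4 - 1)"
    using nz by (simp add: field_simps)
  moreover have "1 + 1 / (p ^ 2 * (p + 1)) - 1 / (p ^ 3 * (p + 1)) = (p ^ 3 * (p + 1) + p - 1) / (p ^ 3 * (p + 1))"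
  proof -
    have "1 / (p ^ 2 * (p + 1)) = p / (p ^ 3 * (p + 1))"
      using nz by (simp add: power2_eq_square power3_eq_cube)
    moreover have "1 = p ^ 3 * (p + 1) / (p ^ 3 * (p + 1))" using nz by simp
    ultimately show ?thesis by (simp only: add_divide_distrib diff_divide_distrib)
  qed
  moreover have "1 + 1 / ((p ^ 2 - 1) * (p + 1)) = (p ^ 3 * (p + 1) + p - 1) / (p ^ 3 * (p + 1)) * (p ^ 4 / (p ^ 4 - 1))"
  proof -
    have f: "p ^ 4 - 1 = (p ^ 2 - 1) * (p ^ 2 + 1)" by algebra
    have "p ^ 2 + 1 \<noteq> 0" by (metis add.commute power_one sum_power2_eq_zero_iff zero_neq_one)
    have "(p ^ 3 * (p + 1) + p - 1) / (p ^ 3 * (p + 1)) * (p ^ 4 / (p ^ 4 - 1))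
       = (p ^ 3 * (p + 1) + p - 1) * p / ((p + 1) * (p ^ 4 - 1))"
    proof -
      have "N / (w * q) * (p * w / r) = N * p / (q * r)" if "w \<noteq> 0" for N w q r :: real
        using that by simp
      from this[of "p ^ 3"] nz show ?thesis by (simp only: power_eq_0_iff) (simp add: eval_nat_numeral)
    qed
    moreover have "1 + 1 / ((p ^ 2 - 1) * (p + 1)) = ((p ^ 2 - 1) * (p + 1) + 1) / ((p ^ 2 - 1) * (p + 1))"
      using nz by (simp add: add_divide_distrib)
    moreover have "((p ^ 2 - 1) * (p + 1) + 1) * ((p + 1) * (p ^ 4 - 1)) = (p ^ 3 * (p + 1) + p - 1) * p * ((p ^ 2 - 1) * (p + 1))"
      by algebra
    hence "((p ^ 2 - 1) * (p + 1) + 1) / ((p ^ 2 - 1) * (p + 1)) = (p ^ 3 * (p + 1) + p - 1) * p / ((p + 1) * (p ^ 4 - 1))"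
      using nz by (subst frac_eq_eq) auto
    ultimately show ?thesis by (simp only:)
  qed
  ultimately show ?thesis unfolding e by (simp only:)
qed

definition h_factor :: "nat \<Rightarrow> real" where
  "h_factor p = 1 + 1 / (real p ^ 2 * (real p + 1)) - 1 / (real p ^ 3 * (real p + 1))"

text \<open>Each factor differs from 1 by at most p^(-2), so the infinite product converges
  absolutely and may be computed along the primes up to N.\<close>

lemma h_at_1_LIMSEQ: "(\<lambda>N. \<Prod>p | prime p \<and> p \<le> N. h_factor p) \<longlonglongrightarrow> h_at_1"
proof -
  define g where "g = (\<lambda>p. if prime p then h_factor p else 1)"
  have b: "norm (norm (g p - 1)) \<le> real p powr (- 2)" for p
  proof (cases "prime p")
    case True
    hence p1: "real p > 1" using prime_gt_1_nat by auto
    have "g p - 1 = 1 / (real p ^ 2 * (real p + 1)) - 1 / (real p ^ 3 * (real p + 1))"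
      using True by (simp add: g_def h_factor_def)
    moreover have "0 < 1 / (real p ^ 3 * (real p + 1))" using p1 by simp
    moreover have "1 / (real p ^ 3 * (real p + 1)) \<le> 1 / (real p ^ 2 * (real p + 1))"
      using p1 by (intro divide_left_mono mult_right_mono power_increasing mult_pos_pos) auto
    moreover have "1 / (real p ^ 2 * (real p + 1)) \<le> 1 / real p ^ 2"
      using p1 by (intro divide_left_mono) auto
    moreover have "1 / real p ^ 2 = real p powr (- 2)"
      using p1 by (simp add: powr_minus_divide powr_numeral)
    ultimately show ?thesis by (simp only: real_norm_def)
  qed (simp add: g_def)
  have "summable (\<lambda>p. norm (g p - 1))"
    by (rule summable_comparison_test'[of "\<lambda>p. real p powr (- 2)" 0])
       (use b in \<open>auto simp: summable_real_powr_iff\<close>)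
  hence "convergent_prod g"
    by (intro abs_convergent_prod_imp_convergent_prod summable_imp_abs_convergent_prod)
  hence "(\<lambda>N. \<Prod>p\<le>N. g p) \<longlonglongrightarrow> prodinf g" by (rule convergent_prod_LIMSEQ)
  moreover have "prodinf g = h_at_1" unfolding h_at_1_def g_def h_factor_def ..
  moreover have "(\<Prod>p\<le>N. g p) = (\<Prod>p | prime p \<and> p \<le> N. h_factor p)" for N
  proof -
    have "{p. prime p \<and> p \<le> N} = {p \<in> {..N}. prime p}" by auto
    thus ?thesis unfolding g_def by (simp only: prod.inter_filter[OF finite_atMost])
  qed
  ultimately show ?thesis by simp
qed

lemma infsum_bcoeff_over_n: "infsum (\<lambda>n. bcoeff n * real n powr (- 1)) {0<..} = Re (zeta 4) * h_at_1"
proof -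
  define f where "f = (\<lambda>n. bcoeff n * real n powr (- 1))"
  define F where "F = (\<lambda>p. 1 + real p powr (- 2) / ((1 - real p powr (- 2)) * (real p + 1)))"
  have sm: "f summable_on {0<..}" unfolding f_def by (rule summable_on_bcoeff_powr) simp
  have F: "(\<lambda>j. f (p ^ j)) sums F p" if "prime p" for p
    using bcoeff_powr_sums[OF that, of "- 1"] by (simp add: f_def F_def)
  have F': "(\<Sum>\<^sub>\<infinity>j. complex_of_real (f (p ^ j))) = of_real (F p)" if "prime p" for p
  proof (rule infsumI, rule norm_summable_imp_has_sum)
    show "(\<lambda>j. complex_of_real (f (p ^ j))) sums of_real (F p)" by (rule sums_of_real[OF F[OF that]])
    have "norm (complex_of_real (f n)) = f n" for n unfolding norm_of_real by (simp add: f_def bcoeff_nonneg)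
    thus "summable (\<lambda>j. norm (complex_of_real (f (p ^ j))))"
      using F[OF that] by (simp only: sums_iff)
  qed
  have m: "multiplicative (\<lambda>n. complex_of_real (f n))"
    using multiplicative_bcoeff_powr[of "- 1"] unfolding f_def[symmetric] by (simp add: multiplicative_def)
  have "(\<lambda>N. \<Prod>p | prime p \<and> p \<le> N. \<Sum>\<^sub>\<infinity>j. complex_of_real (f (p ^ j))) \<longlonglongrightarrow> infsum (\<lambda>n. complex_of_real (f n)) {0<..}"
    by (rule euler_product[OF m summable_on_of_real[OF sm]])
  hence "(\<lambda>N. complex_of_real (\<Prod>p | prime p \<and> p \<le> N. F p)) \<longlonglongrightarrow> of_real (infsum f {0<..})"
    by (simp add: F' infsumI[OF has_sum_of_real[OF has_sum_infsum[OF sm]]])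
  hence 1: "(\<lambda>N. \<Prod>p | prime p \<and> p \<le> N. F p) \<longlonglongrightarrow> infsum f {0<..}"
    by (simp only: tendsto_of_real_iff)
  have pw: "1 / (1 - of_nat p powr (- 4)) = complex_of_real (1 / (1 - real p powr (- 4)))" for p :: nat
    using powr_of_real[of "real p" "- 4"] by simp
  have "(\<lambda>N. \<Prod>p | prime p \<and> p \<le> N. 1 / (1 - of_nat p powr (- 4))) \<longlonglongrightarrow> zeta 4"
    by (rule zeta_euler_product) simp
  hence "(\<lambda>N. complex_of_real (\<Prod>p | prime p \<and> p \<le> N. 1 / (1 - real p powr (- 4)))) \<longlonglongrightarrow> zeta 4"
    unfolding pw by simp
  from tendsto_Re[OF this]
  have 2: "(\<lambda>N. \<Prod>p | prime p \<and> p \<le> N. 1 / (1 - real p powr (- 4))) \<longlonglongrightarrow> Re (zeta 4)"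
    by (simp only: Re_complex_of_real)
  have "(\<lambda>N. (\<Prod>p | prime p \<and> p \<le> N. 1 / (1 - real p powr (- 4))) * (\<Prod>p | prime p \<and> p \<le> N. h_factor p))
      \<longlonglongrightarrow> Re (zeta 4) * h_at_1"
    by (rule tendsto_mult[OF 2 h_at_1_LIMSEQ])
  moreover have "(\<Prod>p | prime p \<and> p \<le> N. 1 / (1 - real p powr (- 4))) * (\<Prod>p | prime p \<and> p \<le> N. h_factor p)
      = (\<Prod>p | prime p \<and> p \<le> N. F p)" for N
    unfolding prod.distrib[symmetric]
  proof (rule prod.cong)
    fix p assume "p \<in> {p. prime p \<and> p \<le> N}"
    hence "real p > 1" using prime_gt_1_nat by auto
    from local_factor_identity[OF this]
    show "1 / (1 - real p powr (- 4)) * h_factor p = F p" by (simp add: F_def h_factor_def)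
  qed simp
  ultimately show ?thesis using LIMSEQ_unique[OF 1] unfolding f_def by auto
qed

lemma finite_real_le: "finite {l::nat. 0 < l \<and> real l \<le> x}"
proof (rule finite_subset)
  show "{l::nat. 0 < l \<and> real l \<le> x} \<subseteq> {..nat \<lfloor>x\<rfloor>}" by (auto simp: le_nat_floor)
qed simp

text \<open>Writing l = d m, the Riesz weight depends only on l / x = m / (x / d), so the inner sum
  over m is a Riesz mean at x / d.\<close>

lemma S_sum_2_eq:
  assumes x: "x > 0"
  shows "S_sum 2 x = (\<Sum>d | 0 < d \<and> real d \<le> x. bcoeff d * phi_mean (x / real d))"
proof -
  define A where "A = (\<lambda>y. {l::nat. 0 < l \<and> real l \<le> y})"
  have fA: "finite (A y)" for y unfolding A_def by (rule finite_real_le)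
  have fd: "finite {d. d dvd l}" if "l \<in> A x" for l using that by (auto simp: A_def)
  have "2 * S_sum 2 x = (\<Sum>l\<in>A x. psi_ratio l * (1 - real l / x) ^ 2)"
    by (simp add: S_sum_def psi_ratio_def A_def)
  also have "\<dots> = (\<Sum>l\<in>A x. \<Sum>d | d dvd l. bcoeff d * (phi_ratio (l div d) * (1 - real l / x) ^ 2))"
    by (intro sum.cong refl) (simp add: A_def psi_ratio_eq_dconv dconv_def sum_distrib_right mult.assoc)
  also have "\<dots> = (\<Sum>(l, d)\<in>Sigma (A x) (\<lambda>l. {d. d dvd l}). bcoeff d * (phi_ratio (l div d) * (1 - real l / x) ^ 2))"
    by (rule sum.Sigma) (use fA fd in auto)
  also have "\<dots> = (\<Sum>(d, m)\<in>Sigma (A x) (\<lambda>d. A (x / real d)). bcoeff d * (phi_ratio m * (1 - real m / (x / real d)) ^ 2))"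
  proof (rule sum.reindex_bij_witness[of _ "\<lambda>(d, m). (d * m, d)" "\<lambda>(l, d). (d, l div d)"])
    fix z assume "z \<in> Sigma (A x) (\<lambda>l. {d. d dvd l})"
    then obtain l d where z: "z = (l, d)" and l: "l \<in> A x" "d dvd l" by auto
    then obtain m where m: "l = d * m" by auto
    have d: "d > 0" "m > 0" using l m by (auto simp: A_def)
    have "d * 1 \<le> l" unfolding m using d by (intro mult_left_mono) auto
    hence "real d \<le> real l" by simp
    hence "d \<in> A x" using l d by (auto simp: A_def)
    moreover have "l div d \<in> A (x / real d)" using l m d by (auto simp: A_def field_simps)
    ultimately show "(case z of (l, d) \<Rightarrow> (d, l div d)) \<in> Sigma (A x) (\<lambda>d. A (x / real d))"
      by (simp add: z)
    show "(case (case z of (l, d) \<Rightarrow> (d, l div d)) of (d, m) \<Rightarrow> (d * m, d)) = z" using m d by (simp add: z)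
    have "real (l div d) / (x / real d) = real l / x" using m d x by (simp add: field_simps)
    thus "(case (case z of (l, d) \<Rightarrow> (d, l div d)) of (d, m) \<Rightarrow> bcoeff d * (phi_ratio m * (1 - real m / (x / real d)) ^ 2))
       = (case z of (l, d) \<Rightarrow> bcoeff d * (phi_ratio (l div d) * (1 - real l / x) ^ 2))"
      by (simp only: z prod.case)
  next
    fix z assume "z \<in> Sigma (A x) (\<lambda>d. A (x / real d))"
    then obtain d m where z: "z = (d, m)" and dm: "d \<in> A x" "m \<in> A (x / real d)" by auto
    show "(case (case z of (d, m) \<Rightarrow> (d * m, d)) of (l, d) \<Rightarrow> (d, l div d)) = z" using dm by (simp add: z A_def)
    show "(case z of (d, m) \<Rightarrow> (d * m, d)) \<in> Sigma (A x) (\<lambda>l. {d. d dvd l})"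
      using dm by (auto simp: z A_def field_simps)
  qed
  also have "\<dots> = (\<Sum>d\<in>A x. \<Sum>m\<in>A (x / real d). bcoeff d * (phi_ratio m * (1 - real m / (x / real d)) ^ 2))"
    by (rule sum.Sigma[symmetric]) (use fA in auto)
  also have "\<dots> = (\<Sum>d\<in>A x. 2 * (bcoeff d * phi_mean (x / real d)))"
  proof (rule sum.cong)
    fix d
    have "2 * phi_mean (x / real d) = (\<Sum>m\<in>A (x / real d). phi_ratio m * (1 - real m / (x / real d)) ^ 2)"
      by (simp add: phi_mean_def A_def)
    thus "(\<Sum>m\<in>A (x / real d). bcoeff d * (phi_ratio m * (1 - real m / (x / real d)) ^ 2)) = 2 * (bcoeff d * phi_mean (x / real d))"
      by (simp only: sum_distrib_left[symmetric] mult.left_commute[of 2])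
  qed simp
  also have "\<dots> = 2 * (\<Sum>d\<in>A x. bcoeff d * phi_mean (x / real d))" by (simp add: sum_distrib_left)
  finally show ?thesis by (simp add: A_def)
qed

lemma phi_mean_eq_0: "y < 1 \<Longrightarrow> phi_mean y = 0"
proof -
  assume "y < 1"
  hence "{l::nat. 0 < l \<and> real l \<le> y} = {}" by auto
  thus ?thesis by (simp only: phi_mean_def) simp
qed

text \<open>The main part of \<open>phi_mean\<close> is subtracted for every n, including n > x,
  where \<open>phi_mean (x / n)\<close> is 0. The main parts therefore add up to the complete series
  with value zeta(4) h(1) and no tail has to be estimated; in return the hypothesis covers all y >
  0. The errors (x / n)^(-1/2) are summed against b.\<close>

lemma E_err_2_bound:
  assumes C: "\<And>y. y > 0 \<Longrightarrow> \<bar>phi_mean y - y / (6 * Re (zeta 2))\<bar> \<le> C * y powr (- 1 / 2)" and x: "x > 0"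
  shows "\<bar>E_err 2 x\<bar> \<le> C * infsum (\<lambda>n. bcoeff n * real n powr (1 / 2)) {0<..} * x powr (- 1 / 2)"
proof -
  define \<kappa> where "\<kappa> = 1 / (6 * Re (zeta 2))"
  have 1: "((\<lambda>n. bcoeff n * phi_mean (x / real n)) has_sum S_sum 2 x) {0<..}"
  proof -
    have "((\<lambda>n. bcoeff n * phi_mean (x / real n)) has_sum S_sum 2 x) {l. 0 < l \<and> real l \<le> x}"
      unfolding S_sum_2_eq[OF x] by (rule has_sum_finite[OF finite_real_le])
    thus ?thesis
      by (rule iffD1[OF has_sum_cong_neutral, rotated -1]) (auto intro!: phi_mean_eq_0 simp: divide_less_eq)
  qed
  have "((\<lambda>n. bcoeff n * real n powr (- 1)) has_sum Re (zeta 4) * h_at_1) {0<..}"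
    unfolding infsum_bcoeff_over_n[symmetric] by (rule has_sum_infsum[OF summable_on_bcoeff_powr]) simp
  hence 2: "((\<lambda>n. bcoeff n * real n powr (- 1) * (\<kappa> * x)) has_sum Re (zeta 4) * h_at_1 * (\<kappa> * x)) {0<..}"
    by (rule has_sum_cmult_left)
  have "E_err 2 x = S_sum 2 x - Re (zeta 4) * h_at_1 * (\<kappa> * x)"
    by (simp add: E_err_def \<kappa>_def fact_numeral)
  hence E: "((\<lambda>n. bcoeff n * phi_mean (x / real n) - bcoeff n * real n powr (- 1) * (\<kappa> * x)) has_sum E_err 2 x) {0<..}"
    using has_sum_add[OF 1 has_sum_uminusI[OF 2]] by simp
  have 3: "((\<lambda>n. bcoeff n * real n powr (1 / 2) * (C * x powr (- 1 / 2)))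
     has_sum infsum (\<lambda>n. bcoeff n * real n powr (1 / 2)) {0<..} * (C * x powr (- 1 / 2))) {0<..}"
    by (intro has_sum_cmult_left has_sum_infsum summable_on_bcoeff_powr) simp
  have "norm (E_err 2 x) \<le> infsum (\<lambda>n. bcoeff n * real n powr (1 / 2)) {0<..} * (C * x powr (- 1 / 2))"
  proof (rule norm_infsum_le[OF E 3])
    fix n :: nat assume "n \<in> {0<..}"
    hence n: "real n > 0" by simp
    have p: "(x / real n) powr (- 1 / 2) = x powr (- 1 / 2) * real n powr (1 / 2)"
      using x n by (simp add: powr_divide powr_minus field_simps)
    have "bcoeff n * phi_mean (x / real n) - bcoeff n * real n powr (- 1) * (\<kappa> * x)
        = bcoeff n * (phi_mean (x / real n) - (x / real n) / (6 * Re (zeta 2)))"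
      using n by (simp add: powr_minus \<kappa>_def field_simps)
    hence "norm (bcoeff n * phi_mean (x / real n) - bcoeff n * real n powr (- 1) * (\<kappa> * x))
       = bcoeff n * \<bar>phi_mean (x / real n) - (x / real n) / (6 * Re (zeta 2))\<bar>"
      by (simp only: real_norm_def abs_mult abs_of_nonneg[OF bcoeff_nonneg])
    also have "\<dots> \<le> bcoeff n * (C * (x / real n) powr (- 1 / 2))"
      using C[of "x / real n"] x n by (intro mult_left_mono bcoeff_nonneg) auto
    finally show "norm (bcoeff n * phi_mean (x / real n) - bcoeff n * real n powr (- 1) * (\<kappa> * x))
       \<le> bcoeff n * real n powr (1 / 2) * (C * x powr (- 1 / 2))"
      by (simp only: p mult_ac)
  qed
  thus ?thesis by (simp add: mult_ac)
qed

section \<open>The step from k to k + 1\<close>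

lemma truncated_power_has_integral:
  fixes a x :: real
  assumes "0 \<le> a" "a \<le> x"
  shows "((\<lambda>u. if a \<le> u then (u - a) ^ k else 0) has_integral (x - a) ^ Suc k / real (Suc k)) {0..x}"
proof -
  have "((\<lambda>u. (u - a) ^ k) has_integral ((x - a) ^ Suc k / real (Suc k) - (a - a) ^ Suc k / real (Suc k))) {a..x}"
  proof (rule fundamental_theorem_of_calculus[OF assms(2)])
    fix u
    have "((\<lambda>u. (u - a) ^ Suc k / real (Suc k)) has_real_derivative (real (Suc k) * (u - a) ^ k / real (Suc k))) (at u within {a..x})"
      by (intro DERIV_cdivide) (auto intro!: derivative_eq_intros simp del: power_Suc)
    hence "((\<lambda>u. (u - a) ^ Suc k / real (Suc k)) has_real_derivative (u - a) ^ k) (at u within {a..x})"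
      by (simp del: of_nat_Suc power_Suc)
    thus "((\<lambda>u. (u - a) ^ Suc k / real (Suc k)) has_vector_derivative (u - a) ^ k) (at u within {a..x})"
      by (simp add: has_real_derivative_iff_has_vector_derivative)
  qed
  hence "((\<lambda>u. if u \<in> {a..x} then (u - a) ^ k else 0) has_integral (x - a) ^ Suc k / real (Suc k)) {0..x}"
    using assms by (subst has_integral_restrict) auto
  thus ?thesis by (rule has_integral_eq[rotated]) auto
qed

text \<open>u^k S_k(u) is the sum of l / psi(l) times (u - l)^k / k! over l \<le> u. Extended by 0
  to u < l, each such power integrates to the one of exponent k + 1, and the main part, a multiple
  of u^(k + 1) / (k + 1)!, integrates accordingly.\<close>

lemma E_err_Suc_has_integral:
  assumes x: "x > 0" and k: "k > 0"
  shows "((\<lambda>u. u ^ k * E_err k u) has_integral x ^ Suc k * E_err (Suc k) x) {0..x}"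
proof -
  define M where "M = Re (zeta 4) * h_at_1 / Re (zeta 2)"
  define A where "A = {l::nat. 0 < l \<and> real l \<le> x}"
  have fA: "finite A" unfolding A_def by (rule finite_real_le)
  have pw: "u ^ j * (c * (1 - real l / u) ^ j) = c * (u - real l) ^ j" if "u > 0" for u c :: real and j l
  proof -
    have "u ^ j * (1 - real l / u) ^ j = (u - real l) ^ j"
      using that by (simp add: power_mult_distrib[symmetric] right_diff_distrib)
    thus ?thesis by simp
  qed
  have S: "u ^ j * S_sum j u = (\<Sum>l | 0 < l \<and> real l \<le> u. psi_ratio l / fact j * (u - real l) ^ j)" if "u > 0" for u j
    using that by (simp add: S_sum_def sum_distrib_left psi_ratio_def pw[OF that, symmetric] mult_ac sum_divide_distrib)
  have E: "u ^ j * E_err j u = u ^ j * S_sum j u - M / fact (Suc j) * u ^ Suc j" for u j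
    by (simp add: E_err_def M_def right_diff_distrib mult_ac)
  have "((\<lambda>u. (\<Sum>l\<in>A. psi_ratio l / fact k * (if real l \<le> u then (u - real l) ^ k else 0))
        - M / fact (Suc k) * (if 0 \<le> u then (u - 0) ^ Suc k else 0))
     has_integral ((\<Sum>l\<in>A. psi_ratio l / fact k * ((x - real l) ^ Suc k / real (Suc k)))
        - M / fact (Suc k) * ((x - 0) ^ Suc (Suc k) / real (Suc (Suc k))))) {0..x}"
    using x by (intro has_integral_diff has_integral_sum fA has_integral_mult_right truncated_power_has_integral)
       (auto simp: A_def)
  also have "(\<Sum>l\<in>A. psi_ratio l / fact k * ((x - real l) ^ Suc k / real (Suc k))) = x ^ Suc k * S_sum (Suc k) x"
    unfolding S[OF x] A_def by (intro sum.cong refl) (simp add: field_simps)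
  also have "M / fact (Suc k) * ((x - 0) ^ Suc (Suc k) / real (Suc (Suc k))) = M / fact (Suc (Suc k)) * x ^ Suc (Suc k)"
    by (simp add: fact_Suc[of "Suc k"] del: fact_Suc of_nat_Suc power_Suc)
  also have "x ^ Suc k * S_sum (Suc k) x - M / fact (Suc (Suc k)) * x ^ Suc (Suc k) = x ^ Suc k * E_err (Suc k) x"
    by (rule E[symmetric])
  finally show ?thesis
  proof (rule has_integral_eq[rotated])
    fix u assume u: "u \<in> {0..x}"
    show "(\<Sum>l\<in>A. psi_ratio l / fact k * (if real l \<le> u then (u - real l) ^ k else 0))
        - M / fact (Suc k) * (if 0 \<le> u then (u - 0) ^ Suc k else 0) = u ^ k * E_err k u"
    \<comment> \<open>At u = 0 the default values of division in \<open>E_err\<close> are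
      irrelevant, since the factor u^k vanishes for k > 0.\<close>
    proof (cases "u = 0")
      case True
      have "(\<Sum>l\<in>A. psi_ratio l / fact k * (if real l \<le> 0 then (0 - real l) ^ k else 0)) = 0"
        by (rule sum.neutral) (auto simp: A_def)
      thus ?thesis unfolding True using k by simp
    next
      case False
      hence u0: "u > 0" using u by simp
      have "{l \<in> A. real l \<le> u} = {l. 0 < l \<and> real l \<le> u}" using u by (auto simp: A_def)
      hence "u ^ k * S_sum k u = (\<Sum>l\<in>A. if real l \<le> u then psi_ratio l / fact k * (u - real l) ^ k else 0)"
        unfolding S[OF u0] using sum.inter_filter[OF fA, of "\<lambda>l. psi_ratio l / fact k * (u - real l) ^ k" "\<lambda>l. real l \<le> u"]
        by simp
      also have "\<dots> = (\<Sum>l\<in>A. psi_ratio l / fact k * (if real l \<le> u then (u - real l) ^ k else 0))"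
        by (intro sum.cong) auto
      finally show ?thesis using u0 by (simp add: E)
    qed
  qed
qed

text \<open>Integrating u^(k - 1/2) and dividing by x^(k + 1) reproduces the exponent -1/2. The
  integral starts at 0, which is why the bound is assumed for all positive x and not only for large
  ones.\<close>

lemma E_err_Suc_bound:
  assumes C: "\<And>x. x > 0 \<Longrightarrow> \<bar>E_err k x\<bar> \<le> C * x powr (- 1 / 2)" and x: "x > 0" and k: "k > 0"
  shows "\<bar>E_err (Suc k) x\<bar> \<le> C / (real k + 1 / 2) * x powr (- 1 / 2)"
proof -
  have i1: "((\<lambda>u. u ^ k * E_err k u) has_integral x ^ Suc k * E_err (Suc k) x) {0..x}"
    by (rule E_err_Suc_has_integral[OF x k])
  have "((\<lambda>u. u powr (real k - 1 / 2)) has_integral (x powr (real k - 1 / 2 + 1) / (real k - 1 / 2 + 1))) {0..x}"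
    by (rule has_integral_powr_from_0) (use k x in auto)
  hence i2: "((\<lambda>u. C * u powr (real k - 1 / 2)) has_integral C * (x powr (real k - 1 / 2 + 1) / (real k - 1 / 2 + 1))) {0..x}"
    by (rule has_integral_mult_right)
  have "norm (integral {0..x} (\<lambda>u. u ^ k * E_err k u)) \<le> integral {0..x} (\<lambda>u. C * u powr (real k - 1 / 2))"
  proof (rule integral_norm_bound_integral)
    fix u assume u: "u \<in> {0..x}"
    show "norm (u ^ k * E_err k u) \<le> C * u powr (real k - 1 / 2)"
    proof (cases "u = 0")
      case False
      hence u0: "u > 0" using u by simp
      have "norm (u ^ k * E_err k u) = u ^ k * \<bar>E_err k u\<bar>" using u0 by (simp add: abs_mult)
      also have "\<dots> \<le> u ^ k * (C * u powr (- 1 / 2))" using C[OF u0] u0 by (intro mult_left_mono) auto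
      also have "\<dots> = C * (u powr (real k) * u powr (- 1 / 2))" using u0 by (simp add: powr_realpow)
      also have "u powr (real k) * u powr (- 1 / 2) = u powr (real k - 1 / 2)" by (simp add: powr_add[symmetric])
      finally show ?thesis .
    qed (use k in simp)
  qed (use i1 i2 in auto)
  hence "x ^ Suc k * \<bar>E_err (Suc k) x\<bar> \<le> C * (x powr (real k - 1 / 2 + 1) / (real k - 1 / 2 + 1))"
    unfolding integral_unique[OF i1] integral_unique[OF i2] using x by (simp add: abs_mult)
  also have "x powr (real k - 1 / 2 + 1) = x ^ Suc k * x powr (- 1 / 2)"
  proof -
    have "x ^ Suc k = x powr real (Suc k)" using x by (simp only: powr_realpow)
    thus ?thesis by (simp add: powr_add[symmetric] algebra_simps)
  qed
  also have "C * (x ^ Suc k * x powr (- 1 / 2) / (real k - 1 / 2 + 1)) = x ^ Suc k * (C / (real k + 1 / 2) * x powr (- 1 / 2))"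
    by (simp add: field_simps)
  finally show ?thesis using x by (simp only: mult_le_cancel_left_pos zero_less_power)
qed

theorem theorem2:
  assumes "riemann_hypothesis"
    and "simple_zeros_on_critical_line"
    and "\<And>\<epsilon>::real. \<epsilon> > 0 \<Longrightarrow> J_minus_half \<in> O[at_top](\<lambda>T. T powr (1 + \<epsilon>))"
  shows "\<forall>k::nat. k \<ge> 2 \<longrightarrow> E_err k \<in> O[at_top](\<lambda>x. x powr (- 1 / 2))"
proof (intro allI impI)
  \<comment> \<open>The instance \<epsilon> = 1/2: its exponent 3/2 is less than 2, as the dyadic
    sum over the zeros requires.\<close>
  have "J_minus_half \<in> O[at_top](\<lambda>T. T powr (3 / 2))" using assms(3)[of "1 / 2"] by simp
  then obtain P r where Pr: "\<And>n::nat. P n \<in> qpoles" "summable (\<lambda>n. norm (r n))"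
    "\<And>p. p \<in> qpoles \<Longrightarrow> \<exists>n. P n = p \<and> r n = qres p \<and> (\<forall>m. m \<noteq> n \<longrightarrow> P m = p \<longrightarrow> r m = 0)"
    using qpoles_sequence[OF assms(1)] by blast
  interpret qpole_data P r by unfold_locales (use assms(1,2) Pr in auto)
  obtain C where C: "C > 0" "\<And>x. x \<ge> 1 \<Longrightarrow> norm (of_real (phi_mean x) - of_real x / (6 * zeta 2)) \<le> C * x powr (- 1 / 2)"
    using phi_mean_bound by blast
  define \<kappa> where "\<kappa> = 1 / (6 * Re (zeta 2))"
  have z2: "zeta 2 = of_real (Re (zeta 2))" using zeta_real_sums(2)[of 2] by simp
  \<comment> \<open>Extends the bound to 0 < y < 1, where the mean is an empty sum and the main part
    alone is estimated by y \<le> y^(-1/2).\<close>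
  have main: "\<bar>phi_mean y - y / (6 * Re (zeta 2))\<bar> \<le> (C + \<bar>\<kappa>\<bar>) * y powr (- 1 / 2)" if y: "y > 0" for y
  proof (cases "y \<ge> 1")
    case True
    have "of_real (phi_mean y) - of_real y / (6 * zeta 2) = complex_of_real (phi_mean y - y / (6 * Re (zeta 2)))"
      by (subst z2) simp
    hence "\<bar>phi_mean y - y / (6 * Re (zeta 2))\<bar> \<le> C * y powr (- 1 / 2)"
      using C(2)[OF True] by (simp only: norm_of_real)
    also have "\<dots> \<le> (C + \<bar>\<kappa>\<bar>) * y powr (- 1 / 2)" by (intro mult_right_mono) auto
    finally show ?thesis .
  next
    case False
    have "y powr 1 \<le> y powr (- 1 / 2)" using y False by (intro powr_mono') auto
    hence "\<bar>\<kappa>\<bar> * y \<le> \<bar>\<kappa>\<bar> * y powr (- 1 / 2)" using y by (intro mult_left_mono) auto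
    also have "\<dots> \<le> (C + \<bar>\<kappa>\<bar>) * y powr (- 1 / 2)" using C(1) by (intro mult_right_mono) auto
    finally show ?thesis using False y phi_mean_eq_0[of y] by (simp add: \<kappa>_def abs_mult)
  qed
  fix k :: nat assume "k \<ge> 2"
  hence "\<exists>C. \<forall>x>0. \<bar>E_err k x\<bar> \<le> C * x powr (- 1 / 2)"
  proof (induction k rule: dec_induct)
    case base
    show ?case using E_err_2_bound[OF main] by blast
  next
    case (step k)
    then obtain D where "\<And>x. x > 0 \<Longrightarrow> \<bar>E_err k x\<bar> \<le> D * x powr (- 1 / 2)" by blast
    hence "\<bar>E_err (Suc k) x\<bar> \<le> D / (real k + 1 / 2) * x powr (- 1 / 2)" if "x > 0" for x
      using E_err_Suc_bound[of k D x] that step.hyps by simp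
    thus ?case by blast
  qed
  then obtain D where D: "\<And>x. x > 0 \<Longrightarrow> \<bar>E_err k x\<bar> \<le> D * x powr (- 1 / 2)" by blast
  have "eventually (\<lambda>x. norm (E_err k x) \<le> D * norm (x powr (- 1 / 2))) at_top"
    using eventually_gt_at_top[of 0] by eventually_elim (use D in auto)
  thus "E_err k \<in> O[at_top](\<lambda>x. x powr (- 1 / 2))" by (rule bigoI)
qed

end
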